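(* Let $\phi\in\mathrm{Diff}_c(\mathbb{D},\omega_0)$. Then there is a subset $\Omega\subset\mathbb{D}$ of full Lebesgue measure, containing every periodic point of $\phi$, such that for every $x\in\Omega$: the limit $a^\infty_\phi(x)$ exists; for almost every $y\in\mathbb{D}$ the limit $W^\infty_\phi(x,y)$ exists; the function $y\mapsto W^\infty_\phi(x,y)$ is integrable on $\mathbb{D}$; and \[ a^\infty_\phi(x)=\int_{\mathbb{D}} W^\infty_\phi(x,y)\,\omega_0(y). \]
   Context: $\mathbb{D}\subset\mathbb{R}^2\cong\mathbb{C}$ is the closed unit disk, $\omega_0=dx\wedge dy$ the standard area form, and $\mathrm{Diff}_c(\mathbb{D},\omega_0)$ the group of smooth diffeomorphisms of $\mathbb{D}$ preserving $\omega_0$ and equal to the identity outside a compact subset of the interior of $\mathbb{D}$. Action: for a smooth 1-form $\lambda$ on $\mathbb{D}$ with $d\lambda=\omega_0$, $a_{\phi,\lambda}:\mathbb{D}\to\mathbb{R}$ is the unique smooth function with $da_{\phi,\lambda}=\phi^*\lambda-\lambda$ and $a_{\phi,\lambda}=0$ on $\partial\mathbb{D}$. The asymptotic action is $a^\infty_\phi(z)=\lim_{n\to\infty}a_{\phi^n,\lambda}(z)/n$ at points where the limit exists; its existence and value do not depend on $\lambda$. Hamiltonian isotopy: a smooth $H:\mathbb{D}\times[0,1]\to\mathbb{R}$, $H_t=H(\cdot,t)$, vanishing near $\partial\mathbb{D}\times[0,1]$, defines $X_t$ by $\omega_0(X_t,\cdot)=dH_t$ and the isotopy $\phi^t$ by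 $\frac{d}{dt}\phi^t=X_t\circ\phi^t$, $\phi^0=\mathrm{id}$; every $\phi\in\mathrm{Diff}_c(\mathbb{D},\omega_0)$ equals $\phi^1$ for some such $H$. Winding number: for distinct $x,y\in\mathbb{D}$, $W_\phi(x,y)=(\theta(1)-\theta(0))/2\pi$, where $\theta:[0,1]\to\mathbb{R}$ is continuous with $\frac{\phi^t(y)-\phi^t(x)}{\|\phi^t(y)-\phi^t(x)\|}=e^{i\theta(t)}$ for a Hamiltonian isotopy $\phi^t$ from $\mathrm{id}$ to $\phi$ (the value is independent of the isotopy). The asymptotic winding number is $W^\infty_\phi(x,y)=\lim_{n\to\infty}W_{\phi^n}(x,y)/n$ where the limit exists. A point $x$ is $k$-periodic if $\phi^k(x)=x$. *)

theory Defs
  imports "HOL-Analysis.Analysis"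
begin

fun Ck_on :: "nat \<Rightarrow> 'a::euclidean_space set \<Rightarrow> ('a \<Rightarrow> 'b::real_normed_vector) \<Rightarrow> bool" where
  "Ck_on 0 U f = continuous_on U f"
| "Ck_on (Suc k) U f =
     (f differentiable_on U \<and> (\<forall>i\<in>Basis. Ck_on k U (\<lambda>x. frechet_derivative f (at x) i)))"

definition smooth_on :: "'a::euclidean_space set \<Rightarrow> ('a \<Rightarrow> 'b::real_normed_vector) \<Rightarrow> bool" where
  "smooth_on S f \<longleftrightarrow>
     (\<exists>U g. open U \<and> S \<subseteq> U \<and> (\<forall>x\<in>S. g x = f x) \<and> (\<forall>k. Ck_on k U g))"

abbreviation Disk :: "complex set" where "Disk \<equiv> cball 0 1"

definition dD :: "(complex \<Rightarrow> 'b::real_normed_vector) \<Rightarrow> complex \<Rightarrow> complex \<Rightarrow> 'b" where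
  "dD f z = frechet_derivative f (at z within Disk)"

definition jac_det :: "(complex \<Rightarrow> complex) \<Rightarrow> complex \<Rightarrow> real" where
  "jac_det f z = Re (dD f z 1) * Im (dD f z \<i>) - Im (dD f z 1) * Re (dD f z \<i>)"

definition Diff_c :: "(complex \<Rightarrow> complex) set" where
  "Diff_c = {phi. smooth_on Disk phi \<and> bij_betw phi Disk Disk \<and> smooth_on Disk (inv_into Disk phi)
      \<and> (\<forall>z\<in>Disk. jac_det phi z = 1)
      \<and> (\<exists>K. compact K \<and> K \<subseteq> ball 0 1 \<and> (\<forall>z\<in>Disk - K. phi z = z))}"

text \<open>A 1-form lambda = P dx + Q dy on D is encoded by lam z = P z + i Q z, so that
  lambda_z(v) = lam z \<bullet> v. It is a primitive of omega_0 iff dQ/dx - dP/dy = 1.\<close>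
definition primitive_form :: "(complex \<Rightarrow> complex) \<Rightarrow> bool" where
  "primitive_form lam \<longleftrightarrow> smooth_on Disk lam \<and>
     (\<forall>z\<in>Disk. Im (dD lam z 1) - Re (dD lam z \<i>) = 1)"

text \<open>a_{phi,lambda}(z): value at z of the unique smooth a with da = phi^* lambda - lambda
  on D and a = 0 on the boundary circle.\<close>
definition action :: "(complex \<Rightarrow> complex) \<Rightarrow> (complex \<Rightarrow> complex) \<Rightarrow> complex \<Rightarrow> real" where
  "action phi lam z = (THE c. \<exists>a :: complex \<Rightarrow> real. smooth_on Disk a
       \<and> (\<forall>w\<in>Disk. (a has_derivative (\<lambda>v. lam (phi w) \<bullet> dD phi w v - lam w \<bullet> v)) (at w within Disk))
       \<and> (\<forall>w\<in>sphere 0 1. a w = 0) \<and> a z = c)"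

definition asym_action_exists :: "(complex \<Rightarrow> complex) \<Rightarrow> (complex \<Rightarrow> complex) \<Rightarrow> complex \<Rightarrow> bool" where
  "asym_action_exists phi lam z \<longleftrightarrow> convergent (\<lambda>n. action (phi ^^ n) lam z / real n)"

definition asym_action :: "(complex \<Rightarrow> complex) \<Rightarrow> (complex \<Rightarrow> complex) \<Rightarrow> complex \<Rightarrow> real" where
  "asym_action phi lam z = lim (\<lambda>n. action (phi ^^ n) lam z / real n)"

definition Hx :: "(complex \<times> real \<Rightarrow> real) \<Rightarrow> complex \<Rightarrow> real \<Rightarrow> real" where
  "Hx H z t = frechet_derivative H (at (z, t) within Disk \<times> {0..1}) (1, 0)"
definition Hy :: "(complex \<times> real \<Rightarrow> real) \<Rightarrow> complex \<Rightarrow> real \<Rightarrow> real" where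
  "Hy H z t = frechet_derivative H (at (z, t) within Disk \<times> {0..1}) (\<i>, 0)"

text \<open>Hamiltonian vector field: omega_0(X_t, .) = dH_t gives X_t = (dH/dy, -dH/dx).\<close>
definition ham_field :: "(complex \<times> real \<Rightarrow> real) \<Rightarrow> real \<Rightarrow> complex \<Rightarrow> complex" where
  "ham_field H t z = Complex (Hy H z t) (- Hx H z t)"

definition hamiltonian :: "(complex \<times> real \<Rightarrow> real) \<Rightarrow> bool" where
  "hamiltonian H \<longleftrightarrow> smooth_on (Disk \<times> {0..1}) H \<and>
     (\<exists>r<1. \<forall>z t. z \<in> Disk \<and> r \<le> norm z \<and> t \<in> {0..1} \<longrightarrow> H (z, t) = 0)"

definition ham_isotopy :: "(complex \<times> real \<Rightarrow> real) \<Rightarrow> (real \<Rightarrow> complex \<Rightarrow> complex) \<Rightarrow> bool" where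
  "ham_isotopy H Phi \<longleftrightarrow> hamiltonian H \<and>
     (\<forall>z\<in>Disk. Phi 0 z = z \<and>
        (\<forall>t\<in>{0..1}. Phi t z \<in> Disk \<and>
           ((\<lambda>s. Phi s z) has_vector_derivative ham_field H t (Phi t z)) (at t within {0..1})))"

definition angle_change :: "(real \<Rightarrow> complex) \<Rightarrow> real" where
  "angle_change \<gamma> = (THE w. \<exists>\<theta>. continuous_on {0..1} \<theta> \<and>
      (\<forall>t\<in>{0..1}. \<gamma> t / complex_of_real (norm (\<gamma> t)) = exp (\<i> * complex_of_real (\<theta> t))) \<and>
      w = (\<theta> 1 - \<theta> 0) / (2 * pi))"

definition wind :: "(complex \<Rightarrow> complex) \<Rightarrow> complex \<Rightarrow> complex \<Rightarrow> real" where
  "wind phi x y = (THE w. \<exists>H Phi. ham_isotopy H Phi \<and> (\<forall>z\<in>Disk. Phi 1 z = phi z) \<and>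
      w = angle_change (\<lambda>t. Phi t y - Phi t x))"

definition asym_wind_exists :: "(complex \<Rightarrow> complex) \<Rightarrow> complex \<Rightarrow> complex \<Rightarrow> bool" where
  "asym_wind_exists phi x y \<longleftrightarrow> convergent (\<lambda>n. wind (phi ^^ n) x y / real n)"

definition asym_wind :: "(complex \<Rightarrow> complex) \<Rightarrow> complex \<Rightarrow> complex \<Rightarrow> real" where
  "asym_wind phi x y = lim (\<lambda>n. wind (phi ^^ n) x y / real n)"

definition periodic_point :: "(complex \<Rightarrow> complex) \<Rightarrow> complex \<Rightarrow> bool" where
  "periodic_point phi x \<longleftrightarrow> x \<in> Disk \<and> (\<exists>k::nat. k \<ge> 1 \<and> (phi ^^ k) x = x)"

end

(* Let Phi_t be the flow of a compactly supported Hamiltonian H with field X and time-one map phi.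
   Differentiating the angle of Phi_t(y) - Phi_t(x) writes 2 pi W(x,y) as the time integral of
   Im((X(y') - X(x'))/(y' - x')) with x' = Phi_t(x), y' = Phi_t(y), a quantity bounded by the Lipschitz
   constant of X. Green's formula for the regularized fields (w - z)/(|w - z|^2 + eps) gives
   int_D Im((X(w) - X(z))/(w - z)) dw = 2 pi H(z) + pi omega_0(z, X(z)). As Phi_t preserves area,
   Fubini yields int_D W(x,y) dy = a(x) for the primitive (x dy - y dx)/2.
   W is additive along orbits. Birkhoff's theorem for phi x phi on D x D, and on (a finite orbit) x D,
   gives the asymptotic winding number; dominated convergence passes to the limit in the average, and
   another primitive alters the actions of the iterates only by a bounded amount.

   Every phi in Diff_c is Hamiltonian: phi carries the horizontal direction field to a field of
   directions exp(i theta) with theta real-valued. The fields of angle s theta interpolate between the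
   two, and a Hamiltonian isotopy moves leaves to leaves. What is left preserves the horizontal lines. *)
theory Submission
  imports Defs "HOL-Real_Asymp.Real_Asymp" "HOL-Probability.Probability"
begin

section \<open>Calculus of smooth maps\<close>

text \<open>The winding number is defined through Hamiltonian isotopies, so nothing can be computed
  before one is known to exist inside the disk; this is the hardest part. Interpolating the angle is
  harmless only if no intermediate leaf turns back or is trapped. That is ensured by a function
  growing along the field at a definite rate and staying within bounded distance of
  \<open>Re\<close>; the existence of such a function survives a change of the angle by at most
  pi/3, so finitely many steps lead from \<open>th\<close> down to every \<open>s * th\<close>.
  Integrating the flux along leaves gives a Hamiltonian that need not vanish at the far right. It is
  cancelled by bending the leaves there: first back to their original heights, then by a bump so
  wide that the leaves stay disjoint. The map left over after the isotopy preserves area and sends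
  each horizontal line into a prescribed graph; comparing both ends of the line forces it to be the
  identity. The isotopy may leave the unit disk, so it is run at a small scale and then scaled up;
  the generator of this scaling is given by the action function of phi itself.\<close>

abbreviation FD :: "('a::euclidean_space \<Rightarrow> 'b::real_normed_vector) \<Rightarrow> 'a \<Rightarrow> 'a \<Rightarrow> 'b"
  where "FD f x \<equiv> frechet_derivative f (at x)"

lemma FD_eq: "(f has_derivative f') (at x) \<Longrightarrow> FD f x = f'"
  using frechet_derivative_at by metis

lemma Ck_on_cong:
  assumes "open U" "\<And>x. x \<in> U \<Longrightarrow> f x = g x" "Ck_on k U f"
  shows "Ck_on k U g"
  using assms(2,3)
proof (induction k arbitrary: f g)
  case 0
  then show ?case by (simp cong: continuous_on_cong)
next
  case (Suc k)
  have d: "(g has_derivative FD f x) (at x)" if "x \<in> U" for x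
  proof -
    have "f differentiable (at x)"
      using Suc.prems(2) that at_within_open[OF that assms(1)] unfolding Ck_on.simps differentiable_on_def by metis
    then have "(f has_derivative FD f x) (at x)" by (simp add: frechet_derivative_works)
    then show ?thesis
      using has_derivative_transform_within_open[OF _ assms(1) that] Suc.prems(1) by blast
  qed
  have "g differentiable_on U"
    using d by (auto simp: differentiable_on_def differentiable_def intro: has_derivative_at_withinI)
  moreover have "Ck_on k U (\<lambda>x. FD g x i)" if "i \<in> Basis" for i
  proof (rule Suc.IH)
    show "Ck_on k U (\<lambda>x. FD f x i)" using Suc.prems(2) that by simp
    show "FD f x i = FD g x i" if "x \<in> U" for x using FD_eq[OF d[OF that]] by simp
  qed
  ultimately show ?case by simp
qed

lemma Ck_on_SucI:
  assumes "open U" "\<And>x. x \<in> U \<Longrightarrow> (f has_derivative f' x) (at x)"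
    "\<And>i. i \<in> Basis \<Longrightarrow> Ck_on k U (\<lambda>x. f' x i)"
  shows "Ck_on (Suc k) U f"
proof -
  have "f differentiable_on U"
    using assms(2) by (auto simp: differentiable_on_def differentiable_def intro: has_derivative_at_withinI)
  moreover have "Ck_on k U (\<lambda>x. FD f x i)" if "i \<in> Basis" for i
    by (rule Ck_on_cong[OF assms(1) _ assms(3)[OF that]]) (simp add: FD_eq[OF assms(2)])
  ultimately show ?thesis by simp
qed

lemma Ck_on_Suc_has_derivative:
  assumes "open U" "Ck_on (Suc k) U f" "x \<in> U"
  shows "(f has_derivative FD f x) (at x)"
proof -
  have "f differentiable (at x within U)" using assms(2,3) by (simp add: differentiable_on_def)
  then have "f differentiable (at x)" using at_within_open[OF assms(3,1)] by simp
  then show ?thesis by (simp add: frechet_derivative_works)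
qed

lemma Ck_on_Suc_imp: "Ck_on (Suc k) U f \<Longrightarrow> Ck_on k U f"
proof (induction k arbitrary: f)
  case 0
  then show ?case by (simp add: differentiable_imp_continuous_on)
next
  case (Suc k)
  have "f differentiable_on U" using Suc.prems by simp
  moreover have "\<forall>i\<in>Basis. Ck_on k U (\<lambda>x. FD f x i)"
  proof
    fix i :: 'a assume "i \<in> Basis"
    then have "Ck_on (Suc k) U (\<lambda>x. FD f x i)" using Suc.prems by (subst (asm) Ck_on.simps) blast
    then show "Ck_on k U (\<lambda>x. FD f x i)" by (rule Suc.IH)
  qed
  ultimately show ?case by simp
qed

lemma Ck_on_const: "open U \<Longrightarrow> Ck_on k U (\<lambda>x. c)"
proof (induction k arbitrary: c)
  case (Suc k)
  show ?case by (rule Ck_on_SucI[where f' = "\<lambda>x v. 0"]) (auto simp: Suc)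
qed simp

lemma Ck_on_bounded_linear:
  assumes "open U" "bounded_linear h" "Ck_on k U f"
  shows "Ck_on k U (\<lambda>x. h (f x))"
  using assms(3)
proof (induction k arbitrary: f)
  case 0
  then show ?case
    using continuous_on_compose2[OF linear_continuous_on[OF assms(2), of UNIV], of U f] by simp
next
  case (Suc k)
  show ?case
  proof (rule Ck_on_SucI[OF assms(1), where f' = "\<lambda>x v. h (FD f x v)"])
    show "((\<lambda>x. h (f x)) has_derivative (\<lambda>v. h (FD f x v))) (at x)" if "x \<in> U" for x
      using bounded_linear.has_derivative[OF assms(2) Ck_on_Suc_has_derivative[OF assms(1) Suc.prems that]] .
    show "Ck_on k U (\<lambda>x. h (FD f x i))" if "i \<in> Basis" for i
      using Suc.IH Suc.prems that by simp
  qed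
qed

lemma Ck_on_id: "open U \<Longrightarrow> Ck_on k U (\<lambda>x. x)"
proof (cases k)
  case (Suc m)
  assume "open U"
  then show ?thesis unfolding Suc
    by (intro Ck_on_SucI[where f' = "\<lambda>x v. v"]) (auto intro: Ck_on_const)
qed simp

lemma Ck_on_add:
  assumes "open U" "Ck_on k U f" "Ck_on k U g"
  shows "Ck_on k U (\<lambda>x. f x + g x)"
  using assms(2,3)
proof (induction k arbitrary: f g)
  case 0
  then show ?case by (simp add: continuous_on_add)
next
  case (Suc k)
  show ?case
  proof (rule Ck_on_SucI[OF assms(1), where f' = "\<lambda>x v. FD f x v + FD g x v"])
    show "((\<lambda>x. f x + g x) has_derivative (\<lambda>v. FD f x v + FD g x v)) (at x)" if "x \<in> U" for x
      by (intro has_derivative_add Ck_on_Suc_has_derivative[OF assms(1) Suc.prems(1) that]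
          Ck_on_Suc_has_derivative[OF assms(1) Suc.prems(2) that])
  qed (use Suc in auto)
qed

lemma Ck_on_bilinear:
  assumes "open U" "bounded_bilinear pr" "Ck_on k U f" "Ck_on k U g"
  shows "Ck_on k U (\<lambda>x. pr (f x) (g x))"
  using assms(3,4)
proof (induction k arbitrary: f g)
  case 0
  then show ?case using bounded_bilinear.continuous_on[OF assms(2)] by simp
next
  case (Suc k)
  show ?case
  proof (rule Ck_on_SucI[OF assms(1), where f' = "\<lambda>x v. pr (f x) (FD g x v) + pr (FD f x v) (g x)"])
    show "((\<lambda>x. pr (f x) (g x)) has_derivative (\<lambda>v. pr (f x) (FD g x v) + pr (FD f x v) (g x))) (at x)"
      if "x \<in> U" for x
      by (intro bounded_bilinear.FDERIV[OF assms(2)] Ck_on_Suc_has_derivative[OF assms(1) Suc.prems(1) that]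
          Ck_on_Suc_has_derivative[OF assms(1) Suc.prems(2) that])
    show "Ck_on k U (\<lambda>x. pr (f x) (FD g x i) + pr (FD f x i) (g x))" if "i \<in> Basis" for i
      using Suc that by (intro Ck_on_add[OF assms(1)] Suc.IH) (auto intro: Ck_on_Suc_imp)
  qed
qed

lemma Ck_on_sum:
  assumes "open U" "\<And>i. i \<in> I \<Longrightarrow> Ck_on k U (f i)"
  shows "Ck_on k U (\<lambda>x. \<Sum>i\<in>I. f i x)"
  using assms(2)
  by (induction I rule: infinite_finite_induct) (auto intro!: Ck_on_const Ck_on_add assms(1))

lemma linear_expand_Basis:
  assumes "bounded_linear (f :: 'a::euclidean_space \<Rightarrow> 'b::real_normed_vector)"
  shows "f v = (\<Sum>i\<in>Basis. (v \<bullet> i) *\<^sub>R f i)"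
proof -
  interpret bounded_linear f by fact
  show ?thesis
    using sum[of "\<lambda>i. (v \<bullet> i) *\<^sub>R i" Basis] by (simp add: euclidean_representation scaleR)
qed

text \<open>In coordinates of the intermediate space the chain rule is a sum of products of
  functions that are one degree less smooth, so the induction runs over \<open>g\<close> and its
  partial derivatives while \<open>f\<close> stays fixed.\<close>

lemma Ck_on_compose:
  fixes f :: "'a::euclidean_space \<Rightarrow> 'b::euclidean_space"
  assumes "open U" "open V" "Ck_on k U f" "Ck_on k V g" "f ` U \<subseteq> V"
  shows "Ck_on k U (\<lambda>x. g (f x))"
  using assms(3,4)
proof (induction k arbitrary: g)
  case 0
  then show ?case using assms(5) by (auto intro: continuous_on_compose2)
next
  case (Suc k)
  show ?case
  proof (rule Ck_on_SucI[OF assms(1),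
        where f' = "\<lambda>x v. \<Sum>j\<in>Basis. (FD f x v \<bullet> j) *\<^sub>R FD g (f x) j"])
    show "((\<lambda>x. g (f x)) has_derivative (\<lambda>v. \<Sum>j\<in>Basis. (FD f x v \<bullet> j) *\<^sub>R FD g (f x) j)) (at x)"
      if "x \<in> U" for x
    proof -
      have g: "(g has_derivative FD g (f x)) (at (f x))"
        using Ck_on_Suc_has_derivative[OF assms(2) Suc.prems(2)] assms(5) that by blast
      have "((\<lambda>x. g (f x)) has_derivative (\<lambda>v. FD g (f x) (FD f x v))) (at x)"
        using has_derivative_compose[OF Ck_on_Suc_has_derivative[OF assms(1) Suc.prems(1) that] g] .
      then show ?thesis
        by (subst (asm) linear_expand_Basis[OF has_derivative_bounded_linear[OF g]])
    qed
    fix i :: 'a assume i: "i \<in> Basis"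
    have "Ck_on k U (\<lambda>x. (FD f x i \<bullet> j) *\<^sub>R FD g (f x) j)" if "j \<in> Basis" for j
      using Suc.prems i that
      by (intro Ck_on_bilinear[OF assms(1) bounded_bilinear_scaleR]
          Ck_on_bounded_linear[OF assms(1) bounded_linear_inner_left] Suc.IH)
        (auto intro: Ck_on_Suc_imp)
    then show "Ck_on k U (\<lambda>x. \<Sum>j\<in>Basis. (FD f x i \<bullet> j) *\<^sub>R FD g (f x) j)"
      by (rule Ck_on_sum[OF assms(1)])
  qed
qed

lemma Ck_on_subset:
  assumes "open V" "V \<subseteq> U" "Ck_on k U f" shows "Ck_on k V f"
  using assms(3)
proof (induction k arbitrary: f)
  case 0
  then show ?case using assms(2) continuous_on_subset by auto
next
  case (Suc k)
  then show ?case using assms(2) differentiable_on_subset by auto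
qed

lemma Ck_on_local:
  assumes "\<And>x. x \<in> U \<Longrightarrow> \<exists>V. open V \<and> x \<in> V \<and> Ck_on k V f"
  shows "Ck_on k U f"
  using assms
proof (induction k arbitrary: f)
  case 0
  then show ?case
    by (metis Ck_on.simps(1) continuous_at_imp_continuous_on continuous_on_eq_continuous_at)
next
  case (Suc k)
  have "f differentiable_on U" unfolding differentiable_on_def
  proof
    fix x assume "x \<in> U"
    then obtain V where "open V" "x \<in> V" "Ck_on (Suc k) V f" using Suc.prems by blast
    then have "(f has_derivative FD f x) (at x)" 
      by (intro Ck_on_Suc_has_derivative)
    then show "f differentiable at x within U"
      by (metis differentiable_def has_derivative_at_withinI)
  qed
  moreover have "Ck_on k U (\<lambda>x. FD f x i)" if "i \<in> Basis" for i
    using Suc.prems that by (intro Suc.IH) (metis Ck_on.simps(2))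
  ultimately show ?case by simp
qed

text \<open>\<open>Ck_on\<close> mixes derivatives within \<open>U\<close> with derivatives at the
  point. They agree on open sets, hence openness is built in.\<close>

definition Cinf_on :: "'a::euclidean_space set \<Rightarrow> ('a \<Rightarrow> 'b::real_normed_vector) \<Rightarrow> bool"
  where "Cinf_on U f \<longleftrightarrow> open U \<and> (\<forall>k. Ck_on k U f)"

abbreviation Cinf :: "('a::euclidean_space \<Rightarrow> 'b::real_normed_vector) \<Rightarrow> bool"
  where "Cinf \<equiv> Cinf_on UNIV"

lemma Cinf_on_has_derivative: "Cinf_on U f \<Longrightarrow> x \<in> U \<Longrightarrow> (f has_derivative FD f x) (at x)"
  using Ck_on_Suc_has_derivative unfolding Cinf_on_def by blast

lemma Cinf_has_derivative: "Cinf f \<Longrightarrow> (f has_derivative FD f x) (at x)"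
  using Cinf_on_has_derivative by blast

lemma Cinf_on_FD: "Cinf_on U f \<Longrightarrow> Cinf_on U (\<lambda>x. FD f x v)"
proof -
  assume f: "Cinf_on U f"
  then have U: "open U" by (simp add: Cinf_on_def)
  have "Ck_on k U (\<lambda>x. FD f x v)" for k
  proof (rule Ck_on_cong[OF U])
    have "Ck_on (Suc k) U f" using f by (auto simp: Cinf_on_def simp del: Ck_on.simps)
    then show "Ck_on k U (\<lambda>x. \<Sum>i\<in>Basis. (v \<bullet> i) *\<^sub>R FD f x i)"
      by (intro Ck_on_sum[OF U] Ck_on_bounded_linear[OF U bounded_linear_scaleR_right]) auto
    show "(\<Sum>i\<in>Basis. (v \<bullet> i) *\<^sub>R FD f x i) = FD f x v" if "x \<in> U" for x
      by (rule linear_expand_Basis[OF has_derivative_bounded_linear[OF Cinf_on_has_derivative[OF f that]], symmetric])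
  qed
  then show ?thesis using U by (simp add: Cinf_on_def)
qed

lemma Cinf_on_continuous: "Cinf_on U f \<Longrightarrow> continuous_on U f"
  unfolding Cinf_on_def using Ck_on.simps(1) by blast

lemma Cinf_continuous: "Cinf f \<Longrightarrow> continuous_on A f"
  using Cinf_on_continuous continuous_on_subset by blast

named_theorems smooth_intros

lemma Cinf_const [smooth_intros]: "Cinf (\<lambda>x. c)" by (simp add: Cinf_on_def Ck_on_const)
lemma Cinf_ident [smooth_intros]: "Cinf (\<lambda>x. x)" by (simp add: Cinf_on_def Ck_on_id)
lemma Cinf_add [smooth_intros]: "Cinf_on U f \<Longrightarrow> Cinf_on U g \<Longrightarrow> Cinf_on U (\<lambda>x. f x + g x)"
  by (simp add: Cinf_on_def Ck_on_add)
lemma Cinf_bounded_linear: "bounded_linear h \<Longrightarrow> Cinf_on U f \<Longrightarrow> Cinf_on U (\<lambda>x. h (f x))"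
  by (simp add: Cinf_on_def Ck_on_bounded_linear)
lemma Cinf_bilinear: "bounded_bilinear h \<Longrightarrow> Cinf_on U f \<Longrightarrow> Cinf_on U g \<Longrightarrow> Cinf_on U (\<lambda>x. h (f x) (g x))"
  by (simp add: Cinf_on_def Ck_on_bilinear)
lemma Cinf_compose_on:
  "Cinf_on V g \<Longrightarrow> Cinf_on U f \<Longrightarrow> f ` U \<subseteq> V \<Longrightarrow> Cinf_on U (\<lambda>x. g (f x))"
  unfolding Cinf_on_def using Ck_on_compose by blast
lemma Cinf_compose: "Cinf g \<Longrightarrow> Cinf f \<Longrightarrow> Cinf (\<lambda>x. g (f x))"
  by (rule Cinf_compose_on) auto

lemmas Cinf_minus [smooth_intros] = Cinf_bounded_linear[OF bounded_linear_minus[OF bounded_linear_ident]]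
lemmas Cinf_Re [smooth_intros] = Cinf_bounded_linear[OF bounded_linear_Re]
lemmas Cinf_Im [smooth_intros] = Cinf_bounded_linear[OF bounded_linear_Im]
lemmas Cinf_fst [smooth_intros] = Cinf_bounded_linear[OF bounded_linear_fst]
lemmas Cinf_snd [smooth_intros] = Cinf_bounded_linear[OF bounded_linear_snd]
lemmas Cinf_of_real [smooth_intros] = Cinf_bounded_linear[OF bounded_linear_of_real]
lemmas Cinf_scaleR [smooth_intros] = Cinf_bilinear[OF bounded_bilinear_scaleR]
lemmas Cinf_mult [smooth_intros] = Cinf_bilinear[OF bounded_bilinear_mult]
lemmas Cinf_inner [smooth_intros] = Cinf_bilinear[OF bounded_bilinear_inner]

lemma Cinf_diff [smooth_intros]: "Cinf_on U f \<Longrightarrow> Cinf_on U g \<Longrightarrow> Cinf_on U (\<lambda>x. f x - g x)"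
  using Cinf_add[of U f "\<lambda>x. - g x"] Cinf_minus[of U g] by simp

lemma Cinf_Pair [smooth_intros]: "Cinf_on U f \<Longrightarrow> Cinf_on U g \<Longrightarrow> Cinf_on U (\<lambda>x. (f x, g x))"
proof -
  assume fg: "Cinf_on U f" "Cinf_on U g"
  have "bounded_linear (\<lambda>a::'b. (a, 0::'c))" "bounded_linear (\<lambda>a::'c. (0::'b, a))"
    by (auto intro!: bounded_linear_Pair bounded_linear_ident bounded_linear_zero)
  then have "Cinf_on U (\<lambda>x. (f x, 0::'c))" "Cinf_on U (\<lambda>x. (0::'b, g x))"
    using Cinf_bounded_linear[of "\<lambda>a. (a, 0::'c)" U f] Cinf_bounded_linear[of "\<lambda>a. (0::'b, a)" U g] fg by auto
  then show ?thesis
    using Cinf_add[of U "\<lambda>x. (f x, 0)" "\<lambda>x. (0, g x)"] by simp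
qed

lemma Cinf_Complex [smooth_intros]: "Cinf_on U f \<Longrightarrow> Cinf_on U g \<Longrightarrow> Cinf_on U (\<lambda>x. Complex (f x) (g x))"
  unfolding Complex_eq
  by (intro Cinf_add Cinf_of_real Cinf_bounded_linear[OF bounded_linear_mult_right])

lemma Cinf_sum [smooth_intros]:
  "open U \<Longrightarrow> (\<And>i. i \<in> I \<Longrightarrow> Cinf_on U (f i)) \<Longrightarrow> Cinf_on U (\<lambda>x. \<Sum>i\<in>I. f i x)"
  unfolding Cinf_on_def by (auto intro: Ck_on_sum)

lemma Cinf_FD [smooth_intros]:
  assumes "Cinf f" "Cinf h" "Cinf v"
  shows "Cinf (\<lambda>x. FD f (h x) (v x))"
proof -
  have "Cinf (\<lambda>x. \<Sum>i\<in>Basis. (v x \<bullet> i) *\<^sub>R FD f (h x) i)"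
    by (intro smooth_intros assms Cinf_compose[OF Cinf_on_FD] open_UNIV)
  then show ?thesis
    by (simp only: linear_expand_Basis[OF has_derivative_bounded_linear[OF Cinf_has_derivative[OF assms(1)]], symmetric])
qed

lemma Cinf_on_subset: "Cinf_on U f \<Longrightarrow> open V \<Longrightarrow> V \<subseteq> U \<Longrightarrow> Cinf_on V f"
  unfolding Cinf_on_def using Ck_on_subset by blast

lemma Cinf_on_cong: "Cinf_on U f \<Longrightarrow> (\<And>x. x \<in> U \<Longrightarrow> f x = g x) \<Longrightarrow> Cinf_on U g"
  unfolding Cinf_on_def using Ck_on_cong by blast

lemma Cinf_on_Un: "Cinf_on U f \<Longrightarrow> Cinf_on V f \<Longrightarrow> Cinf_on (U \<union> V) f"
  unfolding Cinf_on_def by (auto intro!: Ck_on_local)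

lemma Cinf_exp [smooth_intros]:
  fixes f :: "'a::euclidean_space \<Rightarrow> 'b::{real_normed_field,banach,euclidean_space}"
  assumes "Cinf f" shows "Cinf (\<lambda>x. exp (f x))"
proof -
  have "Ck_on k UNIV (exp :: 'b \<Rightarrow> 'b)" for k
  proof (induction k)
    case 0
    then show ?case by (simp add: continuous_on_exp continuous_on_id)
  next
    case (Suc k)
    show ?case
    proof (rule Ck_on_SucI[where f' = "\<lambda>x v. exp x * v"])
      show "(exp has_derivative (\<lambda>v. exp x * v)) (at x)" for x :: 'b
        using DERIV_exp[of x] by (simp add: has_field_derivative_def)
      show "Ck_on k UNIV (\<lambda>x. exp x * i)" for i :: 'b
        by (rule Ck_on_bounded_linear[OF open_UNIV bounded_linear_mult_left Suc])
    qed simp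
  qed
  then show ?thesis using Cinf_compose assms by (auto simp: Cinf_on_def)
qed

lemma Cinf_on_inverse: "Cinf_on (-{0}) (inverse :: real \<Rightarrow> real)"
proof -
  have "Ck_on k (-{0}) (inverse :: real \<Rightarrow> real)" for k
  proof (induction k)
    case 0
    then show ?case by (auto intro!: continuous_intros)
  next
    case (Suc k)
    show ?case
    proof (rule Ck_on_SucI[where f' = "\<lambda>x v. - (inverse x * v * inverse x)"])
      show "(inverse has_derivative (\<lambda>v. - (inverse x * v * inverse x))) (at x)" if "x \<in> - {0}" for x :: real
        using that by (intro has_derivative_inverse') auto
    qed (auto intro!: Ck_on_bounded_linear[OF _ bounded_linear_minus[OF bounded_linear_ident]]
        Ck_on_bilinear[OF _ bounded_bilinear_mult] Suc Ck_on_const)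
  qed
  then show ?thesis by (simp add: Cinf_on_def open_Compl)
qed

lemma Cinf_divide:
  assumes "Cinf f" "Cinf g" "\<And>x. g x \<noteq> 0"
  shows "Cinf (\<lambda>x. f x / g x :: real)"
  unfolding divide_inverse
  using assms by (intro Cinf_mult Cinf_compose_on[OF Cinf_on_inverse]) auto


section \<open>A smooth step function\<close>

lemma has_derivative_at_vanishing:
  fixes f :: "real \<Rightarrow> real"
  assumes "(\<lambda>x. f x / x) \<midarrow>0\<rightarrow> 0" "f 0 = 0"
  shows "(f has_derivative (\<lambda>v. 0)) (at 0)"
proof -
  have "(f has_field_derivative 0) (at 0)"
    unfolding has_field_derivative_iff using assms by simp
  then show ?thesis by (simp add: has_field_derivative_def lambda_zero)
qed

text \<open>The derivative of one member is a combination of two others, so smoothness of exp(-1/x),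
  extended by 0, is proved for the whole family by one induction on the order.\<close>

definition flat_pow :: "nat \<Rightarrow> real \<Rightarrow> real"
  where "flat_pow m x = (if x \<le> 0 then 0 else (1 / x) ^ m * exp (- 1 / x))"

lemma flat_pow_0 [simp]: "flat_pow m 0 = 0" by (simp add: flat_pow_def)

lemma flat_pow_lim: "(\<lambda>x. flat_pow m x) \<midarrow>0\<rightarrow> 0"
proof -
  have 1: "((\<lambda>x::real. (1 / x) ^ m * exp (- 1 / x)) \<longlongrightarrow> 0) (at_right 0)"
    by real_asymp
  have "(flat_pow m \<longlongrightarrow> 0) (at_right 0)"
    by (rule Lim_transform_eventually[OF 1])
      (auto simp: flat_pow_def eventually_at_filter)
  moreover have "(flat_pow m \<longlongrightarrow> 0) (at_left 0)"
    by (rule Lim_transform_eventually[OF tendsto_const])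
      (auto simp: flat_pow_def eventually_at_filter)
  ultimately show ?thesis by (simp add: filterlim_split_at)
qed

lemma flat_pow_has_derivative:
  "(flat_pow m has_derivative (\<lambda>v. (flat_pow (m+2) x - m * flat_pow (m+1) x) * v)) (at x)"
proof -
  consider "x < 0" | "x = 0" | "x > 0" by linarith
  then show ?thesis
  proof cases
    case 1
    have "((\<lambda>x. 0::real) has_derivative (\<lambda>v. 0)) (at x)" by simp
    then have "(flat_pow m has_derivative (\<lambda>v. 0)) (at x)"
      by (rule has_derivative_transform_within_open[of _ _ _ _ "{..<0}"]) (use 1 in \<open>auto simp: flat_pow_def\<close>)
    then show ?thesis using 1 by (simp add: flat_pow_def)
  next
    case 2
    have "(\<lambda>x. flat_pow m x / x) \<midarrow>0\<rightarrow> 0"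
      by (rule Lim_transform_eventually[OF flat_pow_lim[of "Suc m"]])
        (auto simp: flat_pow_def eventually_at_filter)
    from has_derivative_at_vanishing[OF this] show ?thesis
      using 2 by simp
  next
    case 3
    have *: "((\<lambda>x. (1 / x) ^ m * exp (- 1 / x)) has_field_derivative
        (flat_pow (m+2) x - m * flat_pow (m+1) x)) (at x)"
      using 3 by (cases m; auto intro!: derivative_eq_intros simp: flat_pow_def field_simps power2_eq_square)
        (metis Suc_pred gr0I power_Suc)
    show ?thesis
      by (rule has_derivative_transform_within_open[of _ _ _ _ "{0<..}"])
        (use 3 * in \<open>auto simp: has_field_derivative_def flat_pow_def\<close>)
  qed
qed

lemma Cinf_flat_pow: "Cinf (flat_pow m)"
proof -
  have "Ck_on k UNIV (flat_pow m)" for k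
  proof (induction k arbitrary: m)
    case 0
    show ?case
      using flat_pow_has_derivative has_derivative_continuous by (force simp: continuous_on_eq_continuous_at)
  next
    case (Suc k)
    have "Ck_on k UNIV (\<lambda>x. (flat_pow (m+2) x + (- m) * flat_pow (m+1) x) * i)" for i :: real
      by (intro Ck_on_bounded_linear[OF _ bounded_linear_mult_left]
          Ck_on_bounded_linear[OF _ bounded_linear_mult_right] Ck_on_add Suc open_UNIV)
    then have *: "Ck_on k UNIV (\<lambda>x. (flat_pow (m+2) x - m * flat_pow (m+1) x) * i)" for i :: real
      by simp
    show ?case by (rule Ck_on_SucI[OF open_UNIV flat_pow_has_derivative *])
  qed
  then show ?thesis by (simp add: Cinf_on_def)
qed

definition smooth_step :: "real \<Rightarrow> real"
  where "smooth_step x = flat_pow 0 x / (flat_pow 0 x + flat_pow 0 (1 - x))"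

lemma Cinf_smooth_step: "Cinf smooth_step"
proof -
  have "flat_pow 0 x + flat_pow 0 (1 - x) \<noteq> 0" for x
    by (auto simp: flat_pow_def add_eq_0_iff)
      (smt (verit) exp_gt_zero)
  then show ?thesis
    unfolding smooth_step_def
    by (intro Cinf_divide smooth_intros Cinf_flat_pow Cinf_compose[OF Cinf_flat_pow]) auto
qed

lemma smooth_step_le0: "x \<le> 0 \<Longrightarrow> smooth_step x = 0"
  and smooth_step_ge1: "x \<ge> 1 \<Longrightarrow> smooth_step x = 1"
  by (auto simp: smooth_step_def flat_pow_def)

lemma smooth_step_range: "0 \<le> smooth_step x" "smooth_step x \<le> 1"
  by (auto simp: smooth_step_def flat_pow_def divide_simps add_nonneg_nonneg)
    (smt (verit) exp_gt_zero)+

text \<open>The inverse is continuous by invariance of domain; smoothness then propagates through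
  the formula for its derivative.\<close>
lemma Cinf_inverse:
  fixes f :: "'a::euclidean_space \<Rightarrow> 'a"
  assumes f: "Cinf f" and gf: "\<And>x. g (f x) = x" and fg: "\<And>y. f (g y) = y"
    and J: "\<And>x. bounded_linear (J x)" "\<And>x v. J x (FD f x v) = v"
    and JC: "\<And>i. i \<in> Basis \<Longrightarrow> Cinf (\<lambda>x. J x i)"
  shows "Cinf g"
proof -
  have inj: "inj f" using gf by (metis injI)
  have "range f = UNIV" using fg by (metis surjI)
  moreover obtain h where "homeomorphism UNIV (range f) f h"
    using invariance_of_domain_homeomorphism[OF open_UNIV Cinf_continuous[OF f] _ inj] by auto
  ultimately have "continuous_on UNIV h" "h y = g y" for y
    using fg gf by (auto simp: homeomorphism_def) (metis)
  then have cg: "continuous_on UNIV g" by (metis ext)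
  have dg: "(g has_derivative J (g y)) (at y)" for y
  proof (rule has_derivative_inverse_basic[OF Cinf_has_derivative[OF f] J(1) _ _ open_UNIV])
    show "J (g y) \<circ> FD f (g y) = id" using J(2) by auto
    show "continuous (at y) g" using cg by (simp add: continuous_on_eq_continuous_at)
  qed (use fg in auto)
  have "Ck_on k UNIV g" for k
  proof (induction k)
    case 0
    then show ?case using cg by simp
  next
    case (Suc k)
    show ?case
    proof (rule Ck_on_SucI[OF open_UNIV dg])
      show "Ck_on k UNIV (\<lambda>y. J (g y) i)" if "i \<in> Basis" for i
        using JC[OF that] by (intro Ck_on_compose[OF open_UNIV open_UNIV Suc]) (auto simp: Cinf_on_def)
    qed
  qed
  then show ?thesis by (simp add: Cinf_on_def)
qed

section \<open>Smooth dependence of solutions of differential equations\<close>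

lemma has_vector_derivative_imp_continuous_on:
  assumes "\<And>t. (w has_vector_derivative w' t) (at t)"
  shows "continuous_on S w"
  by (intro continuous_at_imp_continuous_on ballI has_vector_derivative_continuous[OF assms])

text \<open>Estimating the square of the norm keeps the comparison function differentiable.\<close>
lemma gronwall_pos:
  fixes w :: "real \<Rightarrow> 'a::real_inner"
  assumes "continuous_on {0..T} w" "T \<ge> 0" "L \<ge> 0"
    and d: "\<And>t. 0 < t \<Longrightarrow> t < T \<Longrightarrow> (w has_vector_derivative w' t) (at t)"
    and b: "\<And>t. 0 < t \<Longrightarrow> t < T \<Longrightarrow> norm (w' t) \<le> L * norm (w t) + a"
  shows "(norm (w T))\<^sup>2 + a\<^sup>2 \<le> ((norm (w 0))\<^sup>2 + a\<^sup>2) * exp ((2*L+1) * T)"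
proof (cases "T = 0")
  case False
  then have T: "0 < T" using assms by simp
  define g where "g t = exp (-(2*L+1) * t) * (w t \<bullet> w t + a\<^sup>2)" for t
  have "g T \<le> g 0"
  proof (rule DERIV_nonpos_imp_decreasing_open[OF assms(2)])
    fix t assume t: "0 < t" "t < T"
    have dw: "(w has_derivative (\<lambda>h. h *\<^sub>R w' t)) (at t)" using d[OF t] by (simp add: has_vector_derivative_def)
    have "(g has_field_derivative (exp (-(2*L+1) * t) * (2 * (w t \<bullet> w' t) - (2*L+1) * (w t \<bullet> w t + a\<^sup>2)))) (at t)"
      unfolding g_def has_field_derivative_def
      by (rule derivative_eq_intros dw refl ext | simp)+
        (auto simp: algebra_simps inner_commute)
    moreover have "2 * (w t \<bullet> w' t) \<le> (2*L+1) * (w t \<bullet> w t + a\<^sup>2)"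
    proof -
      have "w t \<bullet> w' t \<le> norm (w t) * (L * norm (w t) + a)"
        using norm_cauchy_schwarz[of "w t" "w' t"] b[OF t] by (meson mult_left_mono norm_ge_zero order_trans)
      moreover have "2 * (norm (w t) * a) \<le> (norm (w t))\<^sup>2 + a\<^sup>2"
        using sum_squares_bound[of "norm (w t)" a] by (simp add: algebra_simps)
      moreover have "0 \<le> L * a\<^sup>2" using assms by simp
      ultimately show ?thesis by (simp add: dot_square_norm power2_eq_square algebra_simps)
    qed
    ultimately show "\<exists>y. (g has_field_derivative y) (at t) \<and> y \<le> 0"
      by (intro exI conjI) (auto simp: mult_nonneg_nonpos)
  next
    show "continuous_on {0..T} g" unfolding g_def
      by (intro continuous_intros assms(1))
  qed
  then show ?thesis
    by (simp add: g_def dot_square_norm exp_minus field_simps exp_diff exp_add)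
qed simp

text \<open>The bound is demanded only between 0 and \<open>T\<close>. This is what is available for
  leaves near the disk, whose comparison line avoids the disk in one direction of time only.\<close>

lemma gronwall_segment:
  fixes w :: "real \<Rightarrow> 'a::real_inner"
  assumes "L \<ge> 0" and d: "\<And>t. (w has_vector_derivative w' t) (at t)"
    and b: "\<And>t. t \<in> closed_segment 0 T \<Longrightarrow> norm (w' t) \<le> L * norm (w t) + a"
  shows "(norm (w T))\<^sup>2 + a\<^sup>2 \<le> ((norm (w 0))\<^sup>2 + a\<^sup>2) * exp ((2*L+1) * \<bar>T\<bar>)"
proof (cases "T \<ge> 0")
  case True
  have "continuous_on {0..T} w"
    by (rule has_vector_derivative_imp_continuous_on[OF d])
  from gronwall_pos[OF this True assms(1) d] b True show ?thesis
    by (simp add: closed_segment_eq_real_ivl)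
next
  case False
  have d': "((\<lambda>t. w (- t)) has_vector_derivative - w' (- t)) (at t)" for t
  proof -
    have "(uminus has_vector_derivative - 1) (at t)" by (auto intro!: derivative_eq_intros)
    from vector_diff_chain_at[OF this d] show ?thesis by (simp add: o_def)
  qed
  have "continuous_on {0..-T} (\<lambda>t. w (- t))"
    by (rule has_vector_derivative_imp_continuous_on[OF d'])
  from gronwall_pos[OF this _ assms(1) d'] b False show ?thesis
    by (simp add: closed_segment_eq_real_ivl)
qed

lemma gronwall:
  fixes w :: "real \<Rightarrow> 'a::real_inner"
  assumes "L \<ge> 0" and d: "\<And>t. (w has_vector_derivative w' t) (at t)"
    and b: "\<And>t. \<bar>t\<bar> \<le> \<bar>T\<bar> \<Longrightarrow> norm (w' t) \<le> L * norm (w t) + a"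
  shows "(norm (w T))\<^sup>2 + a\<^sup>2 \<le> ((norm (w 0))\<^sup>2 + a\<^sup>2) * exp ((2*L+1) * \<bar>T\<bar>)"
  by (rule gronwall_segment[OF assms(1) d b]) (auto simp: closed_segment_eq_real_ivl split: if_splits)

text \<open>Rescaling the integral from 0 to t to the fixed interval [0,1] turns it into a parameter
  integral and treats both signs of t alike.\<close>

lemma scaled_integral_has_vector_derivative:
  fixes f :: "real \<Rightarrow> 'a::euclidean_space"
  assumes "continuous_on UNIV f"
  shows "((\<lambda>t. integral {0..1} (\<lambda>s. t *\<^sub>R f (s * t))) has_vector_derivative f t) (at t)"
proof -
  define N where "N = \<bar>t\<bar> + 1"
  obtain g where g: "\<And>x. x \<in> {-N..N} \<Longrightarrow> (g has_vector_derivative f x) (at x within {-N..N})"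
    using antiderivative_continuous[of "-N" N f] assms continuous_on_subset by blast
  have eq: "integral {0..1} (\<lambda>s. r *\<^sub>R f (s * r)) = g r - g 0" if r: "r \<in> {-N<..<N}" for r
  proof -
    have "((\<lambda>s. r *\<^sub>R f (s * r)) has_integral g (1 * r) - g (0 * r)) {0..1}"
    proof (rule fundamental_theorem_of_calculus)
      fix s :: real assume s: "s \<in> {0..1}"
      have im: "(\<lambda>s. s * r) ` {0..1} \<subseteq> {-N..N}"
      proof clarsimp
        fix x :: real assume "0 \<le> x" "x \<le> 1"
        then have "\<bar>x * r\<bar> \<le> \<bar>r\<bar>" by (simp add: abs_mult mult_left_le_one_le)
        then show "- N \<le> x * r \<and> x * r \<le> N" using r by auto
      qed
      have "(g has_vector_derivative f (s * r)) (at (s * r) within (\<lambda>s. s * r) ` {0..1})"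
        using has_vector_derivative_within_subset[OF g im] im s by blast
      moreover have "((\<lambda>s. s * r) has_vector_derivative r) (at s within {0..1})"
        by (auto intro!: derivative_eq_intros)
      ultimately show "((\<lambda>s. g (s * r)) has_vector_derivative r *\<^sub>R f (s * r)) (at s within {0..1})"
        using vector_diff_chain_within by (fastforce simp: o_def)
    qed simp
    then show ?thesis by (intro integral_unique) simp
  qed
  have t: "t \<in> {-N<..<N}" by (auto simp: N_def)
  have "(g has_vector_derivative f t) (at t)"
    using g[of t] t at_within_Icc_at[of "-N" t N] by simp
  then have "((\<lambda>t. g t - g 0) has_vector_derivative f t) (at t)"
    by (auto intro!: derivative_eq_intros)
  then show ?thesis
    by (rule has_vector_derivative_transform_within_open[of _ _ _ "{-N<..<N}"]) (use t eq in auto)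
qed

text \<open>Picard iteration for all times at once. With a global Lipschitz constant the n-th
  increment is at most T M (L |t|)^n / n! on a compact set of times and parameters, so the iterates
  converge locally uniformly without shrinking the time interval.\<close>

lemma ode_C0:
  fixes F :: "(real \<times> 'p::euclidean_space) \<times> 'y::euclidean_space \<Rightarrow> 'y"
  assumes F: "continuous_on UNIV F" and L: "L \<ge> 0" "\<And>q a b. norm (F (q, a) - F (q, b)) \<le> L * norm (a - b)"
    and y0: "continuous_on UNIV y0"
  shows "\<exists>y. continuous_on UNIV y \<and> (\<forall>p. y (0, p) = y0 p) \<and>
    (\<forall>t p. ((\<lambda>t. y (t, p)) has_vector_derivative F ((t, p), y (t, p))) (at t))"
proof -
  define I where "I y q = integral (cbox 0 1) (\<lambda>s. fst q *\<^sub>R F ((s * fst q, snd q), y (s * fst q, snd q)))"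
    for y and q :: "real \<times> 'p"
  define P where "P y q = y0 (snd q) + I y q" for y q
  define Y where "Y n = (P ^^ n) (\<lambda>q. y0 (snd q))" for n
  have Y0: "Y 0 = (\<lambda>q. y0 (snd q))" and YS: "Y (Suc n) = P (Y n)" for n by (simp_all add: Y_def)
  note [continuous_intros] = continuous_on_compose2[OF F] continuous_on_compose2[OF y0]
  have cint: "continuous_on (A \<times> B) (\<lambda>(q, s). fst q *\<^sub>R F ((s * fst q, snd q), y (s * fst q, snd q)))"
    if y: "continuous_on UNIV y" for y A B
    unfolding case_prod_unfold
    by (intro continuous_intros continuous_on_compose2[OF y]) auto
  have cI: "continuous_on UNIV (I y)" if y: "continuous_on UNIV y" for y
    unfolding I_def by (rule integral_continuous_on_param[OF cint[OF y]])
  have cY: "continuous_on UNIV (Y n)" for n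
    by (induction n) (auto simp: Y0 YS P_def intro!: continuous_intros cI)
  have iI: "(\<lambda>s. fst q *\<^sub>R F ((s * fst q, snd q), y (s * fst q, snd q))) integrable_on cbox 0 1"
    if y: "continuous_on UNIV y" for y q
    by (intro integrable_continuous continuous_intros continuous_on_compose2[OF y]) auto
  have dI: "norm (I y q - I z q) \<le> C"
    if y: "continuous_on UNIV y" and z: "continuous_on UNIV z"
      and C: "(\<lambda>s. \<bar>fst q\<bar> * L * c s) integrable_on cbox 0 1" "integral (cbox 0 1) (\<lambda>s. \<bar>fst q\<bar> * L * c s) \<le> C"
      and c: "\<And>s. s \<in> cbox 0 1 \<Longrightarrow> norm (y (s * fst q, snd q) - z (s * fst q, snd q)) \<le> c s" for y z q c C
  proof -
    have "norm (I y q - I z q) = norm (integral (cbox 0 1) (\<lambda>s. fst q *\<^sub>R F ((s * fst q, snd q), y (s * fst q, snd q))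
        - fst q *\<^sub>R F ((s * fst q, snd q), z (s * fst q, snd q))))"
      unfolding I_def by (simp add: Henstock_Kurzweil_Integration.integral_diff iI[OF y, simplified] iI[OF z, simplified])
    also have "\<dots> \<le> integral (cbox 0 1) (\<lambda>s. \<bar>fst q\<bar> * L * c s)"
    proof (rule integral_norm_bound_integral)
      fix s :: real assume s: "s \<in> cbox 0 1"
      have "norm (F ((s * fst q, snd q), y (s * fst q, snd q)) - F ((s * fst q, snd q), z (s * fst q, snd q))) \<le> L * c s"
        using L(2) c[OF s] L(1) by (meson mult_left_mono order_trans)
      then show "norm (fst q *\<^sub>R F ((s * fst q, snd q), y (s * fst q, snd q))
        - fst q *\<^sub>R F ((s * fst q, snd q), z (s * fst q, snd q))) \<le> \<bar>fst q\<bar> * L * c s"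
        by (simp flip: scaleR_diff_right add: mult.assoc mult_left_mono)
    qed (intro integrable_diff iI y z C)+
    finally show ?thesis using C(2) by simp
  qed
  define y where "y q = Y 0 q + (\<Sum>i. Y (Suc i) q - Y i q)" for q
  have UL: "uniform_limit ({-T..T} \<times> cball 0 R) Y y sequentially" if "T > 0" for T R
  proof -
    let ?K = "{-T..T} \<times> cball (0::'p) R"
    have "compact ((\<lambda>q. F (q, y0 (snd q))) ` ?K)"
      by (intro compact_continuous_image compact_Times continuous_intros) auto
    then obtain M where M: "\<And>q. q \<in> ?K \<Longrightarrow> norm (F (q, y0 (snd q))) \<le> M" and M0: "M \<ge> 0"
      using compact_imp_bounded[of "(\<lambda>q. F (q, y0 (snd q))) ` ?K"] unfolding bounded_pos
      by (meson imageI less_imp_le)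
    have est: "norm (Y (Suc n) q - Y n q) \<le> T * M * (L * \<bar>fst q\<bar>) ^ n / fact n" if "q \<in> ?K" for n q
      using that
    proof (induction n arbitrary: q)
      case 0
      have "norm (integral (cbox 0 1) (\<lambda>s. fst q *\<^sub>R F ((s * fst q, snd q), y0 (snd q)))) \<le> integral (cbox 0 (1::real)) (\<lambda>s. T * M)"
      proof (rule integral_norm_bound_integral)
        show "(\<lambda>s. fst q *\<^sub>R F ((s * fst q, snd q), y0 (snd q))) integrable_on cbox 0 1"
          by (intro integrable_continuous continuous_intros) auto
        fix s :: real assume s: "s \<in> cbox 0 1"
        then have "\<bar>s * fst q\<bar> \<le> \<bar>fst q\<bar>" by (simp add: abs_mult mult_left_le_one_le)
        then have "(s * fst q, snd q) \<in> ?K" using 0 by (auto simp: mem_Times_iff)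
        from M[OF this] have "norm (F ((s * fst q, snd q), y0 (snd q))) \<le> M" by simp
        then show "norm (fst q *\<^sub>R F ((s * fst q, snd q), y0 (snd q))) \<le> T * M"
          using 0 M0 by (auto intro!: mult_mono simp: mem_Times_iff)
      qed (rule integrable_const)
      then show ?case by (simp add: YS P_def I_def Y0)
    next
      case (Suc n)
      let ?c = "\<lambda>s. T * M * (L * \<bar>s * fst q\<bar>) ^ n / fact n"
      have hi: "((\<lambda>s. s ^ n) has_integral 1 / Suc n) {0..1::real}"
      proof -
        have "((\<lambda>s. s ^ n) has_integral (1 ^ Suc n / Suc n - 0 ^ Suc n / Suc n)) {0..1::real}"
        proof (rule fundamental_theorem_of_calculus)
          show "((\<lambda>s. s ^ Suc n / Suc n) has_vector_derivative s ^ n) (at s within {0..1})" for s :: real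
            using DERIV_cdivide[OF DERIV_pow[of "Suc n" s "{0..1}"], of "Suc n"]
            by (simp add: has_real_derivative_iff_has_vector_derivative del: of_nat_Suc power_Suc)
        qed simp
        then show ?thesis by simp
      qed
      have "((\<lambda>s. \<bar>fst q\<bar> * L * (T * M * (L * \<bar>fst q\<bar>) ^ n / fact n) * s ^ n) has_integral
          \<bar>fst q\<bar> * L * (T * M * (L * \<bar>fst q\<bar>) ^ n / fact n) * (1 / Suc n)) {0..1}"
        by (rule has_integral_mult_right[OF hi])
      then have hi2: "((\<lambda>s. \<bar>fst q\<bar> * L * ?c s) has_integral T * M * (L * \<bar>fst q\<bar>) ^ Suc n / fact (Suc n)) {0..1}"
        by (rule has_integral_eq_rhs[OF has_integral_eq[rotated]])
          (auto simp: abs_mult power_mult_distrib field_simps)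
      have "norm (I (Y (Suc n)) q - I (Y n) q) \<le> T * M * (L * \<bar>fst q\<bar>) ^ Suc n / fact (Suc n)"
      proof (rule dI[OF cY cY, where c = ?c])
        fix s :: real assume s: "s \<in> cbox 0 1"
        then have "\<bar>s * fst q\<bar> \<le> \<bar>fst q\<bar>" by (simp add: abs_mult mult_left_le_one_le)
        then have "(s * fst q, snd q) \<in> ?K" using Suc.prems by (auto simp: mem_Times_iff)
        from Suc.IH[OF this] show "norm (Y (Suc n) (s * fst q, snd q) - Y n (s * fst q, snd q)) \<le> ?c s" by simp
      next
        show "(\<lambda>s. \<bar>fst q\<bar> * L * ?c s) integrable_on cbox 0 1"
          using has_integral_integrable[OF hi2] by (simp only: box_real)
        show "integral (cbox 0 1) (\<lambda>s. \<bar>fst q\<bar> * L * ?c s) \<le> T * M * (L * \<bar>fst q\<bar>) ^ Suc n / fact (Suc n)"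
          using integral_unique[OF hi2] by (simp only: box_real order_refl)
      qed
      moreover have "Y (Suc (Suc n)) q - Y (Suc n) q = I (Y (Suc n)) q - I (Y n) q"
        by (simp add: YS[of "Suc n"] P_def) (simp add: YS P_def)
      ultimately show ?case by simp
    qed
    have "norm (Y (Suc n) q - Y n q) \<le> T * M * ((L * T) ^ n /\<^sub>R fact n)" if q: "q \<in> ?K" for n q
    proof -
      have "(L * \<bar>fst q\<bar>) ^ n \<le> (L * T) ^ n" using q L by (intro power_mono mult_left_mono) (auto simp: mem_Times_iff)
      then have "T * M * (L * \<bar>fst q\<bar>) ^ n / fact n \<le> T * M * (L * T) ^ n / fact n"
        using that M0 \<open>T > 0\<close> by (intro divide_right_mono mult_left_mono) auto
      with est[OF q, of n] show ?thesis by (simp add: field_simps)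
    qed
    then have "uniform_limit ?K (\<lambda>n q. \<Sum>i<n. Y (Suc i) q - Y i q) (\<lambda>q. \<Sum>i. Y (Suc i) q - Y i q) sequentially"
      by (rule Weierstrass_m_test) (assumption, rule summable_mult, rule summable_exp_generic)
    then have "uniform_limit ?K (\<lambda>n q. Y 0 q + (\<Sum>i<n. Y (Suc i) q - Y i q)) y sequentially"
      unfolding y_def by (intro uniform_limit_intros)
    moreover have "Y 0 q + (\<Sum>i<n. Y (Suc i) q - Y i q) = Y n q" for n q
      by (simp add: sum_lessThan_telescope[of "\<lambda>i. Y i q"])
    ultimately show ?thesis by simp
  qed
  have cy: "continuous_on UNIV y"
  proof (rule continuous_at_imp_continuous_on, clarify)
    fix t :: real and p :: 'p
    let ?V = "{-(\<bar>t\<bar>+1)<..<\<bar>t\<bar>+1} \<times> ball (0::'p) (norm p + 1)"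
    have "continuous_on ({-(\<bar>t\<bar>+1)..\<bar>t\<bar>+1} \<times> cball 0 (norm p + 1)) y"
      by (rule uniform_limit_theorem[OF _ UL]) (auto intro!: always_eventually continuous_on_subset[OF cY])
    then have "continuous_on ?V y" by (rule continuous_on_subset) auto
    moreover have "open ?V" by (intro open_Times) auto
    moreover have "(t, p) \<in> ?V" by auto
    ultimately show "continuous (at (t, p)) y" by (simp add: continuous_on_eq_continuous_at)
  qed
  have fixp: "y q = P y q" for q
  proof (rule LIMSEQ_unique)
    let ?T = "\<bar>fst q\<bar> + 1" and ?R = "norm (snd q)"
    have ul: "uniform_limit ({-?T..?T} \<times> cball 0 ?R) Y y sequentially" by (rule UL) auto
    have "(\<lambda>n. Y n q) \<longlonglongrightarrow> y q"
      by (rule tendsto_uniform_limitI[OF ul]) (auto simp: mem_Times_iff)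
    then show "(\<lambda>n. Y (Suc n) q) \<longlonglongrightarrow> y q" by (rule LIMSEQ_Suc)
    show "(\<lambda>n. Y (Suc n) q) \<longlonglongrightarrow> P y q"
      unfolding YS P_def
    proof (intro tendsto_add tendsto_const tendstoI)
      fix e :: real assume e: "e > 0"
      define d where "d = e / (2 * (\<bar>fst q\<bar> * L + 1))"
      have dpos: "d > 0" using e L unfolding d_def by (intro divide_pos_pos) (auto intro!: add_nonneg_pos)
      have "\<forall>\<^sub>F n in sequentially. \<forall>x\<in>{-?T..?T} \<times> cball 0 ?R. dist (Y n x) (y x) < d"
        by (rule uniform_limitD[OF ul dpos])
      then show "\<forall>\<^sub>F n in sequentially. dist (I (Y n) q) (I y q) < e"
      proof eventually_elim
        case (elim n)
        have "norm (I (Y n) q - I y q) \<le> \<bar>fst q\<bar> * L * d"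
        proof (rule dI[OF cY cy, where c = "\<lambda>s. d"])
          fix s :: real assume s: "s \<in> cbox 0 1"
          then have "\<bar>s * fst q\<bar> \<le> \<bar>fst q\<bar>" by (simp add: abs_mult mult_left_le_one_le)
          then have "(s * fst q, snd q) \<in> {-?T..?T} \<times> cball 0 ?R" by (auto simp: mem_Times_iff)
          with elim show "norm (Y n (s * fst q, snd q) - y (s * fst q, snd q)) \<le> d"
            by (metis dist_norm less_imp_le)
        qed auto
        also have "\<dots> \<le> (\<bar>fst q\<bar> * L + 1) * d" using dpos by (simp add: algebra_simps)
        also have "\<dots> = e / 2"
        proof -
          have "\<bar>fst q\<bar> * L + 1 > 0" using L(1) by (simp add: add_nonneg_pos)
          then show ?thesis
            by (simp only: d_def times_divide_eq_right mult.commute[of 2] nonzero_mult_divide_mult_cancel_left)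
        qed
        finally show ?case using e by (simp add: dist_norm)
      qed
    qed
  qed
  have "((\<lambda>t. y (t, p)) has_vector_derivative F ((t, p), y (t, p))) (at t)" for t p
  proof -
    have "continuous_on UNIV (\<lambda>t. F ((t, p), y (t, p)))"
      by (intro continuous_intros continuous_on_compose2[OF cy]) auto
    from has_vector_derivative_add[OF has_vector_derivative_const[of "y0 p"] scaled_integral_has_vector_derivative[OF this]]
    have "((\<lambda>t. y0 p + integral {0..1} (\<lambda>s. t *\<^sub>R F ((s * t, p), y (s * t, p)))) has_vector_derivative F ((t, p), y (t, p))) (at t)"
      by simp
    moreover have "y0 p + integral {0..1} (\<lambda>s. t *\<^sub>R F ((s * t, p), y (s * t, p))) = y (t, p)" for t
      by (subst fixp) (simp add: P_def I_def)
    ultimately show ?thesis by simp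
  qed
  moreover have "y (0, p) = y0 p" for p by (subst fixp) (simp add: P_def I_def)
  ultimately show ?thesis using cy by blast
qed


section \<open>Differentiability of solutions in the parameters\<close>

lemma FD_bound_compact:
  fixes F :: "'a::euclidean_space \<Rightarrow> 'b::real_normed_vector"
  assumes F: "\<And>x. (F has_derivative F' x) (at x)" and c: "\<And>i. i \<in> Basis \<Longrightarrow> continuous_on UNIV (\<lambda>x. F' x i)"
    and S: "compact S"
  obtains K where "K \<ge> 0" "\<And>x v. x \<in> S \<Longrightarrow> norm (F' x v) \<le> K * norm v"
proof -
  have "compact ((\<lambda>x. \<Sum>i\<in>Basis. norm (F' x i)) ` S)"
    by (intro compact_continuous_image S continuous_intros continuous_on_subset[OF c]) auto
  then obtain K where K: "\<And>x. x \<in> S \<Longrightarrow> norm (\<Sum>i\<in>Basis. norm (F' x i)) \<le> K" "K > 0"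
    using compact_imp_bounded[of "(\<lambda>x. \<Sum>i\<in>Basis. norm (F' x i)) ` S"] unfolding bounded_pos by blast
  show thesis
  proof (rule that[of K])
    fix x v assume x: "x \<in> S"
    have "norm (F' x v) = norm (\<Sum>i\<in>Basis. (v \<bullet> i) *\<^sub>R F' x i)"
      using linear_expand_Basis[OF has_derivative_bounded_linear[OF F]] by metis
    also have "\<dots> \<le> (\<Sum>i\<in>Basis. norm ((v \<bullet> i) *\<^sub>R F' x i))" by (rule norm_sum)
    also have "\<dots> \<le> (\<Sum>i\<in>Basis. norm v * norm (F' x i))"
      by (intro sum_mono) (auto intro!: mult_right_mono Basis_le_norm)
    also have "\<dots> = norm v * (\<Sum>i\<in>Basis. norm (F' x i))" by (simp add: sum_distrib_left)
    also have "\<dots> \<le> norm v * K" using K(1)[OF x] by (intro mult_left_mono) auto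
    finally show "norm (F' x v) \<le> K * norm v" by (simp add: mult.commute)
  qed (use K in auto)
qed

text \<open>The partial derivatives are uniformly continuous on the thickening of \<open>S\<close>
  by radius 1, which contains every short segment starting in \<open>S\<close>; the mean value
  inequality along such a segment gives one radius for all base points.\<close>

lemma uniformly_differentiable_compact:
  fixes F :: "'a::euclidean_space \<Rightarrow> 'b::real_normed_vector"
  assumes F: "\<And>x. (F has_derivative F' x) (at x)" and c: "\<And>i. i \<in> Basis \<Longrightarrow> continuous_on UNIV (\<lambda>x. F' x i)"
    and S: "compact S" and e: "e > 0"
  obtains d where "d > 0" "\<And>x v. x \<in> S \<Longrightarrow> norm v < d \<Longrightarrow> norm (F (x + v) - F x - F' x v) \<le> e * norm v"
proof -
  define S' where "S' = {x + y |x y. x \<in> S \<and> y \<in> cball 0 (1::real)}"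
  have S': "compact S'" unfolding S'_def by (intro compact_sums S) auto
  define e' where "e' = e / DIM('a)"
  have e': "e' > 0" using e by (simp add: e'_def)
  have "\<exists>d>0. \<forall>x\<in>S'. \<forall>y\<in>S'. dist y x < d \<longrightarrow> norm (F' y i - F' x i) < e'" if i: "i \<in> Basis" for i
    using compact_uniformly_continuous[OF continuous_on_subset[OF c[OF i]] S'] e'
    unfolding uniformly_continuous_on_def dist_norm by blast
  then obtain D where D: "\<And>i. i \<in> Basis \<Longrightarrow> D i > 0"
    "\<And>i x y. i \<in> Basis \<Longrightarrow> x \<in> S' \<Longrightarrow> y \<in> S' \<Longrightarrow> dist y x < D i \<Longrightarrow> norm (F' y i - F' x i) < e'"
    by metis
  define d where "d = min 1 (Min (D ` Basis))"
  have d: "d > 0" "d \<le> 1" "\<And>i. i \<in> Basis \<Longrightarrow> d \<le> D i"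
    using D(1) by (auto simp: d_def min_le_iff_disj)
  show thesis
  proof (rule that[OF d(1)])
    fix x v :: 'a assume x: "x \<in> S" and v: "norm v < d"
    have mem: "x + t *\<^sub>R v \<in> S'" "dist (x + t *\<^sub>R v) x < d" if "t \<in> {0..1}" for t
    proof -
      have *: "norm (t *\<^sub>R v) \<le> norm v" using that by (auto intro: mult_left_le_one_le)
      then show "dist (x + t *\<^sub>R v) x < d" using v by (simp add: dist_norm)
      show "x + t *\<^sub>R v \<in> S'" unfolding S'_def using x * v d(2) by fastforce
    qed
    have "norm (F (x + v) - F x - F' x ((x + v) - x)) \<le> norm ((x + v) - x) * e"
    proof (rule differentiable_bound_linearization[where S = "(\<lambda>t. x + t *\<^sub>R v) ` {0..1}" and f' = F'])
      show "x + t *\<^sub>R (x + v - x) \<in> (\<lambda>t. x + t *\<^sub>R v) ` {0..1}" if "t \<in> {0..1}" for t using that by auto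
      show "x \<in> (\<lambda>t. x + t *\<^sub>R v) ` {0..1}" by (rule image_eqI[of _ _ 0]) auto
      show "(F has_derivative F' z) (at z within (\<lambda>t. x + t *\<^sub>R v) ` {0..1})" for z
        by (rule has_derivative_at_withinI[OF F])
      fix z assume "z \<in> (\<lambda>t. x + t *\<^sub>R v) ` {0..1}"
      then obtain t where t: "t \<in> {0..1}" "z = x + t *\<^sub>R v" by auto
      show "onorm (F' z - F' x) \<le> e" unfolding fun_diff_def
      proof (rule onorm_le)
        fix h
        have "bounded_linear (\<lambda>h. F' z h - F' x h)"
          by (intro bounded_linear_sub has_derivative_bounded_linear[OF F])
        then have "norm (F' z h - F' x h) = norm (\<Sum>i\<in>Basis. (h \<bullet> i) *\<^sub>R (F' z i - F' x i))"
          using linear_expand_Basis by metis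
        also have "\<dots> \<le> (\<Sum>i\<in>Basis. norm ((h \<bullet> i) *\<^sub>R (F' z i - F' x i)))" by (rule norm_sum)
        also have "\<dots> \<le> (\<Sum>i\<in>(Basis::'a set). norm h * e')"
        proof (rule sum_mono)
          fix i :: 'a assume i: "i \<in> Basis"
          have "x \<in> S'" using mem(1)[of 0] by simp
          then have "norm (F' z i - F' x i) < e'"
            using D(2)[OF i, of x z] mem[OF t(1)] t d(3)[OF i] by auto
          then show "norm ((h \<bullet> i) *\<^sub>R (F' z i - F' x i)) \<le> norm h * e'"
            using Basis_le_norm[OF i, of h] by (auto intro!: mult_mono)
        qed
        also have "\<dots> = e * norm h" by (simp add: e'_def)
        finally show "norm (F' z h - F' x h) \<le> e * norm h" .
      qed
    qed
    then show "norm (F (x + v) - F x - F' x v) \<le> e * norm v" by (simp add: mult.commute)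
  qed
qed

text \<open>Two Gronwall estimates. The difference of two solutions is at most a constant times |h|;
  hence the difference minus the linearized solution is driven by an error that is small compared
  with |h|, uniformly along the compact piece \<open>S\<close> of the trajectory.\<close>

lemma ode_param_derivative:
  fixes F :: "(real \<times> 'p::euclidean_space) \<times> 'y::euclidean_space \<Rightarrow> 'y"
  assumes F: "\<And>x. (F has_derivative F' x) (at x)" and c: "\<And>i. i \<in> Basis \<Longrightarrow> continuous_on UNIV (\<lambda>x. F' x i)"
    and L: "L \<ge> 0" "\<And>q a b. norm (F (q, a) - F (q, b)) \<le> L * norm (a - b)"
    and y: "continuous_on UNIV y" "\<And>t p. ((\<lambda>t. y (t, p)) has_vector_derivative F ((t, p), y (t, p))) (at t)"
    and y0: "((\<lambda>p. y (0, p)) has_derivative y0') (at p)"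
    and U: "\<And>t h. ((\<lambda>t. U t h) has_vector_derivative F' ((t, p), y (t, p)) ((0, h), U t h)) (at t)"
    and U0: "\<And>h. U 0 h = y0' h" and Ul: "bounded_linear (U t)"
  shows "((\<lambda>p. y (t, p)) has_derivative U t) (at p)"
proof -
  define S where "S = (\<lambda>s. ((s, p), y (s, p))) ` {-\<bar>t\<bar>..\<bar>t\<bar>}"
  have S: "compact S" unfolding S_def
    by (intro compact_continuous_image continuous_intros continuous_on_compose2[OF y(1)]) auto
  have inS: "((s, p), y (s, p)) \<in> S" if "\<bar>s\<bar> \<le> \<bar>t\<bar>" for s
    unfolding S_def by (rule image_eqI[OF refl]) (use that in auto)
  obtain K' where K': "K' \<ge> 0" "\<And>x v. x \<in> S \<Longrightarrow> norm (F' x v) \<le> K' * norm v"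
    using FD_bound_compact[OF F c S] by blast
  \<comment> \<open>One constant serves both as Lipschitz constant of \<open>F\<close> in the state
    and as bound of \<open>F'\<close> along the trajectory.\<close>
  define K where "K = K' + L"
  have K: "K \<ge> 0" "\<And>x v. x \<in> S \<Longrightarrow> norm (F' x v) \<le> K * norm v"
  proof -
    show "K \<ge> 0" using K' L(1) by (simp add: K_def)
    show "norm (F' x v) \<le> K * norm v" if "x \<in> S" for x v
      by (rule order_trans[OF K'(2)[OF that]]) (use L(1) in \<open>simp add: K_def mult_right_mono\<close>)
  qed
  have LK: "norm (F (q, a) - F (q, b)) \<le> K * norm (a - b)" for q a b
    by (rule order_trans[OF L(2)]) (use K' in \<open>simp add: K_def mult_right_mono\<close>)
  note lin = has_derivative_bounded_linear[OF F]
  define E where "E = exp ((2*K+1) * \<bar>t\<bar>)"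
  have E: "E > 0" "\<And>s. \<bar>s\<bar> \<le> \<bar>t\<bar> \<Longrightarrow> exp ((2*K+1) * \<bar>s\<bar>) \<le> E"
    using K(1) by (auto simp: E_def intro!: mult_left_mono)
  have y0a: "\<exists>d>0. \<forall>h. norm h < d \<longrightarrow> norm (y (0, p + h) - y (0, p) - y0' h) \<le> e * norm h" if "e > 0" for e
    using y0[unfolded has_derivative_at_alt] that by (metis add_diff_cancel_left')
  obtain K0 where K0: "K0 \<ge> 0" "\<And>h. norm (y0' h) \<le> K0 * norm h"
    using bounded_linear.nonneg_bounded[OF has_derivative_bounded_linear[OF y0]] by (metis mult.commute)
  obtain d0 where d0: "d0 > 0" "\<And>h. norm h < d0 \<Longrightarrow> norm (y (0, p + h) - y (0, p) - y0' h) \<le> 1 * norm h"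
    using y0a[of 1] by auto
  obtain d1 where d1: "d1 > 0" "\<And>x v. x \<in> S \<Longrightarrow> norm v < d1 \<Longrightarrow> norm (F (x + v) - F x - F' x v) \<le> 1 * norm v"
    using uniformly_differentiable_compact[OF F c S, of 1] by auto
  define C where "C = sqrt (((1 + K0)\<^sup>2 + (1 + K)\<^sup>2) * E)"
  have C: "C \<ge> 0" "C\<^sup>2 = ((1 + K0)\<^sup>2 + (1 + K)\<^sup>2) * E" using E by (auto simp: C_def)
  have z: "norm (y (s, p + h) - y (s, p)) \<le> C * norm h"
    if s: "\<bar>s\<bar> \<le> \<bar>t\<bar>" and h: "norm h < d0" "norm h < d1" for s h
  proof -
    let ?z = "\<lambda>s. y (s, p + h) - y (s, p)"
    have "(norm (?z s))\<^sup>2 + ((1 + K) * norm h)\<^sup>2 \<le> ((norm (?z 0))\<^sup>2 + ((1 + K) * norm h)\<^sup>2) * exp ((2*K+1) * \<bar>s\<bar>)"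
    proof (rule gronwall[OF K(1)])
      show "(?z has_vector_derivative F ((r, p + h), y (r, p + h)) - F ((r, p), y (r, p))) (at r)" for r
        by (intro has_vector_derivative_diff y)
      fix r assume r: "\<bar>r\<bar> \<le> \<bar>s\<bar>"
      let ?x = "((r, p), y (r, p))"
      have xS: "?x \<in> S" using inS r s by simp
      have nv: "norm ((0::real, h), 0::'y) = norm h" by (simp add: norm_Pair)
      have "norm (F (?x + ((0, h), 0)) - F ?x) \<le> norm (F (?x + ((0, h), 0)) - F ?x - F' ?x ((0, h), 0)) + norm (F' ?x ((0, h), 0))"
        by (metis diff_add_cancel norm_triangle_ineq)
      also have "\<dots> \<le> (1 + K) * norm h"
        using d1(2)[OF xS, of "((0, h), 0)"] K(2)[OF xS, of "((0, h), 0)"] nv h by (simp add: algebra_simps)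
      finally have "norm (F ((r, p + h), y (r, p)) - F ?x) \<le> (1 + K) * norm h" by simp
      moreover have "norm (F ((r, p + h), y (r, p + h)) - F ((r, p + h), y (r, p))) \<le> K * norm (?z r)"
        by (rule LK)
      ultimately show "norm (F ((r, p + h), y (r, p + h)) - F ((r, p), y (r, p))) \<le> K * norm (?z r) + (1 + K) * norm h"
        using norm_triangle_ineq[of "F ((r, p + h), y (r, p + h)) - F ((r, p + h), y (r, p))" "F ((r, p + h), y (r, p)) - F ?x"] by simp
    qed
    moreover have "norm (?z 0) \<le> (1 + K0) * norm h"
      using d0(2)[OF h(1)] K0(2)[of h] norm_triangle_ineq[of "?z 0 - y0' h" "y0' h"] by (simp add: algebra_simps)
    then have "(norm (?z 0))\<^sup>2 \<le> ((1 + K0) * norm h)\<^sup>2" by (simp add: power_mono)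
    then have "((norm (?z 0))\<^sup>2 + ((1 + K) * norm h)\<^sup>2) * exp ((2*K+1) * \<bar>s\<bar>) \<le> (((1 + K0) * norm h)\<^sup>2 + ((1 + K) * norm h)\<^sup>2) * E"
      using E(2)[OF s] by (intro mult_mono) auto
    ultimately have "(norm (?z s))\<^sup>2 \<le> (((1 + K0) * norm h)\<^sup>2 + ((1 + K) * norm h)\<^sup>2) * E"
      by (smt (verit) zero_le_power2)
    also have "\<dots> = (C * norm h)\<^sup>2" by (simp only: power_mult_distrib C(2)) (simp add: algebra_simps)
    finally show ?thesis using C(1) by (meson mult_nonneg_nonneg norm_ge_zero power2_le_imp_le)
  qed
  define C2 where "C2 = sqrt ((1 + (1 + C)\<^sup>2) * E)"
  have C2: "C2 > 0" "C2\<^sup>2 = (1 + (1 + C)\<^sup>2) * E" using E by (auto simp: C2_def add_pos_nonneg)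
  show ?thesis unfolding has_derivative_at_alt
  proof (intro conjI allI impI Ul)
    fix e :: real assume e: "e > 0"
    define \<epsilon> where "\<epsilon> = e / C2"
    have \<epsilon>: "\<epsilon> > 0" using e C2 by (simp add: \<epsilon>_def)
    obtain d2 where d2: "d2 > 0" "\<And>x v. x \<in> S \<Longrightarrow> norm v < d2 \<Longrightarrow> norm (F (x + v) - F x - F' x v) \<le> \<epsilon> * norm v"
      using uniformly_differentiable_compact[OF F c S \<epsilon>] by auto
    obtain d3 where d3: "d3 > 0" "\<And>h. norm h < d3 \<Longrightarrow> norm (y (0, p + h) - y (0, p) - y0' h) \<le> \<epsilon> * norm h"
      using y0a[OF \<epsilon>] by auto
  \<comment> \<open>The displacement of the trajectory point in time, parameter and state has norm
    at most (1 + C)|h|; dividing d2 by 1 + C keeps it within the radius of uniform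
    differentiability.\<close>
  define d where "d = min (min d0 d1) (min d3 (d2 / (1 + C)))"
    have "d \<le> d2 / (1 + C)" by (simp add: d_def)
    then have d: "d > 0" "d \<le> d0" "d \<le> d1" "d \<le> d3" "d * (1 + C) \<le> d2"
      using d0(1) d1(1) d2(1) d3(1) C(1) by (auto simp: d_def pos_le_divide_eq)
    have "norm (y (t, p + h) - y (t, p) - U t h) \<le> e * norm h" if h: "norm h < d" for h
    proof -
      let ?z = "\<lambda>s. y (s, p + h) - y (s, p)" and ?w = "\<lambda>s. y (s, p + h) - y (s, p) - U s h"
      have 0: "(norm (?w t))\<^sup>2 + (\<epsilon> * (1 + C) * norm h)\<^sup>2 \<le> ((norm (?w 0))\<^sup>2 + (\<epsilon> * (1 + C) * norm h)\<^sup>2) * exp ((2*K+1) * \<bar>t\<bar>)" 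
      proof (rule gronwall[OF K(1)])
        show "(?w has_vector_derivative F ((r, p + h), y (r, p + h)) - F ((r, p), y (r, p)) - F' ((r, p), y (r, p)) ((0, h), U r h)) (at r)" for r
          by (intro has_vector_derivative_diff y U)
        fix r assume r: "\<bar>r\<bar> \<le> \<bar>t\<bar>"
        let ?x = "((r, p), y (r, p))" and ?v = "((0::real, h), ?z r)"
        have xS: "?x \<in> S" using inS r by simp
        have zr: "norm (?z r) \<le> C * norm h" using z[OF r] h d by simp
        have "norm ?v \<le> norm (0::real, h) + norm (?z r)" by (rule norm_Pair_le)
        then have nv: "norm ?v \<le> (1 + C) * norm h" using zr by (simp add: norm_Pair algebra_simps)
        also have "\<dots> < (1 + C) * d" using h C by (intro mult_strict_left_mono) auto
        also have "\<dots> \<le> d2" using d by (simp add: mult.commute)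
        finally have "norm (F (?x + ?v) - F ?x - F' ?x ?v) \<le> \<epsilon> * norm ?v" by (rule d2(2)[OF xS])
        also have "\<dots> \<le> \<epsilon> * (1 + C) * norm h" using nv \<epsilon> by (simp add: mult.assoc)
        finally have 1: "norm (F ((r, p + h), y (r, p + h)) - F ?x - F' ?x ?v) \<le> \<epsilon> * (1 + C) * norm h" by simp
        have "F' ?x ?v - F' ?x ((0, h), U r h) = F' ?x (?v - ((0, h), U r h))"
          using linear_diff[OF bounded_linear.linear[OF lin]] by metis
        also have "\<dots> = F' ?x ((0, 0), ?w r)" by (simp add: zero_prod_def)
        finally have 2: "norm (F' ?x ?v - F' ?x ((0, h), U r h)) \<le> K * norm (?w r)"
          using K(2)[OF xS, of "((0, 0), ?w r)"] by (simp add: norm_Pair)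
        show "norm (F ((r, p + h), y (r, p + h)) - F ?x - F' ?x ((0, h), U r h)) \<le> K * norm (?w r) + \<epsilon> * (1 + C) * norm h"
          using 1 2 norm_triangle_ineq[of "F ((r, p + h), y (r, p + h)) - F ?x - F' ?x ?v" "F' ?x ?v - F' ?x ((0, h), U r h)"] by simp
      qed
      have "norm (?w 0) \<le> \<epsilon> * norm h" using d3(2)[of h] h d U0 by simp
      then have "(norm (?w 0))\<^sup>2 \<le> (\<epsilon> * norm h)\<^sup>2" by (simp add: power_mono)
      then have "((norm (?w 0))\<^sup>2 + (\<epsilon> * (1 + C) * norm h)\<^sup>2) * exp ((2*K+1) * \<bar>t\<bar>)
          \<le> ((\<epsilon> * norm h)\<^sup>2 + (\<epsilon> * (1 + C) * norm h)\<^sup>2) * E"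
        using E(2)[of t] by (intro mult_mono) auto
      with 0 have "(norm (?w t))\<^sup>2 \<le> ((\<epsilon> * norm h)\<^sup>2 + (\<epsilon> * (1 + C) * norm h)\<^sup>2) * E"
        by (smt (verit) zero_le_power2)
      also have "\<dots> = (\<epsilon> * norm h)\<^sup>2 * C2\<^sup>2" by (simp only: power_mult_distrib C2(2)) (simp add: algebra_simps)
      also have "\<dots> = (e * norm h)\<^sup>2" using C2(1) by (simp add: \<epsilon>_def power_divide power_mult_distrib)
      finally show ?thesis using e by (meson mult_nonneg_nonneg norm_ge_zero power2_le_imp_le less_imp_le)
    qed
    then show "\<exists>d>0. \<forall>q. norm (q - p) < d \<longrightarrow> norm (y (t, q) - y (t, p) - U t (q - p)) \<le> e * norm (q - p)"
      using d(1) by (metis add_diff_cancel_left' diff_add_cancel add.commute)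
  qed
qed


lemma Ck_on_Pair: "open U \<Longrightarrow> Ck_on k U f \<Longrightarrow> Ck_on k U g \<Longrightarrow> Ck_on k U (\<lambda>x. (f x, g x))"
proof -
  assume fg: "open U" "Ck_on k U f" "Ck_on k U g"
  have "bounded_linear (\<lambda>a::'b. (a, 0::'c))" "bounded_linear (\<lambda>a::'c. (0::'b, a))"
    by (auto intro!: bounded_linear_Pair bounded_linear_ident bounded_linear_zero)
  then have "Ck_on k U (\<lambda>x. (f x, 0::'c))" "Ck_on k U (\<lambda>x. (0::'b, g x))"
    using Ck_on_bounded_linear[of U "\<lambda>a. (a, 0::'c)"] Ck_on_bounded_linear[of U "\<lambda>a. (0::'b, a)"] fg by auto
  then show ?thesis
    using Ck_on_add[of U k "\<lambda>x. (f x, 0)" "\<lambda>x. (0, g x)"] fg by simp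
qed

lemma Ck_on_imp_continuous: "Ck_on k U f \<Longrightarrow> continuous_on U f"
  by (induction k) (use Ck_on_Suc_imp in \<open>auto simp del: Ck_on.simps(2)\<close>)

lemma has_derivative_time_param:
  fixes y :: "real \<times> 'p::euclidean_space \<Rightarrow> 'y::real_normed_vector"
  assumes dt: "\<And>t p. ((\<lambda>t. y (t, p)) has_vector_derivative f (t, p)) (at t)"
    and f: "continuous_on UNIV f" and dp: "((\<lambda>p. y (t, p)) has_derivative B) (at p)"
  shows "(y has_derivative (\<lambda>v. fst v *\<^sub>R f (t, p) + B (snd v))) (at (t, p))"
proof -
  have "((\<lambda>(p, t). y (t, p)) has_derivative (\<lambda>(h, r). B h + blinfun_scaleR_left (f (t, p)) r)) (at (p, t) within UNIV \<times> UNIV)"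
  proof (rule has_derivative_partialsI[where fy = "\<lambda>p t. blinfun_scaleR_left (f (t, p))"])
    show "((\<lambda>y'. y (y', x)) has_derivative blinfun_scaleR_left (f (r, x))) (at r within UNIV)" for x r
      using dt[of x r] by (simp add: has_vector_derivative_def)
    have "continuous_on UNIV (\<lambda>q. blinfun_scaleR_left (f (snd q, fst q)))"
      by (intro bounded_linear.continuous_on[OF bounded_linear_blinfun_scaleR_left]
          continuous_on_compose2[OF f] continuous_intros) auto
    then show "continuous (at (p, t) within UNIV \<times> UNIV) (\<lambda>(p, t). blinfun_scaleR_left (f (t, p)))"
      by (simp add: continuous_on_eq_continuous_at case_prod_unfold)
  qed (use dp in auto)
  then have 1: "((\<lambda>(p, t). y (t, p)) has_derivative (\<lambda>(h, r). B h + r *\<^sub>R f (t, p))) (at (snd (t, p), fst (t, p)))"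
    by simp
  have "((\<lambda>q::real \<times> 'p. (snd q, fst q)) has_derivative (\<lambda>v. (snd v, fst v))) (at (t, p))"
    by (auto intro!: derivative_eq_intros)
  from has_derivative_compose[OF this 1] show ?thesis by (simp add: case_prod_unfold add.commute)
qed

lemma has_vector_derivative_at_0_iff:
  "(f has_vector_derivative D) (at 0) \<longleftrightarrow> ((\<lambda>s. (1 / s) *\<^sub>R (f s - f 0)) \<longlongrightarrow> D) (at 0)"
proof -
  have "((\<lambda>s. (1 / s) *\<^sub>R (f s - f 0) - D) \<longlongrightarrow> 0) (at 0) \<longleftrightarrow> ((\<lambda>s. (f s - (f 0 + s *\<^sub>R D)) /\<^sub>R norm s) \<longlongrightarrow> 0) (at 0)"
  proof (subst (1 2) tendsto_norm_zero_iff[symmetric], rule tendsto_cong, unfold eventually_at_filter,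
      rule always_eventually, intro allI impI)
    fix s :: real assume "s \<noteq> 0"
    then have "(1 / s) *\<^sub>R (f s - f 0) - D = (1 / s) *\<^sub>R (f s - (f 0 + s *\<^sub>R D))" by (simp add: algebra_simps)
    then have "norm ((1 / s) *\<^sub>R (f s - f 0) - D) = norm ((1 / s) *\<^sub>R (f s - (f 0 + s *\<^sub>R D)))" by (rule arg_cong)
    also have "\<dots> = norm ((f s - (f 0 + s *\<^sub>R D)) /\<^sub>R norm s)" by (simp only: norm_scaleR) (simp add: divide_inverse)
    finally show "norm ((1 / s) *\<^sub>R (f s - f 0) - D) = norm ((f s - (f 0 + s *\<^sub>R D)) /\<^sub>R norm s)" .
  qed
  then show ?thesis
    by (simp add: has_vector_derivative_def has_derivative_at_within bounded_linear_scaleR_left LIM_zero_iff diff_diff_eq)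
qed

lemma derivative_bound_of_Lipschitz:
  fixes F :: "'a::real_normed_vector \<times> 'b::real_normed_vector \<Rightarrow> 'c::real_normed_vector"
  assumes F: "(F has_derivative F') (at (q, a))" and L: "\<And>b. norm (F (q, b) - F (q, a)) \<le> L * norm (b - a)"
  shows "norm (F' (0, w)) \<le> L * norm w"
proof -
  have "((\<lambda>s. (q, a + s *\<^sub>R w)) has_derivative (\<lambda>s. (0, s *\<^sub>R w))) (at 0)"
    by (auto intro!: derivative_eq_intros)
  moreover have "(F has_derivative F') (at (q, a + 0 *\<^sub>R w))" using F by simp
  ultimately have "((\<lambda>s. F (q, a + s *\<^sub>R w)) has_derivative (\<lambda>s. F' (0, s *\<^sub>R w))) (at 0)"
    by (rule has_derivative_compose)
  moreover have "F' (0, s *\<^sub>R w) = s *\<^sub>R F' (0, w)" for s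
    using linear_scale[OF bounded_linear.linear[OF has_derivative_bounded_linear[OF F]], of s "(0, w)"] by simp
  ultimately have "((\<lambda>s. F (q, a + s *\<^sub>R w)) has_vector_derivative F' (0, w)) (at 0)"
    by (simp add: has_vector_derivative_def)
  then have "((\<lambda>s. norm ((1 / s) *\<^sub>R (F (q, a + s *\<^sub>R w) - F (q, a)))) \<longlongrightarrow> norm (F' (0, w))) (at 0)"
    by (intro tendsto_norm) (simp add: has_vector_derivative_at_0_iff)
  then show ?thesis
  proof (rule tendsto_upperbound)
    show "\<forall>\<^sub>F s in at 0. norm ((1 / s) *\<^sub>R (F (q, a + s *\<^sub>R w) - F (q, a))) \<le> L * norm w"
      unfolding eventually_at_filter
    proof (rule always_eventually, intro allI impI)
      fix s :: real assume s: "s \<noteq> 0"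
      have "norm (F (q, a + s *\<^sub>R w) - F (q, a)) \<le> L * (\<bar>s\<bar> * norm w)" using L[of "a + s *\<^sub>R w"] by simp
      then show "norm ((1 / s) *\<^sub>R (F (q, a + s *\<^sub>R w) - F (q, a))) \<le> L * norm w"
        unfolding norm_scaleR using s by (simp add: divide_simps mult.commute mult.left_commute)
    qed
  qed simp
qed

text \<open>Bootstrapping. The parameter derivative solves the linearized equation, whose right-hand
  side \<open>G\<close> is C^k as soon as \<open>F\<close> is C^(k+1) and \<open>y\<close> is C^k,
  with the same Lipschitz constant. The induction hypothesis applied to it makes the partial
  derivatives of \<open>y\<close> C^k. The linearized equation itself is recorded because Jacobians
  and actions are computed from it.\<close>

lemma ode_Ck:
  fixes F :: "(real \<times> 'p::euclidean_space) \<times> 'y::euclidean_space \<Rightarrow> 'y"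
  assumes "Ck_on k UNIV F" "Ck_on k UNIV (\<lambda>p. y (0, p))"
    and "L \<ge> 0" "\<And>q a b. norm (F (q, a) - F (q, b)) \<le> L * norm (a - b)"
    and "continuous_on UNIV y" "\<And>t p. ((\<lambda>t. y (t, p)) has_vector_derivative F ((t, p), y (t, p))) (at t)"
  shows "Ck_on k UNIV y \<and> (k > 0 \<longrightarrow> (\<forall>t p h. ((\<lambda>t. FD y (t, p) (0, h)) has_vector_derivative
    FD F ((t, p), y (t, p)) ((0, h), FD y (t, p) (0, h))) (at t)))"
  using assms
proof (induction k arbitrary: F y L)
  case 0
  then show ?case by simp
next
  case (Suc k)
  note L = Suc.prems(3,4) and y = Suc.prems(5,6)
  have F: "(F has_derivative FD F x) (at x)" for x
    using Ck_on_Suc_has_derivative[OF open_UNIV Suc.prems(1)] by simp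
  have FC: "Ck_on k UNIV (\<lambda>x. FD F x i)" if "i \<in> Basis" for i using Suc.prems(1) that by simp
  note c = Ck_on_imp_continuous[OF FC]
  note lin = bounded_linear.linear[OF has_derivative_bounded_linear[OF F]]
  have yk: "Ck_on k UNIV y" using Suc.IH[OF Ck_on_Suc_imp[OF Suc.prems(1)] Ck_on_Suc_imp[OF Suc.prems(2)] L y] by blast
  define G where "G h x = FD F (fst x, y (fst x)) ((0, h), snd x)" for h :: 'p and x :: "(real \<times> 'p) \<times> 'y"
  have Gk: "Ck_on k UNIV (G h)" for h
  proof -
    have "Ck_on k UNIV (\<lambda>x. \<Sum>i\<in>Basis. (((0, h), snd x) \<bullet> i) *\<^sub>R FD F (fst x, y (fst x)) i)"
      by (intro Ck_on_sum Ck_on_bilinear[OF _ bounded_bilinear_scaleR] open_UNIV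
          Ck_on_bounded_linear[OF _ bounded_linear_inner_left] Ck_on_Pair Ck_on_const
          Ck_on_bounded_linear[OF _ bounded_linear_snd] Ck_on_bounded_linear[OF _ bounded_linear_fst] Ck_on_id
          Ck_on_compose[OF _ _ _ FC, OF open_UNIV open_UNIV] Ck_on_compose[OF _ _ _ yk, OF open_UNIV open_UNIV] subset_UNIV)
    then show ?thesis
      unfolding G_def by (simp only: linear_expand_Basis[OF has_derivative_bounded_linear[OF F], symmetric])
  qed
  have GL: "norm (G h (q, a) - G h (q, b)) \<le> L * norm (a - b)" for h q a b
  proof -
    have "G h (q, a) - G h (q, b) = FD F (q, y q) (0, a - b)"
      unfolding G_def using linear_diff[OF lin, of "(q, y q)" "((0, h), a)" "((0, h), b)"]
      by (simp add: zero_prod_def)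
    then show ?thesis using derivative_bound_of_Lipschitz[OF F L(2)] by simp
  qed
  have y0k: "Ck_on k UNIV (\<lambda>p. FD (\<lambda>p. y (0, p)) p b)" if "b \<in> Basis" for b
    using Suc.prems(2) that by simp
  have "\<exists>u. continuous_on UNIV u \<and> (\<forall>p. u (0, p) = FD (\<lambda>p. y (0, p)) p b) \<and>
    (\<forall>t p. ((\<lambda>t. u (t, p)) has_vector_derivative G b ((t, p), u (t, p))) (at t))" if b: "b \<in> Basis" for b
    by (rule ode_C0[OF Ck_on_imp_continuous[OF Gk] L(1) GL Ck_on_imp_continuous[OF y0k[OF b]]])
  then obtain u where u: "\<And>b. b \<in> Basis \<Longrightarrow> continuous_on UNIV (u b)"
    "\<And>b p. b \<in> Basis \<Longrightarrow> u b (0, p) = FD (\<lambda>p. y (0, p)) p b"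
    "\<And>b t p. b \<in> Basis \<Longrightarrow> ((\<lambda>t. u b (t, p)) has_vector_derivative G b ((t, p), u b (t, p))) (at t)"
    by metis
  have uk: "Ck_on k UNIV (u b)" if b: "b \<in> Basis" for b
    using Suc.IH[OF Gk _ L(1) GL u(1)[OF b] u(3)[OF b]] y0k[OF b] u(2)[OF b] by simp
  define U where "U p t h = (\<Sum>b\<in>Basis. (h \<bullet> b) *\<^sub>R u b (t, p))" for p t h
  have Ul: "bounded_linear (U p t)" for p t
    unfolding U_def by (intro bounded_linear_sum bounded_linear_scaleR_const bounded_linear_inner_left)
  have dU: "((\<lambda>t. U p t h) has_vector_derivative FD F ((t, p), y (t, p)) ((0, h), U p t h)) (at t)" for p t h
  proof -
    have "((\<lambda>t. U p t h) has_vector_derivative (\<Sum>b\<in>Basis. (h \<bullet> b) *\<^sub>R G b ((t, p), u b (t, p)))) (at t)"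
      unfolding U_def by (intro has_vector_derivative_sum bounded_linear.has_vector_derivative[OF bounded_linear_scaleR_right] u)
    moreover have "((0, h), U p t h) = (\<Sum>b\<in>Basis. (h \<bullet> b) *\<^sub>R ((0::real, b), u b (t, p)))"
      by (simp add: prod_eq_iff fst_sum snd_sum U_def euclidean_representation)
    then have "FD F ((t, p), y (t, p)) ((0, h), U p t h) = (\<Sum>b\<in>Basis. (h \<bullet> b) *\<^sub>R G b ((t, p), u b (t, p)))"
      by (simp add: G_def linear_sum[OF lin] linear_scale[OF lin] del: scaleR_Pair)
    ultimately show ?thesis by simp
  qed
  have y0d: "((\<lambda>p. y (0, p)) has_derivative FD (\<lambda>p. y (0, p)) p) (at p)" for p
    using Ck_on_Suc_has_derivative[OF open_UNIV Suc.prems(2)] by simp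
  have U0: "U p 0 h = FD (\<lambda>p. y (0, p)) p h" for p h
    unfolding U_def using linear_expand_Basis[OF has_derivative_bounded_linear[OF y0d], of p h] u(2) by simp
  have dp: "((\<lambda>p. y (t, p)) has_derivative U p t) (at p)" for t p
    by (rule ode_param_derivative[OF F c L y y0d dU U0 Ul])
  have "continuous_on UNIV (\<lambda>q. F (q, y q))"
    by (intro continuous_on_compose2[OF Ck_on_imp_continuous[OF Suc.prems(1)]] continuous_intros y(1)) auto
  then have dy: "(y has_derivative (\<lambda>v. fst v *\<^sub>R F (q, y q) + U (snd q) (fst q) (snd v))) (at q)" for q
    using has_derivative_time_param[of y "\<lambda>q. F (q, y q)", OF y(2) _ dp, of "fst q" "snd q"] by simp
  have "Ck_on (Suc k) UNIV y"
  proof (rule Ck_on_SucI[OF open_UNIV dy])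
    show "Ck_on k UNIV (\<lambda>q. fst i *\<^sub>R F (q, y q) + U (snd q) (fst q) (snd i))" for i
      unfolding U_def
      by (simp, intro Ck_on_add Ck_on_sum Ck_on_bounded_linear[OF _ bounded_linear_scaleR_right] open_UNIV uk
          Ck_on_compose[OF _ _ _ Ck_on_Suc_imp[OF Suc.prems(1)], OF open_UNIV open_UNIV] Ck_on_Pair Ck_on_id yk subset_UNIV)
  qed
  moreover have "FD y (t, p) (0, h) = U p t h" for t p h using FD_eq[OF dy] by simp
  ultimately show ?case using dU by simp
qed

theorem ode_smooth:
  fixes F :: "(real \<times> 'p::euclidean_space) \<times> 'y::euclidean_space \<Rightarrow> 'y"
  assumes F: "Cinf F" and y0: "Cinf y0"
    and L: "L \<ge> 0" "\<And>q a b. norm (F (q, a) - F (q, b)) \<le> L * norm (a - b)"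
  obtains y where "Cinf y" "\<And>p. y (0, p) = y0 p"
    "\<And>t p. ((\<lambda>t. y (t, p)) has_vector_derivative F ((t, p), y (t, p))) (at t)"
    "\<And>t p h. ((\<lambda>t. FD y (t, p) (0, h)) has_vector_derivative
      FD F ((t, p), y (t, p)) ((0, h), FD y (t, p) (0, h))) (at t)"
proof -
  obtain y where y: "continuous_on UNIV y" "\<And>p. y (0, p) = y0 p"
    "\<And>t p. ((\<lambda>t. y (t, p)) has_vector_derivative F ((t, p), y (t, p))) (at t)"
    using ode_C0[OF Cinf_continuous[OF F] L Cinf_continuous[OF y0]] by blast
  have k: "Ck_on k UNIV F" "Ck_on k UNIV (\<lambda>p. y (0, p))" for k
    using F y0 by (auto simp: Cinf_on_def y(2))
  note * = ode_Ck[OF k L y(1,3)]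
  have "Cinf y" using * by (simp add: Cinf_on_def)
  then show thesis by (rule that[OF _ y(2,3)]) (rule *[of 1, THEN conjunct2, rule_format, OF zero_less_one])
qed

text \<open>An integral with parameters solves an equation whose right-hand side ignores the state,
  so smoothness and differentiation under the integral sign are instances of
  \<open>ode_smooth\<close>.\<close>

lemma smooth_antiderivative:
  fixes f :: "real \<times> 'p::euclidean_space \<Rightarrow> 'y::euclidean_space"
  assumes f: "Cinf f"
  obtains y where "Cinf y" "\<And>p. y (0, p) = 0"
    "\<And>t p. ((\<lambda>t. y (t, p)) has_vector_derivative f (t, p)) (at t)"
    "\<And>t p h. ((\<lambda>t. FD y (t, p) (0, h)) has_vector_derivative FD f (t, p) (0, h)) (at t)"
proof -
  let ?F = "\<lambda>x :: (real \<times> 'p) \<times> 'y. f (fst x)"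
  have "FD ?F x = (\<lambda>v. FD f (fst x) (fst v))" for x
    by (rule FD_eq, rule has_derivative_compose[OF has_derivative_fst[OF has_derivative_ident] Cinf_has_derivative[OF f]])
  moreover have "Cinf ?F" by (intro Cinf_compose[OF f] smooth_intros)
  moreover obtain y where "Cinf y" "\<And>p. y (0, p) = 0"
    "\<And>t p. ((\<lambda>t. y (t, p)) has_vector_derivative ?F ((t, p), y (t, p))) (at t)"
    "\<And>t p h. ((\<lambda>t. FD y (t, p) (0, h)) has_vector_derivative
      FD ?F ((t, p), y (t, p)) ((0, h), FD y (t, p) (0, h))) (at t)"
    by (rule ode_smooth[of ?F "\<lambda>p. 0" 0]) (use calculation in \<open>simp_all add: Cinf_const\<close>)
  ultimately show thesis by (intro that[of y]) simp_all
qed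

section \<open>Hamiltonian flows in the plane\<close>

text \<open>The area form omega_0, which is also the determinant of two vectors of the
  plane.\<close>

definition om :: "complex \<Rightarrow> complex \<Rightarrow> real"
  where "om a b = Re a * Im b - Im a * Re b"

lemma bounded_bilinear_om: "bounded_bilinear om"
proof -
  have "om a b = (\<i> * a) \<bullet> b" for a b by (simp add: om_def inner_complex_def)
  moreover have "bounded_bilinear (\<lambda>a b :: complex. (\<i> * a) \<bullet> b)"
    by (rule bounded_bilinear.comp1[OF bounded_bilinear_inner bounded_linear_mult_right])
  ultimately show ?thesis by (metis (no_types, lifting) ext)
qed

lemmas Cinf_om [smooth_intros] = Cinf_bilinear[OF bounded_bilinear_om]

lemma om_self [simp]: "om a a = 0" and om_swap: "om a b = - om b a"
  and om_add_left: "om (a + b) c = om a c + om b c" and om_add_right: "om a (b + c) = om a b + om a c"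
  and om_diff_left: "om (a - b) c = om a c - om b c" and om_diff_right: "om a (b - c) = om a b - om a c"
  and om_scaleR_left: "om (r *\<^sub>R a) c = r * om a c" and om_scaleR_right: "om a (r *\<^sub>R c) = r * om a c"
  and om_zero [simp]: "om 0 a = 0" "om a 0 = 0"
  by (simp_all add: om_def algebra_simps)

lemma om_eq_inner: "om a b = (\<i> * a) \<bullet> b" by (simp add: om_def inner_complex_def)

lemma complex_linear_expand:
  assumes "linear A" shows "A v = Re v *\<^sub>R A 1 + Im v *\<^sub>R A \<i>"
proof -
  have "v = Re v *\<^sub>R 1 + Im v *\<^sub>R \<i>" by (simp add: complex_eq_iff)
  then show ?thesis using linear_add[OF assms] linear_scale[OF assms] by metis
qed

lemma om_linear_trace:
  assumes "linear A"
  shows "om (A a) b + om a (A b) = (Re (A 1) + Im (A \<i>)) * om a b"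
  by (subst (1 2) complex_linear_expand[OF assms]) (simp add: om_def algebra_simps)

lemma om_has_real_derivative:
  assumes "(a has_vector_derivative A (a t)) (at t)" "(b has_vector_derivative A (b t)) (at t)" "linear A"
  shows "((\<lambda>t. om (a t) (b t)) has_real_derivative (Re (A 1) + Im (A \<i>)) * om (a t) (b t)) (at t)"
proof -
  have "((\<lambda>t. om (a t) (b t)) has_vector_derivative om (a t) (A (b t)) + om (A (a t)) (b t)) (at t)"
    by (rule bounded_bilinear.has_vector_derivative[OF bounded_bilinear_om assms(1,2)])
  then show ?thesis
    using om_linear_trace[OF assms(3), of "a t" "b t"]
    by (simp add: has_real_derivative_iff_has_vector_derivative add.commute)
qed

lemma constant_of_zero_vector_derivative:
  assumes "\<And>t. t \<in> S \<Longrightarrow> (f has_vector_derivative 0) (at t)" "convex S" "a \<in> S" "b \<in> S"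
  shows "f a = f b"
proof -
  have "\<exists>c. \<forall>x\<in>S. f x = c"
  proof (rule has_derivative_zero_constant[OF assms(2)])
    show "(f has_derivative (\<lambda>h. 0)) (at x within S)" if "x \<in> S" for x
      using assms(1)[OF that] has_derivative_at_withinI by (fastforce simp: has_vector_derivative_def)
  qed
  then show ?thesis using assms(3,4) by metis
qed

lemma ode_unique:
  fixes u :: "real \<Rightarrow> 'y::euclidean_space"
  assumes u: "\<And>t. (u has_vector_derivative f t (u t)) (at t)" and v: "\<And>t. (v has_vector_derivative f t (v t)) (at t)"
    and L: "L \<ge> 0" "\<And>t a b. norm (f t a - f t b) \<le> L * norm (a - b)" and eq: "u t0 = v t0"
  shows "u t = v t"
proof -
  have "((\<lambda>s. u (t0 + s) - v (t0 + s)) has_vector_derivative f (t0 + s) (u (t0 + s)) - f (t0 + s) (v (t0 + s))) (at s)" for s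
  proof -
    have 1: "((\<lambda>s. t0 + s) has_vector_derivative 1) (at s)" by (auto intro!: derivative_eq_intros)
    show ?thesis
      using vector_diff_chain_at[OF 1 u] vector_diff_chain_at[OF 1 v]
      by (intro has_vector_derivative_diff) (auto simp: o_def)
  qed
  from gronwall[OF L(1) this, of "t - t0" 0] L(2) eq show ?thesis by simp
qed

lemma Lipschitz_of_compact_support:
  fixes f :: "'a::euclidean_space \<Rightarrow> 'b::real_normed_vector"
  assumes f: "Cinf f" and K: "compact K" "\<And>x. x \<notin> K \<Longrightarrow> f x = 0"
  obtains L where "L \<ge> 0" "\<And>x y. norm (f x - f y) \<le> L * norm (x - y)"
proof -
  obtain L where L: "L \<ge> 0" "\<And>x v. x \<in> K \<Longrightarrow> norm (FD f x v) \<le> L * norm v"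
    using FD_bound_compact[OF Cinf_has_derivative[OF f] Cinf_continuous[OF Cinf_on_FD[OF f]] K(1)] by blast
  have FD0: "FD f x = (\<lambda>v. 0)" if "x \<notin> K" for x
  proof (rule FD_eq, rule has_derivative_transform_within_open[of "\<lambda>x. 0"])
    show "open (- K)" using K(1) by (simp add: compact_imp_closed open_Compl)
  qed (use that K(2) in auto)
  have "norm (FD f x v) \<le> L * norm v" for x v
    by (cases "x \<in> K") (use L FD0 in auto)
  then have "onorm (FD f x) \<le> L" for x by (rule onorm_le)
  then have "norm (f x - f y) \<le> L * norm (x - y)" for x y
    by (intro differentiable_bound[of UNIV f "FD f"]) (use Cinf_has_derivative[OF f] in auto)
  then show thesis using that L(1) by blast
qed

lemma linear_pair_left: "linear F \<Longrightarrow> linear (\<lambda>v. F (v, 0))"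
  using linear_compose[of "\<lambda>v. (v, 0)" F] by (auto simp: o_def linear_iff)

text \<open>Same sign convention as \<open>ham_field\<close>, but with derivatives taken in the
  whole space, so that no boundary interferes; see \<open>FD_hfield\<close>.\<close>

definition hfield :: "(complex \<times> real \<Rightarrow> real) \<Rightarrow> complex \<times> real \<Rightarrow> complex"
  where "hfield H q = Complex (FD H q (\<i>, 0)) (- FD H q (1, 0))"

lemma Cinf_hfield: "Cinf H \<Longrightarrow> Cinf (hfield H)"
  unfolding hfield_def by (intro smooth_intros Cinf_FD)

lemma FD_hfield: "Cinf H \<Longrightarrow> FD H q (v, 0) = om (hfield H q) v"
proof -
  assume "Cinf H"
  then have l: "linear (FD H q)" by (intro bounded_linear.linear has_derivative_bounded_linear[OF Cinf_has_derivative])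
  from linear_pair_left[OF l] have "linear (\<lambda>v. FD H q (v, 0))" .
  from complex_linear_expand[OF this, of v] show ?thesis by (simp add: om_def hfield_def)
qed

lemma FD_compose:
  "Cinf f \<Longrightarrow> (g has_derivative g') (at x) \<Longrightarrow> ((\<lambda>x. f (g x)) has_derivative (\<lambda>h. FD f (g x) (g' h))) (at x)"
  using has_derivative_compose Cinf_has_derivative by blast

lemma FD_compose_vector:
  "Cinf f \<Longrightarrow> (g has_vector_derivative g') (at x) \<Longrightarrow> ((\<lambda>x. f (g x)) has_vector_derivative FD f (g x) g') (at x)"
  unfolding has_vector_derivative_def
  using FD_compose[of f g "\<lambda>h. h *\<^sub>R g'" x]
  by (simp add: linear_scale[OF bounded_linear.linear[OF has_derivative_bounded_linear[OF Cinf_has_derivative]]])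

lemma linear_FD: "Cinf f \<Longrightarrow> linear (FD f x)"
  by (rule bounded_linear.linear[OF has_derivative_bounded_linear[OF Cinf_has_derivative]])

lemma FD_partial_right:
  "Cinf f \<Longrightarrow> ((\<lambda>p. f (t, p)) has_derivative (\<lambda>h. FD f (t, p) (0, h))) (at p)"
  by (rule FD_compose) (auto intro!: derivative_eq_intros)

lemma FD_partial_left:
  "Cinf f \<Longrightarrow> ((\<lambda>t. f (t, p)) has_derivative (\<lambda>h. FD f (t, p) (h, 0))) (at t)"
  by (rule FD_compose) (auto intro!: derivative_eq_intros)

text \<open>Both orders of differentiation are the derivative, at time 0, of the same solution of a
  differential equation with parameter.\<close>
lemma FD_symmetric:
  fixes g :: "'a::euclidean_space \<Rightarrow> 'b::euclidean_space"
  assumes g: "Cinf g"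
  shows "FD (\<lambda>x. FD g x v) a w = FD (\<lambda>x. FD g x w) a v"
proof -
  define l where "l q = a + fst q *\<^sub>R v + snd q *\<^sub>R w" for q :: "real \<times> real"
  have l: "(l has_derivative (\<lambda>h. fst h *\<^sub>R v + snd h *\<^sub>R w)) (at q)" for q
    unfolding l_def by (auto intro!: derivative_eq_intros)
  have lC: "Cinf l" unfolding l_def by (intro smooth_intros)
  define f where "f q = FD g (l q) v" for q
  have fC: "Cinf f" unfolding f_def by (intro Cinf_FD g lC smooth_intros)
  obtain y where y: "Cinf y" "\<And>p. y (0, p) = 0"
    "\<And>t p. ((\<lambda>t. y (t, p)) has_vector_derivative f (t, p)) (at t)"
    "\<And>t p h. ((\<lambda>t. FD y (t, p) (0, h)) has_vector_derivative FD f (t, p) (0, h)) (at t)"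
    by (rule smooth_antiderivative[OF fC]) (rule that)
  have lv: "((\<lambda>t. l (t, p)) has_vector_derivative v) (at t)" for t p
    unfolding l_def by (auto intro!: derivative_eq_intros)
  have "y (t, p) = g (l (t, p)) - g (l (0, p))" for t p
  proof -
    have "((\<lambda>t. g (l (t, p)) - y (t, p)) has_vector_derivative f (t, p) - f (t, p)) (at t)" for t
      by (intro has_vector_derivative_diff y) (use FD_compose_vector[OF g lv] in \<open>simp add: f_def\<close>)
    then have "g (l (t, p)) - y (t, p) = g (l (0, p)) - y (0, p)"
      by (intro constant_of_zero_vector_derivative[of UNIV]) auto
    then show ?thesis using y(2) by (simp add: algebra_simps)
  qed
  then have eq: "(\<lambda>p. y (t, p)) = (\<lambda>p. g (l (t, p)) - g (l (0, p)))" for t by auto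
  have dd: "((\<lambda>p. y (t, p)) has_derivative (\<lambda>h. FD g (l (t, p)) (h *\<^sub>R w) - FD g (l (0, p)) (h *\<^sub>R w))) (at p)" for t p
  proof -
    have "((\<lambda>p. l (t, p)) has_derivative (\<lambda>h. h *\<^sub>R w)) (at p)" for t
      unfolding l_def by (auto intro!: derivative_eq_intros)
    from FD_compose[OF g this] show ?thesis unfolding eq by (intro has_derivative_diff)
  qed
  have "FD y (t, p) (0, h) = FD g (l (t, p)) (h *\<^sub>R w) - FD g (l (0, p)) (h *\<^sub>R w)" for t p h
    by (rule fun_cong[OF has_derivative_unique[OF FD_partial_right[OF y(1)] dd]])
  then have "((\<lambda>t. FD g (l (t, 0)) w - FD g (l (0, 0)) w) has_vector_derivative FD f (0, 0) (0, 1)) (at 0)"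
    using y(4)[of 0 1 0] by simp
  moreover have "((\<lambda>t. FD g (l (t, 0)) w - FD g (l (0, 0)) w) has_vector_derivative FD (\<lambda>x. FD g x w) a v) (at 0)"
  proof -
    have "((\<lambda>t. FD g (l (t, 0)) w - FD g (l (0, 0)) w) has_vector_derivative FD (\<lambda>x. FD g x w) (l (0, 0)) v - 0) (at 0)"
      by (intro has_vector_derivative_diff FD_compose_vector[OF Cinf_on_FD[OF g] lv] has_vector_derivative_const)
    then show ?thesis by (simp add: l_def)
  qed
  ultimately have "FD (\<lambda>x. FD g x w) a v = FD f (0, 0) (0, 1)" by (rule vector_derivative_unique_at[rotated])
  moreover have "FD f (0, 0) = (\<lambda>h. FD (\<lambda>x. FD g x v) (l (0, 0)) (fst h *\<^sub>R v + snd h *\<^sub>R w))"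
    unfolding f_def by (rule FD_eq, rule FD_compose[OF Cinf_on_FD[OF g] l])
  ultimately show ?thesis by (simp add: l_def)
qed

text \<open>These Hamiltonians live on the whole plane and for all times. Vanishing outside the time
  interval makes the flow stationary there, so flows can be concatenated smoothly and one-sided
  derivatives are avoided.\<close>

locale ham_flow =
  fixes H :: "complex \<times> real \<Rightarrow> real" and R :: real
  assumes H: "Cinf H" and R: "R > 0"
    and supp_z: "\<And>z t. norm z \<ge> R \<Longrightarrow> H (z, t) = 0" and supp_t: "\<And>z t. t \<le> 0 \<or> t \<ge> 1 \<Longrightarrow> H (z, t) = 0"
begin

abbreviation "X \<equiv> hfield H"

lemma XC: "Cinf X" by (rule Cinf_hfield[OF H])

lemma X_zero: assumes "norm z > R \<or> t < 0 \<or> t > 1" shows "X (z, t) = 0"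
proof -
  have "FD H (z, t) = (\<lambda>v. 0)"
  proof (rule FD_eq, rule has_derivative_transform_within_open[of "\<lambda>x. 0"])
    show "open (- (cball 0 R \<times> {0..1::real}) :: (complex \<times> real) set)"
      by (intro open_Compl closed_Times) auto
    show "(z, t) \<in> - (cball 0 R \<times> {0..1})" using assms by auto
    show "0 = H q" if "q \<in> - (cball 0 R \<times> {0..1})" for q
      using that supp_z[of "fst q" "snd q"] supp_t[of "snd q" "fst q"] by (auto simp: mem_Times_iff)
  qed simp
  then show ?thesis by (simp add: hfield_def complex_eq_iff)
qed

lemma X_zero_t: assumes "t \<le> 0 \<or> t \<ge> 1" shows "X (z, t) = 0"
proof -
  have c: "continuous_on A (\<lambda>t. X (z, t))" for A
    by (intro continuous_on_compose2[OF Cinf_continuous[OF XC]] continuous_intros) auto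
  have "X (z, t) = 0" if "t \<in> closure {..<0}"
    by (rule continuous_constant_on_closure[OF c _ that]) (simp add: X_zero)
  moreover have "X (z, t) = 0" if "t \<in> closure {1<..}"
    by (rule continuous_constant_on_closure[OF c _ that]) (simp add: X_zero)
  ultimately show ?thesis using assms by (metis atLeast_iff atMost_iff closure_lessThan closure_greaterThan)
qed

lemma X_Lipschitz: obtains L where "L \<ge> 0" "\<And>t a b. norm (X (a, t) - X (b, t)) \<le> L * norm (a - b)"
proof -
  obtain L where "L \<ge> 0" "\<And>x y. norm (X x - X y) \<le> L * norm (x - y)"
  proof (rule Lipschitz_of_compact_support[OF XC])
    show "compact (cball 0 R \<times> {0..1::real} :: (complex \<times> real) set)" by (intro compact_Times) auto
    show "X x = 0" if "x \<notin> cball 0 R \<times> {0..1}" for x using that X_zero[of "fst x" "snd x"] by (auto simp: mem_Times_iff)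
  qed blast
  then have "norm (X (a, t) - X (b, t)) \<le> L * norm ((a, t) - (b, t))" for t a b by blast
  then show thesis using that[OF \<open>L \<ge> 0\<close>] by (simp add: norm_Pair)
qed

definition Phi :: "real \<times> complex \<Rightarrow> complex"
  where "Phi = (SOME y. Cinf y \<and> (\<forall>p. y (0, p) = p) \<and>
    (\<forall>t p. ((\<lambda>t. y (t, p)) has_vector_derivative X (y (t, p), t)) (at t)) \<and>
    (\<forall>t p h. ((\<lambda>t. FD y (t, p) (0, h)) has_vector_derivative FD X (y (t, p), t) (FD y (t, p) (0, h), 0)) (at t)))"

lemma Phi_props:
  "Cinf Phi" "Phi (0, p) = p" "((\<lambda>t. Phi (t, p)) has_vector_derivative X (Phi (t, p), t)) (at t)"
  "((\<lambda>t. FD Phi (t, p) (0, h)) has_vector_derivative FD X (Phi (t, p), t) (FD Phi (t, p) (0, h), 0)) (at t)"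
proof -
  obtain L where L: "L \<ge> 0" "\<And>t a b. norm (X (a, t) - X (b, t)) \<le> L * norm (a - b)" by (rule X_Lipschitz) (rule that)
  let ?F = "\<lambda>x :: (real \<times> complex) \<times> complex. X (snd x, fst (fst x))"
  have FF: "FD ?F x = (\<lambda>v. FD X (snd x, fst (fst x)) (snd v, fst (fst v)))" for x
    by (rule FD_eq, rule has_derivative_compose[OF _ Cinf_has_derivative[OF XC]]) (auto intro!: derivative_eq_intros)
  have "Cinf ?F" by (intro Cinf_compose[OF XC] smooth_intros)
  then obtain y where "Cinf y" "\<And>p. y (0, p) = p"
    "\<And>t p. ((\<lambda>t. y (t, p)) has_vector_derivative ?F ((t, p), y (t, p))) (at t)"
    "\<And>t p h. ((\<lambda>t. FD y (t, p) (0, h)) has_vector_derivative FD ?F ((t, p), y (t, p)) ((0, h), FD y (t, p) (0, h))) (at t)"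
    by (rule ode_smooth[of ?F "\<lambda>p. p" L]) (use L in \<open>auto intro: Cinf_ident\<close>)
  then have "\<exists>y. Cinf y \<and> (\<forall>p. y (0, p) = p) \<and>
    (\<forall>t p. ((\<lambda>t. y (t, p)) has_vector_derivative X (y (t, p), t)) (at t)) \<and>
    (\<forall>t p h. ((\<lambda>t. FD y (t, p) (0, h)) has_vector_derivative FD X (y (t, p), t) (FD y (t, p) (0, h), 0)) (at t))"
    unfolding FF by auto
  from someI_ex[OF this, folded Phi_def]
  show "Cinf Phi" "Phi (0, p) = p" "((\<lambda>t. Phi (t, p)) has_vector_derivative X (Phi (t, p), t)) (at t)"
    "((\<lambda>t. FD Phi (t, p) (0, h)) has_vector_derivative FD X (Phi (t, p), t) (FD Phi (t, p) (0, h), 0)) (at t)"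
    by blast+
qed

lemma Phi_unique:
  assumes "\<And>t. (u has_vector_derivative X (u t, t)) (at t)" "u t0 = Phi (t0, z)"
  shows "u t = Phi (t, z)"
proof -
  obtain L where L: "L \<ge> 0" "\<And>t a b. norm (X (a, t) - X (b, t)) \<le> L * norm (a - b)" by (rule X_Lipschitz) (rule that)
  show ?thesis by (rule ode_unique[of u "\<lambda>t a. X (a, t)", OF assms(1) Phi_props(3) L assms(2)])
qed

lemma Phi_static: "norm z > R \<Longrightarrow> Phi (t, z) = z"
  by (rule Phi_unique[of "\<lambda>t. z" 0, symmetric]) (auto simp: Phi_props X_zero)

lemma Phi_inj: "Phi (t, z) = Phi (t, z') \<Longrightarrow> z = z'"
  using Phi_unique[of "\<lambda>t. Phi (t, z)" t z' 0, OF Phi_props(3)] by (simp add: Phi_props)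

text \<open>The final position is itself a fixed point of the flow, and the flow is
  injective.\<close>

lemma Phi_static': "norm (Phi (t, z)) > R \<Longrightarrow> Phi (t, z) = z"
  using Phi_static[of "Phi (t, z)" t] Phi_inj by blast

lemma Phi_bound: "norm z \<le> r \<Longrightarrow> R < r \<Longrightarrow> norm (Phi (t, z)) \<le> r"
  using Phi_static'[of t z] by (cases "norm (Phi (t, z)) > R") auto

text \<open>The equation is solved with initial position w at time t; following that solution to
  time 0 gives the preimage.\<close>

lemma Phi_surj: obtains z where "Phi (t, z) = w"
proof -
  obtain L where L: "L \<ge> 0" "\<And>t a b. norm (X (a, t) - X (b, t)) \<le> L * norm (a - b)" by (rule X_Lipschitz) (rule that)
  let ?F = "\<lambda>x :: (real \<times> complex) \<times> complex. X (snd x, t + fst (fst x))"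
  have "\<exists>y. continuous_on UNIV y \<and> (\<forall>p. y (0, p) = p) \<and>
    (\<forall>s p. ((\<lambda>s. y (s, p)) has_vector_derivative ?F ((s, p), y (s, p))) (at s))"
    by (rule ode_C0[of ?F L]) (use L in \<open>auto intro!: continuous_on_compose2[OF Cinf_continuous[OF XC]] continuous_intros\<close>)
  then obtain y where y: "y (0, w) = w" "\<And>s. ((\<lambda>s. y (s, w)) has_vector_derivative X (y (s, w), t + s)) (at s)"
    by auto
  have "((\<lambda>s. y (s - t, w)) has_vector_derivative X (y (s - t, w), s)) (at s)" for s
  proof -
    have 1: "((\<lambda>s. s - t) has_vector_derivative 1) (at s)" by (auto intro!: derivative_eq_intros)
    show ?thesis using vector_diff_chain_at[OF 1 y(2)] by (simp add: o_def)
  qed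
  from Phi_unique[OF this, of 0 "y (- t, w)" t] have "y (0, w) = Phi (t, y (- t, w))" by (simp add: Phi_props)
  then show thesis using that y(1) by metis
qed

lemma Phi_bij: "bij (\<lambda>z. Phi (t, z))"
proof (rule bijI)
  show "inj (\<lambda>z. Phi (t, z))" using Phi_inj by (rule injI)
  show "surj (\<lambda>z. Phi (t, z))" by (rule surjI[of _ "\<lambda>w. SOME z. Phi (t, z) = w"]) (metis (mono_tags) Phi_surj someI_ex)
qed

lemma Phi_time: "t \<le> 0 \<Longrightarrow> Phi (t, z) = z" "t \<ge> 1 \<Longrightarrow> Phi (t, z) = Phi (1, z)" for t :: real
proof -
  have d: "((\<lambda>t. Phi (t, z)) has_vector_derivative 0) (at t)" if "t \<le> 0 \<or> t \<ge> 1" for t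
    using Phi_props(3)[of z t] X_zero_t[OF that] by simp
  have "Phi (t, z) = Phi (0, z)" if "t \<le> 0"
    by (rule constant_of_zero_vector_derivative[of "{..0}"]) (use that d in simp_all)
  then show "t \<le> 0 \<Longrightarrow> Phi (t, z) = z" by (simp add: Phi_props)
  show "Phi (t, z) = Phi (1, z)" if "t \<ge> 1"
    by (rule constant_of_zero_vector_derivative[of "{1..}"]) (use that d in simp_all)
qed

text \<open>The divergence of a Hamiltonian field is a difference of two mixed second
  derivatives.\<close>

lemma FD_X_trace: "Re (FD X q (1, 0)) + Im (FD X q (\<i>, 0)) = 0"
proof -
  have "FD X q = (\<lambda>v. Complex (FD (\<lambda>q. FD H q (\<i>, 0)) q v) (- FD (\<lambda>q. FD H q (1, 0)) q v))"
    unfolding hfield_def[abs_def] Complex_eq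
    by (rule FD_eq) (intro has_derivative_add has_derivative_of_real has_derivative_mult_right
        has_derivative_minus Cinf_has_derivative Cinf_on_FD H)
  then show ?thesis using FD_symmetric[OF H, of "(\<i>, 0)" q "(1, 0)"] by simp
qed

lemma FD_Phi_0: "FD Phi (0, z) (0, h) = h"
proof -
  have "((\<lambda>p. Phi (0, p)) has_derivative (\<lambda>h. h)) (at z)" by (simp add: Phi_props)
  then show ?thesis using FD_partial_right[OF Phi_props(1)] has_derivative_unique by metis
qed

lemma linear_FD_X: "linear (\<lambda>v. FD X q (v, 0))"
  by (rule linear_pair_left[OF linear_FD[OF XC]])

text \<open>Liouville: the determinant of the linearized flow solves a linear equation whose
  coefficient is the divergence of the field.\<close>

lemma Phi_jac: "om (FD Phi (t, z) (0, 1)) (FD Phi (t, z) (0, \<i>)) = 1"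
proof -
  have "((\<lambda>t. om (FD Phi (t, z) (0, 1)) (FD Phi (t, z) (0, \<i>))) has_vector_derivative 0) (at t)" for t
    using om_has_real_derivative[of "\<lambda>t. FD Phi (t, z) (0, 1)" "\<lambda>v. FD X (Phi (t, z), t) (v, 0)" t "\<lambda>t. FD Phi (t, z) (0, \<i>)",
        OF Phi_props(4) Phi_props(4) linear_FD_X] FD_X_trace
    by (simp add: has_real_derivative_iff_has_vector_derivative)
  then have "om (FD Phi (t, z) (0, 1)) (FD Phi (t, z) (0, \<i>)) = om (FD Phi (0, z) (0, 1)) (FD Phi (0, z) (0, \<i>))"
    by (intro constant_of_zero_vector_derivative[of UNIV]) auto
  then show ?thesis by (simp add: FD_Phi_0 om_def)
qed

text \<open>The integral of \<open>H + \<lambda>(X)\<close> along the flow is the action; its differential is found by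
  differentiating under the integral, which turns \<open>dH + \<iota>\<^sub>X d\<lambda>\<close> into a total time derivative.\<close>
lemma flow_action:
  assumes lam: "Cinf (lam :: complex \<Rightarrow> complex)"
  obtains a where "Cinf a"
    "\<And>z. a z = integral {0..1} (\<lambda>t. H (Phi (t, z), t) + lam (Phi (t, z)) \<bullet> X (Phi (t, z), t))"
    "\<And>z. R < norm z \<Longrightarrow> a z = 0"
    "\<And>z h. \<forall>s u v. FD lam (Phi (s, z)) u \<bullet> v - FD lam (Phi (s, z)) v \<bullet> u = om u v \<Longrightarrow>
      FD a z h = lam (Phi (1, z)) \<bullet> FD Phi (1, z) (0, h) - lam z \<bullet> h"
proof -
  let ?P = "\<lambda>q. (Phi q, fst q)"
  define f where "f q = H (?P q) + lam (Phi q) \<bullet> X (?P q)" for q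
  have fC: "Cinf f" unfolding f_def
    by (intro smooth_intros Cinf_compose[OF H] Cinf_compose[OF lam] Cinf_compose[OF XC] Phi_props(1))
  obtain A where A: "Cinf A" "\<And>p. A (0, p) = 0"
    "\<And>t p. ((\<lambda>t. A (t, p)) has_vector_derivative f (t, p)) (at t)"
    "\<And>t p h. ((\<lambda>t. FD A (t, p) (0, h)) has_vector_derivative FD f (t, p) (0, h)) (at t)"
    by (rule smooth_antiderivative[OF fC]) (rule that)
  define a where "a z = A (1, z)" for z
  have "Cinf a" unfolding a_def by (intro Cinf_compose[OF A(1)] smooth_intros)
  have int: "a z = integral {0..1} (\<lambda>t. f (t, z))" for z
  proof -
    have "((\<lambda>t. f (t, z)) has_integral A (1, z) - A (0, z)) {0..1}"
      by (rule fundamental_theorem_of_calculus) (auto intro: has_vector_derivative_at_within A(3))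
    then show ?thesis by (simp add: a_def A(2) integral_unique)
  qed
  have zero: "a z = 0" if "R < norm z" for z
    unfolding int f_def using that by (simp add: Phi_static X_zero supp_z)
  have der: "FD a z h = lam (Phi (1, z)) \<bullet> FD Phi (1, z) (0, h) - lam z \<bullet> h"
    if curl: "\<forall>s u v. FD lam (Phi (s, z)) u \<bullet> v - FD lam (Phi (s, z)) v \<bullet> u = om u v" for z h
  proof -
    let ?W = "\<lambda>t. FD Phi (t, z) (0, h)"
    have Ff: "FD f (t, z) (0, h) = FD H (Phi (t, z), t) (?W t, 0) + (FD lam (Phi (t, z)) (?W t) \<bullet> X (Phi (t, z), t)
        + lam (Phi (t, z)) \<bullet> FD X (Phi (t, z), t) (?W t, 0))" for t
    proof -
      have P: "(?P has_derivative (\<lambda>v. (FD Phi q v, fst v))) (at q)" for q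
        by (intro has_derivative_Pair Cinf_has_derivative[OF Phi_props(1)] has_derivative_fst has_derivative_ident)
      have "(f has_derivative (\<lambda>v. FD H (?P q) (FD Phi q v, fst v) + (lam (Phi q) \<bullet> FD X (?P q) (FD Phi q v, fst v)
          + FD lam (Phi q) (FD Phi q v) \<bullet> X (?P q)))) (at q)" for q
        unfolding f_def
        by (intro has_derivative_add has_derivative_inner FD_compose[OF H P] FD_compose[OF XC P]
            FD_compose[OF lam Cinf_has_derivative[OF Phi_props(1)]])
      from FD_eq[OF this] show ?thesis by simp
    qed
    have e1: "((\<lambda>t. lam (Phi (t, z)) \<bullet> ?W t) has_vector_derivative
        (lam (Phi (t, z)) \<bullet> FD X (Phi (t, z), t) (?W t, 0) + FD lam (Phi (t, z)) (X (Phi (t, z), t)) \<bullet> ?W t)) (at t)" for t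
      by (intro bounded_bilinear.has_vector_derivative[OF bounded_bilinear_inner]
          FD_compose_vector[OF lam] Phi_props)
    have e2: "FD f (t, z) (0, h) = lam (Phi (t, z)) \<bullet> FD X (Phi (t, z), t) (?W t, 0) + FD lam (Phi (t, z)) (X (Phi (t, z), t)) \<bullet> ?W t" for t
      unfolding Ff FD_hfield[OF H] using curl[rule_format, of t "X (Phi (t, z), t)" "?W t"] by simp
    have d: "((\<lambda>t. FD A (t, z) (0, h) - lam (Phi (t, z)) \<bullet> ?W t) has_vector_derivative 0) (at t)" for t
      using has_vector_derivative_diff[OF A(4)[of z h t] e1[of t]] unfolding e2 by simp
    have "FD A (1, z) (0, h) - lam (Phi (1, z)) \<bullet> ?W 1 = FD A (0, z) (0, h) - lam (Phi (0, z)) \<bullet> ?W 0"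
      by (rule constant_of_zero_vector_derivative[of UNIV, OF d]) auto
    moreover have "FD A (0, z) (0, h) = 0"
    proof -
      have "((\<lambda>p. A (0, p)) has_derivative (\<lambda>h. 0)) (at z)" by (simp add: A(2))
      then show ?thesis using FD_partial_right[OF A(1)] has_derivative_unique by metis
    qed
    moreover have "FD a z = (\<lambda>h. FD A (1, z) (0, h))"
      unfolding a_def by (rule FD_eq[OF FD_partial_right[OF A(1)]])
    ultimately show ?thesis by (simp add: FD_Phi_0 Phi_props)
  qed
  show thesis by (rule that[OF \<open>Cinf a\<close> _ zero der]) (simp_all add: int f_def)
qed

end

section \<open>Direction fields and their first integrals\<close>

text \<open>Carrying the parameter along as a component turns the family into a single bijection of
  R x C. \<open>J\<close> inverts its derivative by Cramer's rule and is visibly smooth.\<close>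

lemma Cinf_family_inverse:
  fixes F :: "real \<times> complex \<Rightarrow> complex"
  assumes F: "Cinf F" and bij: "\<And>s. bij (\<lambda>w. F (s, w))"
    and jac: "\<And>q. om (FD F q (0, 1)) (FD F q (0, \<i>)) \<noteq> 0"
  obtains G where "Cinf G" "\<And>s w. G (s, F (s, w)) = w" "\<And>s z. F (s, G (s, z)) = z"
proof -
  define f where "f q = (fst q, F q)" for q
  define g where "g q = (fst q, inv (\<lambda>w. F (fst q, w)) (snd q))" for q
  define d where "d q = om (FD F q (0, 1)) (FD F q (0, \<i>))" for q
  define J where "J q v = (fst v, Complex (om (snd v - fst v *\<^sub>R FD F q (1, 0)) (FD F q (0, \<i>)) / d q)
      (om (FD F q (0, 1)) (snd v - fst v *\<^sub>R FD F q (1, 0)) / d q))" for q and v :: "real \<times> complex"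
  have 1: "inv (\<lambda>w. F (s, w)) (F (s, w)) = w" for s w
    using inv_f_f[OF bij_is_inj[OF bij[of s]], of w] by simp
  have 2: "F (s, inv (\<lambda>w. F (s, w)) z) = z" for s z
    using surj_f_inv_f[OF bij_is_surj[OF bij[of s]], of z] by simp
  have fC: "Cinf f" unfolding f_def by (intro smooth_intros F)
  have Ff: "FD f q v = (fst v, FD F q v)" for q v
  proof -
    have "(f has_derivative (\<lambda>v. (fst v, FD F q v))) (at q)"
      unfolding f_def by (intro has_derivative_Pair has_derivative_fst has_derivative_ident Cinf_has_derivative F)
    from FD_eq[OF this] show ?thesis by simp
  qed
  have d0: "d q \<noteq> 0" for q using jac by (simp add: d_def)
  have "Cinf g"
  proof (rule Cinf_inverse[OF fC, of g J])
    show "g (f q) = q" for q using 1[of "fst q" "snd q"] by (simp add: f_def g_def)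
    show "f (g q) = q" for q by (simp add: f_def g_def 2)
    show "bounded_linear (J q)" for q
      unfolding linear_conv_bounded_linear[symmetric] J_def
      by (rule linearI) (auto simp: complex_eq_iff om_def algebra_simps add_divide_distrib diff_divide_distrib)
    show "J q (FD f q v) = v" for q v
    proof -
      have l: "linear (FD F q)" by (rule linear_FD[OF F])
      have "v = (fst v) *\<^sub>R (1, 0) + (0, snd v)" by (simp add: prod_eq_iff)
      then have e1: "FD F q v = fst v *\<^sub>R FD F q (1, 0) + FD F q (0, snd v)"
        using linear_add[OF l] linear_scale[OF l] by metis
      have "linear (\<lambda>w. FD F q (0, w))"
        using linear_compose[OF _ l, of "\<lambda>w. (0, w)"] by (auto simp: o_def linear_iff)
      from complex_linear_expand[OF this, of "snd v"]
      have e2: "FD F q (0, snd v) = Re (snd v) *\<^sub>R FD F q (0, 1) + Im (snd v) *\<^sub>R FD F q (0, \<i>)" .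
      have "om (FD F q (0, snd v)) (FD F q (0, \<i>)) = Re (snd v) * d q"
        "om (FD F q (0, 1)) (FD F q (0, snd v)) = Im (snd v) * d q"
        unfolding e2 by (simp_all add: om_add_left om_add_right om_scaleR_left om_scaleR_right d_def)
      then show ?thesis
        using d0[of q] unfolding J_def Ff by (simp add: e1 prod_eq_iff complex_eq_iff)
    qed
    show "Cinf (\<lambda>q. J q i)" for i
      unfolding J_def d_def using jac
      by (intro smooth_intros Cinf_divide Cinf_FD F) auto
  qed
  show thesis
  proof (rule that[of "\<lambda>q. snd (g q)"])
    show "Cinf (\<lambda>q. snd (g q))" by (intro smooth_intros \<open>Cinf g\<close>)
  qed (simp_all add: g_def 1 2)
qed

lemma norm_cis_diff_le: "norm (cis a - cis b) \<le> \<bar>a - b\<bar>"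
proof -
  have "norm (cis a - cis b) \<le> 1 * norm (a - b)"
  proof (rule differentiable_bound[of UNIV cis "\<lambda>x h. h *\<^sub>R (\<i> * cis x)"])
    show "(cis has_derivative (\<lambda>h. h *\<^sub>R (\<i> * cis x))) (at x)" for x
    proof -
      have "((\<lambda>z. exp (\<i> * z)) has_field_derivative \<i> * exp (\<i> * of_real x)) (at (of_real x))"
        by (auto intro!: derivative_eq_intros)
      from has_vector_derivative_real_field[OF this] show ?thesis
        by (simp add: has_vector_derivative_def cis_conv_exp[abs_def])
    qed
    show "onorm (\<lambda>h. h *\<^sub>R (\<i> * cis x)) \<le> 1" for x by (rule onorm_le) (simp add: norm_mult)
  qed auto
  then show ?thesis by simp
qed

text \<open>\<open>U\<close> increases at a definite rate along the field of angle \<open>th\<close>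
  and stays within bounded distance of \<open>Re\<close>, which forces every leaf to cross the plane
  from left to right. It is this property that can be carried along a deformation of the
  angle.\<close>

definition transversal :: "(complex \<Rightarrow> real) \<Rightarrow> bool"
  where "transversal th \<longleftrightarrow> (\<exists>U c M. Cinf (U :: complex \<Rightarrow> real) \<and> c > 0 \<and>
    (\<forall>z. c \<le> FD U z (cis (th z))) \<and> (\<forall>z. \<bar>U z - Re z\<bar> \<le> M))"

locale dirflow =
  fixes ang :: "real \<times> complex \<Rightarrow> real" and L :: real
  assumes ang: "Cinf ang" and ang0: "\<And>s z. norm z \<ge> 1 \<Longrightarrow> ang (s, z) = 0"
    and L: "L \<ge> 0" "\<And>s a b. \<bar>ang (s, a) - ang (s, b)\<bar> \<le> L * norm (a - b)"
begin

definition V :: "real \<times> complex \<Rightarrow> complex" where "V q = cis (ang q)"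

lemma VC: "Cinf V" unfolding V_def cis_conv_exp by (intro smooth_intros ang)

lemma VL: "norm (V (s, a) - V (s, b)) \<le> L * norm (a - b)"
  unfolding V_def using norm_cis_diff_le L(2) order_trans by blast

lemma V_outside: "norm z \<ge> 1 \<Longrightarrow> V (s, z) = 1" by (simp add: V_def ang0)

definition Fl :: "real \<times> (real \<times> complex) \<Rightarrow> complex"
  where "Fl = (SOME y. Cinf y \<and> (\<forall>p. y (0, p) = snd p) \<and>
    (\<forall>t p. ((\<lambda>t. y (t, p)) has_vector_derivative V (fst p, y (t, p))) (at t)) \<and>
    (\<forall>t p h. ((\<lambda>t. FD y (t, p) (0, h)) has_vector_derivative FD V (fst p, y (t, p)) (fst h, FD y (t, p) (0, h))) (at t)))"

lemma Fl_props:
  "Cinf Fl" "Fl (0, p) = snd p" "((\<lambda>t. Fl (t, p)) has_vector_derivative V (fst p, Fl (t, p))) (at t)"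
  "((\<lambda>t. FD Fl (t, p) (0, h)) has_vector_derivative FD V (fst p, Fl (t, p)) (fst h, FD Fl (t, p) (0, h))) (at t)"
proof -
  let ?F = "\<lambda>x :: (real \<times> (real \<times> complex)) \<times> complex. V (fst (snd (fst x)), snd x)"
  have FF: "FD ?F x = (\<lambda>v. FD V (fst (snd (fst x)), snd x) (fst (snd (fst v)), snd v))" for x
    by (rule FD_eq, rule FD_compose[OF VC]) (intro has_derivative_Pair has_derivative_fst has_derivative_snd has_derivative_ident)
  have "Cinf ?F" by (intro Cinf_compose[OF VC] smooth_intros)
  then obtain y where "Cinf y" "\<And>p. y (0, p) = snd p"
    "\<And>t p. ((\<lambda>t. y (t, p)) has_vector_derivative ?F ((t, p), y (t, p))) (at t)"
    "\<And>t p h. ((\<lambda>t. FD y (t, p) (0, h)) has_vector_derivative FD ?F ((t, p), y (t, p)) ((0, h), FD y (t, p) (0, h))) (at t)"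
    by (rule ode_smooth[of ?F snd L]) (use L(1) VL in \<open>auto intro: smooth_intros\<close>)
  then have "\<exists>y. Cinf y \<and> (\<forall>p. y (0, p) = snd p) \<and>
    (\<forall>t p. ((\<lambda>t. y (t, p)) has_vector_derivative V (fst p, y (t, p))) (at t)) \<and>
    (\<forall>t p h. ((\<lambda>t. FD y (t, p) (0, h)) has_vector_derivative FD V (fst p, y (t, p)) (fst h, FD y (t, p) (0, h))) (at t))"
    unfolding FF by auto
  from someI_ex[OF this, folded Fl_def]
  show "Cinf Fl" "Fl (0, p) = snd p" "((\<lambda>t. Fl (t, p)) has_vector_derivative V (fst p, Fl (t, p))) (at t)"
    "((\<lambda>t. FD Fl (t, p) (0, h)) has_vector_derivative FD V (fst p, Fl (t, p)) (fst h, FD Fl (t, p) (0, h))) (at t)"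
    by blast+
qed

lemma Fl_add: "Fl (t + r, (s, z)) = Fl (t, (s, Fl (r, (s, z))))"
proof (rule ode_unique[of "\<lambda>t. Fl (t + r, (s, z))" "\<lambda>t a. V (s, a)" _ L 0])
  show "((\<lambda>t. Fl (t + r, (s, z))) has_vector_derivative V (s, Fl (t + r, (s, z)))) (at t)" for t
  proof -
    have 1: "((\<lambda>t. t + r) has_vector_derivative 1) (at t)" by (auto intro!: derivative_eq_intros)
    show ?thesis using vector_diff_chain_at[OF 1 Fl_props(3)[of "(s, z)"]] by (simp add: o_def)
  qed
  show "((\<lambda>t. Fl (t, (s, Fl (r, (s, z))))) has_vector_derivative V (s, Fl (t, (s, Fl (r, (s, z)))))) (at t)" for t
    using Fl_props(3)[of "(s, Fl (r, (s, z)))" t] by simp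
qed (use L VL in \<open>auto simp: Fl_props\<close>)

lemma Fl_straight:
  assumes "\<And>\<tau>. \<tau> \<in> closed_segment 0 t \<Longrightarrow> norm (z + of_real \<tau>) \<ge> 1"
  shows "Fl (t, (s, z)) = z + of_real t"
proof -
  have "(norm (Fl (t, (s, z)) - (z + of_real t)))\<^sup>2 + 0\<^sup>2 \<le> ((norm (Fl (0, (s, z)) - (z + of_real 0)))\<^sup>2 + 0\<^sup>2) * exp ((2*L+1) * \<bar>t\<bar>)"
  proof (rule gronwall_segment[OF L(1)])
    show "((\<lambda>t. Fl (t, (s, z)) - (z + of_real t)) has_vector_derivative V (s, Fl (\<tau>, (s, z))) - (0 + of_real 1)) (at \<tau>)" for \<tau>
      by (intro has_vector_derivative_diff has_vector_derivative_add has_vector_derivative_const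
          has_vector_derivative_of_real DERIV_ident) (use Fl_props(3)[of "(s, z)"] in auto)
    fix \<tau> assume "\<tau> \<in> closed_segment 0 t"
    from V_outside[OF assms[OF this], of s] VL[of s "Fl (\<tau>, (s, z))" "z + of_real \<tau>"]
    show "norm (V (s, Fl (\<tau>, (s, z))) - (0 + of_real 1)) \<le> L * norm (Fl (\<tau>, (s, z)) - (z + of_real \<tau>)) + 0" by simp
  qed
  then show ?thesis by (simp add: Fl_props)
qed

lemma Fl_right: "Re z \<ge> 1 \<Longrightarrow> t \<ge> 0 \<Longrightarrow> Fl (t, (s, z)) = z + of_real t"
proof (rule Fl_straight)
  fix \<tau> assume "Re z \<ge> 1" "t \<ge> 0" "\<tau> \<in> closed_segment 0 t"
  then have "1 \<le> \<bar>Re (z + of_real \<tau>)\<bar>" by (auto simp: closed_segment_eq_real_ivl split: if_splits)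
  then show "1 \<le> norm (z + of_real \<tau>)" using abs_Re_le_cmod order_trans by blast
qed

lemma Fl_left: "Re z \<le> -1 \<Longrightarrow> t \<le> 0 \<Longrightarrow> Fl (t, (s, z)) = z + of_real t"
proof (rule Fl_straight)
  fix \<tau> assume "Re z \<le> -1" "t \<le> 0" "\<tau> \<in> closed_segment 0 t"
  then have "1 \<le> \<bar>Re (z + of_real \<tau>)\<bar>" by (auto simp: closed_segment_eq_real_ivl split: if_splits)
  then show "1 \<le> norm (z + of_real \<tau>)" using abs_Re_le_cmod order_trans by blast
qed

lemma Fl_strip: "\<bar>Im z\<bar> \<ge> 1 \<Longrightarrow> Fl (t, (s, z)) = z + of_real t"
proof (rule Fl_straight)
  fix \<tau> assume "\<bar>Im z\<bar> \<ge> 1"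
  then show "1 \<le> norm (z + of_real \<tau>)" using abs_Im_le_cmod[of "z + of_real \<tau>"] by simp
qed

text \<open>Flow coordinates: start left of the disk, on the line \<open>Re = -2\<close> at height
  \<open>Im w\<close>, and follow the unit field for time \<open>Re w + 2\<close>. Thus horizontal
  lines go to leaves parametrized by arc length, and left of the disk nothing moves.\<close>

definition Lam :: "real \<times> complex \<Rightarrow> complex"
  where "Lam q = Fl (Re (snd q) + 2, (fst q, Complex (-2) (Im (snd q))))"

lemma LamC: "Cinf Lam"
  unfolding Lam_def by (intro Cinf_compose[OF Fl_props(1)] smooth_intros)

lemma Lam_left: "Re w \<le> -1 \<Longrightarrow> Lam (s, w) = w"
proof -
  assume w: "Re w \<le> -1"
  have "Lam (s, w) = Complex (-2) (Im w) + of_real (Re w + 2)"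
    unfolding Lam_def fst_conv snd_conv
  proof (rule Fl_straight)
    fix \<tau> assume "\<tau> \<in> closed_segment 0 (Re w + 2)"
    then have "1 \<le> \<bar>Re (Complex (-2) (Im w) + of_real \<tau>)\<bar>" using w by (auto simp: closed_segment_eq_real_ivl split: if_splits)
    then show "1 \<le> norm (Complex (-2) (Im w) + of_real \<tau>)" using abs_Re_le_cmod order_trans by blast
  qed
  then show ?thesis by (simp add: complex_eq_iff)
qed

lemma Lam_strip: "\<bar>Im w\<bar> \<ge> 1 \<Longrightarrow> Lam (s, w) = w"
  unfolding Lam_def by (subst Fl_strip) (auto simp: complex_eq_iff)

lemma Lam_add: "Lam (s, w + of_real r) = Fl (r, (s, Lam (s, w)))"
  unfolding Lam_def using Fl_add[of r "Re w + 2" s "Complex (-2) (Im w)"] by (simp add: add_ac)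

lemma Lam_right: "Re (Lam (s, w)) \<ge> 1 \<Longrightarrow> r \<ge> 0 \<Longrightarrow> Lam (s, w + of_real r) = Lam (s, w) + of_real r"
  unfolding Lam_add by (rule Fl_right)

lemma Lam_of_Fl: "Lam (s, Complex (r - 2) c) = Fl (r, (s, Complex (-2) c))"
  by (simp add: Lam_def)

lemma FD_Lam: "FD Lam q v = FD Fl (Re (snd q) + 2, (fst q, Complex (-2) (Im (snd q)))) (Re (snd v), (fst v, Complex 0 (Im (snd v))))"
proof -
  have "((\<lambda>q :: real \<times> complex. (Re (snd q) + 2, (fst q, Complex (-2) (Im (snd q))))) has_derivative
      (\<lambda>v. (Re (snd v), (fst v, Complex 0 (Im (snd v)))))) (at q)"
    unfolding Complex_eq by (auto intro!: derivative_eq_intros)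
  from FD_eq[OF FD_compose[OF Fl_props(1) this]] show ?thesis by (simp add: Lam_def[abs_def])
qed

lemma FD_Lam_1: "FD Lam (s, w) (0, 1) = V (s, Lam (s, w))"
proof -
  have "FD Fl (t, p) (1, 0) = V (fst p, Fl (t, p))" for t p
    using fun_cong[OF has_derivative_unique[OF FD_partial_left[OF Fl_props(1)]
          Fl_props(3)[unfolded has_vector_derivative_def]], of t p 1] by simp
  moreover have "Complex 0 0 = 0" by (simp add: complex_eq_iff)
  ultimately show ?thesis unfolding FD_Lam by (simp add: Lam_def zero_prod_def)
qed

text \<open>Along a leaf the determinant satisfies D' = (div V) D and starts with the value 1. A
  zero would propagate back to the start by Gronwall, and connectedness then keeps the sign.\<close>

lemma Lam_jac: "om (FD Lam q (0, 1)) (FD Lam q (0, \<i>)) > 0"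
proof -
  define s where "s = fst q"
  define c where "c = Im (snd q)"
  define p where "p = (s, Complex (-2) c)"
  define D where "D r = om (V (s, Fl (r, p))) (FD Fl (r, p) (0, (0, \<i>)))" for r
  let ?A = "\<lambda>r v. FD V (s, Fl (r, p)) (0, v)"
  have lA: "linear (?A r)" for r
    using linear_compose[OF _ linear_FD[OF VC], of "\<lambda>w. (0, w)"] by (auto simp: o_def linear_iff)
  have D': "(D has_real_derivative (Re (?A r 1) + Im (?A r \<i>)) * D r) (at r)" for r
    unfolding D_def
  proof (rule om_has_real_derivative[OF _ _ lA])
    have "((\<lambda>r. (s, Fl (r, p))) has_vector_derivative (0, V (s, Fl (r, p)))) (at r)"
      by (intro has_vector_derivative_Pair has_vector_derivative_const) (use Fl_props(3)[of p r] in \<open>simp add: p_def\<close>)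
    from FD_compose_vector[OF VC this]
    show "((\<lambda>r. V (s, Fl (r, p))) has_vector_derivative ?A r (V (s, Fl (r, p)))) (at r)" .
    show "((\<lambda>r. FD Fl (r, p) (0, (0, \<i>))) has_vector_derivative ?A r (FD Fl (r, p) (0, (0, \<i>)))) (at r)"
      using Fl_props(4)[of p "(0, \<i>)" r] by (simp add: p_def)
  qed
  have nA: "norm (?A r v) \<le> L * norm v" for r v
    by (rule derivative_bound_of_Lipschitz[OF Cinf_has_derivative[OF VC] VL])
  have K: "\<bar>Re (?A r 1) + Im (?A r \<i>)\<bar> \<le> 2 * L" for r
    using nA[of r 1] nA[of r \<i>] abs_Re_le_cmod[of "?A r 1"] abs_Im_le_cmod[of "?A r \<i>"] by simp
  have D0: "D 0 = 1"
  proof -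
    have "((\<lambda>p. Fl (0, p)) has_derivative snd) (at p)" by (simp add: Fl_props has_derivative_snd[OF has_derivative_ident])
    from fun_cong[OF has_derivative_unique[OF FD_partial_right[OF Fl_props(1)] this], of "(0, \<i>)"]
    have "FD Fl (0, p) (0, (0, \<i>)) = \<i>" by simp
    moreover have "norm (Complex (-2) c) \<ge> 1" using abs_Re_le_cmod[of "Complex (-2) c"] by simp
    ultimately show ?thesis by (simp add: D_def Fl_props p_def V_outside om_def)
  qed
  have nz: "D r \<noteq> 0" for r
  proof
    assume "D r = 0"
    have "((\<lambda>x. D (r + x)) has_vector_derivative (Re (?A (r + x) 1) + Im (?A (r + x) \<i>)) * D (r + x)) (at x)" for x
    proof -
      have 1: "((\<lambda>x. r + x) has_vector_derivative 1) (at x)" by (auto intro!: derivative_eq_intros)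
      show ?thesis
        using vector_diff_chain_at[OF 1 D'[unfolded has_real_derivative_iff_has_vector_derivative]] by (simp add: o_def)
    qed
    from gronwall[OF _ this, of "2 * L" "- r" 0] L(1) K \<open>D r = 0\<close> D0 show False
      by (simp add: abs_mult mult_right_mono)
  qed
  have "continuous_on UNIV D"
    using D' DERIV_continuous by (blast intro: continuous_at_imp_continuous_on)
  then have "connected (range D)" by (rule connected_continuous_image) simp
  then have "D r > 0" for r
    using connectedD_interval[of "range D" "D r" "D 0" 0] nz D0 by (metis (mono_tags) imageE not_less rangeI zero_le_one)
  moreover have "D (Re (snd q) + 2) = om (FD Lam q (0, 1)) (FD Lam q (0, \<i>))"
    using FD_Lam_1[of s "snd q"] FD_Lam[of q "(0, \<i>)"]
    by (simp add: D_def p_def s_def c_def Lam_def flip: imaginary_unit.code)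
  ultimately show ?thesis by metis
qed

text \<open>\<open>U\<close> gains at least c per unit of time. Replacing it by \<open>Re\<close> at
  both ends of a piece of leaf costs at most twice the bound on their difference.\<close>

lemma escape:
  assumes "transversal (\<lambda>z. ang (s, z))"
  obtains c M where "c > 0" "M \<ge> 0" "\<And>z t. t \<ge> 0 \<Longrightarrow> Re (Fl (t, (s, z))) \<ge> Re z - M + c * t"
    "\<And>z t. t \<le> 0 \<Longrightarrow> Re (Fl (t, (s, z))) \<le> Re z + M + c * t"
proof -
  obtain U c M where U: "Cinf (U :: complex \<Rightarrow> real)" "c > 0" "\<And>z. c \<le> FD U z (V (s, z))" "\<And>z. \<bar>U z - Re z\<bar> \<le> M"
    using assms unfolding transversal_def V_def by auto
  have d: "((\<lambda>t. U (Fl (t, (s, z))) - c * t) has_real_derivative FD U (Fl (t, (s, z))) (V (s, Fl (t, (s, z)))) - c) (at t)" for z t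
    using FD_compose_vector[OF U(1) Fl_props(3)[of "(s, z)" t]]
    by (auto simp: has_real_derivative_iff_has_vector_derivative intro!: derivative_eq_intros)
  have mono: "U (Fl (t, (s, z))) - c * t \<le> U (Fl (t', (s, z))) - c * t'" if "t \<le> t'" for z t t'
    by (rule DERIV_nonneg_imp_nondecreasing[OF that]) (use d U(3) in \<open>meson diff_ge_0_iff_ge\<close>)
  show thesis
  proof (rule that[of c "2 * M"])
    show "2 * M \<ge> 0" using U(4)[of 0] by simp
    show "Re (Fl (t, (s, z))) \<ge> Re z - 2 * M + c * t" if "t \<ge> 0" for z t
      using mono[OF that, of z] U(4)[of z] U(4)[of "Fl (t, (s, z))"] unfolding abs_le_iff by (simp add: Fl_props)
    show "Re (Fl (t, (s, z))) \<le> Re z + 2 * M + c * t" if "t \<le> 0" for z t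
      using mono[OF that, of z] U(4)[of z] U(4)[of "Fl (t, (s, z))"] unfolding abs_le_iff by (simp add: Fl_props)
  qed (rule U(2))
qed

lemma Fl_hits:
  assumes "transversal (\<lambda>z. ang (s, z))"
  obtains t where "Re (Fl (t, (s, z))) = x"
proof -
  obtain c M where e: "c > 0" "M \<ge> 0" "\<And>z t. t \<ge> 0 \<Longrightarrow> Re (Fl (t, (s, z))) \<ge> Re z - M + c * t"
    "\<And>z t. t \<le> 0 \<Longrightarrow> Re (Fl (t, (s, z))) \<le> Re z + M + c * t" using escape[OF assms] by blast
  define T where "T = (\<bar>Re z\<bar> + \<bar>x\<bar> + M) / c"
  have T: "T \<ge> 0" "c * T = \<bar>Re z\<bar> + \<bar>x\<bar> + M" using e by (auto simp: T_def)
  have "\<exists>t\<ge>- T. t \<le> T \<and> Re (Fl (t, (s, z))) = x"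
  proof (rule IVT')
    show "continuous_on {- T..T} (\<lambda>t. Re (Fl (t, (s, z))))"
      by (intro continuous_intros continuous_on_compose2[OF Cinf_continuous[OF Fl_props(1)]]) auto
  qed (use e(3)[of T z] e(4)[of "- T" z] T in auto)
  then show thesis using that by blast
qed

text \<open>Onto because every leaf meets the line \<open>Re = -2\<close>; one-to-one because it
  does so only once, the flow being a translation when followed backwards from there.\<close>

lemma Lam_bij:
  assumes "transversal (\<lambda>z. ang (s, z))"
  shows "bij (\<lambda>w. Lam (s, w))"
proof (rule bijI)
  show "surj (\<lambda>w. Lam (s, w))"
  proof (rule surjI)
    fix z
    obtain t where t: "Re (Fl (t, (s, z))) = -2" by (rule Fl_hits[OF assms])
    have "Lam (s, Complex (- t - 2) (Im (Fl (t, (s, z))))) = Fl (- t, (s, Complex (-2) (Im (Fl (t, (s, z))))))"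
      by (rule Lam_of_Fl)
    also have "Complex (-2) (Im (Fl (t, (s, z)))) = Fl (t, (s, z))" using t by (simp add: complex_eq_iff)
    also have "Fl (- t, (s, Fl (t, (s, z)))) = z" by (subst Fl_add[symmetric]) (simp add: Fl_props)
    finally have "\<exists>w. Lam (s, w) = z" by blast
    then show "Lam (s, SOME w. Lam (s, w) = z) = z" by (rule someI_ex)
  qed
  have hit: "t' = t \<and> c = c'" if "Fl (t, (s, Complex (-2) c)) = Fl (t', (s, Complex (-2) c'))" "t \<le> t'" for t t' c c'
  proof -
    have "Complex (-2) c' = Fl (- t', (s, Fl (t', (s, Complex (-2) c'))))"
      by (subst Fl_add[symmetric]) (simp add: Fl_props)
    also have "\<dots> = Fl (t - t', (s, Complex (-2) c))"
      by (subst that(1)[symmetric], subst Fl_add[symmetric]) simp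
    also have "\<dots> = Complex (-2) c + of_real (t - t')" by (rule Fl_left) (use that in auto)
    finally show ?thesis by (auto simp: complex_eq_iff)
  qed
  show "inj (\<lambda>w. Lam (s, w))"
  proof (rule injI)
    fix w w' assume "Lam (s, w) = Lam (s, w')"
    then have "Fl (Re w + 2, (s, Complex (-2) (Im w))) = Fl (Re w' + 2, (s, Complex (-2) (Im w')))" by (simp add: Lam_def)
    then show "w = w'" using hit[of "Re w + 2" "Im w" "Re w' + 2" "Im w'"] hit[of "Re w' + 2" "Im w'" "Re w + 2" "Im w"]
      by (cases "Re w \<le> Re w'") (auto simp: complex_eq_iff)
  qed
qed

end

text \<open>\<open>W\<close> is the label of a leaf, the height at which it enters from the left.
  Its differential kills the field and is therefore a multiple of om(cis (th z), v). The factor is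
  bounded below on the compact box \<open>?K\<close>; outside the box \<open>W\<close> equals
  \<open>Im\<close> or is invariant under translation to the right, down to the edge of the
  box.\<close>

lemma first_integral:
  assumes th: "Cinf th" "\<And>z. norm z \<ge> 1 \<Longrightarrow> th z = 0" and tr: "transversal th"
  obtains W :: "complex \<Rightarrow> real" and c M where "Cinf W" "c > 0" "\<And>z. c \<le> FD W z (\<i> * cis (th z))"
    "\<And>z v. FD W z v = FD W z (\<i> * cis (th z)) * om (cis (th z)) v" "\<And>z. \<bar>W z - Im z\<bar> \<le> M"
proof -
  obtain L where L: "L \<ge> 0" "\<And>x y. norm (th x - th y) \<le> L * norm (x - y)"
    by (rule Lipschitz_of_compact_support[OF th(1), of "cball 0 1"]) (use th(2) in auto)
  interpret dirflow "\<lambda>q. th (snd q)" L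
    by unfold_locales (use th L in \<open>auto intro!: Cinf_compose[OF th(1)] smooth_intros\<close>)
  have bij: "bij (\<lambda>w. Lam (s, w))" for s by (rule Lam_bij) (use tr in simp)
  obtain G where G: "Cinf G" "\<And>s w. G (s, Lam (s, w)) = w" "\<And>s z. Lam (s, G (s, z)) = z"
    by (rule Cinf_family_inverse[OF LamC bij]) (use Lam_jac in \<open>auto simp: less_le intro: that\<close>)
  define W where "W z = Im (G (0, z))" for z
  have WC: "Cinf W" unfolding W_def by (intro smooth_intros Cinf_compose[OF G(1)])
  have lW: "linear (FD W z)" for z by (rule linear_FD[OF WC])
  have key: "FD W z v = FD W z (\<i> * cis (th z)) * om (cis (th z)) v \<and> FD W z (\<i> * cis (th z)) > 0" for z v
  proof -
    define w where "w = G (0, z)"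
    have zw: "Lam (0, w) = z" by (simp add: w_def G)
    let ?V = "cis (th z)" and ?u = "FD Lam (0, w) (0, \<i>)"
    have V: "FD Lam (0, w) (0, 1) = ?V" using FD_Lam_1[of 0 w] by (simp add: zw V_def)
    have "((\<lambda>w. W (Lam (0, w))) has_derivative (\<lambda>h. FD W (Lam (0, w)) (FD Lam (0, w) (0, h)))) (at w)"
      by (rule FD_compose[OF WC FD_partial_right[OF LamC]])
    moreover have "(\<lambda>w. W (Lam (0, w))) = Im" by (auto simp: W_def G)
    ultimately have "(Im has_derivative (\<lambda>h. FD W z (FD Lam (0, w) (0, h)))) (at w)" by (simp add: zw)
    from fun_cong[OF has_derivative_unique[OF this bounded_linear_imp_has_derivative[OF bounded_linear_Im]]]
    have FW: "FD W z (FD Lam (0, w) (0, h)) = Im h" for h .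
    define D where "D = om ?V ?u"
    have D: "D > 0" using Lam_jac[of "(0, w)"] V by (simp add: D_def)
    \<comment> \<open>Cramer's rule expresses v in the basis of the leaf direction, which
      \<open>FD W z\<close> kills, and the transverse direction, where it takes the value 1.\<close>
    have *: "D * FD W z v = om ?V v" for v
    proof -
      have "D *\<^sub>R v = om v ?u *\<^sub>R ?V + om ?V v *\<^sub>R ?u"
        by (simp add: D_def om_def complex_eq_iff algebra_simps)
      then have "FD W z (D *\<^sub>R v) = FD W z (om v ?u *\<^sub>R ?V + om ?V v *\<^sub>R ?u)" by (rule arg_cong)
      then show ?thesis
        using FW[of 1] FW[of \<i>] by (simp add: linear_add[OF lW] linear_scale[OF lW] V)
    qed
    have "om ?V (\<i> * ?V) = 1" by (simp add: om_def power2_eq_square[symmetric])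
    then have "D * FD W z (\<i> * ?V) = 1" using * by simp
    then have "FD W z (\<i> * ?V) = 1 / D" using D by (simp add: field_simps)
    moreover have "FD W z v = om ?V v / D" using *[of v] D by (simp add: field_simps)
    ultimately show ?thesis using D by simp
  qed
  have straight: "FD W z i = 1" if "open S" "z \<in> S" "\<And>z. z \<in> S \<Longrightarrow> W z = Im z" "i = \<i>" for S z i
  proof -
    have "(W has_derivative Im) (at z)"
      by (rule has_derivative_transform_within_open[OF bounded_linear_imp_has_derivative[OF bounded_linear_Im] that(1,2)])
        (use that(3) in simp)
    from FD_eq[OF this] that(4) show ?thesis by simp
  qed
  have Wl: "W z = Im z" if "Re z \<le> -1" for z using G(2)[of 0 z] Lam_left[OF that, of 0] by (simp add: W_def)
  have Ws: "W z = Im z" if "\<bar>Im z\<bar> \<ge> 1" for z using G(2)[of 0 z] Lam_strip[OF that, of 0] by (simp add: W_def)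
  have Wr: "W (z + of_real r) = W z" if "Re z \<ge> 1" "r \<ge> 0" for z r
  proof -
    have "Lam (0, G (0, z) + of_real r) = z + of_real r" using Lam_right[of 0 "G (0, z)" r] that by (simp add: G)
    then have "G (0, z + of_real r) = G (0, z) + of_real r" by (metis G(2))
    then show ?thesis by (simp add: W_def)
  qed
  let ?K = "cbox (Complex (-2) (-1)) (Complex 2 1)"
  have Kmem: "z \<in> ?K \<longleftrightarrow> \<bar>Re z\<bar> \<le> 2 \<and> \<bar>Im z\<bar> \<le> 1" for z by (auto simp: in_cbox_complex_iff)
  have "continuous_on ?K (\<lambda>z. FD W z (\<i> * cis (th z)))"
    unfolding cis_conv_exp by (intro Cinf_continuous Cinf_FD WC smooth_intros th)
  moreover have "0 \<in> ?K" by (simp add: Kmem)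
  ultimately obtain z0 where z0: "\<And>z. z \<in> ?K \<Longrightarrow> FD W z0 (\<i> * cis (th z0)) \<le> FD W z (\<i> * cis (th z))"
    using continuous_attains_inf[of ?K "\<lambda>z. FD W z (\<i> * cis (th z))"] by auto
  define c where "c = min 1 (FD W z0 (\<i> * cis (th z0)))"
  show thesis
  proof (rule that[OF WC, of c 2])
    show "c > 0" using conjunct2[OF key[of z0 0]] by (simp add: c_def)
    show "FD W z v = FD W z (\<i> * cis (th z)) * om (cis (th z)) v" for z v using key by blast
    show "c \<le> FD W z (\<i> * cis (th z))" for z
    proof -
      consider "z \<in> ?K" | "Re z < -1" | "\<bar>Im z\<bar> > 1" | "Re z > 2" "\<bar>Im z\<bar> \<le> 1" by (fastforce simp: Kmem)
      then show ?thesis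
      proof cases
        case 1
        then show ?thesis using z0 by (auto simp: c_def min_le_iff_disj)
      next
        case 2
        have "norm z \<ge> 1" using 2 abs_Re_le_cmod[of z] by simp
        then show ?thesis using 2 straight[of "{z. Re z < -1}" z \<i>] Wl
          by (auto simp: c_def th(2) open_halfspace_Re_lt)
      next
        case 3
        have "norm z \<ge> 1" using 3 abs_Im_le_cmod[of z] by simp
        moreover have "open {z. \<bar>Im z\<bar> > 1}" by (intro open_Collect_less continuous_intros)
        ultimately show ?thesis using 3 straight[of "{z. \<bar>Im z\<bar> > 1}" z \<i>] Ws by (auto simp: c_def th(2))
      next
        case 4
        define z' where "z' = Complex 2 (Im z)"
        define r where "r = Re z - 2"
        have z: "z = z' + of_real r" "r \<ge> 0" using 4 by (auto simp: z'_def r_def complex_eq_iff)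
        have t: "th z = 0" "th z' = 0" using 4 abs_Re_le_cmod[of z] abs_Re_le_cmod[of z'] by (auto intro!: th(2) simp: z'_def)
        have "((\<lambda>x. W (x + of_real r)) has_derivative FD W (z' + of_real r)) (at z')"
          by (rule FD_compose[OF WC]) (auto intro!: derivative_eq_intros)
        then have "(W has_derivative FD W (z' + of_real r)) (at z')"
          by (rule has_derivative_transform_within_open[of _ _ _ _ "{z. Re z > 1}"])
            (use Wr z(2) in \<open>auto simp: open_halfspace_Re_gt z'_def\<close>)
        from FD_eq[OF this] have "FD W z' = FD W z" by (simp add: z)
        moreover have "z' \<in> ?K" using 4 by (simp add: Kmem z'_def)
        ultimately show ?thesis using z0[of z'] t by (simp add: c_def min_le_iff_disj)
      qed
    qed
    \<comment> \<open>A leaf through a point with |Im| < 1 has its label in the same interval,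
      because lines outside the strip are fixed by \<open>Lam\<close>.\<close>
    show "\<bar>W z - Im z\<bar> \<le> 2" for z
    proof (cases "\<bar>Im z\<bar> \<ge> 1")
      case False
      have "\<bar>Im (G (0, z))\<bar> < 1"
      proof (rule ccontr)
        assume n: "\<not> \<bar>Im (G (0, z))\<bar> < 1"
        then have "Lam (0, G (0, z)) = G (0, z)" by (intro Lam_strip) simp
        then show False using n False by (simp add: G)
      qed
      then show ?thesis using False by (simp add: W_def)
    qed (simp add: Ws)
  qed
qed

text \<open>In coordinates turned by a right angle, a first integral of the field is a function
  growing along the orthogonal field, which is therefore transversal as well. The first integral of
  that one, turned back, has its gradient parallel to cis (th z). Along a direction deviating by at
  most pi/3 it still grows at half the rate, as cos (pi/3) = 1/2.\<close>

lemma transversal_step: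
  assumes th: "Cinf th" "\<And>z. norm z \<ge> 1 \<Longrightarrow> th z = 0" and tr: "transversal th"
    and near: "\<And>z. \<bar>th z - th' z\<bar> \<le> pi / 3"
  shows "transversal th'"
proof -
  obtain W :: "complex \<Rightarrow> real" and c M where W: "Cinf W" "c > 0" "\<And>z. c \<le> FD W z (\<i> * cis (th z))" "\<And>z. \<bar>W z - Im z\<bar> \<le> M"
    by (rule first_integral[OF th tr]) (assumption, rule that)
  have "transversal (\<lambda>z. th (\<i> * z))" unfolding transversal_def
  proof (rule exI[of _ "\<lambda>z. W (\<i> * z)"], rule exI[of _ c], rule exI[of _ M], intro conjI allI)
    show "Cinf (\<lambda>z. W (\<i> * z))" by (intro Cinf_compose[OF W(1)] smooth_intros)
    have "((\<lambda>z. W (\<i> * z)) has_derivative (\<lambda>v. FD W (\<i> * z) (\<i> * v))) (at z)" for z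
      by (rule FD_compose[OF W(1)]) (auto intro!: derivative_eq_intros)
    from FD_eq[OF this] show "c \<le> FD (\<lambda>z. W (\<i> * z)) z (cis (th (\<i> * z)))" for z using W(3)[of "\<i> * z"] by simp
    show "\<bar>W (\<i> * z) - Re z\<bar> \<le> M" for z using W(4)[of "\<i> * z"] by simp
  qed (rule W(2))
  moreover have "Cinf (\<lambda>z. th (\<i> * z))" by (intro Cinf_compose[OF th(1)] smooth_intros)
  moreover have "th (\<i> * z) = 0" if "norm z \<ge> 1" for z using that by (intro th(2)) (simp add: norm_mult)
  ultimately obtain W2 :: "complex \<Rightarrow> real" and c2 M2 where W2: "Cinf W2" "c2 > 0" "\<And>z. c2 \<le> FD W2 z (\<i> * cis (th (\<i> * z)))"
    "\<And>z v. FD W2 z v = FD W2 z (\<i> * cis (th (\<i> * z))) * om (cis (th (\<i> * z))) v" "\<And>z. \<bar>W2 z - Im z\<bar> \<le> M2"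
    using first_integral[of "\<lambda>z. th (\<i> * z)"] by metis
  show ?thesis unfolding transversal_def
  proof (rule exI[of _ "\<lambda>z. - W2 (- \<i> * z)"], rule exI[of _ "c2 / 2"], rule exI[of _ M2], intro conjI allI)
    show "Cinf (\<lambda>z. - W2 (- \<i> * z))" by (intro smooth_intros Cinf_compose[OF W2(1)])
    fix z
    have "((\<lambda>z. - W2 (- \<i> * z)) has_derivative (\<lambda>v. - FD W2 (- \<i> * z) (- \<i> * v))) (at z)"
      by (intro has_derivative_minus FD_compose[OF W2(1)] has_derivative_mult_right has_derivative_ident)
    from FD_eq[OF this] have "FD (\<lambda>z. - W2 (- \<i> * z)) z (cis (th' z)) = - FD W2 (- \<i> * z) (- \<i> * cis (th' z))" by simp
    also have "\<dots> = FD W2 (- \<i> * z) (\<i> * cis (th z)) * cos (th z - th' z)"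
      using W2(4)[of "- \<i> * z" "- \<i> * cis (th' z)"] by (simp add: om_def cos_diff algebra_simps)
    also have "\<dots> \<ge> c2 * (1 / 2)"
    proof (rule mult_mono)
      show "c2 \<le> FD W2 (- \<i> * z) (\<i> * cis (th z))" using W2(3)[of "- \<i> * z"] by simp
      have "cos (pi / 3) \<le> cos \<bar>th z - th' z\<bar>"
        using near[of z] by (intro cos_monotone_0_pi_le) auto
      then show "1 / 2 \<le> cos (th z - th' z)" by (simp add: cos_60)
      show "0 \<le> FD W2 (- \<i> * z) (\<i> * cis (th z))" using W2(3)[of "- \<i> * z"] W2(2) by simp
    qed auto
    finally show "c2 / 2 \<le> FD (\<lambda>z. - W2 (- \<i> * z)) z (cis (th' z))" by simp
    show "\<bar>- W2 (- \<i> * z) - Re z\<bar> \<le> M2" using W2(5)[of "- \<i> * z"] by (simp add: abs_minus_commute)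
  qed (use W2(2) in simp)
qed

text \<open>The scale is lowered from 1 to s in finitely many steps, each changing the angle by at
  most pi/3; n counts the steps that are allowed, and B bounds the angle.\<close>

lemma transversal_scale:
  assumes th: "Cinf th" "\<And>z. norm z \<ge> 1 \<Longrightarrow> th z = 0" and tr: "transversal th" and s: "0 \<le> s" "s \<le> 1"
  shows "transversal (\<lambda>z. s * th z)"
proof -
  have "compact (th ` cball 0 1)" by (intro compact_continuous_image Cinf_continuous th) auto
  then obtain B where B: "B > 0" "\<And>z. z \<in> cball 0 1 \<Longrightarrow> \<bar>th z\<bar> \<le> B"
    using compact_imp_bounded[of "th ` cball 0 1"] unfolding bounded_pos by auto
  have B': "\<bar>th z\<bar> \<le> B" for z using B th(2)[of z] by (cases "norm z \<le> 1") auto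
  have "transversal (\<lambda>z. s * th z)" if "0 \<le> s" "s \<le> 1" "(1 - s) * B \<le> real n * (pi / 3)" for n s
    using that
  proof (induction n arbitrary: s)
    case 0
    then have "s = 1" using B(1) by (simp add: mult_le_0_iff)
    then show ?case using tr by simp
  next
    case (Suc n)
    define s' where "s' = min 1 (s + pi / 3 / B)"
    have s': "0 \<le> s'" "s' \<le> 1" "s \<le> s'" "(s' - s) * B \<le> pi / 3"
      using Suc.prems B(1) by (auto simp: s'_def min_def field_simps)
    have "s' * B = min B (s * B + pi / 3)" using B(1) by (simp add: s'_def min_mult_distrib_right distrib_right)
    then have "(1 - s') * B \<le> real n * (pi / 3)"
      using Suc.prems(3) by (simp add: left_diff_distrib distrib_right min_def split: if_splits)
    from Suc.IH[OF s'(1,2) this] have t: "transversal (\<lambda>z. s' * th z)" .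
    show ?case
    proof (rule transversal_step[OF _ _ t])
      show "Cinf (\<lambda>z. s' * th z)" by (intro smooth_intros th)
      show "\<bar>s' * th z - s * th z\<bar> \<le> pi / 3" for z
      proof -
        have "\<bar>s' * th z - s * th z\<bar> = (s' - s) * \<bar>th z\<bar>" using s'(3) by (simp add: abs_mult left_diff_distrib[symmetric])
        also have "\<dots> \<le> (s' - s) * B" using s'(3) B' by (intro mult_left_mono) auto
        finally show ?thesis using s'(4) by simp
      qed
    qed (use th in simp)
  qed
  moreover obtain n :: nat where "(1 - s) * B \<le> real n * (pi / 3)"
    using real_arch_simple[of "(1 - s) * B / (pi / 3)"] by (auto simp: field_simps)
  ultimately show ?thesis using s by blast
qed

text \<open>Near z a continuous logarithm is \<open>g z\<close> plus the principal logarithm of a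
  function close to 1, so its derivative is f'/f. This formula raises the smoothness of g by one
  order at a time.\<close>

lemma Cinf_logarithm:
  assumes f: "Cinf (f :: complex \<Rightarrow> complex)" and g: "continuous_on UNIV g" "\<And>z. f z = exp (g z)"
  shows "Cinf g" "(g has_derivative (\<lambda>v. FD f z v * exp (- g z))) (at z)"
proof -
  show d: "(g has_derivative (\<lambda>v. FD f z v * exp (- g z))) (at z)" for z
  proof -
    have "((\<lambda>w. Ln (f w * exp (- g z)) + g z) has_derivative (\<lambda>v. FD f z v * exp (- g z))) (at z)"
    proof -
      have "((\<lambda>w. f w * exp (- g z)) has_derivative (\<lambda>v. FD f z v * exp (- g z))) (at z)"
        by (intro has_derivative_mult_left Cinf_has_derivative f)
      moreover have "(Ln has_derivative (\<lambda>v. v)) (at (f z * exp (- g z)))"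
        using has_field_derivative_Ln[of 1] by (simp add: g(2) mult_exp_exp has_field_derivative_def lambda_one complex_nonpos_Reals_iff)
      ultimately have "((\<lambda>w. Ln (f w * exp (- g z))) has_derivative (\<lambda>v. FD f z v * exp (- g z))) (at z)"
        by (rule has_derivative_compose)
      from has_derivative_add[OF this has_derivative_const[of "g z"]] show ?thesis by simp
    qed
    then show ?thesis
    proof (rule has_derivative_transform_within_open)
      show "open {w. norm (g w - g z) < pi}"
        by (intro open_Collect_less continuous_intros g(1))
      show "Ln (f w * exp (- g z)) + g z = g w" if "w \<in> {w. norm (g w - g z) < pi}" for w
      proof -
        have "\<bar>Im (g w - g z)\<bar> < pi" using that abs_Im_le_cmod[of "g w - g z"] by simp
        then have "Ln (exp (g w - g z)) = g w - g z" by (intro Ln_exp) auto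
        then show ?thesis by (simp add: g(2) mult_exp_exp)
      qed
    qed simp
  qed
  have "Ck_on k UNIV g" for k
  proof (induction k)
    case 0
    then show ?case using g by simp
  next
    case (Suc k)
    have "Cinf (\<lambda>z. exp (- z :: complex))" by (intro smooth_intros)
    then show ?case
      by (intro Ck_on_SucI[OF open_UNIV d] Ck_on_bilinear[OF _ bounded_bilinear_mult]
          Ck_on_compose[of UNIV UNIV k g "\<lambda>z. exp (- z)"] Suc)
        (use Cinf_on_FD[OF f] in \<open>auto simp: Cinf_on_def\<close>)
  qed
  then show "Cinf g" by (simp add: Cinf_on_def)
qed

text \<open>The direction of a nonvanishing vector field on the plane lifts to a real-valued angle.\<close>
lemma smooth_angle:
  assumes f: "Cinf (f :: complex \<Rightarrow> complex)" "\<And>z. f z \<noteq> 0" "\<And>z. norm z > 1 \<Longrightarrow> f z = 1"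
  obtains th where "Cinf th" "\<And>z. norm z \<ge> 1 \<Longrightarrow> th z = 0" "\<And>z. f z = norm (f z) *\<^sub>R cis (th z)"
proof -
  obtain g where g: "continuous_on UNIV g" "\<And>z. f z = exp (g z)"
    using continuous_logarithm_on_contractible[OF Cinf_continuous[OF f(1)], of UNIV] f(2)
      convex_imp_contractible[OF convex_UNIV] by (metis UNIV_I)
  note gC = Cinf_logarithm[OF f(1) g]
  let ?E = "- cball (0::complex) 1"
  have "connected ?E" by (rule connected_complement_bounded_convex) auto
  moreover have "(g has_derivative (\<lambda>h. 0)) (at z within ?E)" if "z \<in> ?E" for z
  proof -
    have "(f has_derivative (\<lambda>v. 0)) (at z)"
      by (rule has_derivative_transform_within_open[of "\<lambda>z. 1" _ _ _ ?E]) (use that f(3) in auto)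
    from FD_eq[OF this] gC(2)[of z] show ?thesis by (simp add: has_derivative_at_withinI)
  qed
  ultimately have "g constant_on ?E"
    using has_derivative_zero_connected_constant_on[of ?E "{}" g] continuous_on_subset[OF g(1)] by auto
  then obtain c where c: "\<And>z. z \<in> ?E \<Longrightarrow> g z = c" unfolding constant_on_def by blast
  \<comment> \<open>The logarithm has a constant value c outside the disk, and exp c = 1 there, so
    subtracting \<open>Im c\<close> makes the angle vanish outside without changing any
    direction.\<close>
  define th where "th z = Im (g z) - Im c" for z
  have thC: "Cinf th" unfolding th_def by (intro smooth_intros gC)
  have "exp c = 1" using c[of 2] g(2)[of 2] f(3)[of 2] by simp
  then have cc: "cis (Im c) = 1" by (metis cis_conv_exp exp_eq_polar mult_cancel_right1 norm_exp_eq_Re norm_one of_real_1 mult_1)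
  show thesis
  proof (rule that[OF thC])
    have "th z = 0" if "z \<in> closure ?E" for z
      by (rule continuous_constant_on_closure[OF Cinf_continuous[OF thC] _ that]) (use c in \<open>simp add: th_def\<close>)
    then show "th z = 0" if "norm z \<ge> 1" for z using that by (auto simp: closure_complement interior_cball)
    show "f z = norm (f z) *\<^sub>R cis (th z)" for z
    proof -
      have "cis (th z) = cis (Im (g z))" using cc by (simp add: th_def cis_divide[symmetric])
      then show ?thesis using g(2)[of z] exp_eq_polar[of "g z"] by (simp add: norm_exp_eq_Re scaleR_conv_of_real norm_mult)
    qed
  qed
qed


lemma FD_vector_curve:
  assumes f: "Cinf f" and c: "(c has_vector_derivative c') (at x)" and d: "((\<lambda>r. f (c r)) has_vector_derivative d') (at x)"
  shows "FD f (c x) c' = d'"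
  using vector_derivative_unique_at[OF FD_compose_vector[OF f c] d] .

lemma smooth_step_antiderivative:
  obtains B where "Cinf B" "\<And>x. (B has_vector_derivative smooth_step x) (at x)" "\<And>x. x \<le> 0 \<Longrightarrow> B x = 0"
    "\<And>x. x \<ge> 1 \<Longrightarrow> B x = x - 1 + B 1"
proof -
  obtain y :: "real \<times> real \<Rightarrow> real" where y: "Cinf y" "\<And>p. y (0, p) = 0"
    "\<And>t p. ((\<lambda>t. y (t, p)) has_vector_derivative smooth_step t) (at t)"
  proof -
    have "Cinf (\<lambda>q :: real \<times> real. smooth_step (fst q))" by (intro Cinf_compose[OF Cinf_smooth_step] smooth_intros)
    from smooth_antiderivative[OF this] show thesis using that by (metis fst_conv)
  qed
  show thesis
  proof (rule that[of "\<lambda>x. y (x, 0)"])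
    show "Cinf (\<lambda>x. y (x, 0))" by (intro Cinf_compose[OF y(1)] smooth_intros)
    show "((\<lambda>x. y (x, 0)) has_vector_derivative smooth_step x) (at x)" for x by (rule y)
    show "y (x, 0) = 0" if "x \<le> 0" for x
    proof -
      have "((\<lambda>x. y (x, 0)) has_vector_derivative 0) (at t)" if "t \<le> 0" for t
        using y(3)[of 0 t] smooth_step_le0[OF that] by simp
      then have "y (x, 0) = y (0, 0)" by (intro constant_of_zero_vector_derivative[of "{..0}"]) (use that in auto)
      then show ?thesis by (simp add: y)
    qed
    show "y (x, 0) = x - 1 + y (1, 0)" if "x \<ge> 1" for x
    proof -
      have "((\<lambda>x. y (x, 0) - x) has_vector_derivative smooth_step t - 1) (at t)" for t
        by (intro has_vector_derivative_diff y has_vector_derivative_id)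
      then have "((\<lambda>x. y (x, 0) - x) has_vector_derivative 0) (at t)" if "t \<ge> 1" for t
        using smooth_step_ge1[OF that] by (metis diff_self)
      then have "y (x, 0) - x = y (1, 0) - 1" by (intro constant_of_zero_vector_derivative[of "{1..}"]) (use that in auto)
      then show ?thesis by simp
    qed
  qed
qed

section \<open>Straightening the horizontal foliation by a Hamiltonian isotopy\<close>

locale leaf_family =
  fixes th :: "complex \<Rightarrow> real"
  assumes th: "Cinf th" "\<And>z. norm z \<ge> 1 \<Longrightarrow> th z = 0" and tr: "transversal th"
begin

text \<open>The smooth step makes the family stationary for s <= 0, where the field is horizontal,
  and for s >= 1, where it has angle \<open>th\<close>. The resulting Hamiltonian can then vanish
  outside the time interval.\<close>

definition ang :: "real \<times> complex \<Rightarrow> real" where "ang q = smooth_step (fst q) * th (snd q)"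

lemma ex_L: "\<exists>L\<ge>0. \<forall>s a b. \<bar>ang (s, a) - ang (s, b)\<bar> \<le> L * norm (a - b)"
proof -
  obtain L where L: "L \<ge> 0" "\<And>x y. norm (th x - th y) \<le> L * norm (x - y)"
    by (rule Lipschitz_of_compact_support[OF th(1), of "cball 0 1"]) (use th(2) in auto)
  have "\<bar>ang (s, a) - ang (s, b)\<bar> \<le> L * norm (a - b)" for s a b
  proof -
    have "\<bar>ang (s, a) - ang (s, b)\<bar> = smooth_step s * \<bar>th a - th b\<bar>"
      using smooth_step_range(1)[of s] by (simp add: ang_def abs_mult flip: right_diff_distrib)
    also have "\<dots> \<le> 1 * (L * norm (a - b))"
      using smooth_step_range[of s] L(2)[of a b] by (intro mult_mono) auto
    finally show ?thesis by simp
  qed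
  then show ?thesis using L(1) by blast
qed

definition LL :: real where "LL = (SOME L. L \<ge> 0 \<and> (\<forall>s a b. \<bar>ang (s, a) - ang (s, b)\<bar> \<le> L * norm (a - b)))"

sublocale dirflow ang LL
proof unfold_locales
  show "Cinf ang" unfolding ang_def by (intro smooth_intros Cinf_compose[OF Cinf_smooth_step] Cinf_compose[OF th(1)])
  show "ang (s, z) = 0" if "norm z \<ge> 1" for s z using th(2)[OF that] by (simp add: ang_def)
  show "LL \<ge> 0" "\<bar>ang (s, a) - ang (s, b)\<bar> \<le> LL * norm (a - b)" for s a b
    using someI_ex[OF ex_L[unfolded Bex_def], folded LL_def] by auto
qed

lemma trs: "transversal (\<lambda>z. ang (s, z))"
  unfolding ang_def fst_conv snd_conv by (rule transversal_scale[OF th tr smooth_step_range])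

lemma Fl_cong:
  assumes "\<And>z. ang (s, z) = ang (s', z)" shows "Fl (t, (s, z)) = Fl (t, (s', z))"
proof (rule ode_unique[of "\<lambda>t. Fl (t, (s, z))" "\<lambda>t a. V (s, a)" _ LL 0])
  show "((\<lambda>t. Fl (t, (s', z))) has_vector_derivative V (s, Fl (t, (s', z)))) (at t)" for t
    using Fl_props(3)[of "(s', z)" t] assms by (simp add: V_def)
qed (use Fl_props(3)[of "(s, z)"] L(1) VL in \<open>auto simp: Fl_props\<close>)

lemma Lam_ge1: "s \<ge> 1 \<Longrightarrow> Lam (s, w) = Lam (1, w)"
  unfolding Lam_def by (simp, intro Fl_cong) (simp add: ang_def smooth_step_ge1)

lemma Lam_le0: "s \<le> 0 \<Longrightarrow> Lam (s, w) = w"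
proof -
  assume s: "s \<le> 0"
  have "Fl (t, (s, z)) = z + of_real t" for t z
  proof (rule ode_unique[of "\<lambda>t. Fl (t, (s, z))" "\<lambda>t a. V (s, a)" _ LL 0])
    show "((\<lambda>t. z + of_real t) has_vector_derivative V (s, z + of_real t)) (at t)" for t
      using s by (auto simp: V_def ang_def smooth_step_le0 intro!: derivative_eq_intros)
  qed (use Fl_props(3)[of "(s, z)"] L(1) VL in \<open>auto simp: Fl_props\<close>)
  then show ?thesis by (simp add: Lam_def complex_eq_iff)
qed

lemma FD_Lam_s: "FD Lam (s, w) (1, 0) = 0" if "s \<le> 0 \<or> s \<ge> 1 \<or> \<bar>Im w\<bar> \<ge> 1 \<or> Re w \<le> -1"
proof -
  have loc: "FD Lam (s, w) (1, 0) = 0" if "open S" "s \<in> S" "\<And>s. s \<in> S \<Longrightarrow> Lam (s, w) = a" for S s a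
  proof -
    have "((\<lambda>s. Lam (s, w)) has_derivative (\<lambda>h. 0)) (at s)"
      by (rule has_derivative_transform_within_open[of "\<lambda>s. a", OF _ that(1,2)]) (use that(3) in auto)
    from fun_cong[OF has_derivative_unique[OF FD_partial_left[OF LamC] this], of 1] show ?thesis .
  qed
  have c: "continuous_on A (\<lambda>s. FD Lam (s, w) (1, 0))" for A
    by (intro Cinf_continuous Cinf_FD LamC smooth_intros)
  have 1: "FD Lam (s, w) (1, 0) = 0" if "s \<in> closure {..<0}"
    by (rule continuous_constant_on_closure[OF c _ that]) (rule loc[of "{..<0}" _ w]; simp add: Lam_le0)
  have 2: "FD Lam (s, w) (1, 0) = 0" if "s \<in> closure {1<..}"
    by (rule continuous_constant_on_closure[OF c _ that]) (rule loc[of "{1<..}" _ "Lam (1, w)"], simp, assumption, rule Lam_ge1, simp)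
  have 3: "FD Lam (s, w) (1, 0) = 0" if "\<bar>Im w\<bar> \<ge> 1 \<or> Re w \<le> -1"
    by (rule loc[of UNIV _ w]) (use that Lam_strip Lam_left in auto)
  show ?thesis using that 1 2 3 by (metis atLeast_iff atMost_iff closure_lessThan closure_greaterThan)
qed

text \<open>Each leaf eventually stays right of the disk; compactness makes the parameter uniform
  for s in [0,1] and |c| <= 1. Other labels give straight lines, and other s repeat the fields at
  the ends.\<close>

lemma ex_T0: "\<exists>T\<ge>1. \<forall>s c. Re (Lam (s, Complex T c)) \<ge> 1"
proof -
  let ?S = "{0..1::real} \<times> {-1..1::real}"
  let ?N = "\<lambda>n::nat. {q :: real \<times> real. Re (Lam (fst q, Complex n (snd q))) > 1}"
  have mono: "Re (Lam (s, Complex r' c)) \<ge> 1" if "Re (Lam (s, Complex r c)) \<ge> 1" "r \<le> r'" for r r' s c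
  proof -
    have "Complex r' c = Complex r c + of_real (r' - r)" by (simp add: complex_eq_iff)
    then show ?thesis using Lam_right[OF that(1), of "r' - r"] that by simp
  qed
  have "?S \<subseteq> (\<Union>n\<in>UNIV. ?N n)"
  proof clarify
    fix s c :: real
    obtain k M where k: "k > 0" "\<And>z t. t \<ge> 0 \<Longrightarrow> Re (Fl (t, (s, z))) \<ge> Re z - M + k * t"
      using escape[OF trs[of s]] by metis
    obtain n :: nat where n: "real n \<ge> (4 + M) / k" using real_arch_simple by blast
    have "k * (real n + 2) > 3 + M" using n k(1) by (simp add: field_simps)
    then have "Re (Lam (s, Complex n c)) > 1"
      using k(2)[of "real n + 2" "Complex (-2) c"] by (simp add: Lam_def)
    then show "(s, c) \<in> (\<Union>n\<in>UNIV. ?N n)" by auto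
  qed
  moreover have "open (?N n)" for n
    by (intro open_Collect_less continuous_intros Cinf_continuous Cinf_compose[OF LamC] smooth_intros)
  moreover have "compact ?S" by (intro compact_Times) auto
  ultimately obtain C' where C': "finite C'" "?S \<subseteq> (\<Union>n\<in>C'. ?N n)"
    by (elim compactE_image[of ?S UNIV ?N]) auto
  define T where "T = real (Max (insert 1 C'))"
  have T: "T \<ge> 1" "\<And>n. n \<in> C' \<Longrightarrow> real n \<le> T"
  proof -
    have "1 \<le> Max (insert 1 C')" "\<And>n. n \<in> C' \<Longrightarrow> n \<le> Max (insert 1 C')" using C'(1) by auto
    then show "T \<ge> 1" "\<And>n. n \<in> C' \<Longrightarrow> real n \<le> T" unfolding T_def by (simp_all del: Max_insert)
  qed
  have 01: "Re (Lam (s, Complex T c)) \<ge> 1" if "s \<in> {0..1}" for s c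
  proof (cases "\<bar>c\<bar> \<ge> 1")
    case True
    then show ?thesis using Lam_strip[of "Complex T c" s] T by simp
  next
    case False
    then have "(s, c) \<in> ?S" using that by auto
    then obtain n where "n \<in> C'" "Re (Lam (s, Complex n c)) > 1" using C'(2) by fastforce
    then show ?thesis using mono[of s "real n" c T] T(2) by simp
  qed
  have "Re (Lam (s, Complex T c)) \<ge> 1" for s c
  proof -
    consider "s \<in> {0..1}" | "s \<le> 0" | "s \<ge> 1" by force
    then show ?thesis
    proof cases
      case 3
      show ?thesis unfolding Lam_ge1[OF 3] by (rule 01) simp
    qed (use 01[of s] T(1) Lam_le0 in auto)
  qed
  then show ?thesis using T(1) by blast
qed

definition T0 where "T0 = (SOME T. T \<ge> 1 \<and> (\<forall>s c. Re (Lam (s, Complex T c)) \<ge> 1))"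

lemma T0: "T0 \<ge> 1" "Re (Lam (s, Complex T0 c)) \<ge> 1"
  using someI_ex[OF ex_T0[unfolded Bex_def], folded T0_def] by auto

text \<open>\<open>xT\<close> and \<open>gT\<close> are the coordinates of the leaf of label c at
  parameter \<open>T0\<close>, from where on it is horizontal. So \<open>gT\<close> is the holonomy
  of the field from left to right, and \<open>dg\<close> its speed under the deformation.\<close>

definition xT where "xT q = Re (Lam (fst q, Complex T0 (snd q)))" for q :: "real \<times> real"
definition gT where "gT q = Im (Lam (fst q, Complex T0 (snd q)))" for q :: "real \<times> real"
definition dg where "dg q = FD gT q (1, 0)" for q :: "real \<times> real"

lemma xTC: "Cinf xT" and gTC: "Cinf gT" and dgC: "Cinf dg"
proof -
  show "Cinf xT" unfolding xT_def by (intro Cinf_compose[OF LamC] smooth_intros)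
  show "Cinf gT" unfolding gT_def by (intro Cinf_compose[OF LamC] smooth_intros)
  then show "Cinf dg" unfolding dg_def by (rule Cinf_on_FD)
qed

lemma Lam_far: "\<sigma> \<ge> T0 \<Longrightarrow> Lam (s, Complex \<sigma> c) = Complex (xT (s, c) + \<sigma> - T0) (gT (s, c))"
proof -
  assume "\<sigma> \<ge> T0"
  then have "Lam (s, Complex T0 c + of_real (\<sigma> - T0)) = Lam (s, Complex T0 c) + of_real (\<sigma> - T0)"
    by (intro Lam_right T0) simp
  moreover have "Complex T0 c + of_real (\<sigma> - T0) = Complex \<sigma> c" by (simp add: complex_eq_iff)
  ultimately have "Lam (s, Complex \<sigma> c) = Lam (s, Complex T0 c) + of_real (\<sigma> - T0)" by (simp only:)
  then show ?thesis by (simp add: complex_eq_iff xT_def gT_def)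
qed

lemma Lam_right_form:
  assumes "Re (Lam (s, w)) \<ge> 1"
  shows "Im (Lam (s, w)) = gT (s, Im w)" "Re (Lam (s, w)) = xT (s, Im w) + Re w - T0"
proof -
  define r where "r = \<bar>Re w\<bar> + T0"
  have r: "Re w + r \<ge> T0" "r \<ge> 0" using T0(1) by (auto simp: r_def)
  have "w + of_real r = Complex (Re w + r) (Im w)" by (simp add: complex_eq_iff)
  then have "Lam (s, w) + of_real r = Complex (xT (s, Im w) + (Re w + r) - T0) (gT (s, Im w))"
    using Lam_right[OF assms r(2)] Lam_far[OF r(1), of s "Im w"] by (simp only:)
  then show "Im (Lam (s, w)) = gT (s, Im w)" "Re (Lam (s, w)) = xT (s, Im w) + Re w - T0"
    by (simp_all add: complex_eq_iff)
qed

lemma FD_gT: "FD gT (s, c) (a, b) = Im (FD Lam (s, Complex T0 c) (a, Complex 0 b))"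
proof -
  have "((\<lambda>q :: real \<times> real. (fst q, Complex T0 (snd q))) has_derivative (\<lambda>v. (fst v, Complex 0 (snd v)))) (at q)" for q
    unfolding Complex_eq by (auto intro!: derivative_eq_intros)
  from FD_eq[OF has_derivative_Im[OF FD_compose[OF LamC this]]] show ?thesis by (simp add: gT_def[abs_def])
qed

lemma dg_eq: "dg (s, c) = Im (FD Lam (s, Complex T0 c) (1, 0))"
proof -
  have "Complex 0 0 = 0" by (simp add: complex_eq_iff)
  then show ?thesis by (simp add: dg_def FD_gT)
qed

lemma dg_zero: "s \<le> 0 \<or> s \<ge> 1 \<or> \<bar>c\<bar> \<ge> 1 \<Longrightarrow> dg (s, c) = 0"
  unfolding dg_eq by (subst FD_Lam_s) auto

lemma gT_strip: "\<bar>c\<bar> \<ge> 1 \<Longrightarrow> gT (s, c) = c" "\<bar>c\<bar> \<ge> 1 \<Longrightarrow> xT (s, c) = T0"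
  by (simp_all add: gT_def xT_def Lam_strip)

lemma dcg_pos: "FD gT (s, c) (0, 1) > 0"
proof -
  have "V (s, Lam (s, Complex T0 c)) = 1"
    using T0(2)[of s c] abs_Re_le_cmod[of "Lam (s, Complex T0 c)"] by (intro V_outside) simp
  then show ?thesis
    using Lam_jac[of "(s, Complex T0 c)"] FD_Lam_1[of s "Complex T0 c"] FD_gT[of s c 0 1]
    by (simp add: om_def flip: imaginary_unit.code)
qed

text \<open>A field X that moves leaves to leaves must agree with the s-derivative of
  \<open>Lam\<close> up to a vector along the leaf. If X has Hamiltonian H, this prescribes the
  derivative of H along the leaf, namely \<open>qq\<close>; integrating from the left, where H has
  to vanish, gives \<open>Q\<close>.\<close>

definition qq where "qq q = om (FD Lam q (1, 0)) (FD Lam q (0, 1))"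

lemma qqC: "Cinf qq" unfolding qq_def by (intro smooth_intros Cinf_FD LamC)

lemma ex_Q: "\<exists>Q. Cinf Q \<and> (\<forall>s w. Re w = -2 \<longrightarrow> Q (s, w) = 0) \<and>
   (\<forall>s w r. ((\<lambda>r. Q (s, Complex r (Im w))) has_vector_derivative qq (s, Complex r (Im w))) (at r))"
proof -
  define f where "f x = qq (fst (snd x), Complex (fst x - 2) (snd (snd x)))" for x :: "real \<times> real \<times> real"
  have "Cinf f" unfolding f_def by (intro Cinf_compose[OF qqC] smooth_intros)
  then obtain y where y: "Cinf y" "\<And>p. y (0, p) = 0" "\<And>t p. ((\<lambda>t. y (t, p)) has_vector_derivative f (t, p)) (at t)"
    by (rule smooth_antiderivative) (rule that)
  show ?thesis
  proof (intro exI[of _ "\<lambda>q. y (Re (snd q) + 2, (fst q, Im (snd q)))"] conjI allI impI)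
    show "Cinf (\<lambda>q :: real \<times> complex. y (Re (snd q) + 2, (fst q, Im (snd q))))"
      by (intro Cinf_compose[OF y(1)] smooth_intros)
    show "((\<lambda>r. y (Re (snd (s, Complex r (Im w))) + 2, (fst (s, Complex r (Im w)), Im (snd (s, Complex r (Im w))))))
        has_vector_derivative qq (s, Complex r (Im w))) (at r)" for s w r
    proof -
      have 1: "((\<lambda>r. r + 2) has_vector_derivative 1) (at r)" by (auto intro!: derivative_eq_intros)
      show ?thesis using vector_diff_chain_at[OF 1 y(3)[of "(s, Im w)"]] by (simp add: o_def f_def)
    qed
  qed (simp add: y(2))
qed

definition Q where "Q = (SOME Q. Cinf Q \<and> (\<forall>s w. Re w = -2 \<longrightarrow> Q (s, w) = 0) \<and>
   (\<forall>s w r. ((\<lambda>r. Q (s, Complex r (Im w))) has_vector_derivative qq (s, Complex r (Im w))) (at r)))"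

lemma QC: "Cinf Q" and Q_start: "Re w = -2 \<Longrightarrow> Q (s, w) = 0"
  and Q_der: "((\<lambda>r. Q (s, Complex r c)) has_vector_derivative qq (s, Complex r c)) (at r)"
proof -
  note * = someI_ex[OF ex_Q, folded Q_def]
  show "Cinf Q" "Re w = -2 \<Longrightarrow> Q (s, w) = 0" using * by blast+
  show "((\<lambda>r. Q (s, Complex r c)) has_vector_derivative qq (s, Complex r c)) (at r)"
    using *[THEN conjunct2, THEN conjunct2, rule_format, of s "Complex 0 c" r] by simp
qed

lemma Q_zero: "Q (s, w) = 0" if "s \<le> 0 \<or> s \<ge> 1 \<or> \<bar>Im w\<bar> \<ge> 1 \<or> Re w \<le> -1"
proof -
  define S where "S = (if s \<le> 0 \<or> s \<ge> 1 \<or> \<bar>Im w\<bar> \<ge> 1 then UNIV else {..-1::real})"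
  have "Q (s, Complex (Re w) (Im w)) = Q (s, Complex (-2) (Im w))"
  proof (rule constant_of_zero_vector_derivative[of S "\<lambda>r. Q (s, Complex r (Im w))"])
    fix r assume "r \<in> S"
    then have "FD Lam (s, Complex r (Im w)) (1, 0) = 0"
      using that by (intro FD_Lam_s) (auto simp: S_def split: if_splits)
    then show "((\<lambda>r. Q (s, Complex r (Im w))) has_vector_derivative 0) (at r)"
      using Q_der[of s "Im w" r] by (simp add: qq_def)
  qed (use that in \<open>auto simp: S_def\<close>)
  then show ?thesis by (simp add: Q_start)
qed

text \<open>Right of the disk the leaf is horizontal, so the flux per unit of length is minus its
  vertical speed \<open>dg\<close>.\<close>

lemma Q_far: "\<sigma> \<ge> T0 \<Longrightarrow> Q (s, Complex \<sigma> c) = Q (s, Complex T0 c) - (\<sigma> - T0) * dg (s, c)"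
proof -
  assume \<sigma>: "\<sigma> \<ge> T0"
  have q: "qq (s, Complex r c) = - dg (s, c)" if "r \<ge> T0" for r
  proof -
    have "Re (Lam (s, Complex r c)) \<ge> 1" using Lam_far[OF that, of s c] T0(2)[of s c] that by (simp add: xT_def)
    then have V1: "V (s, Lam (s, Complex r c)) = 1"
      using abs_Re_le_cmod[of "Lam (s, Complex r c)"] by (intro V_outside) simp
    have "((\<lambda>s. Im (Lam (s, Complex r c))) has_derivative (\<lambda>h. Im (FD Lam (s, Complex r c) (h, 0)))) (at s)"
      by (intro has_derivative_Im FD_partial_left LamC)
    moreover have "(\<lambda>s. Im (Lam (s, Complex r c))) = (\<lambda>s. gT (s, c))" using Lam_far[OF that] by auto
    ultimately have "((\<lambda>s. gT (s, c)) has_derivative (\<lambda>h. Im (FD Lam (s, Complex r c) (h, 0)))) (at s)" by simp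
    from fun_cong[OF has_derivative_unique[OF this FD_partial_left[OF gTC]], of 1]
    have "Im (FD Lam (s, Complex r c) (1, 0)) = dg (s, c)" by (simp add: dg_def)
    then show ?thesis by (simp add: qq_def FD_Lam_1 V1 om_def)
  qed
  have "Q (s, Complex \<sigma> c) + \<sigma> * dg (s, c) = Q (s, Complex T0 c) + T0 * dg (s, c)"
  proof (rule constant_of_zero_vector_derivative[of "{T0..}" "\<lambda>r. Q (s, Complex r c) + r * dg (s, c)"])
    fix r assume "r \<in> {T0..}"
    then have "((\<lambda>r. Q (s, Complex r c) + r * dg (s, c)) has_vector_derivative - dg (s, c) + 1 * dg (s, c)) (at r)"
      using q[of r] Q_der[of s c r]
      by (intro has_vector_derivative_add has_vector_derivative_mult_left has_vector_derivative_id) auto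
    then show "((\<lambda>r. Q (s, Complex r c) + r * dg (s, c)) has_vector_derivative 0) (at r)" by simp
  qed (use \<sigma> in auto)
  then show ?thesis by (simp add: algebra_simps)
qed


definition Bb where "Bb = (SOME B. Cinf B \<and> (\<forall>x. (B has_vector_derivative smooth_step x) (at x)) \<and> (\<forall>x\<le>0. B x = 0) \<and>
  (\<forall>x\<ge>1. B x = x - 1 + (B 1 :: real)))"

lemma Bb: "Cinf Bb" "(Bb has_vector_derivative smooth_step x) (at x)" "x \<le> 0 \<Longrightarrow> Bb x = 0" "x \<ge> 1 \<Longrightarrow> Bb x = x - 1 + Bb 1"
proof -
  have "\<exists>B. Cinf B \<and> (\<forall>x. (B has_vector_derivative smooth_step x) (at x)) \<and> (\<forall>x\<le>0. B x = 0) \<and>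
    (\<forall>x\<ge>1. B x = x - 1 + (B 1 :: real))"
    by (rule smooth_step_antiderivative) blast
  note * = someI_ex[OF this, folded Bb_def]
  show "Cinf Bb" "(Bb has_vector_derivative smooth_step x) (at x)" "x \<le> 0 \<Longrightarrow> Bb x = 0" using * by blast+
  show "x \<ge> 1 \<Longrightarrow> Bb x = x - 1 + Bb 1" using * by blast
qed

text \<open>Chosen such that \<open>Bb (x - 2) = x - xbar\<close> for x >= 3.\<close>

definition xbar where "xbar = 3 - Bb 1"

text \<open>The area swept out by a leaf from the left up to the line \<open>T0\<close>, up to sign: it has to be
  compensated further to the right, so that the Hamiltonian gets compact support.\<close>
definition mm where "mm q = - Q (fst q, Complex T0 (snd q)) - (xT q - xbar) * dg q" for q :: "real \<times> real"

lemma mmC: "Cinf mm" unfolding mm_def by (intro smooth_intros Cinf_compose[OF QC] xTC dgC)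

lemma mm_zero: "s \<le> 0 \<or> s \<ge> 1 \<or> \<bar>c\<bar> \<ge> 1 \<Longrightarrow> mm (s, c) = 0"
  unfolding mm_def by (simp add: dg_zero) (subst Q_zero, auto)

text \<open>The compensation accumulated up to s. It becomes the amplitude of the bump by which the
  leaf of label c is bent to the right of the disk.\<close>

definition ee where "ee = (SOME e. Cinf e \<and> (\<forall>c. e (0, c) = 0) \<and> (\<forall>s c. ((\<lambda>s. e (s, c)) has_vector_derivative mm (s, c)) (at s)))"

lemma ee: "Cinf ee" "ee (0, c) = 0" "((\<lambda>s. ee (s, c)) has_vector_derivative mm (s, c)) (at s)"
proof -
  have "\<exists>e. Cinf e \<and> (\<forall>c. e (0, c) = 0) \<and> (\<forall>s c. ((\<lambda>s. e (s, c)) has_vector_derivative mm (s, c)) (at s))"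
    by (rule smooth_antiderivative[OF mmC]) blast
  note * = someI_ex[OF this, folded ee_def]
  show "Cinf ee" "ee (0, c) = 0" "((\<lambda>s. ee (s, c)) has_vector_derivative mm (s, c)) (at s)" using * by blast+
qed

lemma ee_zero: "s \<le> 0 \<or> \<bar>c\<bar> \<ge> 1 \<Longrightarrow> ee (s, c) = 0" and ee_ge1: "s \<ge> 1 \<Longrightarrow> ee (s, c) = ee (1, c)"
proof -
  have d: "((\<lambda>s. ee (s, c)) has_vector_derivative 0) (at s)" if "s \<le> 0 \<or> s \<ge> 1 \<or> \<bar>c\<bar> \<ge> 1" for s
    using ee(3)[of c s] mm_zero[OF that] by simp
  show "ee (s, c) = 0" if "s \<le> 0 \<or> \<bar>c\<bar> \<ge> 1"
  proof (cases "\<bar>c\<bar> \<ge> 1")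
    case True
    have "ee (s, c) = ee (0, c)"
      by (rule constant_of_zero_vector_derivative[of UNIV "\<lambda>s. ee (s, c)"]) (use d True in auto)
    then show ?thesis by (simp add: ee)
  next
    case False
    have "ee (s, c) = ee (0, c)"
      by (rule constant_of_zero_vector_derivative[of "{..0}" "\<lambda>s. ee (s, c)"]) (use d that False in auto)
    then show ?thesis by (simp add: ee)
  qed
  show "s \<ge> 1 \<Longrightarrow> ee (s, c) = ee (1, c)"
    by (rule constant_of_zero_vector_derivative[of "{1..}" "\<lambda>s. ee (s, c)"]) (use d in auto)
qed

lemma ex_E: "\<exists>E>0. \<forall>q. \<bar>FD ee q (0, 1)\<bar> \<le> E"
proof -
  have "compact ((\<lambda>q. FD ee q (0, 1)) ` ({0..1} \<times> {-1..1}))"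
    by (intro compact_continuous_image compact_Times Cinf_continuous Cinf_FD ee smooth_intros) auto
  then obtain E where E: "E > 0" "\<And>q. q \<in> {0..1} \<times> {-1..1} \<Longrightarrow> \<bar>FD ee q (0, 1)\<bar> \<le> E"
    using compact_imp_bounded[of "(\<lambda>q. FD ee q (0, 1)) ` ({0..1} \<times> {-1..1})"] unfolding bounded_pos by auto
  have z: "FD ee (s, c) (0, 1) = 0" if "\<bar>c\<bar> > 1 \<or> s \<le> 0" for s c
  proof -
    have "((\<lambda>c. ee (s, c)) has_derivative (\<lambda>h. 0)) (at c)"
    proof (cases "s \<le> 0")
      case True
      then show ?thesis by (simp add: ee_zero)
    next
      case False
      have "open {c :: real. \<bar>c\<bar> > 1}" by (intro open_Collect_less continuous_intros)
      then show ?thesis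
        by (rule has_derivative_transform_within_open[of "\<lambda>c. 0", rotated]) (use that False ee_zero in auto)
    qed
    from fun_cong[OF has_derivative_unique[OF FD_partial_right[OF ee(1)] this], of 1] show ?thesis .
  qed
  have g: "FD ee (s, c) (0, 1) = FD ee (1, c) (0, 1)" if "s \<ge> 1" for s c
  proof -
    have "(\<lambda>c. ee (s, c)) = (\<lambda>c. ee (1, c))" using ee_ge1[OF that] by auto
    then have "((\<lambda>c. ee (s, c)) has_derivative (\<lambda>h. FD ee (1, c) (0, h))) (at c)" using FD_partial_right[OF ee(1)] by simp
    from fun_cong[OF has_derivative_unique[OF FD_partial_right[OF ee(1)] this], of 1] show ?thesis .
  qed
  have "\<bar>FD ee (s, c) (0, 1)\<bar> \<le> E" for s c
  proof -
    consider "\<bar>c\<bar> > 1 \<or> s \<le> 0" | "\<bar>c\<bar> \<le> 1" "0 \<le> s" "s \<le> 1" | "\<bar>c\<bar> \<le> 1" "s \<ge> 1" by linarith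
    then show ?thesis
    proof cases
      case 3
      then show ?thesis unfolding g[OF 3(2)] by (intro E(2)) auto
    next
      case 2
      then show ?thesis by (intro E(2)) auto
    qed (use z E in auto)
  qed
  then show ?thesis using E(1) by auto
qed

lemma ex_B1: "\<exists>B>0. \<forall>x. \<bar>FD smooth_step x 1\<bar> \<le> B"
proof -
  have "compact ((\<lambda>x. FD smooth_step x 1) ` {0..1})"
    by (intro compact_continuous_image Cinf_continuous Cinf_FD Cinf_smooth_step smooth_intros) auto
  then obtain B where B: "B > 0" "\<And>x. x \<in> {0..1} \<Longrightarrow> \<bar>FD smooth_step x 1\<bar> \<le> B"
    using compact_imp_bounded[of "(\<lambda>x. FD smooth_step x 1) ` {0..1}"] unfolding bounded_pos by auto
  have "FD smooth_step x 1 = 0" if "x < 0 \<or> x > 1" for x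
  proof -
    have "(smooth_step has_derivative (\<lambda>h. 0)) (at x)"
    proof (cases "x < 0")
      case True
      show ?thesis
        by (rule has_derivative_transform_within_open[of "\<lambda>c. 0" _ _ _ "{..<0}"]) (use True smooth_step_le0 in auto)
    next
      case False
      show ?thesis
        by (rule has_derivative_transform_within_open[of "\<lambda>c. 1" _ _ _ "{1<..}"]) (use that False smooth_step_ge1 in auto)
    qed
    from FD_eq[OF this] show ?thesis by simp
  qed
  then show ?thesis using B by (metis abs_zero atLeastAtMost_iff less_imp_le not_le)
qed

definition E1 where "E1 = (SOME E. E > 0 \<and> (\<forall>q. \<bar>FD ee q (0, 1)\<bar> \<le> E))"
definition B1 :: real where "B1 = (SOME B. B > 0 \<and> (\<forall>x. \<bar>FD smooth_step x 1\<bar> \<le> B))"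
text \<open>The width of the bump \<open>kap\<close>, which has integral 1 because it is the
  derivative of the step \<open>Kk\<close>. Its height is at most B1/ell, and the slope of
  \<open>ee\<close> in the label at most E1, so the bump changes the slope of the leaves in c by at
  most 1/2.\<close>

definition ell where "ell = 1 + 2 * B1 * E1"
definition Kk where "Kk x = smooth_step ((x - 3) / ell)"
definition kap where "kap x = FD smooth_step ((x - 3) / ell) 1 / ell"

lemma E1: "E1 > 0" "\<bar>FD ee q (0, 1)\<bar> \<le> E1" using someI_ex[OF ex_E, folded E1_def] by blast+
lemma B1: "B1 > 0" "\<bar>FD smooth_step x 1\<bar> \<le> B1" using someI_ex[OF ex_B1, folded B1_def] by auto
lemma ell: "ell \<ge> 1" using E1(1) B1(1) by (simp add: ell_def)

lemma kapC: "Cinf kap" and KkC: "Cinf Kk"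
  using ell unfolding kap_def Kk_def
  by (auto intro!: Cinf_divide Cinf_FD Cinf_smooth_step smooth_intros Cinf_compose[OF Cinf_smooth_step])

lemma Kk_der: "(Kk has_vector_derivative kap x) (at x)"
proof -
  have 1: "((\<lambda>x. (x - 3) / ell) has_vector_derivative (1 / ell)) (at x)"
    using ell by (auto intro!: derivative_eq_intros simp flip: has_real_derivative_iff_has_vector_derivative)
  have "FD smooth_step y (1 / ell) = FD smooth_step y 1 / ell" for y
    using linear_scale[OF linear_FD[OF Cinf_smooth_step], of y "1 / ell" 1] by simp
  then show ?thesis using FD_compose_vector[OF Cinf_smooth_step 1] by (simp add: Kk_def[abs_def] kap_def)
qed

lemma Kk_simps: "x \<le> 3 \<Longrightarrow> Kk x = 0" "x \<ge> 3 + ell \<Longrightarrow> Kk x = 1"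
  using ell by (auto simp: Kk_def intro!: smooth_step_le0 smooth_step_ge1 simp: field_simps)

lemma kap_zero: "x \<le> 3 \<Longrightarrow> kap x = 0"
proof -
  assume x: "x \<le> 3"
  have "kap x = 0" if "x \<in> closure {..<3}"
  proof (rule continuous_constant_on_closure[OF Cinf_continuous[OF kapC] _ that])
    fix y :: real assume y: "y \<in> {..<3}"
    have "(Kk has_vector_derivative 0) (at y)"
      by (rule has_vector_derivative_transform_within_open[of "\<lambda>x. 0" _ _ "{..<3}"]) (use y Kk_simps in auto)
    then show "kap y = 0" using Kk_der vector_derivative_unique_at by blast
  qed
  then show ?thesis using x by simp
qed

lemma kap_ee: "\<bar>kap x * FD ee q (0, 1)\<bar> \<le> 1 / 2"
proof -
  have "\<bar>kap x * FD ee q (0, 1)\<bar> = \<bar>FD smooth_step ((x - 3) / ell) 1\<bar> * \<bar>FD ee q (0, 1)\<bar> / ell"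
    using ell by (simp add: kap_def abs_mult)
  also have "\<dots> \<le> B1 * E1 / ell"
    using ell E1 B1 by (intro divide_right_mono mult_mono) auto
  also have "\<dots> \<le> 1 / 2" using ell by (simp add: field_simps) (simp add: ell_def)
  finally show ?thesis .
qed

end

section \<open>Bending the leaves to the right of the disk and the resulting Hamiltonian\<close>

context leaf_family
begin

text \<open>The vertical correction of the leaves. Between x = 2 and x = 3 the first summand brings
  the leaf from height \<open>gT\<close> back to its label; between 3 and 3 + ell the second one
  adds a bump of area minus \<open>ee\<close>, which balances the flux.\<close>

definition kf where "kf x = - smooth_step (fst (snd x) - 2) * (gT (fst x, snd (snd x)) - snd (snd x))
    - kap (fst (snd x)) * ee (fst x, snd (snd x))" for x :: "real \<times> real \<times> real"

definition pt where "pt q = (fst q, Re (Lam q), Im (snd q))" for q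

definition LamT where "LamT q = Lam q + \<i> * of_real (kf (pt q))"

lemma kfC: "Cinf kf"
  unfolding kf_def
  by (intro smooth_intros Cinf_compose[OF Cinf_smooth_step] Cinf_compose[OF gTC] Cinf_compose[OF kapC] Cinf_compose[OF ee(1)])

lemma LamTC: "Cinf LamT"
  unfolding LamT_def pt_def
  by (intro smooth_intros LamC Cinf_compose[OF kfC] Cinf_bounded_linear[OF bounded_linear_mult_right])

definition ks where "ks q = FD kf (pt q) (1, 0)"
definition kx where "kx q = FD kf (pt q) (0, 1, 0)"
definition kc where "kc q = FD kf (pt q) (0, 0, 1)"

lemma ks_eq: "ks (s, w) = - smooth_step (Re (Lam (s, w)) - 2) * dg (s, Im w) - kap (Re (Lam (s, w))) * mm (s, Im w)"
proof -
  let ?x = "Re (Lam (s, w))" and ?c = "Im w"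
  have c: "((\<lambda>r. (r, ?x, ?c)) has_vector_derivative (1, 0)) (at s)"
    by (auto intro!: derivative_eq_intros simp: zero_prod_def)
  have "((\<lambda>r. gT (r, ?c)) has_vector_derivative dg (s, ?c)) (at s)"
    unfolding dg_def by (rule FD_compose_vector[OF gTC]) (auto intro!: derivative_eq_intros)
  then have "((\<lambda>r. kf (r, ?x, ?c)) has_vector_derivative (- smooth_step (?x - 2) * (dg (s, ?c) - 0) - kap ?x * mm (s, ?c))) (at s)"
    unfolding kf_def fst_conv snd_conv
    by (intro has_vector_derivative_diff has_vector_derivative_mult_right has_vector_derivative_const ee(3))
  from FD_vector_curve[OF kfC c this] show ?thesis by (simp add: ks_def pt_def)
qed

lemma kc_eq: "kc (s, w) = - smooth_step (Re (Lam (s, w)) - 2) * (FD gT (s, Im w) (0, 1) - 1) - kap (Re (Lam (s, w))) * FD ee (s, Im w) (0, 1)"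
proof -
  let ?x = "Re (Lam (s, w))" and ?c = "Im w"
  have c: "((\<lambda>r. (s, ?x, r)) has_vector_derivative (0, 0, 1)) (at ?c)" and c': "((\<lambda>r. (s, r)) has_vector_derivative (0, 1)) (at ?c)"
    by (auto intro!: derivative_eq_intros)
  have "((\<lambda>r. kf (s, ?x, r)) has_vector_derivative (- smooth_step (?x - 2) * (FD gT (s, ?c) (0, 1) - 1) - kap ?x * FD ee (s, ?c) (0, 1))) (at ?c)"
    unfolding kf_def fst_conv snd_conv
    by (intro has_vector_derivative_diff has_vector_derivative_mult_right has_vector_derivative_id
        FD_compose_vector[OF gTC c'] FD_compose_vector[OF ee(1) c'])
  from FD_vector_curve[OF kfC c this] show ?thesis by (simp add: kc_def pt_def)
qed

lemma FD_LamT: "FD LamT q v = FD Lam q v + \<i> * of_real (fst v * ks q + Re (FD Lam q v) * kx q + Im (snd v) * kc q)"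
proof -
  have pt: "(pt has_derivative (\<lambda>v. (fst v, Re (FD Lam q v), Im (snd v)))) (at q)"
    unfolding pt_def by (intro has_derivative_Pair has_derivative_Re has_derivative_Im Cinf_has_derivative LamC
        has_derivative_fst has_derivative_snd has_derivative_ident)
  have l: "linear (FD kf (pt q))" by (rule linear_FD[OF kfC])
  have "(LamT has_derivative (\<lambda>v. FD Lam q v + \<i> * of_real (FD kf (pt q) (fst v, Re (FD Lam q v), Im (snd v))))) (at q)"
    unfolding LamT_def[abs_def]
    by (intro has_derivative_add Cinf_has_derivative LamC has_derivative_mult_right has_derivative_of_real FD_compose[OF kfC pt])
  from FD_eq[OF this] have 1: "FD LamT q v = FD Lam q v + \<i> * of_real (FD kf (pt q) (fst v, Re (FD Lam q v), Im (snd v)))" by simp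
  have "FD kf (pt q) (a, b, d) = a * ks q + b * kx q + d * kc q" for a b d
  proof -
    have "(a, b, d) = a *\<^sub>R (1, 0) + b *\<^sub>R (0, 1, 0) + d *\<^sub>R (0, 0, 1)" by (simp add: zero_prod_def)
    then show ?thesis by (simp only: linear_add[OF l] linear_scale[OF l] ks_def kx_def kc_def real_scaleR_def)
  qed
  then show ?thesis unfolding 1 by simp
qed

lemma Re_LamT [simp]: "Re (LamT q) = Re (Lam q)" and Im_LamT: "Im (LamT q) = Im (Lam q) + kf (pt q)"
  by (simp_all add: LamT_def)

lemma kf_zero: "x \<le> 2 \<Longrightarrow> kf (s, x, c) = 0"
  by (simp add: kf_def kap_zero smooth_step_le0)

lemma LamT_near: "Re (Lam q) \<le> 2 \<Longrightarrow> LamT q = Lam q"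
  by (simp add: LamT_def pt_def kf_zero)

text \<open>To the right of the disk the corrected leaves are graphs; this is the height over the
  abscissa x of the leaf of label c.\<close>

definition hh where "hh s x c = gT (s, c) + kf (s, x, c)"

lemma LamT_right:
  assumes "Re (Lam (s, w)) \<ge> 1" shows "LamT (s, w) = Complex (Re (Lam (s, w))) (hh s (Re (Lam (s, w))) (Im w))"
  using Lam_right_form[OF assms] by (simp add: complex_eq_iff Im_LamT hh_def pt_def)

lemma hh_der: "((\<lambda>c. hh s x c) has_real_derivative
    ((1 - smooth_step (x - 2)) * FD gT (s, c) (0, 1) + smooth_step (x - 2) - kap x * FD ee (s, c) (0, 1))) (at c)"
proof -
  have c': "((\<lambda>r. (s, r)) has_vector_derivative (0, 1)) (at c)" by (auto intro!: derivative_eq_intros)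
  have "((\<lambda>r. hh s x r) has_vector_derivative (FD gT (s, c) (0, 1) + (- smooth_step (x - 2) * (FD gT (s, c) (0, 1) - 1) - kap x * FD ee (s, c) (0, 1)))) (at c)"
    unfolding kf_def fst_conv snd_conv hh_def
    by (intro has_vector_derivative_add has_vector_derivative_diff has_vector_derivative_mult_right has_vector_derivative_id
        FD_compose_vector[OF gTC c'] FD_compose_vector[OF ee(1) c'])
  then show ?thesis by (simp add: has_real_derivative_iff_has_vector_derivative algebra_simps)
qed

text \<open>Up to x = 3 this is a convex combination of the positive slope of \<open>gT\<close> and
  1; beyond, it is 1 minus a term of size at most 1/2.\<close>

lemma hh_der_pos: "(1 - smooth_step (x - 2)) * FD gT (s, c) (0, 1) + smooth_step (x - 2) - kap x * FD ee (s, c) (0, 1) > 0"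
proof (cases "x \<le> 3")
  case True
  have p: "FD gT (s, c) (0, 1) > 0" by (rule dcg_pos)
  have "(1 - smooth_step (x - 2)) * FD gT (s, c) (0, 1) \<ge> 0" using p smooth_step_range(2)[of "x - 2"] by simp
  moreover have "(1 - smooth_step (x - 2)) * FD gT (s, c) (0, 1) > 0" if "smooth_step (x - 2) = 0" using p that by simp
  moreover have "smooth_step (x - 2) > 0" if "smooth_step (x - 2) \<noteq> 0" using that smooth_step_range(1)[of "x - 2"] by simp
  ultimately have "(1 - smooth_step (x - 2)) * FD gT (s, c) (0, 1) + smooth_step (x - 2) > 0"
    by (metis add.right_neutral add_nonneg_pos)
  then show ?thesis using True by (simp add: kap_zero)
next
  case False
  then show ?thesis using kap_ee[of x "(s, c)"] by (simp add: smooth_step_ge1 abs_le_iff)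
qed

lemma hh_mono: "c < c' \<Longrightarrow> hh s x c < hh s x c'"
  using DERIV_pos_imp_increasing[of c c' "hh s x"] hh_der hh_der_pos by blast

lemma hh_strip: "\<bar>c\<bar> \<ge> 1 \<Longrightarrow> hh s x c = c"
  by (simp add: hh_def kf_def gT_strip ee_zero)

text \<open>The correction is vertical and preserves \<open>Re\<close>. Where \<open>Re\<close> is
  at most 2 nothing changes; further right a height on a vertical line determines the label, since
  \<open>hh\<close> increases in c and covers all heights.\<close>

lemma LamT_bij: "bij (\<lambda>w. LamT (s, w))"
proof (rule bijI)
  have inj: "inj (\<lambda>w. Lam (s, w))" and surj: "surj (\<lambda>w. Lam (s, w))"
    using Lam_bij[OF trs] by (auto simp: bij_def)
  show "inj (\<lambda>w. LamT (s, w))"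
  proof (rule injI)
    fix w w' assume eq: "LamT (s, w) = LamT (s, w')"
    then have x: "Re (Lam (s, w)) = Re (Lam (s, w'))" using Re_LamT by metis
    show "w = w'"
    proof (cases "Re (Lam (s, w)) \<le> 2")
      case True
      then have "Lam (s, w) = Lam (s, w')" using eq x LamT_near by metis
      then show ?thesis using inj by (simp add: inj_def)
    next
      case False
      then have "hh s (Re (Lam (s, w))) (Im w) = hh s (Re (Lam (s, w))) (Im w')"
        using eq LamT_right[of s w] LamT_right[of s w'] x by simp
      then have "Im w = Im w'" using hh_mono by (metis less_irrefl linorder_neqE_linordered_idom)
      moreover have "Re w = Re w'" using Lam_right_form(2)[of s w] Lam_right_form(2)[of s w'] x False calculation by simp
      ultimately show ?thesis by (simp add: complex_eq_iff)
    qed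
  qed
  have "\<exists>w. LamT (s, w) = z" for z
  proof (cases "Re z \<le> 2")
    case True
    obtain w where "z = Lam (s, w)" using surjD[OF surj, of z] by blast
    then show ?thesis using LamT_near[of "(s, w)"] True by (intro exI[of _ w]) simp
  next
    case False
    define A where "A = \<bar>Im z\<bar> + 1"
    have "\<exists>c\<ge>- A. c \<le> A \<and> hh s (Re z) c = Im z"
    proof (rule IVT')
      show "continuous_on {- A..A} (hh s (Re z))"
        by (rule DERIV_continuous_on[OF has_field_derivative_at_within[OF hh_der]])
    qed (auto simp: hh_strip A_def)
    then obtain c where c: "hh s (Re z) c = Im z" by blast
    obtain t where t: "Re (Fl (t, (s, Complex (-2) c))) = Re z" by (rule Fl_hits[OF trs])
    then have "Re (Lam (s, Complex (t - 2) c)) = Re z" by (simp add: Lam_of_Fl)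
    then have "LamT (s, Complex (t - 2) c) = z" using LamT_right[of s "Complex (t - 2) c"] False c by (simp add: complex_eq_iff)
    then show ?thesis by blast
  qed
  then show "surj (\<lambda>w. LamT (s, w))" unfolding surj_def by (metis (no_types))
qed

lemma LamT_jac: "om (FD LamT q (0, 1)) (FD LamT q (0, \<i>)) > 0"
proof -
  obtain s w where q: "q = (s, w)" by (cases q)
  have e: "om (FD LamT q (0, 1)) (FD LamT q (0, \<i>)) = om (FD Lam q (0, 1)) (FD Lam q (0, \<i>)) + Re (FD Lam q (0, 1)) * kc q"
    unfolding FD_LamT by (simp add: om_def algebra_simps)
  show ?thesis
  proof (cases "Re (Lam q) \<le> 2")
    case True
    then have "kc q = 0" unfolding q by (subst kc_eq) (simp add: smooth_step_le0 kap_zero)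
    then show ?thesis using e Lam_jac by simp
  next
    case False
    have V1: "FD Lam q (0, 1) = 1"
      using FD_Lam_1[of s w] V_outside[of "Lam q" s] abs_Re_le_cmod[of "Lam q"] False by (simp add: q)
    have "((\<lambda>w. Im (Lam (s, w))) has_derivative (\<lambda>v. FD gT (s, Im w) (0, Im v))) (at w)"
    proof (rule has_derivative_transform_within_open)
      show "((\<lambda>w. gT (s, Im w)) has_derivative (\<lambda>v. FD gT (s, Im w) (0, Im v))) (at w)"
        by (rule FD_compose[OF gTC]) (auto intro!: derivative_eq_intros)
      show "open {w. Re (Lam (s, w)) > 1}"
        by (intro open_Collect_less continuous_intros Cinf_continuous Cinf_compose[OF LamC] smooth_intros)
    qed (use False Lam_right_form(1) in \<open>auto simp: q\<close>)
    from fun_cong[OF has_derivative_unique[OF this has_derivative_Im[OF FD_partial_right[OF LamC]]], of \<i>]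
    have "Im (FD Lam q (0, \<i>)) = FD gT (s, Im w) (0, 1)" by (simp add: q)
    then have "om (FD LamT q (0, 1)) (FD LamT q (0, \<i>)) = FD gT (s, Im w) (0, 1) + kc q"
      unfolding e V1 by (simp add: om_def)
    also have "\<dots> > 0"
      using hh_der_pos[of "Re (Lam q)" s "Im w"] unfolding q kc_eq by (simp add: algebra_simps)
    finally show ?thesis .
  qed
qed

text \<open>The Hamiltonian in leaf coordinates. \<open>Bb (x - 2)\<close> and \<open>Kk x\<close>
  are the antiderivatives in x of the two profiles occurring in \<open>ks\<close>, so the sum
  integrates the flux along the corrected leaves, as \<open>FD_Hhat\<close> states.\<close>

definition Hhat where "Hhat q = Q q + (Bb (Re (Lam q) - 2) * dg (fst q, Im (snd q)) + Kk (Re (Lam q)) * mm (fst q, Im (snd q)))"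

lemma HhatC: "Cinf Hhat"
  unfolding Hhat_def
  by (intro smooth_intros QC LamC Cinf_compose[OF Bb(1)] Cinf_compose[OF dgC] Cinf_compose[OF KkC] Cinf_compose[OF mmC])

lemma FD_Hhat: "FD Hhat q (0, 1) = om (FD LamT q (1, 0)) (FD LamT q (0, 1))"
proof -
  obtain s w where q: "q = (s, w)" by (cases q)
  define c where "c = Im w"
  let ?x = "\<lambda>r. Re (Lam (s, Complex r c))"
  let ?V = "FD Lam q (0, 1)"
  have w: "w = Complex (Re w) c" by (simp add: c_def complex_eq_iff)
  have C: "((\<lambda>r. (s, Complex r c)) has_vector_derivative (0, 1)) (at r)" for r
    unfolding Complex_eq by (auto intro!: derivative_eq_intros)
  have x: "(?x has_vector_derivative Re ?V) (at (Re w))"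
    using bounded_linear.has_vector_derivative[OF bounded_linear_Re FD_compose_vector[OF LamC C[of "Re w"]]] by (simp add: q w[symmetric])
  have x2: "((\<lambda>r. ?x r - 2) has_vector_derivative Re ?V) (at (Re w))"
    using has_vector_derivative_diff[OF x has_vector_derivative_const[of 2]] by simp
  have B: "((\<lambda>r. Bb (?x r - 2)) has_vector_derivative Re ?V *\<^sub>R smooth_step (?x (Re w) - 2)) (at (Re w))"
    using vector_diff_chain_at[OF x2 Bb(2)] by (simp add: o_def)
  have K: "((\<lambda>r. Kk (?x r)) has_vector_derivative Re ?V *\<^sub>R kap (?x (Re w))) (at (Re w))"
    using vector_diff_chain_at[OF x Kk_der] by (simp add: o_def)
  have "((\<lambda>r. Hhat (s, Complex r c)) has_vector_derivative qq (s, Complex (Re w) c) +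
      (Re ?V *\<^sub>R smooth_step (?x (Re w) - 2) * dg (s, c) + Re ?V *\<^sub>R kap (?x (Re w)) * mm (s, c))) (at (Re w))"
    unfolding Hhat_def fst_conv snd_conv complex.sel
    by (intro has_vector_derivative_add has_vector_derivative_mult_left B K Q_der)
  from FD_vector_curve[OF HhatC C this]
  have "FD Hhat q (0, 1) = qq q + Re ?V * (smooth_step (Re (Lam q) - 2) * dg (s, c) + kap (Re (Lam q)) * mm (s, c))"
    by (simp add: q w[symmetric] algebra_simps)
  also have "\<dots> = qq q - ks q * Re ?V" by (simp add: q ks_eq c_def algebra_simps)
  also have "\<dots> = om (FD LamT q (1, 0)) (FD LamT q (0, 1))"
    unfolding FD_LamT qq_def by (simp add: om_def algebra_simps)
  finally show ?thesis .
qed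

text \<open>To the right of the bump \<open>Q\<close> falls linearly at rate \<open>dg\<close> while
  the \<open>Bb\<close> term rises at the same rate; the constant that remains is cancelled by the
  choice of \<open>mm\<close>.\<close>

lemma Hhat_zero: "Hhat (s, w) = 0" if z: "s \<le> 0 \<or> s \<ge> 1 \<or> \<bar>Im w\<bar> \<ge> 1 \<or> Re w \<le> -1 \<or> Re w \<ge> T0 + 3 + ell"
proof -
  consider "s \<le> 0 \<or> s \<ge> 1 \<or> \<bar>Im w\<bar> \<ge> 1" | "Re w \<le> -1" | "Re w \<ge> T0 + 3 + ell" using z by blast
  then show ?thesis
  proof cases
    case 1
    have "Q (s, w) = 0" by (rule Q_zero) (use 1 in auto)
    then show ?thesis using dg_zero[OF 1] mm_zero[OF 1] by (simp add: Hhat_def)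
  next
    case 2
    have "Q (s, w) = 0" by (rule Q_zero) (use 2 in auto)
    then show ?thesis using 2 by (simp add: Hhat_def Lam_left Bb(3) Kk_simps)
  next
    case 3
    then have far: "Re w \<ge> T0" using ell by simp
    define c where "c = Im w"
    have w: "w = Complex (Re w) c" by (simp add: c_def complex_eq_iff)
    have x: "Re (Lam (s, w)) = xT (s, c) + Re w - T0" using Lam_far[OF far, of s c] w by simp
    have x1: "xT (s, c) \<ge> 1" using T0(2) by (simp add: xT_def)
    have "Q (s, w) = Q (s, Complex T0 c) - (Re w - T0) * dg (s, c)" using Q_far[OF far, of s c] w by simp
    moreover have "Bb (Re (Lam (s, w)) - 2) = Re (Lam (s, w)) - xbar" using 3 x x1 ell by (subst Bb(4)) (auto simp: xbar_def)
    moreover have "Kk (Re (Lam (s, w))) = 1" using 3 x x1 by (intro Kk_simps) simp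
    ultimately show ?thesis by (simp add: Hhat_def mm_def c_def[symmetric] x) (simp add: algebra_simps)
  qed
qed

lemma LamT_0: "s \<le> 0 \<Longrightarrow> LamT (s, w) = w"
  by (simp add: LamT_def Lam_le0 pt_def kf_def ee_zero gT_def)

text \<open>\<open>LamT\<close> pushes the horizontal leaves to the leaves of the direction field, corrected far to
  the right; the Hamiltonian isotopy of \<open>H\<close> has to move leaves to leaves.\<close>
lemma straightening:
  obtains H R where "ham_flow H R" "\<And>z. \<exists>w. LamT (1, w) = ham_flow.Phi H (1, z) \<and> Im w = Im z"
proof -
  obtain G where G: "Cinf G" "\<And>s w. G (s, LamT (s, w)) = w" "\<And>s z. LamT (s, G (s, z)) = z"
    by (rule Cinf_family_inverse[OF LamTC LamT_bij]) (use LamT_jac in \<open>auto simp: less_le intro: that\<close>)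
  define H where "H q = Hhat (snd q, G (snd q, fst q))" for q
  have HC: "Cinf H" unfolding H_def by (intro Cinf_compose[OF HhatC] smooth_intros Cinf_compose[OF G(1)])
  let ?K = "{0..1::real} \<times> cbox (Complex (-1) (-1)) (Complex (T0 + 3 + ell) 1)"
  have "compact (LamT ` ?K)" by (intro compact_continuous_image compact_Times compact_cbox Cinf_continuous LamTC) auto
  then obtain R where R: "R > 0" "\<And>q. q \<in> ?K \<Longrightarrow> norm (LamT q) \<le> R"
    using compact_imp_bounded[of "LamT ` ?K"] unfolding bounded_pos by blast
  have hf: "ham_flow H (R + 1)"
  proof
    show "H (z, t) = 0" if z: "R + 1 \<le> norm z" for z t
    proof (rule ccontr)
      assume "H (z, t) \<noteq> 0"
      then have nz: "Hhat (t, G (t, z)) \<noteq> 0" by (simp add: H_def)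
      have "(t, G (t, z)) \<in> ?K"
        using Hhat_zero[of t "G (t, z)"] nz by (force simp: in_cbox_complex_iff)
      from R(2)[OF this] z show False by (simp add: G)
    qed
    show "H (z, t) = 0" if "t \<le> 0 \<or> 1 \<le> t" for z t unfolding H_def by (rule Hhat_zero) (use that in auto)
  qed (use HC R in auto)
  interpret ham_flow H "R + 1" by (rule hf)
  define W where "W z t = G (t, Phi (t, z))" for z t
  have LW: "LamT (t, W z t) = Phi (t, z)" for z t by (simp add: W_def G)
  have "((\<lambda>t. Im (W z t)) has_vector_derivative 0) (at t)" for z t
  proof -
    define W' where "W' = FD G (t, Phi (t, z)) (1, X (Phi (t, z), t))"
    have dW: "((\<lambda>t. W z t) has_vector_derivative W') (at t)"
      unfolding W_def W'_def
      by (rule FD_compose_vector[OF G(1)]) (intro has_vector_derivative_Pair has_vector_derivative_id Phi_props)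
    let ?q = "(t, W z t)"
    let ?A = "FD LamT ?q (1, 0)" and ?B = "FD LamT ?q (0, 1)" and ?C = "FD LamT ?q (0, \<i>)"
    have l: "linear (FD LamT ?q)" by (rule linear_FD[OF LamTC])
    have "((\<lambda>t. LamT (t, W z t)) has_vector_derivative FD LamT ?q (1, W')) (at t)"
      by (rule FD_compose_vector[OF LamTC]) (intro has_vector_derivative_Pair has_vector_derivative_id dW)
    then have "((\<lambda>t. Phi (t, z)) has_vector_derivative FD LamT ?q (1, W')) (at t)" by (simp add: LW)
    from vector_derivative_unique_at[OF this Phi_props(3)] have "FD LamT ?q (1, W') = X (Phi (t, z), t)" .
    moreover have "FD LamT ?q (1, W') = ?A + Re W' *\<^sub>R ?B + Im W' *\<^sub>R ?C"
    proof -
      have e: "(1, W') = (1, 0) + Re W' *\<^sub>R (0, 1) + Im W' *\<^sub>R (0, \<i>)" by (simp add: complex_eq_iff)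
      show ?thesis unfolding e by (simp only: linear_add[OF l] linear_scale[OF l])
    qed
    ultimately have X: "X (Phi (t, z), t) = ?A + Re W' *\<^sub>R ?B + Im W' *\<^sub>R ?C" by simp
    have "((\<lambda>r. (LamT (t, W z t + of_real r), t)) has_vector_derivative (?B, 0)) (at 0)"
    proof (intro has_vector_derivative_Pair has_vector_derivative_const)
      have "((\<lambda>r. (t, W z t + of_real r)) has_vector_derivative (0, 1)) (at 0)" by (auto intro!: derivative_eq_intros)
      from FD_compose_vector[OF LamTC this] show "((\<lambda>r. LamT (t, W z t + of_real r)) has_vector_derivative ?B) (at 0)" by simp
    qed
    from FD_compose_vector[OF HC this]
    have "((\<lambda>r. H (LamT (t, W z t + of_real r), t)) has_vector_derivative FD H (Phi (t, z), t) (?B, 0)) (at 0)" by (simp add: LW)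
    moreover have "H (LamT (t, W z t + of_real r), t) = Hhat (t, W z t + of_real r)" for r by (simp add: H_def G)
    moreover have "((\<lambda>r. Hhat (t, W z t + of_real r)) has_vector_derivative FD Hhat ?q (0, 1)) (at 0)"
    proof -
      have "((\<lambda>r. (t, W z t + of_real r)) has_vector_derivative (0, 1)) (at 0)" by (auto intro!: derivative_eq_intros)
      from FD_compose_vector[OF HhatC this] show ?thesis by simp
    qed
    ultimately have "FD H (Phi (t, z), t) (?B, 0) = FD Hhat ?q (0, 1)"
      using vector_derivative_unique_at by fastforce
    \<comment> \<open>Pairing with the leaf direction \<open>?B\<close> removes the velocity along
      the leaf, and by \<open>FD_Hhat\<close> also the motion of the family. What remains is the
      transverse velocity \<open>Im W'\<close> times a nonzero determinant.\<close>
    then have "om (X (Phi (t, z), t)) ?B = om ?A ?B" by (simp add: FD_hfield[OF HC] FD_Hhat)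
    then have "Im W' * om ?C ?B = 0" unfolding X by (simp add: om_add_left om_scaleR_left)
    moreover have "om ?C ?B \<noteq> 0" using LamT_jac[of ?q] om_swap[of ?C ?B] by simp
    ultimately have "Im W' = 0" by simp
    then show ?thesis using bounded_linear.has_vector_derivative[OF bounded_linear_Im dW] by simp
  qed
  then have "Im (W z 1) = Im (W z 0)" for z by (intro constant_of_zero_vector_derivative[of UNIV "\<lambda>t. Im (W z t)"]) auto
  moreover have "W z 0 = z" for z using G(2)[of 0 z] by (simp add: W_def Phi_props LamT_0)
  ultimately show thesis using that[OF hf] LW by metis
qed

end

section \<open>Every compactly supported area-preserving map is Hamiltonian\<close>

lemma om_linear_det: "linear T \<Longrightarrow> om (T a) (T b) = om (T 1) (T \<i>) * om a b"
  by (subst (1 2) complex_linear_expand, assumption) (simp add: om_def algebra_simps)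

lemma om_nondegenerate: "(\<And>v. om a v = om b v) \<Longrightarrow> a = b"
  using om_def[of a 1] om_def[of b 1] om_def[of a \<i>] om_def[of b \<i>] by (simp add: complex_eq_iff)

lemma FD_id_outside:
  assumes "\<And>z. r \<le> norm z \<Longrightarrow> f z = z" "norm z > r"
  shows "FD f z = (\<lambda>v. v :: complex)"
proof (rule FD_eq, rule has_derivative_transform_within_open)
  show "((\<lambda>z. z) has_derivative (\<lambda>v. v)) (at z)" by simp
  show "open (- cball (0::complex) r)" by (simp add: open_Compl)
qed (use assms in auto)

text \<open>\<open>psi\<close> carries the leaves of the field of angle \<open>th\<close> to
  horizontal lines. After the straightening isotopy the composition \<open>chi\<close> therefore
  sends the line of height c into an explicit graph over x, and preservation of area leaves only the
  identity.\<close>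

lemma plane_isotopy:
  assumes psi: "Cinf psi" and jac: "\<And>z. om (FD psi z 1) (FD psi z \<i>) = 1"
    and out: "\<And>z. norm z \<ge> 1 \<Longrightarrow> psi z = z" and ins: "\<And>z. norm z \<le> 1 \<Longrightarrow> norm (psi z) \<le> 1"
  obtains H R where "ham_flow H R" "\<And>z. psi (ham_flow.Phi H (1, z)) = z"
proof -
  have lpsi: "linear (FD psi z)" for z by (rule linear_FD[OF psi])
  \<comment> \<open>The field that \<open>psi\<close> maps to the constant field 1, written by
    Cramer's rule with determinant 1.\<close>
  define X0 where "X0 z = Complex (Im (FD psi z \<i>)) (- Im (FD psi z 1))" for z
  have X0C: "Cinf X0" unfolding X0_def by (intro smooth_intros Cinf_FD psi)
  have X0psi: "FD psi z (X0 z) = 1" for z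
    using jac[of z] by (subst complex_linear_expand[OF lpsi]) (simp add: X0_def complex_eq_iff om_def algebra_simps)
  have "X0 z \<noteq> 0" for z using X0psi[of z] linear_0[OF lpsi] by (metis zero_neq_one)
  moreover have "X0 z = 1" if "norm z > 1" for z
    using FD_id_outside[of 1 psi z] out that by (simp add: X0_def complex_eq_iff)
  ultimately obtain th where th: "Cinf th" "\<And>z. norm z \<ge> 1 \<Longrightarrow> th z = 0" "\<And>z. X0 z = norm (X0 z) *\<^sub>R cis (th z)"
    using smooth_angle[OF X0C] by blast
  have key: "norm (X0 z) *\<^sub>R FD psi z (cis (th z)) = 1" for z
    using X0psi[of z] th(3)[of z] linear_scale[OF lpsi] by metis
  have key_Im: "Im (FD psi z (cis (th z))) = 0" for z
    using arg_cong[OF key[of z], of Im] \<open>\<And>z. X0 z \<noteq> 0\<close> by simp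
  have tr: "transversal th"
  proof -
    have "compact (X0 ` cball 0 1)" by (intro compact_continuous_image Cinf_continuous X0C) auto
    then obtain B where B: "B > 0" "\<And>z. z \<in> cball 0 1 \<Longrightarrow> norm (X0 z) \<le> B"
      using compact_imp_bounded[of "X0 ` cball 0 1"] unfolding bounded_pos by blast
    have B': "norm (X0 z) \<le> max B 1" for z
      using B(2)[of z] \<open>\<And>z. norm z > 1 \<Longrightarrow> X0 z = 1\<close>[of z] by (cases "norm z \<le> 1") auto
    show ?thesis unfolding transversal_def
    \<comment> \<open>\<open>Re (psi z)\<close> grows along \<open>X0\<close> at rate exactly 1,
      hence at rate 1/|X0| along its unit direction.\<close>
    proof (rule exI[of _ "\<lambda>z. Re (psi z)"], rule exI[of _ "1 / max B 1"], rule exI[of _ 2], intro conjI allI)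
      show "Cinf (\<lambda>z. Re (psi z))" by (intro smooth_intros psi)
      fix z
      have "FD (\<lambda>z. Re (psi z)) z = (\<lambda>v. Re (FD psi z v))"
        by (rule FD_eq) (intro has_derivative_Re Cinf_has_derivative psi)
      moreover have "norm (X0 z) * Re (FD psi z (cis (th z))) = 1" using arg_cong[OF key[of z], of Re] by simp
      then have "Re (FD psi z (cis (th z))) = 1 / norm (X0 z)"
        using \<open>\<And>z. X0 z \<noteq> 0\<close>[of z] by (simp add: field_simps)
      moreover have "1 / max B 1 \<le> 1 / norm (X0 z)"
        using B'[of z] \<open>\<And>z. X0 z \<noteq> 0\<close>[of z] by (intro divide_left_mono mult_pos_pos) auto
      ultimately show "1 / max B 1 \<le> FD (\<lambda>z. Re (psi z)) z (cis (th z))" by simp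
      show "\<bar>Re (psi z) - Re z\<bar> \<le> 2"
      proof (cases "norm z \<ge> 1")
        case False
        then show ?thesis using ins[of z] abs_Re_le_cmod[of "psi z"] abs_Re_le_cmod[of z] by simp
      qed (simp add: out)
    qed (auto simp: max_def)
  qed
  interpret leaf_family th by unfold_locales (use th tr in auto)
  obtain H R where hs: "ham_flow H R" "\<And>z. \<exists>w. LamT (1, w) = ham_flow.Phi H (1, z) \<and> Im w = Im z"
    by (rule straightening) (rule that)
  interpret ham_flow H R by (rule hs(1))
  have Im_psi: "Im (psi (Lam (1, w))) = Im w" for w
  proof -
    define c where "c = Im w"
    have "((\<lambda>r. Im (psi (Lam (1, Complex r c)))) has_vector_derivative 0) (at r)" for r
    proof -
      have "((\<lambda>r. (1, Complex r c)) has_vector_derivative (0, 1)) (at r)"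
        unfolding Complex_eq by (auto intro!: derivative_eq_intros)
      from FD_compose_vector[OF psi FD_compose_vector[OF LamC this]]
      have "((\<lambda>r. psi (Lam (1, Complex r c))) has_vector_derivative
          FD psi (Lam (1, Complex r c)) (V (1, Lam (1, Complex r c)))) (at r)" by (simp add: FD_Lam_1)
      from bounded_linear.has_vector_derivative[OF bounded_linear_Im this] show ?thesis
        by (simp add: V_def ang_def smooth_step_ge1 key_Im)
    qed
    then have "Im (psi (Lam (1, Complex (Re w) c))) = Im (psi (Lam (1, Complex (-2) c)))"
      by (intro constant_of_zero_vector_derivative[of UNIV "\<lambda>r. Im (psi (Lam (1, Complex r c)))"]) auto
    moreover have "Lam (1, Complex (-2) c) = Complex (-2) c" by (rule Lam_left) simp
    moreover have "psi (Complex (-2) c) = Complex (-2) c"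
      using abs_Re_le_cmod[of "Complex (-2) c"] by (intro out) simp
    ultimately show ?thesis by (simp add: c_def)
  qed
  have psi_Re: "psi z = z" if "Re z \<ge> 1" for z using that complex_Re_le_cmod[of z] by (intro out) simp
  \<comment> \<open>\<open>psi\<close> is the identity right of the disk and preserves labels, so at
    s = 1 every leaf leaves at the height at which it entered.\<close>
  have gT1: "gT (1, c) = c" for c
    using Im_psi[of "Complex T0 c"] psi_Re[OF T0(2)[of 1 c]] by (simp add: gT_def)
  define eps where "eps c = ee (1, c)" for c
  have LamT1: "LamT (1, w) = Lam (1, w) - \<i> * of_real (kap (Re (Lam (1, w))) * eps (Im w))" for w
    by (simp add: LamT_def pt_def kf_def gT1 eps_def)
  define chi where "chi z = psi (Phi (1, z))" for z
  have chiC: "Cinf chi" unfolding chi_def by (intro Cinf_compose[OF psi] Cinf_compose[OF Phi_props(1)] smooth_intros)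
  have Im_chi: "Im (chi z) = Im z - kap (Re (chi z)) * eps (Im z)" for z
  proof -
    obtain w where w: "LamT (1, w) = Phi (1, z)" "Im w = Im z" using hs(2) by blast
    show ?thesis
    proof (cases "Re (Lam (1, w)) \<le> 3")
      case True
      then have e: "chi z = psi (Lam (1, w))" by (simp add: chi_def w(1)[symmetric] LamT1 kap_zero)
      have "Re (psi (Lam (1, w))) \<le> 3"
      proof (cases "norm (Lam (1, w)) \<ge> 1")
        case False
        then show ?thesis using ins[of "Lam (1, w)"] complex_Re_le_cmod[of "psi (Lam (1, w))"] by simp
      qed (use True out in simp)
      then show ?thesis using Im_psi[of w] w(2) by (simp add: e kap_zero)
    next
      case False
      then have "chi z = LamT (1, w)" unfolding chi_def w(1)[symmetric] by (intro psi_Re) simp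
      then show ?thesis using Im_psi[of w] psi_Re[of "Lam (1, w)"] False w(2) by (simp add: LamT1)
    qed
  qed
  have chi_jac: "om (FD chi z 1) (FD chi z \<i>) = 1" for z
  proof -
    have "(chi has_derivative (\<lambda>v. FD psi (Phi (1, z)) (FD Phi (1, z) (0, v)))) (at z)"
      unfolding chi_def by (rule FD_compose[OF psi FD_partial_right[OF Phi_props(1)]])
    from FD_eq[OF this] show ?thesis
      using om_linear_det[OF lpsi[of "Phi (1, z)"]] jac[of "Phi (1, z)"] Phi_jac[of 1 z] by simp
  qed
  have chi_out: "chi z = z" if "norm z > R" "norm z \<ge> 1" for z
    using that by (simp add: chi_def Phi_static out)
  define N where "N = R + 4 + ell"
  have N: "N > R" "N \<ge> 3 + ell" "N \<ge> 1" using R ell by (auto simp: N_def)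
  \<comment> \<open>Determinant 1 says that the r-derivative of \<open>Re chi\<close> times 1 - kap
    (Re chi) * eps'(c) is 1, and \<open>Kk\<close> is an antiderivative of \<open>kap\<close>. The
    constant of integration is read off at the far left, where \<open>chi\<close> is the
    identity.\<close>
  have main: "Re (chi (Complex r c)) - Kk (Re (chi (Complex r c))) * FD ee (1, c) (0, 1) = r" for r c
  proof -
    let ?e = "FD ee (1, c) (0, 1)"
    have d: "((\<lambda>r. Re (chi (Complex r c)) - Kk (Re (chi (Complex r c))) * ?e - r) has_vector_derivative 0) (at r)" for r
    proof -
      let ?z = "Complex r c"
      have cr: "((\<lambda>r. Complex r c) has_vector_derivative 1) (at r)" and ci: "((\<lambda>c. Complex r c) has_vector_derivative \<i>) (at c)"
        unfolding Complex_eq by (auto intro!: derivative_eq_intros)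
      let ?p = "FD chi ?z 1" and ?q = "FD chi ?z \<i>" and ?k = "FD kap (Re (chi ?z)) 1"
      have pr: "((\<lambda>r. Re (chi (Complex r c))) has_vector_derivative Re ?p) (at r)"
        by (rule bounded_linear.has_vector_derivative[OF bounded_linear_Re FD_compose_vector[OF chiC cr]])
      have qr: "((\<lambda>c. Re (chi (Complex r c))) has_vector_derivative Re ?q) (at c)"
        by (rule bounded_linear.has_vector_derivative[OF bounded_linear_Re FD_compose_vector[OF chiC ci]])
      have kl: "FD kap y x = x * FD kap y 1" for x y :: real
        using linear_scale[OF linear_FD[OF kapC], of y x 1] by simp
      have p: "Im ?p = - (Re ?p * ?k * eps c)"
      proof -
        have "((\<lambda>r. kap (Re (chi (Complex r c)))) has_vector_derivative Re ?p * ?k) (at r)"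
          using FD_compose_vector[OF kapC pr] by (simp only: kl[of _ "Re ?p"])
        then have d1: "((\<lambda>r. c - kap (Re (chi (Complex r c))) * eps c) has_vector_derivative 0 - (Re ?p * ?k) * eps c) (at r)"
          by (intro has_vector_derivative_diff has_vector_derivative_mult_left has_vector_derivative_const)
        have "((\<lambda>r. Im (chi (Complex r c))) has_vector_derivative Im ?p) (at r)"
          by (rule bounded_linear.has_vector_derivative[OF bounded_linear_Im FD_compose_vector[OF chiC cr]])
        then have d2: "((\<lambda>r. c - kap (Re (chi (Complex r c))) * eps c) has_vector_derivative Im ?p) (at r)"
          by (simp add: Im_chi)
        from vector_derivative_unique_at[OF d2 d1] show ?thesis by simp
      qed
      have q: "Im ?q = 1 - (kap (Re (chi ?z)) * ?e + Re ?q * ?k * eps c)"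
      proof -
        have "(eps has_vector_derivative ?e) (at c)"
          unfolding eps_def[abs_def] by (rule FD_compose_vector[OF ee(1)]) (auto intro!: derivative_eq_intros)
        moreover have "((\<lambda>c. kap (Re (chi (Complex r c)))) has_vector_derivative Re ?q * ?k) (at c)"
          using FD_compose_vector[OF kapC qr] by (simp only: kl[of _ "Re ?q"])
        ultimately have d1: "((\<lambda>c. c - kap (Re (chi (Complex r c))) * eps c) has_vector_derivative
            1 - (kap (Re (chi ?z)) * ?e + (Re ?q * ?k) * eps c)) (at c)"
          by (intro has_vector_derivative_diff has_vector_derivative_id has_vector_derivative_mult)
        have "((\<lambda>c. Im (chi (Complex r c))) has_vector_derivative Im ?q) (at c)"
          by (rule bounded_linear.has_vector_derivative[OF bounded_linear_Im FD_compose_vector[OF chiC ci]])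
        then have d2: "((\<lambda>c. c - kap (Re (chi (Complex r c))) * eps c) has_vector_derivative Im ?q) (at c)"
          by (simp add: Im_chi)
        from vector_derivative_unique_at[OF d2 d1] show ?thesis by simp
      qed
      have one: "Re ?p * (1 - kap (Re (chi ?z)) * ?e) = 1"
        using chi_jac[of ?z] by (simp add: om_def p q algebra_simps)
      have "((\<lambda>r. Kk (Re (chi (Complex r c)))) has_vector_derivative Re ?p *\<^sub>R kap (Re (chi ?z))) (at r)"
        using vector_diff_chain_at[OF pr Kk_der] by (simp add: o_def)
      then have "((\<lambda>r. Re (chi (Complex r c)) - Kk (Re (chi (Complex r c))) * ?e - r) has_vector_derivative
          Re ?p - (Re ?p *\<^sub>R kap (Re (chi ?z))) * ?e - 1) (at r)"
        by (intro has_vector_derivative_diff has_vector_derivative_mult_left pr has_vector_derivative_id)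
      then show ?thesis using one by (simp add: algebra_simps)
    qed
    have "Re (chi (Complex r c)) - Kk (Re (chi (Complex r c))) * ?e - r
        = Re (chi (Complex (- N) c)) - Kk (Re (chi (Complex (- N) c))) * ?e - (- N)"
      by (rule constant_of_zero_vector_derivative[of UNIV "\<lambda>r. Re (chi (Complex r c)) - Kk (Re (chi (Complex r c))) * ?e - r"])
        (use d in auto)
    moreover have "chi (Complex (- N) c) = Complex (- N) c"
      using abs_Re_le_cmod[of "Complex (- N) c"] N by (intro chi_out) auto
    ultimately show ?thesis using N ell by (simp add: Kk_simps)
  qed
  \<comment> \<open>At the far right \<open>chi\<close> is again the identity, but now
    \<open>Kk\<close> has the value 1.\<close>
  have e0: "FD ee (1, c) (0, 1) = 0" for c
  proof -
    have "chi (Complex N c) = Complex N c" using abs_Re_le_cmod[of "Complex N c"] N by (intro chi_out) auto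
    then show ?thesis using main[of N c] N by (simp add: Kk_simps)
  qed
  have eps0: "eps c = 0" for c
  proof -
    have "(eps has_vector_derivative FD ee (1, c) (0, 1)) (at c)" for c
      unfolding eps_def[abs_def] by (rule FD_compose_vector[OF ee(1)]) (auto intro!: derivative_eq_intros)
    then have "(eps has_vector_derivative 0) (at c)" for c using e0 by simp
    then have "eps c = eps 1" by (intro constant_of_zero_vector_derivative[of UNIV eps]) auto
    then show ?thesis by (simp add: eps_def ee_zero)
  qed
  have "chi z = z" for z
    using main[of "Re z" "Im z"] Im_chi[of z] by (simp add: e0 eps0 complex_eq_iff)
  then show thesis using that[OF hs(1)] by (simp add: chi_def)
qed

lemma FD_smooth_step_zero: "x \<le> 0 \<or> x \<ge> 1 \<Longrightarrow> FD smooth_step x 1 = 0"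
proof -
  assume x: "x \<le> 0 \<or> x \<ge> 1"
  have c: "continuous_on A (\<lambda>x. FD smooth_step x 1)" for A by (intro Cinf_continuous Cinf_FD Cinf_smooth_step smooth_intros)
  have 0: "FD smooth_step y 1 = 0" if "y < 0" for y
  proof -
    have "(smooth_step has_derivative (\<lambda>h. 0)) (at y)"
      by (rule has_derivative_transform_within_open[of "\<lambda>c. 0" _ _ _ "{..<0}"]) (use that smooth_step_le0 in auto)
    from FD_eq[OF this] show ?thesis by simp
  qed
  have 1: "FD smooth_step y 1 = 0" if "y > 1" for y
  proof -
    have "(smooth_step has_derivative (\<lambda>h. 0)) (at y)"
      by (rule has_derivative_transform_within_open[of "\<lambda>c. 1" _ _ _ "{1<..}"]) (use that smooth_step_ge1 in auto)
    from FD_eq[OF this] show ?thesis by simp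
  qed
  have "FD smooth_step x 1 = 0" if "x \<in> closure {..<0}"
    by (rule continuous_constant_on_closure[OF c _ that]) (simp add: 0)
  moreover have "FD smooth_step x 1 = 0" if "x \<in> closure {1<..}"
    by (rule continuous_constant_on_closure[OF c _ that]) (simp add: 1)
  ultimately show ?thesis using x by (metis atLeast_iff atMost_iff closure_lessThan closure_greaterThan)
qed

text \<open>The isotopy of the plane is shrunk into the disk; afterwards the shrunken map is blown up
  again by conjugation with dilations. The Hamiltonian of the latter isotopy is given by the action.\<close>
lemma disk_isotopy:
  assumes phi: "Cinf phi" "Cinf phi'" "\<And>z. phi' (phi z) = z" "\<And>z. phi (phi' z) = z"
    and jac: "\<And>z. om (FD phi z 1) (FD phi z \<i>) = 1" and r0: "r0 < 1" "\<And>z. norm z \<ge> r0 \<Longrightarrow> phi z = z"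
  obtains H r where "ham_flow H r" "r < 1" "\<And>z. ham_flow.Phi H (1, z) = phi z"
proof -
  have lphi: "linear (FD phi z)" "linear (FD phi' z)" for z using linear_FD phi by auto
  have inv: "FD phi (phi' z) (FD phi' z v) = v" for z v
  proof -
    have "((\<lambda>z. phi (phi' z)) has_derivative (\<lambda>v. FD phi (phi' z) (FD phi' z v))) (at z)"
      by (rule FD_compose[OF phi(1) Cinf_has_derivative[OF phi(2)]])
    then have "((\<lambda>z. z) has_derivative (\<lambda>v. FD phi (phi' z) (FD phi' z v))) (at z)" by (simp add: phi)
    from fun_cong[OF has_derivative_unique[OF this has_derivative_ident]] show ?thesis .
  qed
  have out': "phi' z = z" if "norm z \<ge> r0" for z using r0(2)[OF that] phi(3)[of z] by simp
  \<comment> \<open>The inverse map is straightened, so that the isotopy itself ends at phi.\<close>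
  obtain H0 R0 where H0: "ham_flow H0 R0" "\<And>z. phi' (ham_flow.Phi H0 (1, z)) = z"
  proof (rule plane_isotopy[OF phi(2)])
    show "om (FD phi' z 1) (FD phi' z \<i>) = 1" for z
      using om_linear_det[OF lphi(1)[of "phi' z"], of "FD phi' z 1" "FD phi' z \<i>"] jac[of "phi' z"]
      by (simp add: inv) (simp add: om_def)
    show "norm (phi' z) \<le> 1" if "norm z \<le> 1" for z
    proof (rule ccontr)
      assume n: "\<not> norm (phi' z) \<le> 1"
      then have "phi (phi' z) = phi' z" using r0 by (intro r0(2)) simp
      then show False using n that by (simp add: phi)
    qed
  qed (use out' r0(1) in auto)
  interpret h: ham_flow H0 R0 by (rule H0(1))
  let ?P = "h.Phi"
  have P1: "?P (1, z) = phi z" for z using H0(2)[of z] phi(4)[of "?P (1, z)"] by simp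
  define lam where "lam z = (\<i> / 2) * z" for z
  have lamC: "Cinf lam" unfolding lam_def by (intro smooth_intros)
  have "(lam has_derivative (\<lambda>v. (\<i> / 2) * v)) (at z)" for z
    unfolding lam_def by (intro has_derivative_mult_right has_derivative_ident)
  note Flam = FD_eq[OF this]
  have lam_om: "lam z \<bullet> v = om z v / 2" for z v by (simp add: lam_def om_def inner_complex_def)
  obtain a where a_int: "\<And>z. a z = integral {0..1} (\<lambda>t. H0 (?P (t, z), t) + lam (?P (t, z)) \<bullet> h.X (?P (t, z), t))"
    and a: "Cinf a" "\<And>z. R0 < norm z \<Longrightarrow> a z = 0"
    "\<And>z h. \<forall>s u v. FD lam (?P (s, z)) u \<bullet> v - FD lam (?P (s, z)) v \<bullet> u = om u v \<Longrightarrow>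
      FD a z h = lam (?P (1, z)) \<bullet> FD ?P (1, z) (0, h) - lam z \<bullet> h"
    by (rule h.flow_action[OF lamC]) (rule that, assumption+)
  have FP1: "FD ?P (1, z) (0, v) = FD phi z v" for z v
  proof -
    have "(phi has_derivative (\<lambda>v. FD ?P (1, z) (0, v))) (at z)"
      using FD_partial_right[OF h.Phi_props(1), of 1 z] by (simp add: P1)
    from FD_eq[OF this] show ?thesis by simp
  qed
  have da: "FD a z h = om (phi z) (FD phi z h) / 2 - om z h / 2" for z h
  proof -
    have "\<forall>s u v. FD lam (?P (s, z)) u \<bullet> v - FD lam (?P (s, z)) v \<bullet> u = om u v"
      by (simp add: Flam om_def inner_complex_def field_simps)
    from a(3)[OF this] show ?thesis by (simp add: P1 FP1 lam_om)
  qed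
  \<comment> \<open>The differential of the action vanishes where phi is the identity; the
    complement of the disk of radius r0 is connected and reaches out to where a is 0.\<close>
  have a_out: "a z = 0" if "norm z > r0" for z
  proof -
    let ?E = "- cball (0::complex) r0"
    have "connected ?E" by (rule connected_complement_bounded_convex) auto
    moreover have "(a has_derivative (\<lambda>h. 0)) (at z within ?E)" if "z \<in> ?E" for z
    proof -
      have "FD a z = (\<lambda>h. 0)" using FD_id_outside[of r0 phi z] r0(2) that by (auto simp: da)
      then show ?thesis using Cinf_has_derivative[OF a(1), of z] by (simp add: has_derivative_at_withinI)
    qed
    ultimately have "a constant_on ?E"
      using has_derivative_zero_connected_constant_on[of ?E "{}" a] Cinf_continuous[OF a(1)] by auto
    then obtain c where c: "\<And>z. z \<in> ?E \<Longrightarrow> a z = c" unfolding constant_on_def by blast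
    define y where "y = complex_of_real (\<bar>r0\<bar> + \<bar>R0\<bar> + 1)"
    have "norm y = \<bar>r0\<bar> + \<bar>R0\<bar> + 1" unfolding y_def by (subst norm_of_real) simp
    then have "y \<in> ?E" "a y = 0" using a(2)[of y] by auto
    then show ?thesis using c that by (metis ComplI dist_0_norm leD mem_cball)
  qed
  \<comment> \<open>At this scale the support, of radius R0, shrinks to radius less than
    1/2.\<close>
  define \<epsilon> where "\<epsilon> = 1 / (2 * (R0 + 1))"
  have \<epsilon>: "0 < \<epsilon>" "\<epsilon> \<le> 1 / 2" "\<epsilon> * (2 * (R0 + 1)) = 1" using h.R by (auto simp: \<epsilon>_def)
  \<comment> \<open>On [0, 1/2] the scale is \<epsilon> and the clock \<open>b\<close> of the
    isotopy runs from 0 to 1; on [1/2, 1] the clock rests and the scale rises to 1.\<close>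
  define mu where "mu t = \<epsilon> + (1 - \<epsilon>) * smooth_step (2 * t - 1)" for t
  define dmu where "dmu t = (1 - \<epsilon>) * (2 * FD smooth_step (2 * t - 1) 1)" for t
  define b where "b t = smooth_step (2 * t)" for t
  define db where "db t = 2 * FD smooth_step (2 * t) 1" for t
  have stepl: "FD smooth_step x y = y * FD smooth_step x 1" for x y :: real
    using linear_scale[OF linear_FD[OF Cinf_smooth_step], of x y 1] by simp
  have mu_d: "(mu has_vector_derivative dmu t) (at t)" for t
  proof -
    have "((\<lambda>t. 2 * t - 1) has_vector_derivative 2) (at t)" for t :: real by (auto intro!: derivative_eq_intros)
    from FD_compose_vector[OF Cinf_smooth_step this]
    have "((\<lambda>t. smooth_step (2 * t - 1)) has_vector_derivative 2 * FD smooth_step (2 * t - 1) 1) (at t)" by (simp add: stepl[of _ 2])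
    from has_vector_derivative_add[OF has_vector_derivative_const[of \<epsilon>] has_vector_derivative_mult_right[OF this, of "1 - \<epsilon>"]]
    show ?thesis by (simp add: mu_def[abs_def] dmu_def)
  qed
  have b_d: "(b has_vector_derivative db t) (at t)" for t
  proof -
    have "((\<lambda>t. 2 * t) has_vector_derivative 2) (at t)" for t :: real by (auto intro!: derivative_eq_intros)
    from FD_compose_vector[OF Cinf_smooth_step this] show ?thesis by (simp add: stepl[of _ 2] b_def[abs_def] db_def)
  qed
  have mu: "\<epsilon> \<le> mu t" "mu t \<le> 1" "mu t > 0" for t
  proof -
    show "\<epsilon> \<le> mu t" using smooth_step_range[of "2 * t - 1"] \<epsilon> by (simp add: mu_def)
    have "(1 - \<epsilon>) * smooth_step (2 * t - 1) \<le> (1 - \<epsilon>) * 1"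
      using smooth_step_range[of "2 * t - 1"] \<epsilon> by (intro mult_left_mono) auto
    then show "mu t \<le> 1" by (simp add: mu_def)
    show "mu t > 0" using \<open>\<epsilon> \<le> mu t\<close> \<epsilon> by simp
  qed
  have db0: "db t = 0" if "t \<le> 0 \<or> t \<ge> 1 / 2" for t using that by (auto simp: db_def intro!: FD_smooth_step_zero)
  have dmu0: "dmu t = 0" if "t \<le> 1 / 2 \<or> t \<ge> 1" for t using that by (auto simp: dmu_def intro!: FD_smooth_step_zero)
  have C: "Cinf mu" "Cinf dmu" "Cinf b" "Cinf db" unfolding mu_def dmu_def b_def db_def
    by (intro smooth_intros Cinf_compose[OF Cinf_smooth_step] Cinf_FD Cinf_smooth_step)+
  have C1: "Cinf (\<lambda>t. 1 / mu t)" by (intro Cinf_divide C smooth_intros) (use mu(3) in \<open>auto simp: less_le\<close>)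
  \<comment> \<open>Conjugation by a dilation multiplies the Hamiltonian by the square of the scale.
    Changing the scale at constant clock produces the field \<open>dmu\<close> times (p - D phi(w)
    w), where p = phi(w); in the coordinate mu p its Hamiltonian is 2 dmu mu a(w).\<close>
  define H1 where "H1 q = (mu (snd q))\<^sup>2 * db (snd q) * H0 ((1 / mu (snd q)) *\<^sub>R fst q, b (snd q))
      + 2 * dmu (snd q) * mu (snd q) * a (phi' ((1 / mu (snd q)) *\<^sub>R fst q))" for q
  have H1C: "Cinf H1" unfolding H1_def power2_eq_square
    by (intro smooth_intros Cinf_compose[OF C(1)] Cinf_compose[OF C(2)] Cinf_compose[OF C(3)] Cinf_compose[OF C(4)]
        Cinf_compose[OF C1] Cinf_compose[OF h.H] Cinf_compose[OF a(1)] Cinf_compose[OF phi(2)])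
  define r where "r = max (3 / 4) ((1 + r0) / 2)"
  have r: "r < 1" "r > r0" "r \<ge> 1 / 2" "r > 0" using r0(1) by (simp_all add: r_def max_def)
  have hf: "ham_flow H1 r"
  proof
    show "H1 (z, t) = 0" if z: "r \<le> norm z" for z t
    proof -
      have n: "norm ((1 / mu t) *\<^sub>R z) = norm z / mu t" using mu(3)[of t] by simp
      have "db t * H0 ((1 / mu t) *\<^sub>R z, b t) = 0"
      proof (cases "t \<le> 1 / 2")
        case True
        have "2 * r * (R0 + 1) \<ge> 1 * (R0 + 1)" using r h.R by (intro mult_right_mono) auto
        moreover have "r / \<epsilon> = 2 * r * (R0 + 1)" using h.R by (simp add: \<epsilon>_def)
        moreover have "r / \<epsilon> \<le> norm z / \<epsilon>" using z \<epsilon> by (intro divide_right_mono) auto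
        moreover have "mu t = \<epsilon>" using True by (simp add: mu_def smooth_step_le0)
        ultimately have "R0 \<le> norm ((1 / mu t) *\<^sub>R z)" unfolding n by simp
        then show ?thesis using h.supp_z by simp
      qed (simp add: db0)
      moreover have "norm z \<le> norm z / mu t" using mu[of t] mult_left_le[of "mu t" "norm z"] by (simp add: field_simps)
      then have "norm ((1 / mu t) *\<^sub>R z) > r0" unfolding n using z r by linarith
      then have "a (phi' ((1 / mu t) *\<^sub>R z)) = 0" using out'[of "(1 / mu t) *\<^sub>R z"] a_out by simp
      ultimately show ?thesis by (simp add: H1_def)
    qed
    show "H1 (z, t) = 0" if "t \<le> 0 \<or> 1 \<le> t" for z t
    proof -
      have "db t = 0" "dmu t = 0" using that by (auto intro!: db0 dmu0)
      then show ?thesis by (simp add: H1_def)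
    qed
  qed (use H1C r in auto)
  interpret k: ham_flow H1 r by (rule hf)
  have "mu t *\<^sub>R ?P (b t, (1 / mu t) *\<^sub>R z) = k.Phi (t, z)" for t z
  proof (rule k.Phi_unique[of "\<lambda>t. mu t *\<^sub>R ?P (b t, (1 / mu t) *\<^sub>R z)" 0])
    show "mu 0 *\<^sub>R ?P (b 0, (1 / mu 0) *\<^sub>R z) = k.Phi (0, z)"
      using mu(3)[of 0] by (simp add: b_def smooth_step_le0 h.Phi_props k.Phi_props)
    fix t
    define w where "w = (1 / mu t) *\<^sub>R z"
    define p where "p = ?P (b t, w)"
    have lP: "linear (FD ?P q)" for q by (rule linear_FD[OF h.Phi_props(1)])
    have "((\<lambda>t. 1 / mu t) has_vector_derivative - dmu t / (mu t)\<^sup>2) (at t)"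
      using mu_d[of t] mu(3)[of t] by (auto simp: has_real_derivative_iff_has_vector_derivative[symmetric] power2_eq_square
          intro!: derivative_eq_intros)
    then have "((\<lambda>t. (1 / mu t) *\<^sub>R z) has_vector_derivative (- dmu t / (mu t)\<^sup>2) *\<^sub>R z) (at t)"
      by (rule bounded_linear.has_vector_derivative[OF bounded_linear_scaleR_left])
    moreover have "(- dmu t / (mu t)\<^sup>2) *\<^sub>R z = (- dmu t / mu t) *\<^sub>R w" by (simp add: w_def power2_eq_square)
    ultimately have "((\<lambda>t. (b t, (1 / mu t) *\<^sub>R z)) has_vector_derivative (db t, (- dmu t / mu t) *\<^sub>R w)) (at t)"
      by (intro has_vector_derivative_Pair b_d) simp
    from FD_compose_vector[OF h.Phi_props(1) this]
    have dP: "((\<lambda>t. ?P (b t, (1 / mu t) *\<^sub>R z)) has_vector_derivative FD ?P (b t, w) (db t, (- dmu t / mu t) *\<^sub>R w)) (at t)"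
      by (simp add: w_def)
    have X0: "FD ?P (b t, w) (1, 0) = h.X (p, b t)"
      using fun_cong[OF has_derivative_unique[OF FD_partial_left[OF h.Phi_props(1)] h.Phi_props(3)[unfolded has_vector_derivative_def]], of "b t" w 1]
      by (simp add: p_def)
    have "FD ?P (b t, w) (db t, (- dmu t / mu t) *\<^sub>R w) = db t *\<^sub>R h.X (p, b t) - (dmu t / mu t) *\<^sub>R FD ?P (b t, w) (0, w)"
    proof -
      have "(db t, (- dmu t / mu t) *\<^sub>R w) = db t *\<^sub>R (1, 0) - (dmu t / mu t) *\<^sub>R (0, w)" by simp
      then show ?thesis by (simp only: linear_diff[OF lP] linear_scale[OF lP] X0)
    qed
    with dP have "((\<lambda>t. mu t *\<^sub>R ?P (b t, (1 / mu t) *\<^sub>R z)) has_vector_derivative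
        (mu t *\<^sub>R (db t *\<^sub>R h.X (p, b t) - (dmu t / mu t) *\<^sub>R FD ?P (b t, w) (0, w)) + dmu t *\<^sub>R p)) (at t)"
      using bounded_bilinear.has_vector_derivative[OF bounded_bilinear_scaleR mu_d] by (fastforce simp: p_def w_def)
    moreover have "mu t *\<^sub>R (db t *\<^sub>R h.X (p, b t) - (dmu t / mu t) *\<^sub>R FD ?P (b t, w) (0, w)) + dmu t *\<^sub>R p
        = (mu t * db t) *\<^sub>R h.X (p, b t) + dmu t *\<^sub>R (p - FD ?P (b t, w) (0, w))"
      using mu(3)[of t] by (simp add: algebra_simps)
    moreover have "k.X (mu t *\<^sub>R p, t) = (mu t * db t) *\<^sub>R h.X (p, b t) + dmu t *\<^sub>R (p - FD ?P (b t, w) (0, w))"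
    proof (rule om_nondegenerate)
      fix v :: complex
      let ?v = "(1 / mu t) *\<^sub>R v"
      have 1: "((\<lambda>y. mu t *\<^sub>R p + y *\<^sub>R v) has_vector_derivative v) (at 0)" by (auto intro!: derivative_eq_intros)
      have 2: "((\<lambda>y. (1 / mu t) *\<^sub>R (mu t *\<^sub>R p + y *\<^sub>R v)) has_vector_derivative ?v) (at 0)"
        by (rule bounded_linear.has_vector_derivative[OF bounded_linear_scaleR_right 1])
      have p0: "(1 / mu t) *\<^sub>R (mu t *\<^sub>R p + 0 *\<^sub>R v) = p" using mu(3)[of t] by simp
      have "((\<lambda>y. H0 ((1 / mu t) *\<^sub>R (mu t *\<^sub>R p + y *\<^sub>R v), b t)) has_vector_derivative FD H0 (p, b t) (?v, 0)) (at 0)"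
        using FD_compose_vector[OF h.H has_vector_derivative_Pair[OF 2 has_vector_derivative_const[of "b t"]]] p0 by simp
      moreover have "((\<lambda>y. a (phi' ((1 / mu t) *\<^sub>R (mu t *\<^sub>R p + y *\<^sub>R v)))) has_vector_derivative FD a (phi' p) (FD phi' p ?v)) (at 0)"
        using FD_compose_vector[OF a(1) FD_compose_vector[OF phi(2) 2]] p0 by simp
      ultimately have "((\<lambda>y. H1 (mu t *\<^sub>R p + y *\<^sub>R v, t)) has_vector_derivative
          ((mu t)\<^sup>2 * db t * FD H0 (p, b t) (?v, 0) + 2 * dmu t * mu t * FD a (phi' p) (FD phi' p ?v))) (at 0)"
        unfolding H1_def fst_conv snd_conv by (intro has_vector_derivative_add has_vector_derivative_mult_right)
      from FD_vector_curve[OF H1C has_vector_derivative_Pair[OF 1 has_vector_derivative_const[of t]] this]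
      have "om (k.X (mu t *\<^sub>R p, t)) v = (mu t)\<^sup>2 * db t * FD H0 (p, b t) (?v, 0) + 2 * dmu t * mu t * FD a (phi' p) (FD phi' p ?v)"
        by (simp add: FD_hfield[OF H1C])
      also have "(mu t)\<^sup>2 * db t * FD H0 (p, b t) (?v, 0) = mu t * db t * om (h.X (p, b t)) v"
        using mu(3)[of t] by (simp add: FD_hfield[OF h.H] om_scaleR_right power2_eq_square)
      \<comment> \<open>The derivative of the flow may be replaced by that of phi because
        \<open>dmu\<close> is 0 until \<open>b\<close> has reached 1.\<close>
      also have "2 * dmu t * mu t * FD a (phi' p) (FD phi' p ?v) = dmu t * om (p - FD ?P (b t, w) (0, w)) v"
      proof (cases "t \<le> 1 / 2")
        case True
        then show ?thesis by (simp add: dmu0)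
      next
        case False
        then have b1: "b t = 1" by (simp add: b_def smooth_step_ge1)
        then have pw: "p = phi w" "phi' p = w" by (auto simp: p_def P1 phi)
        have F: "FD phi w (FD phi' p u) = u" for u using inv[of p u] pw by simp
        have "om w (FD phi' p ?v) = om (FD phi w w) ?v"
          using om_linear_det[OF lphi(1)[of w], of w "FD phi' p ?v"] jac[of w] by (simp add: F)
        then have "FD a (phi' p) (FD phi' p ?v) = om p ?v / 2 - om (FD phi w w) ?v / 2"
          unfolding da pw(2) F by (simp add: pw(1))
        then have "FD a (phi' p) (FD phi' p ?v) = (om p v - om (FD phi w w) v) / (2 * mu t)"
          using mu(3)[of t] by (simp add: om_scaleR_right field_simps)
        then show ?thesis using mu(3)[of t] by (simp add: b1 FP1 om_diff_left)
      qed
      finally show "om (k.X (mu t *\<^sub>R p, t)) v = om ((mu t * db t) *\<^sub>R h.X (p, b t) + dmu t *\<^sub>R (p - FD ?P (b t, w) (0, w))) v"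
        by (simp add: om_add_left om_scaleR_left)
    qed
    ultimately show "((\<lambda>t. mu t *\<^sub>R ?P (b t, (1 / mu t) *\<^sub>R z)) has_vector_derivative
        k.X (mu t *\<^sub>R ?P (b t, (1 / mu t) *\<^sub>R z), t)) (at t)" by (simp add: p_def w_def)
  qed
  from this[of 1] have "k.Phi (1, z) = phi z" for z
    by (simp add: mu_def b_def smooth_step_ge1 P1)
  then show thesis using that[OF hf r(1)] by blast
qed

section \<open>Smooth maps of the closed disk\<close>

text \<open>The difference of two derivatives vanishes on all directions from x into S. These
  contain a ball, and differences within the ball give every direction. This determines derivatives
  on the boundary of the disk and of the cylinder.\<close>

lemma within_derivative_unique:
  fixes f :: "'a::euclidean_space \<Rightarrow> 'b::real_normed_vector"
  assumes S: "convex S" "interior S \<noteq> {}" "x \<in> S"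
    and A: "(f has_derivative A) (at x within S)" and B: "(f has_derivative B) (at x within S)"
  shows "A = B"
proof
  fix h :: 'a
  define L where "L v = A v - B v" for v
  have "bounded_linear L" unfolding L_def
    by (intro bounded_linear_sub has_derivative_bounded_linear[OF A] has_derivative_bounded_linear[OF B])
  then have lL: "linear L" by (rule bounded_linear.linear)
  have d: "((\<lambda>y. 0) has_derivative L) (at x within S)"
    using has_derivative_diff[OF A B] unfolding L_def[abs_def] by simp
  have L0: "L v = 0" if "x + v \<in> S" for v
  proof -
    have im: "(\<lambda>e. x + e *\<^sub>R v) ` {0..1} \<subseteq> S"
    proof clarify
      fix e :: real assume e: "e \<in> {0..1}"
      have "(1 - e) *\<^sub>R x + e *\<^sub>R (x + v) \<in> S" using convexD[OF S(1) S(3) that, of "1 - e" e] e by simp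
      then show "x + e *\<^sub>R v \<in> S" by (simp add: algebra_simps)
    qed
    have "((\<lambda>e. x + e *\<^sub>R v) has_derivative (\<lambda>e. e *\<^sub>R v)) (at 0 within {0..1})"
      by (auto intro!: derivative_eq_intros)
    moreover have "((\<lambda>y. 0 :: 'b) has_derivative L) (at (x + 0 *\<^sub>R v) within (\<lambda>e. x + e *\<^sub>R v) ` {0..1})"
      using has_derivative_subset[OF d im] by simp
    ultimately have "((\<lambda>e. 0) has_derivative (\<lambda>e. L (e *\<^sub>R v))) (at (0::real) within {0..1})"
      by (rule has_derivative_in_compose)
    then have "((\<lambda>e. 0) has_vector_derivative L v) (at (0::real) within {0..1})"
      by (simp add: has_vector_derivative_def linear_scale[OF lL])
    moreover have "((\<lambda>e. 0) has_vector_derivative 0) (at (0::real) within {0..1})" by simp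
    moreover have "at (0::real) within {0..1} \<noteq> bot" by (simp add: at_within_Icc_at_right)
    ultimately show ?thesis using vector_derivative_unique_within by blast
  qed
  obtain y e where y: "e > 0" "ball y e \<subseteq> S" using S(2) by (auto simp: mem_interior ex_in_conv[symmetric])
  define A1 where "A1 = norm h + 1"
  define s where "s = e / (2 * A1)"
  have n1: "A1 > 0" by (simp add: A1_def add_nonneg_pos)
  have s: "s > 0" "s * norm h < e"
  proof -
    show "s > 0" using y(1) n1 by (simp add: s_def)
    have "s * norm h \<le> s * A1" using \<open>s > 0\<close> by (simp add: A1_def)
    also have "\<dots> = e / 2" using n1 by (simp add: s_def)
    finally show "s * norm h < e" using y(1) by simp
  qed
  have "y + s *\<^sub>R h \<in> ball y e" using s by (simp add: dist_norm)
  then have "L (y - x) = 0" "L (y - x + s *\<^sub>R h) = 0" using y by (auto intro!: L0 simp: algebra_simps subset_iff)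
  then have "s *\<^sub>R L h = 0" by (simp add: linear_add[OF lL] linear_scale[OF lL])
  then show "A h = B h" using s by (simp add: L_def)
qed

lemma Cinf_extension:
  assumes "smooth_on Disk f"
  obtains g where "Cinf g" "\<And>z. z \<in> Disk \<Longrightarrow> g z = f z"
proof -
  obtain U f0 where U: "open U" "Disk \<subseteq> U" "\<And>x. x \<in> Disk \<Longrightarrow> f0 x = f x" "Cinf_on U f0"
    using assms unfolding smooth_on_def Cinf_on_def by metis
  obtain e where e: "e > 0" "{x. infdist x Disk \<le> e} \<subseteq> U"
    using compact_in_open_separated[of Disk U] U(1,2) by auto
  have U': "z \<in> U" if "norm z < 1 + e" for z
  proof (cases "norm z \<le> 1")
    case False
    have "z \<noteq> 0" using False by (metis norm_zero zero_le_one)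
    then have "infdist z Disk \<le> dist z (z /\<^sub>R norm z)" by (intro infdist_le) simp
    also have "dist z (z /\<^sub>R norm z) = \<bar>1 - 1 / norm z\<bar> * norm z"
    proof -
      have "z - z /\<^sub>R norm z = (1 - 1 / norm z) *\<^sub>R z" by (simp add: scaleR_left_diff_distrib divide_inverse)
      then show ?thesis by (simp only: dist_norm norm_scaleR real_norm_def)
    qed
    also have "\<dots> = norm z - 1" using False \<open>z \<noteq> 0\<close> by (simp add: abs_if field_simps)
    finally show ?thesis using that e by auto
  qed (use U(2) in auto)
  \<comment> \<open>The cut-off is a function of |z|^2 that is 1 on the disk and has dropped to 0 at
    radius 1 + e/2, inside the radius 1 + e up to which \<open>f0\<close> is smooth.\<close>
  define d where "d = (1 + e / 2)\<^sup>2 - 1"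
  have d: "d > 0" using e by (simp add: d_def power2_eq_square algebra_simps add_pos_pos)
  define chi where "chi z = 1 - smooth_step ((z \<bullet> z - 1) / d)" for z :: complex
  have chiC: "Cinf chi"
    unfolding chi_def by (intro smooth_intros Cinf_compose[OF Cinf_smooth_step] Cinf_divide) (use d in auto)
  define g where "g z = (if norm z < 1 + e then chi z *\<^sub>R f0 z else 0)" for z
  have "Cinf_on (ball 0 (1 + e)) g"
  proof (rule Cinf_on_cong)
    show "Cinf_on (ball 0 (1 + e)) (\<lambda>z. chi z *\<^sub>R f0 z)"
      by (intro Cinf_scaleR Cinf_on_subset[OF chiC] Cinf_on_subset[OF U(4)]) (use U' in auto)
  qed (simp add: g_def)
  moreover have "Cinf_on (- cball 0 (1 + e / 2)) g"
  proof (rule Cinf_on_cong)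
    show "Cinf_on (- cball 0 (1 + e / 2)) (\<lambda>z::complex. 0)" by (rule Cinf_on_subset[OF Cinf_const]) auto
    fix z :: complex assume "z \<in> - cball 0 (1 + e / 2)"
    then have "(1 + e / 2)\<^sup>2 \<le> (norm z)\<^sup>2" using e by (intro power_mono) auto
    then have "chi z = 0" using d unfolding chi_def by (subst smooth_step_ge1) (auto simp: dot_square_norm d_def)
    then show "0 = g z" by (simp add: g_def)
  qed
  moreover have "ball 0 (1 + e) \<union> - cball (0::complex) (1 + e / 2) = UNIV" using e by auto
  ultimately have "Cinf g" using Cinf_on_Un by metis
  moreover have "g z = f z" if "z \<in> Disk" for z
  proof -
    have "(norm z)\<^sup>2 \<le> 1\<^sup>2" using that by (intro power_mono) auto
    then have "(z \<bullet> z - 1) / d \<le> 0" using d by (simp add: dot_square_norm divide_nonpos_pos)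
    then have "chi z = 1" by (simp add: chi_def smooth_step_le0)
    then show ?thesis using that e U(3) by (simp add: g_def)
  qed
  ultimately show thesis by (rule that)
qed

lemma interior_Disk: "interior Disk \<noteq> {}" by (simp add: interior_cball)

lemma dD_eq:
  assumes "(f has_derivative f') (at z within Disk)" "z \<in> Disk"
  shows "dD f z = f'"
  unfolding dD_def
  using within_derivative_unique[OF convex_cball interior_Disk assms(2) _ assms(1)] assms(1)
  by (metis differentiable_def frechet_derivative_works)

lemma has_derivative_of_extension:
  assumes g: "Cinf g" "\<And>z. z \<in> Disk \<Longrightarrow> g z = f z" and z: "z \<in> Disk"
  shows "(f has_derivative FD g z) (at z within Disk)"
  by (rule has_derivative_transform[OF z _ has_derivative_at_withinI[OF Cinf_has_derivative[OF g(1)]]]) (simp add: g(2))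

lemma dD_extension: "Cinf g \<Longrightarrow> (\<And>z. z \<in> Disk \<Longrightarrow> g z = f z) \<Longrightarrow> z \<in> Disk \<Longrightarrow> dD f z = FD g z"
  using dD_eq[OF has_derivative_of_extension] by metis

lemma Diff_c_isotopy:
  assumes "phi \<in> Diff_c"
  obtains H r where "ham_flow H r" "r < 1" "\<And>z. z \<in> Disk \<Longrightarrow> ham_flow.Phi H (1, z) = phi z"
proof -
  obtain K where phi: "smooth_on Disk phi" "bij_betw phi Disk Disk" "smooth_on Disk (inv_into Disk phi)"
    "\<And>z. z \<in> Disk \<Longrightarrow> jac_det phi z = 1" and K: "compact K" "K \<subseteq> ball 0 1" "\<And>z. z \<in> Disk - K \<Longrightarrow> phi z = z"
    using assms unfolding Diff_c_def by blast
  let ?inv = "inv_into Disk phi"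
  have invK: "?inv z = z" if "z \<in> Disk - K" for z
    using K(3)[OF that] inv_into_f_f[OF bij_betw_imp_inj_on[OF phi(2)], of z] that by simp
  have ext: "Cinf (\<lambda>z. if z \<in> Disk then f z else z)" if f: "smooth_on Disk f" "\<And>z. z \<in> Disk - K \<Longrightarrow> f z = z" for f
  proof -
    let ?g = "\<lambda>z. if z \<in> Disk then f z else z"
    obtain g where g: "Cinf g" "\<And>z. z \<in> Disk \<Longrightarrow> g z = f z" using Cinf_extension[OF f(1)] by blast
    have "Cinf_on (ball 0 1) ?g"
      by (rule Cinf_on_cong[OF Cinf_on_subset[OF g(1)]]) (use g(2) in auto)
    moreover have "Cinf_on (- K) ?g"
      by (rule Cinf_on_cong[OF Cinf_on_subset[OF Cinf_ident]]) (use f(2) K(1) in \<open>auto simp: open_Compl compact_imp_closed\<close>)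
    moreover have "ball 0 1 \<union> - K = UNIV" using K(2) by auto
    ultimately show ?thesis using Cinf_on_Un by metis
  qed
  define F where "F z = (if z \<in> Disk then phi z else z)" for z
  define F' where "F' z = (if z \<in> Disk then ?inv z else z)" for z
  have FC: "Cinf F" "Cinf F'" unfolding F_def F'_def using ext[OF phi(1) K(3)] ext[OF phi(3) invK] by auto
  have mem: "phi z \<in> Disk" "?inv z \<in> Disk" if "z \<in> Disk" for z
    using that phi(2) bij_betw_inv_into[OF phi(2)] by (auto simp: bij_betw_def)
  have FF: "F' (F z) = z" "F (F' z) = z" for z
    using mem[of z] bij_betw_inv_into_left[OF phi(2), of z] bij_betw_inv_into_right[OF phi(2), of z]
    by (auto simp: F_def F'_def)
  obtain r1 where r1: "r1 < 1" "\<And>z. z \<in> K \<Longrightarrow> norm z \<le> r1"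
  proof (cases "K = {}")
    case False
    then obtain z0 where "z0 \<in> K" "\<And>z. z \<in> K \<Longrightarrow> norm z \<le> norm z0"
      using continuous_attains_sup[OF K(1), of norm] continuous_on_norm_id by blast
    then show thesis using that[of "norm z0"] K(2) by auto
  qed (use that[of 0] in auto)
  define r0 where "r0 = (r1 + 1) / 2"
  have r0: "r0 < 1" "r1 < r0" using r1 by (auto simp: r0_def)
  have out: "F z = z" if "norm z \<ge> r0" for z
    using that r0 r1(2)[of z] K(3)[of z] by (force simp: F_def)
  have jac: "om (FD F z 1) (FD F z \<i>) = 1" for z
  proof (cases "z \<in> Disk")
    case True
    then show ?thesis using phi(4)[OF True] dD_extension[OF FC(1), of phi z] by (simp add: F_def jac_det_def om_def)
  next
    case False
    then show ?thesis using FD_id_outside[of r0 F z] out r0 by (simp add: om_def)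
  qed
  obtain H r where "ham_flow H r" "r < 1" "\<And>z. ham_flow.Phi H (1, z) = F z"
    by (rule disk_isotopy[OF FC FF jac r0(1) out]) (assumption, rule that)
  then show thesis using that by (simp add: F_def)
qed

section \<open>Winding numbers\<close>

lemma interior_cylinder: "interior (Disk \<times> {0..1::real}) \<noteq> {}"
  by (simp add: interior_Times interior_cball)

lemma ham_field_eq:
  assumes g: "(H has_derivative g') (at (z, t) within Disk \<times> {0..1})" and zt: "z \<in> Disk" "t \<in> {0..1}"
  shows "ham_field H t z = Complex (g' (\<i>, 0)) (- g' (1, 0))"
proof -
  have "frechet_derivative H (at (z, t) within Disk \<times> {0..1}) = g'"
    using within_derivative_unique[OF convex_Times[OF convex_cball convex_real_interval(5)] interior_cylinder _ _ g] zt g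
    by (metis SigmaI differentiable_def frechet_derivative_works)
  then show ?thesis by (simp add: ham_field_def Hx_def Hy_def)
qed

lemma ham_flow_isotopy:
  assumes "ham_flow H r" "r < 1"
  shows "ham_isotopy H (\<lambda>t z. ham_flow.Phi H (t, z))"
    and "\<And>z t. z \<in> Disk \<Longrightarrow> t \<in> {0..1} \<Longrightarrow> ham_field H t z = hfield H (z, t)"
proof -
  interpret ham_flow H r by fact
  show hf: "ham_field H t z = hfield H (z, t)" if "z \<in> Disk" "t \<in> {0..1}" for z t
    using ham_field_eq[OF has_derivative_at_withinI[OF Cinf_has_derivative[OF H]] that] by (simp add: hfield_def)
  have "hamiltonian H" unfolding hamiltonian_def smooth_on_def
    using H supp_z assms(2) by (auto simp: Cinf_on_def)
  moreover have m: "Phi (t, z) \<in> Disk" if "z \<in> Disk" for t z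
    using Phi_bound[of z 1 t] that assms(2) by simp
  ultimately show "ham_isotopy H (\<lambda>t z. Phi (t, z))"
    unfolding ham_isotopy_def using hf[OF m] Phi_props(2,3) by (auto intro: has_vector_derivative_at_within)
qed

lemma Cinf_on_Lipschitz:
  fixes f :: "'a::euclidean_space \<Rightarrow> 'b::real_normed_vector"
  assumes f: "Cinf_on U f" and S: "compact S" "convex S" "S \<subseteq> U"
  obtains L where "L \<ge> 0" "\<And>x y. x \<in> S \<Longrightarrow> y \<in> S \<Longrightarrow> norm (f x - f y) \<le> L * norm (x - y)"
proof -
  have "compact ((\<lambda>x. \<Sum>i\<in>Basis. norm (FD f x i)) ` S)"
    by (intro compact_continuous_image S continuous_intros continuous_on_subset[OF Cinf_on_continuous[OF Cinf_on_FD[OF f]]])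
  then obtain L where L: "L > 0" "\<And>x. x \<in> S \<Longrightarrow> norm (\<Sum>i\<in>Basis. norm (FD f x i)) \<le> L"
    using compact_imp_bounded[of "(\<lambda>x. \<Sum>i\<in>Basis. norm (FD f x i)) ` S"] unfolding bounded_pos by blast
  have on: "onorm (FD f x) \<le> L" if x: "x \<in> S" for x
  proof (rule onorm_le)
    fix v
    have "norm (FD f x v) = norm (\<Sum>i\<in>Basis. (v \<bullet> i) *\<^sub>R FD f x i)"
      using linear_expand_Basis[OF has_derivative_bounded_linear[OF Cinf_on_has_derivative[OF f]], of x v] x S(3) by auto
    also have "\<dots> \<le> (\<Sum>i\<in>Basis. norm v * norm (FD f x i))"
      by (rule sum_norm_le) (auto intro!: mult_right_mono Basis_le_norm)
    also have "\<dots> = norm v * (\<Sum>i\<in>Basis. norm (FD f x i))" by (simp add: sum_distrib_left)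
    also have "\<dots> \<le> norm v * L" using L(2)[OF x] by (intro mult_left_mono) auto
    finally show "norm (FD f x v) \<le> L * norm v" by (simp add: mult.commute)
  qed
  show thesis
  proof (rule that[of L])
    show "norm (f x - f y) \<le> L * norm (x - y)" if "x \<in> S" "y \<in> S" for x y
      by (rule differentiable_bound[OF S(2) _ on that(1) that(2)])
        (use Cinf_on_has_derivative[OF f] S(3) in \<open>auto intro: has_derivative_at_withinI\<close>)
  qed (use L in auto)
qed

text \<open>The description in \<open>wind\<close> ranges over all isotopies of this kind, whose
  Hamiltonians are smooth on the closed cylinder only. Injectivity, joint continuity and rest near
  the boundary are therefore derived from the one-sided differential equation by Gronwall
  estimates.\<close>

locale isotopy =
  fixes H Phi assumes iso: "ham_isotopy H Phi"
begin

lemma start: "z \<in> Disk \<Longrightarrow> Phi 0 z = z" and inDisk: "z \<in> Disk \<Longrightarrow> t \<in> {0..1} \<Longrightarrow> Phi t z \<in> Disk"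
  and der: "z \<in> Disk \<Longrightarrow> t \<in> {0..1} \<Longrightarrow> ((\<lambda>s. Phi s z) has_vector_derivative ham_field H t (Phi t z)) (at t within {0..1})"
  using iso by (auto simp: ham_isotopy_def)

lemma field_Lipschitz:
  obtains L where "L \<ge> 0" "\<And>t a b. t \<in> {0..1} \<Longrightarrow> a \<in> Disk \<Longrightarrow> b \<in> Disk \<Longrightarrow> norm (ham_field H t a - ham_field H t b) \<le> L * norm (a - b)"
proof -
  obtain U g where U: "Disk \<times> {0..1} \<subseteq> U" "\<And>x. x \<in> Disk \<times> {0..1} \<Longrightarrow> g x = H x" "Cinf_on U g"
    using iso unfolding ham_isotopy_def hamiltonian_def smooth_on_def Cinf_on_def by blast
  define Y where "Y q = Complex (FD g q (\<i>, 0)) (- FD g q (1, 0))" for q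
  have Y: "Cinf_on U Y" unfolding Y_def by (intro smooth_intros Cinf_on_FD U(3))
  have hY: "ham_field H t z = Y (z, t)" if "z \<in> Disk" "t \<in> {0..1}" for z t
    unfolding Y_def
  proof (rule ham_field_eq[OF _ that])
    have "(g has_derivative FD g (z, t)) (at (z, t) within Disk \<times> {0..1})"
      using Cinf_on_has_derivative[OF U(3)] that U(1) has_derivative_at_withinI by blast
    then show "(H has_derivative FD g (z, t)) (at (z, t) within Disk \<times> {0..1})"
      by (rule has_derivative_transform[rotated 2]) (use that U(2) in auto)
  qed
  obtain L where L: "L \<ge> 0" "\<And>x y. x \<in> Disk \<times> {0..1} \<Longrightarrow> y \<in> Disk \<times> {0..1} \<Longrightarrow> norm (Y x - Y y) \<le> L * norm (x - y)"
    by (rule Cinf_on_Lipschitz[OF Y, of "Disk \<times> {0..1}"])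
      (use U(1) in \<open>auto intro!: compact_Times convex_Times\<close>)
  show thesis
  proof (rule that[OF L(1)])
    fix t :: real and a b assume *: "t \<in> {0..1}" "a \<in> Disk" "b \<in> Disk"
    have "norm (Y (a, t) - Y (b, t)) \<le> L * norm ((a, t) - (b, t))" by (rule L(2)) (use * in auto)
    then show "norm (ham_field H t a - ham_field H t b) \<le> L * norm (a - b)" using * by (simp add: hY norm_Pair)
  qed
qed

lemma cont: "z \<in> Disk \<Longrightarrow> continuous_on {0..1} (\<lambda>t. Phi t z)"
  unfolding continuous_on_eq_continuous_within by (intro ballI has_vector_derivative_continuous[OF der])

lemma der_at: "z \<in> Disk \<Longrightarrow> 0 < t \<Longrightarrow> t < 1 \<Longrightarrow> ((\<lambda>s. Phi s z) has_vector_derivative ham_field H t (Phi t z)) (at t)"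
  using der[of z t] by (simp add: at_within_Icc_at)

lemma spread: obtains C where "C \<ge> 0" "\<And>t a b. t \<in> {0..1} \<Longrightarrow> a \<in> Disk \<Longrightarrow> b \<in> Disk \<Longrightarrow> norm (Phi t a - Phi t b) \<le> C * norm (a - b)"
proof -
  obtain L where L: "L \<ge> 0" "\<And>t a b. t \<in> {0..1} \<Longrightarrow> a \<in> Disk \<Longrightarrow> b \<in> Disk \<Longrightarrow> norm (ham_field H t a - ham_field H t b) \<le> L * norm (a - b)"
    by (rule field_Lipschitz) (rule that)
  define C where "C = sqrt (exp (2 * L + 1))"
  have C2: "C\<^sup>2 = exp (2 * L + 1)" by (simp add: C_def)
  show thesis
  proof (rule that[of C])
    fix t :: real and a b :: complex assume t: "t \<in> {0..1}" and ab: "a \<in> Disk" "b \<in> Disk"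
    have "(norm (Phi t a - Phi t b))\<^sup>2 + 0\<^sup>2 \<le> ((norm (Phi 0 a - Phi 0 b))\<^sup>2 + 0\<^sup>2) * exp ((2 * L + 1) * t)"
    proof (rule gronwall_pos[where w' = "\<lambda>t. ham_field H t (Phi t a) - ham_field H t (Phi t b)"])
      show "continuous_on {0..t} (\<lambda>t. Phi t a - Phi t b)"
        by (intro continuous_intros continuous_on_subset[OF cont] ab) (use t in auto)
      show "((\<lambda>t. Phi t a - Phi t b) has_vector_derivative ham_field H s (Phi s a) - ham_field H s (Phi s b)) (at s)"
        if "0 < s" "s < t" for s using that t by (intro has_vector_derivative_diff der_at ab) auto
      show "norm (ham_field H s (Phi s a) - ham_field H s (Phi s b)) \<le> L * norm (Phi s a - Phi s b) + 0"
        if "0 < s" "s < t" for s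
        unfolding add_0_right by (intro L(2) inDisk ab) (use that t in auto)
    qed (use t L in auto)
    also have "\<dots> \<le> (norm (a - b))\<^sup>2 * exp (2 * L + 1)"
      using t L(1) ab by (simp add: start mult_left_mono mult_left_le)
    also have "\<dots> = (C * norm (a - b))\<^sup>2" by (simp add: C2 power_mult_distrib)
    finally have "(norm (Phi t a - Phi t b))\<^sup>2 \<le> (C * norm (a - b))\<^sup>2" by simp
    then show "norm (Phi t a - Phi t b) \<le> C * norm (a - b)"
      by (rule power2_le_imp_le) (simp add: C_def)
  qed (simp add: C_def)
qed

lemma inj: assumes "t \<in> {0..1}" "a \<in> Disk" "b \<in> Disk" "Phi t a = Phi t b" shows "a = b"
proof -
  obtain L where L: "L \<ge> 0" "\<And>t a b. t \<in> {0..1} \<Longrightarrow> a \<in> Disk \<Longrightarrow> b \<in> Disk \<Longrightarrow> norm (ham_field H t a - ham_field H t b) \<le> L * norm (a - b)"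
    by (rule field_Lipschitz) (rule that)
  define w where "w s = Phi (t - s) a - Phi (t - s) b" for s
  have "(norm (w t))\<^sup>2 + 0\<^sup>2 \<le> ((norm (w 0))\<^sup>2 + 0\<^sup>2) * exp ((2 * L + 1) * t)"
  proof (rule gronwall_pos[where w' = "\<lambda>s. - (ham_field H (t - s) (Phi (t - s) a) - ham_field H (t - s) (Phi (t - s) b))"])
    show "continuous_on {0..t} w" unfolding w_def
      by (intro continuous_intros continuous_on_compose2[OF cont] assms) (use assms in auto)
    show "(w has_vector_derivative - (ham_field H (t - s) (Phi (t - s) a) - ham_field H (t - s) (Phi (t - s) b))) (at s)"
      if s: "0 < s" "s < t" for s
    proof -
      have 1: "((\<lambda>s. t - s) has_vector_derivative - 1) (at s)" by (auto intro!: derivative_eq_intros)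
      have "((\<lambda>s. Phi s a - Phi s b) has_vector_derivative ham_field H (t - s) (Phi (t - s) a) - ham_field H (t - s) (Phi (t - s) b)) (at (t - s))"
        using s assms by (intro has_vector_derivative_diff der_at) auto
      from vector_diff_chain_at[OF 1 this] show ?thesis by (simp add: o_def w_def[abs_def])
    qed
    show "norm (- (ham_field H (t - s) (Phi (t - s) a) - ham_field H (t - s) (Phi (t - s) b))) \<le> L * norm (w s) + 0"
      if "0 < s" "s < t" for s
      unfolding w_def norm_minus_cancel add_0_right by (intro L(2) inDisk assms(2,3)) (use that assms(1) in auto)
  qed (use assms L in auto)
  then show ?thesis using assms by (simp add: w_def start)
qed

lemma static: obtains r where "r < 1" "\<And>t z. t \<in> {0..1} \<Longrightarrow> z \<in> Disk \<Longrightarrow> norm z > r \<Longrightarrow> Phi t z = z"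
proof -
  obtain L where L: "L \<ge> 0" "\<And>t a b. t \<in> {0..1} \<Longrightarrow> a \<in> Disk \<Longrightarrow> b \<in> Disk \<Longrightarrow> norm (ham_field H t a - ham_field H t b) \<le> L * norm (a - b)"
    by (rule field_Lipschitz) (rule that)
  obtain r where r: "r < 1" "\<And>z t. z \<in> Disk \<Longrightarrow> r \<le> norm z \<Longrightarrow> t \<in> {0..1} \<Longrightarrow> H (z, t) = 0"
    using iso by (auto simp: ham_isotopy_def hamiltonian_def)
  have X0: "ham_field H t z = 0" if zt: "z \<in> Disk" "t \<in> {0..1}" "norm z > r" for z t
  proof -
    have "((\<lambda>q. 0) has_derivative (\<lambda>v. 0)) (at (z, t) within Disk \<times> {0..1})" by simp
    then have "(H has_derivative (\<lambda>v. 0)) (at (z, t) within Disk \<times> {0..1})"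
    proof (rule has_derivative_transform_within[of _ _ _ _ "norm z - r"])
      fix q assume q: "q \<in> Disk \<times> {0..1::real}" "dist q (z, t) < norm z - r"
      have "norm z - norm (fst q) \<le> dist (fst q) z" by (metis dist_commute dist_norm norm_triangle_ineq2)
      also have "\<dots> \<le> dist q (z, t)" using dist_fst_le[of q "(z, t)"] by simp
      finally have "r \<le> norm (fst q)" using q by simp
      then show "0 = H q" using r(2)[of "fst q" "snd q"] q by (auto simp: mem_Times_iff)
    qed (use zt in auto)
    from ham_field_eq[OF this zt(1,2)] show ?thesis by (simp add: complex_eq_iff)
  qed
  have "Phi t z = z" if t: "t \<in> {0..1}" and z: "z \<in> Disk" "norm z > r" for t z
  proof -
    have "(norm (Phi t z - z))\<^sup>2 + 0\<^sup>2 \<le> ((norm (Phi 0 z - z))\<^sup>2 + 0\<^sup>2) * exp ((2 * L + 1) * t)"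
    proof (rule gronwall_pos[where w' = "\<lambda>t. ham_field H t (Phi t z) - 0"])
      show "continuous_on {0..t} (\<lambda>t. Phi t z - z)"
        by (intro continuous_intros continuous_on_subset[OF cont] z) (use t in auto)
      show "((\<lambda>t. Phi t z - z) has_vector_derivative ham_field H s (Phi s z) - 0) (at s)"
        if "0 < s" "s < t" for s using that t by (intro has_vector_derivative_diff der_at z has_vector_derivative_const) auto
      show "norm (ham_field H s (Phi s z) - 0) \<le> L * norm (Phi s z - z) + 0"
        if "0 < s" "s < t" for s
      proof -
        have s: "s \<in> {0..1}" using that t by auto
        show ?thesis unfolding add_0_right X0[OF z(1) s z(2), symmetric] by (intro L(2) inDisk z s)
      qed
    qed (use t L in auto)
    then show ?thesis using z by (simp add: start)
  qed
  then show thesis using that r(1) by blast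
qed

lemma joint_cont: "continuous_on ({0..1} \<times> Disk) (\<lambda>q. Phi (fst q) (snd q))"
proof -
  obtain C where C: "C \<ge> 0" "\<And>t a b. t \<in> {0..1} \<Longrightarrow> a \<in> Disk \<Longrightarrow> b \<in> Disk \<Longrightarrow> norm (Phi t a - Phi t b) \<le> C * norm (a - b)"
    by (rule spread) (rule that)
  show ?thesis
    unfolding continuous_on_eq_continuous_within continuous_within tendsto_iff
  proof (intro ballI allI impI)
    fix q :: "real \<times> complex" and e :: real assume q: "q \<in> {0..1} \<times> Disk" and e: "e > 0"
    have "((\<lambda>t. Phi t (snd q)) \<longlongrightarrow> Phi (fst q) (snd q)) (at (fst q) within {0..1})"
      using cont[of "snd q"] q by (auto simp: continuous_on_def)
    then obtain d where d: "d > 0" "\<And>t. t \<in> {0..1} \<Longrightarrow> dist t (fst q) < d \<Longrightarrow> dist (Phi t (snd q)) (Phi (fst q) (snd q)) < e / 2"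
      using e unfolding tendsto_iff eventually_at by (metis dist_self half_gt_zero)
    define d' where "d' = min d (e / (2 * (C + 1)))"
    have "d' \<le> e / (2 * (C + 1))" by (simp add: d'_def)
    then have "d' * (2 * (C + 1)) \<le> e" using C(1) by (subst (asm) pos_le_divide_eq) auto
    then have d': "d' > 0" "d' \<le> d" "(C + 1) * d' \<le> e / 2"
      using d(1) e C(1) by (simp_all add: algebra_simps) (simp_all add: d'_def)
    show "\<forall>\<^sub>F x in at q within {0..1} \<times> Disk. dist (Phi (fst x) (snd x)) (Phi (fst q) (snd q)) < e"
      unfolding eventually_at
    proof (intro exI[of _ d'] conjI d' ballI impI)
      fix x assume x: "x \<in> {0..1} \<times> Disk" "x \<noteq> q \<and> dist x q < d'"
      have 1: "dist (fst x) (fst q) < d" using dist_fst_le[of x q] x d' by linarith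
      have 2: "norm (snd x - snd q) \<le> d'" using dist_snd_le[of x q] x by (simp add: dist_norm)
      have "norm (Phi (fst x) (snd x) - Phi (fst x) (snd q)) \<le> C * norm (snd x - snd q)" using C(2) x q by auto
      also have "\<dots> \<le> (C + 1) * d'" using 2 C by (intro mult_mono) auto
      finally have "dist (Phi (fst x) (snd x)) (Phi (fst x) (snd q)) \<le> e / 2" using d' by (simp add: dist_norm)
      moreover have "dist (Phi (fst x) (snd q)) (Phi (fst q) (snd q)) < e / 2" using d(2)[OF _ 1] x by auto
      ultimately show "dist (Phi (fst x) (snd x)) (Phi (fst q) (snd q)) < e"
        using dist_triangle[of "Phi (fst x) (snd x)" "Phi (fst q) (snd q)" "Phi (fst x) (snd q)"] by simp
    qed
  qed
qed

end

text \<open>The values lie in the discrete set 2 pi i Z.\<close>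

lemma constant_of_exp_eq_1:
  fixes d :: "real \<Rightarrow> complex"
  assumes d: "continuous_on {0..1} d" "\<And>t. t \<in> {0..1} \<Longrightarrow> exp (d t) = 1"
  shows "d 1 = d 0"
proof -
  have "d constant_on {0..1}"
  proof (rule continuous_discrete_range_constant[OF _ d(1)])
    fix x :: real assume x: "x \<in> {0..1}"
    show "\<exists>e>0. \<forall>y. y \<in> {0..1} \<and> d y \<noteq> d x \<longrightarrow> e \<le> norm (d y - d x)"
    proof (intro exI[of _ 1] conjI allI impI)
      fix y assume y: "y \<in> {0..1} \<and> d y \<noteq> d x"
      have "exp (d y - d x) = 1" using d(2)[OF x] d(2)[of y] y by (simp add: exp_diff)
      then obtain n :: int where n: "Re (d y - d x) = 0" "Im (d y - d x) = of_int (2 * n) * pi"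
        unfolding exp_eq_1 by blast
      have "n \<noteq> 0" using n y by (auto simp: complex_eq_iff)
      then have "1 \<le> \<bar>real_of_int (2 * n)\<bar>" by linarith
      then have "1 \<le> \<bar>real_of_int (2 * n)\<bar> * pi" using pi_ge_two by (metis mult_mono' mult_1 one_le_numeral order_trans zero_le_one)
      then show "1 \<le> norm (d y - d x)" using abs_Im_le_cmod[of "d y - d x"] n by (simp add: abs_mult)
    qed simp
  qed simp
  then show ?thesis unfolding constant_on_def by auto
qed

lemma angle_change_eq:
  assumes l: "continuous_on {0..1} l" "\<And>t. t \<in> {0..1} \<Longrightarrow> \<gamma> t = exp (l t)"
  shows "angle_change \<gamma> = (Im (l 1) - Im (l 0)) / (2 * pi)"
  unfolding angle_change_def
proof (rule the_equality)
  have n: "\<gamma> t / complex_of_real (norm (\<gamma> t)) = exp (\<i> * complex_of_real (Im (l t)))" if "t \<in> {0..1}" for t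
    using exp_eq_polar[of "l t"] unfolding l(2)[OF that] by (simp add: norm_exp_eq_Re cis_conv_exp norm_mult)
  then show "\<exists>\<theta>. continuous_on {0..1} \<theta> \<and> (\<forall>t\<in>{0..1}. \<gamma> t / complex_of_real (norm (\<gamma> t)) = exp (\<i> * complex_of_real (\<theta> t))) \<and>
      (Im (l 1) - Im (l 0)) / (2 * pi) = (\<theta> 1 - \<theta> 0) / (2 * pi)"
    using l(1) by (intro exI[of _ "\<lambda>t. Im (l t)"]) (auto intro!: continuous_intros)
  fix w
  assume "\<exists>\<theta>. continuous_on {0..1} \<theta> \<and> (\<forall>t\<in>{0..1}. \<gamma> t / complex_of_real (norm (\<gamma> t)) = exp (\<i> * complex_of_real (\<theta> t))) \<and>
      w = (\<theta> 1 - \<theta> 0) / (2 * pi)"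
  then obtain \<theta> where \<theta>: "continuous_on {0..1} \<theta>" "\<And>t. t \<in> {0..1} \<Longrightarrow> \<gamma> t / complex_of_real (norm (\<gamma> t)) = exp (\<i> * complex_of_real (\<theta> t))"
    "w = (\<theta> 1 - \<theta> 0) / (2 * pi)" by blast
  have "\<i> * complex_of_real (\<theta> 1) - \<i> * complex_of_real (Im (l 1)) = \<i> * complex_of_real (\<theta> 0) - \<i> * complex_of_real (Im (l 0))"
    by (rule constant_of_exp_eq_1[of "\<lambda>t. \<i> * complex_of_real (\<theta> t) - \<i> * complex_of_real (Im (l t))"])
      (use \<theta>(1) l(1) \<theta>(2) n in \<open>auto intro!: continuous_intros simp: exp_diff\<close>)
  then have "\<theta> 1 - Im (l 1) = \<theta> 0 - Im (l 0)" by (simp add: complex_eq_iff)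
  then show "w = (Im (l 1) - Im (l 0)) / (2 * pi)" unfolding \<theta>(3) by (simp add: algebra_simps)
qed

lemma path_logarithm:
  fixes \<gamma> :: "real \<Rightarrow> complex"
  assumes "continuous_on {0..1} \<gamma>" "\<And>t. t \<in> {0..1} \<Longrightarrow> \<gamma> t \<noteq> 0"
  obtains l where "continuous_on {0..1} l" "\<And>t. t \<in> {0..1} \<Longrightarrow> \<gamma> t = exp (l t)"
proof -
  have "contractible {0..1::real}" by (intro convex_imp_contractible) simp
  then show thesis using continuous_logarithm_on_contractible[OF assms(1)] assms(2) that by metis
qed

context isotopy
begin

lemma difference_nonzero: "t \<in> {0..1} \<Longrightarrow> x \<in> Disk \<Longrightarrow> y \<in> Disk \<Longrightarrow> x \<noteq> y \<Longrightarrow> Phi t y - Phi t x \<noteq> 0"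
  using inj by auto

lemma curve_cont: "x \<in> Disk \<Longrightarrow> y \<in> Disk \<Longrightarrow> continuous_on {0..1} (\<lambda>t. Phi t y - Phi t x)"
  by (intro continuous_intros cont)

end

text \<open>The difference of the winding numbers for two isotopies is the winding number of a loop; it
  is an integer and hence constant along paths of pairs of distinct points, which are chosen to
  end on the boundary circle, where nothing moves.\<close>
lemma winding_difference_constant:
  assumes I: "isotopy H P" and J: "isotopy H' P'" and e: "\<And>z. z \<in> Disk \<Longrightarrow> P 1 z = P' 1 z"
    and x: "continuous_on {0..1} x" "\<And>s. s \<in> {0..1} \<Longrightarrow> x s \<in> Disk"
    and y: "continuous_on {0..1} y" "\<And>s. s \<in> {0..1} \<Longrightarrow> y s \<in> Disk"
    and ne: "\<And>s. s \<in> {0..1} \<Longrightarrow> x s \<noteq> y s"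
  shows "angle_change (\<lambda>t. P t (y 0) - P t (x 0)) - angle_change (\<lambda>t. P' t (y 0) - P' t (x 0))
    = angle_change (\<lambda>t. P t (y 1) - P t (x 1)) - angle_change (\<lambda>t. P' t (y (1::real)) - P' t (x 1))"
proof -
  interpret p: isotopy H P by (rule I)
  interpret q: isotopy H' P' by (rule J)
  define \<rho> where "\<rho> z = (P (fst z) (y (snd z)) - P (fst z) (x (snd z))) / (P' (fst z) (y (snd z)) - P' (fst z) (x (snd z)))" for z
  let ?S = "{0..1::real} \<times> {0..1::real}"
  have c: "continuous_on ?S (\<lambda>z. Q (fst z) (w (snd z)))"
    if "continuous_on ({0..1} \<times> Disk) (\<lambda>q. Q (fst q) (snd q))" "continuous_on {0..1} w" "\<And>s. s \<in> {0..1} \<Longrightarrow> w s \<in> Disk"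
    for Q :: "real \<Rightarrow> complex \<Rightarrow> complex" and w :: "real \<Rightarrow> complex"
  proof -
    have "continuous_on ?S (\<lambda>z. (fst z, w (snd z)))"
      by (intro continuous_intros continuous_on_compose2[OF that(2)]) auto
    moreover have "(\<lambda>z. (fst z, w (snd z))) ` ?S \<subseteq> {0..1} \<times> Disk" using that(3) by auto
    ultimately show ?thesis using continuous_on_compose2[OF that(1)] by fastforce
  qed
  have "continuous_on ?S \<rho>" unfolding \<rho>_def
  proof (intro continuous_on_divide continuous_on_diff c p.joint_cont q.joint_cont x y)
    show "\<forall>z\<in>?S. P' (fst z) (y (snd z)) - P' (fst z) (x (snd z)) \<noteq> 0"
      using q.difference_nonzero x(2) y(2) ne by (auto simp: mem_Times_iff)
  qed auto
  moreover have "contractible ?S" by (intro convex_imp_contractible convex_Times) auto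
  moreover have "\<rho> z \<noteq> 0" if "z \<in> ?S" for z
    unfolding \<rho>_def using p.difference_nonzero q.difference_nonzero x(2) y(2) ne that by (auto simp: mem_Times_iff)
  ultimately obtain l where l: "continuous_on ?S l" "\<And>z. z \<in> ?S \<Longrightarrow> \<rho> z = exp (l z)"
    using continuous_logarithm_on_contractible by metis
  \<comment> \<open>At t = 0 both isotopies are the identity and at t = 1 they agree, so on these
    two sides of the square the logarithm takes values in 2 pi i Z and is constant.\<close>
  have one: "\<rho> (t, s) = 1" if "t = 0 \<or> t = 1" "s \<in> {0..1}" for t s
    using that x(2)[of s] y(2)[of s] ne[of s] p.start q.start e q.difference_nonzero[of 1 "x s" "y s"] by (auto simp: \<rho>_def)
  have ls: "continuous_on {0..1} (\<lambda>s. l (t, s))" if "t \<in> {0..1}" for t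
    by (rule continuous_on_compose2[OF l(1)]) (use that in \<open>auto intro!: continuous_intros\<close>)
  have lt: "continuous_on {0..1} (\<lambda>t. l (t, s))" if "s \<in> {0..1}" for s
    by (rule continuous_on_compose2[OF l(1)]) (use that in \<open>auto intro!: continuous_intros\<close>)
  have l0: "l (0, 1) = l (0, 0)"
    by (rule constant_of_exp_eq_1[OF ls]) (use one l(2) in \<open>auto simp flip: l(2)\<close>)
  have l1: "l (1, 1) = l (1, 0)"
    by (rule constant_of_exp_eq_1[OF ls]) (use one l(2) in \<open>auto simp flip: l(2)\<close>)
  have "angle_change (\<lambda>t. P t (y s) - P t (x s)) - angle_change (\<lambda>t. P' t (y s) - P' t (x s)) = (Im (l (1, s)) - Im (l (0, s))) / (2 * pi)"
    if s: "s \<in> {0..1}" for s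
  proof -
    note xy = x(2)[OF s] y(2)[OF s] ne[OF s]
    obtain m where m: "continuous_on {0..1} m" "\<And>t. t \<in> {0..1} \<Longrightarrow> P' t (y s) - P' t (x s) = exp (m t)"
      using path_logarithm[OF q.curve_cont[OF xy(1,2)] q.difference_nonzero[OF _ xy]] by blast
    have "P t (y s) - P t (x s) = exp (l (t, s) + m t)" if t: "t \<in> {0..1}" for t
      using l(2)[of "(t, s)"] m(2)[OF t] q.difference_nonzero[OF t xy] s t
      by (simp add: exp_add \<rho>_def field_simps)
    from angle_change_eq[OF continuous_on_add[OF lt[OF s] m(1)] this] angle_change_eq[OF m]
    show ?thesis by (simp add: diff_divide_distrib add_divide_distrib)
  qed
  from this[of 0] this[of 1] show ?thesis by (simp add: l0 l1)
qed

lemma winding_unique: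
  assumes I: "isotopy H P" and J: "isotopy H' P'" and e: "\<And>z. z \<in> Disk \<Longrightarrow> P 1 z = P' 1 z"
    and xy: "x \<in> Disk" "y \<in> Disk" "x \<noteq> y"
  shows "angle_change (\<lambda>t. P t y - P t x) = angle_change (\<lambda>t. P' t y - P' t x)"
proof -
  interpret p: isotopy H P by (rule I)
  interpret q: isotopy H' P' by (rule J)
  define D where "D x y = angle_change (\<lambda>t. P t y - P t x) - angle_change (\<lambda>t. P' t y - P' t x)" for x y
  \<comment> \<open>The ray from x through y is followed until it meets the unit circle: at the
    factor 2/|y - x| its point has norm at least 1. Since b >= 1, moving from y outwards never meets
    x.\<close>
  obtain b where b: "b \<ge> 1" "norm (x + b *\<^sub>R (y - x)) = 1"
  proof -
    define B where "B = 2 / norm (y - x)"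
    have n: "norm (y - x) > 0" using xy by simp
    have "norm (y - x) \<le> 2" using xy norm_triangle_ineq4[of y x] by simp
    then have B: "B \<ge> 1" "B * norm (y - x) = 2" using n by (auto simp: B_def)
    have "\<exists>b\<ge>1. b \<le> B \<and> norm (x + b *\<^sub>R (y - x)) = 1"
    proof (rule IVT')
      have "norm (B *\<^sub>R (y - x)) - norm x \<le> norm (x + B *\<^sub>R (y - x))"
        by (metis add.commute norm_diff_ineq)
      then show "1 \<le> norm (x + B *\<^sub>R (y - x))" using B xy by simp
    qed (use xy B in \<open>auto intro!: continuous_intros\<close>)
    then show thesis using that by blast
  qed
  define y' where "y' = x + b *\<^sub>R (y - x)"
  have y'D: "y' \<in> Disk" "norm y' = 1" using b by (auto simp: y'_def)
  have "D x y = D x y'"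
  proof -
    let ?y = "\<lambda>s. y + s *\<^sub>R (y' - y)"
    have eq: "?y s = x + (1 + s * (b - 1)) *\<^sub>R (y - x)" for s by (simp add: y'_def algebra_simps)
    have "x \<noteq> ?y s" if s: "s \<in> {0..1}" for s
    proof -
      have "1 + s * (b - 1) \<noteq> 0" using s b(1) by (smt (verit) atLeastAtMost_iff mult_nonneg_nonneg)
      then show ?thesis using xy unfolding eq by simp
    qed
    moreover have "?y s \<in> Disk" if "s \<in> {0..1}" for s
      using convexD_alt[OF convex_cball xy(2) y'D(1), of s] that by (simp add: algebra_simps)
    ultimately have "D x (?y 0) = D x (?y 1)" unfolding D_def
      by (intro winding_difference_constant[OF I J e, where x = "\<lambda>_. x" and y = ?y]) (use xy in \<open>auto intro!: continuous_intros\<close>)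
    then show ?thesis by simp
  qed
  also have "\<dots> = D (- y') y'"
  proof -
    let ?x = "\<lambda>s. x + s *\<^sub>R (- y' - x)"
    have xne: "x \<noteq> y'" using xy b by (auto simp: y'_def)
    have inD: "?x s \<in> Disk" if "s \<in> {0..1}" for s
      using convexD_alt[OF convex_cball xy(1), of "- y'" s] that y'D by (simp add: algebra_simps)
    \<comment> \<open>A point y' of the circle can lie on the segment from x to -y' only at its
      start, and x differs from y'.\<close>
    moreover have "?x s \<noteq> y'" if s: "s \<in> {0..1}" for s
    proof
      assume a: "?x s = y'"
      then have "(1 - s) *\<^sub>R x = (1 + s) *\<^sub>R y'" by (simp add: algebra_simps)
      then have "norm ((1 - s) *\<^sub>R x) = norm ((1 + s) *\<^sub>R y')" by (rule arg_cong)
      then have "(1 - s) * norm x = 1 + s" using s y'D by simp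
      moreover have "(1 - s) * norm x \<le> (1 - s) * 1" using s xy by (intro mult_left_mono) auto
      ultimately have "s = 0" using s by simp
      then show False using a xne by simp
    qed
    ultimately have "D (?x 0) y' = D (?x 1) y'" unfolding D_def
      by (intro winding_difference_constant[OF I J e, where x = ?x and y = "\<lambda>_. y'"]) (use y'D in \<open>auto intro!: continuous_intros\<close>)
    then show ?thesis by simp
  qed
  also have "\<dots> = 0"
  proof -
    obtain r where r: "r < 1" "\<And>t z. t \<in> {0..1} \<Longrightarrow> z \<in> Disk \<Longrightarrow> norm z > r \<Longrightarrow> P t z = z" by (rule p.static) (rule that)
    obtain r' where r': "r' < 1" "\<And>t z. t \<in> {0..1} \<Longrightarrow> z \<in> Disk \<Longrightarrow> norm z > r' \<Longrightarrow> P' t z = z" by (rule q.static) (rule that)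
    have "y' \<noteq> 0" using y'D(2) by auto
    then have ne: "y' - - y' \<noteq> 0" by (simp add: complex_eq_iff)
    have st: "angle_change (\<lambda>t. R t y' - R t (- y')) = 0" if "\<And>t. t \<in> {0..1} \<Longrightarrow> R t y' - R t (- y') = y' - - y'"
      for R :: "real \<Rightarrow> complex \<Rightarrow> complex"
    proof -
      have "R t y' - R t (- y') = exp (Ln (y' - - y'))" if "t \<in> {0..1}" for t
        using \<open>\<And>t. t \<in> {0..1} \<Longrightarrow> R t y' - R t (- y') = y' - - y'\<close>[OF that] ne by simp
      from angle_change_eq[OF continuous_on_const this] show ?thesis by simp
    qed
    have "P t y' - P t (- y') = y' - - y'" "P' t y' - P' t (- y') = y' - - y'" if "t \<in> {0..1}" for t
      using r r' that y'D by auto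
    then show ?thesis unfolding D_def by (simp only: st)
  qed
  finally show ?thesis by (simp add: D_def)
qed

lemma wind_eq:
  assumes I: "isotopy H P" and e: "\<And>z. z \<in> Disk \<Longrightarrow> P 1 z = phi z" and xy: "x \<in> Disk" "y \<in> Disk" "x \<noteq> y"
  shows "wind phi x y = angle_change (\<lambda>t. P t y - P t x)"
  unfolding wind_def
proof (rule the_equality)
  show "\<exists>H Phi. ham_isotopy H Phi \<and> (\<forall>z\<in>Disk. Phi 1 z = phi z) \<and>
      angle_change (\<lambda>t. P t y - P t x) = angle_change (\<lambda>t. Phi t y - Phi t x)"
    using isotopy.iso[OF I] e by blast
next
  fix w assume "\<exists>H Phi. ham_isotopy H Phi \<and> (\<forall>z\<in>Disk. Phi 1 z = phi z) \<and> w = angle_change (\<lambda>t. Phi t y - Phi t x)"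
  then obtain H' P' where *: "ham_isotopy H' P'" "\<And>z. z \<in> Disk \<Longrightarrow> P' 1 z = phi z" "w = angle_change (\<lambda>t. P' t y - P' t x)" by blast
  show "w = angle_change (\<lambda>t. P t y - P t x)"
    unfolding *(3) using e *(2) by (intro winding_unique[OF isotopy.intro[OF *(1)] I _ xy]) simp
qed

text \<open>Concatenation needs no reparametrization because the Hamiltonians vanish outside the time interval.\<close>
lemma ham_flow_concat:
  assumes A: "ham_flow H1 r1" and B: "ham_flow H2 r2"
  obtains K where "ham_flow K (max r1 r2)"
    "\<And>t z. ham_flow.Phi K (t, z) = ham_flow.Phi H2 (2 * t - 1, ham_flow.Phi H1 (2 * t, z))"
proof -
  interpret a: ham_flow H1 r1 by (rule A)
  interpret b: ham_flow H2 r2 by (rule B)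
  define K where "K q = 2 * H1 (fst q, 2 * snd q) + 2 * H2 (fst q, 2 * snd q - 1)" for q
  have KC: "Cinf K" unfolding K_def by (intro smooth_intros Cinf_compose[OF a.H] Cinf_compose[OF b.H])
  have hk: "ham_flow K (max r1 r2)"
  proof
    show "max r1 r2 > 0" using a.R by auto
    show "K (z, t) = 0" if "max r1 r2 \<le> norm z" for z t using that a.supp_z b.supp_z by (simp add: K_def)
    show "K (z, t) = 0" if "t \<le> 0 \<or> 1 \<le> t" for z t
      using that a.supp_t[of "2 * t" z] b.supp_t[of "2 * t - 1" z] by (auto simp: K_def)
  qed (rule KC)
  interpret k: ham_flow K "max r1 r2" by (rule hk)
  have kX: "k.X (z, t) = 2 *\<^sub>R a.X (z, 2 * t) + 2 *\<^sub>R b.X (z, 2 * t - 1)" for z t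
  proof -
    have d1: "((\<lambda>q :: complex \<times> real. (fst q, 2 * snd q)) has_derivative (\<lambda>v. (fst v, 2 * snd v))) (at (z, t))"
      and d2: "((\<lambda>q :: complex \<times> real. (fst q, 2 * snd q - 1)) has_derivative (\<lambda>v. (fst v, 2 * snd v))) (at (z, t))"
      by (auto intro!: derivative_eq_intros)
    have "(K has_derivative (\<lambda>v. 2 * FD H1 (z, 2 * t) (fst v, 2 * snd v) + 2 * FD H2 (z, 2 * t - 1) (fst v, 2 * snd v))) (at (z, t))"
      unfolding K_def
      using has_derivative_add[OF has_derivative_mult_right[OF FD_compose[OF a.H d1], of 2] has_derivative_mult_right[OF FD_compose[OF b.H d2], of 2]] by simp
    from FD_eq[OF this] show ?thesis by (simp add: hfield_def complex_eq_iff)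
  qed
  have "b.Phi (2 * t - 1, a.Phi (2 * t, z)) = k.Phi (t, z)" for t z
  proof (rule k.Phi_unique[of "\<lambda>t. b.Phi (2 * t - 1, a.Phi (2 * t, z))" 0])
    show "b.Phi (2 * 0 - 1, a.Phi (2 * 0, z)) = k.Phi (0, z)" by (simp add: a.Phi_props k.Phi_props b.Phi_time)
    fix t :: real
    let ?u = "a.Phi (2 * t, z)"
    have 2: "((\<lambda>t. 2 * t) has_vector_derivative 2) (at t)" "((\<lambda>t. 2 * t - 1) has_vector_derivative 2) (at t)"
      by (auto intro!: derivative_eq_intros)
    have da: "((\<lambda>t. a.Phi (2 * t, z)) has_vector_derivative 2 *\<^sub>R a.X (?u, 2 * t)) (at t)"
      using vector_diff_chain_at[OF 2(1) a.Phi_props(3)] by (simp add: o_def)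
    have "((\<lambda>t. b.Phi (2 * t - 1, a.Phi (2 * t, z))) has_vector_derivative FD b.Phi (2 * t - 1, ?u) (2, 2 *\<^sub>R a.X (?u, 2 * t))) (at t)"
      by (rule FD_compose_vector[OF b.Phi_props(1) has_vector_derivative_Pair[OF 2(2) da]])
    moreover have "FD b.Phi (2 * t - 1, ?u) (2, 2 *\<^sub>R a.X (?u, 2 * t)) = k.X (b.Phi (2 * t - 1, ?u), t)"
    proof -
      have lb: "linear (FD b.Phi q)" for q by (rule linear_FD[OF b.Phi_props(1)])
      have "FD b.Phi (2 * t - 1, ?u) (1, 0) = b.X (b.Phi (2 * t - 1, ?u), 2 * t - 1)"
        using fun_cong[OF has_derivative_unique[OF FD_partial_left[OF b.Phi_props(1)] b.Phi_props(3)[unfolded has_vector_derivative_def]], of "2 * t - 1" ?u 1] by simp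
      moreover have "(2 :: real, 2 *\<^sub>R a.X (?u, 2 * t)) = 2 *\<^sub>R (1, 0) + 2 *\<^sub>R (0, a.X (?u, 2 * t))" by simp
      ultimately have e: "FD b.Phi (2 * t - 1, ?u) (2, 2 *\<^sub>R a.X (?u, 2 * t))
          = 2 *\<^sub>R b.X (b.Phi (2 * t - 1, ?u), 2 * t - 1) + 2 *\<^sub>R FD b.Phi (2 * t - 1, ?u) (0, a.X (?u, 2 * t))"
        by (simp only: linear_add[OF lb] linear_scale[OF lb])
      show ?thesis
      \<comment> \<open>In the second half of the time the first field is zero; in the first half
        the second flow is still the identity, and so is its derivative.\<close>
      proof (cases "2 * t \<ge> 1")
        case True
        then have "a.X (w, 2 * t) = 0" for w by (intro a.X_zero_t) simp
        then show ?thesis unfolding e kX using linear_0[OF lb[of "(2 * t - 1, ?u)"]] by (simp add: zero_prod_def)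
      next
        case False
        then have s: "b.Phi (2 * t - 1, w) = w" for w by (intro b.Phi_time) simp
        then have "((\<lambda>p. b.Phi (2 * t - 1, p)) has_derivative (\<lambda>h. h)) (at ?u)" by simp
        from fun_cong[OF has_derivative_unique[OF FD_partial_right[OF b.Phi_props(1)] this]]
        have "FD b.Phi (2 * t - 1, ?u) (0, v) = v" for v .
        then show ?thesis unfolding e kX s by simp
      qed
    qed
    ultimately show "((\<lambda>t. b.Phi (2 * t - 1, a.Phi (2 * t, z))) has_vector_derivative k.X (b.Phi (2 * t - 1, ?u), t)) (at t)" by simp
  qed
  then show thesis using that[OF hk] by metis
qed

text \<open>Only values on the disk count, but the Hamiltonian is one of the whole plane and of all
  times, with support in a smaller disk. In this form the class is closed under composition.\<close>

definition realizable :: "(complex \<Rightarrow> complex) \<Rightarrow> bool"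
  where "realizable phi \<longleftrightarrow> (\<exists>H r. ham_flow H r \<and> r < 1 \<and> (\<forall>z\<in>Disk. ham_flow.Phi H (1, z) = phi z))"

lemma realizable_Diff_c: "phi \<in> Diff_c \<Longrightarrow> realizable phi"
  unfolding realizable_def using Diff_c_isotopy by metis

lemma wind_flow:
  assumes "ham_flow H r" "r < 1" "\<And>z. z \<in> Disk \<Longrightarrow> ham_flow.Phi H (1, z) = phi z" "x \<in> Disk" "y \<in> Disk" "x \<noteq> y"
  shows "wind phi x y = angle_change (\<lambda>t. ham_flow.Phi H (t, y) - ham_flow.Phi H (t, x))"
  using wind_eq[OF isotopy.intro[OF ham_flow_isotopy(1)[OF assms(1,2)]] assms(3-)] by simp

lemma realizable_compose:
  assumes "realizable psi" "realizable phi"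
  shows "realizable (\<lambda>z. phi (psi z))"
    and "\<And>x y. x \<in> Disk \<Longrightarrow> y \<in> Disk \<Longrightarrow> x \<noteq> y \<Longrightarrow> wind (\<lambda>z. phi (psi z)) x y = wind psi x y + wind phi (psi x) (psi y)"
proof -
  obtain H1 r1 H2 r2 where A: "ham_flow H1 r1" "r1 < 1" "\<And>z. z \<in> Disk \<Longrightarrow> ham_flow.Phi H1 (1, z) = psi z"
    and B: "ham_flow H2 r2" "r2 < 1" "\<And>z. z \<in> Disk \<Longrightarrow> ham_flow.Phi H2 (1, z) = phi z"
    using assms unfolding realizable_def by blast
  interpret a: ham_flow H1 r1 by (rule A)
  interpret b: ham_flow H2 r2 by (rule B)
  obtain K where K: "ham_flow K (max r1 r2)" "\<And>t z. ham_flow.Phi K (t, z) = b.Phi (2 * t - 1, a.Phi (2 * t, z))"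
    by (rule ham_flow_concat[OF A(1) B(1)]) (rule that)
  have m: "psi z \<in> Disk" if "z \<in> Disk" for z
    using a.Phi_bound[of z 1 1] that A by auto
  have r: "max r1 r2 < 1" using A B by simp
  have end_eq: "ham_flow.Phi K (1, z) = phi (psi z)" if "z \<in> Disk" for z
    using that A(3) B(3) m a.Phi_time(2)[of 2 z] by (simp add: K(2))
  show "realizable (\<lambda>z. phi (psi z))" unfolding realizable_def using K(1) r end_eq by blast
  show "wind (\<lambda>z. phi (psi z)) x y = wind psi x y + wind phi (psi x) (psi y)" if xy: "x \<in> Disk" "y \<in> Disk" "x \<noteq> y" for x y
  proof -
    interpret p: isotopy H1 "\<lambda>t z. a.Phi (t, z)" by (rule isotopy.intro[OF ham_flow_isotopy(1)[OF A(1,2)]])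
    interpret q: isotopy H2 "\<lambda>t z. b.Phi (t, z)" by (rule isotopy.intro[OF ham_flow_isotopy(1)[OF B(1,2)]])
    have ne: "psi x \<noteq> psi y" using p.inj[of 1 x y] A(3) xy by auto
    obtain l1 where l1: "continuous_on {0..1} l1" "\<And>t. t \<in> {0..1} \<Longrightarrow> a.Phi (t, y) - a.Phi (t, x) = exp (l1 t)"
      using path_logarithm[OF p.curve_cont[OF xy(1,2)] p.difference_nonzero[OF _ xy]] by blast
    obtain l2 where l2: "continuous_on {0..1} l2" "\<And>t. t \<in> {0..1} \<Longrightarrow> b.Phi (t, psi y) - b.Phi (t, psi x) = exp (l2 t)"
      using path_logarithm[OF q.curve_cont[OF m[OF xy(1)] m[OF xy(2)]] q.difference_nonzero[OF _ m[OF xy(1)] m[OF xy(2)] ne]] by blast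
    \<comment> \<open>A continuous logarithm of the concatenated curve: min and max freeze each
      piece during the other half, and the second piece is shifted to start where the first one
      ends.\<close>
    define l where "l t = l1 (min (2 * t) 1) + (l2 (max (2 * t - 1) 0) - l2 0)" for t
    have lc: "continuous_on {0..1} l" unfolding l_def
      by (intro continuous_intros continuous_on_compose2[OF l1(1)] continuous_on_compose2[OF l2(1)]) auto
    have e0: "exp (l2 0) = psi y - psi x" using l2(2)[of 0] by (simp add: b.Phi_props)
    have e1: "exp (l1 1) = psi y - psi x" using l1(2)[of 1] A(3) xy by simp
    have le: "ham_flow.Phi K (t, y) - ham_flow.Phi K (t, x) = exp (l t)" if t: "t \<in> {0..1}" for t
    proof (cases "2 * t \<le> 1")
      case True
      then have "l t = l1 (2 * t)" by (simp add: l_def)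
      then show ?thesis using l1(2)[of "2 * t"] t True by (simp add: K(2) b.Phi_time)
    next
      case False
      then have "l t = l1 1 + (l2 (2 * t - 1) - l2 0)" by (simp add: l_def)
      then have "exp (l t) = exp (l2 (2 * t - 1))" using e0 e1 ne by (simp add: exp_add exp_diff)
      then show ?thesis using l2(2)[of "2 * t - 1"] t False a.Phi_time(2)[of "2 * t"] A(3) xy by (simp add: K(2))
    qed
    have "wind (\<lambda>z. phi (psi z)) x y = (Im (l 1) - Im (l 0)) / (2 * pi)"
      using wind_flow[OF K(1) r end_eq xy] angle_change_eq[OF lc le] by simp
    moreover have "wind psi x y = (Im (l1 1) - Im (l1 0)) / (2 * pi)"
      using wind_flow[OF A xy] angle_change_eq[OF l1] by simp
    moreover have "wind phi (psi x) (psi y) = (Im (l2 1) - Im (l2 0)) / (2 * pi)"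
      using wind_flow[OF B m[OF xy(1)] m[OF xy(2)] ne] angle_change_eq[OF l2] by simp
    ultimately show ?thesis by (simp add: l_def diff_divide_distrib add_divide_distrib)
  qed
qed

text \<open>An antiderivative of gamma'/gamma is, up to a constant, a continuous logarithm of gamma,
  the difference vector of the two trajectories.\<close>

lemma wind_integral:
  assumes A: "ham_flow H r" "r < 1" "\<And>z. z \<in> Disk \<Longrightarrow> ham_flow.Phi H (1, z) = phi z" and xy: "x \<in> Disk" "y \<in> Disk" "x \<noteq> y"
  shows "wind phi x y = integral {0..1} (\<lambda>t. Im ((hfield H (ham_flow.Phi H (t, y), t) - hfield H (ham_flow.Phi H (t, x), t)) /
    (ham_flow.Phi H (t, y) - ham_flow.Phi H (t, x)))) / (2 * pi)"
proof -
  interpret a: ham_flow H r by (rule A)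
  define \<gamma> where "\<gamma> t = a.Phi (t, y) - a.Phi (t, x)" for t
  define \<gamma>' where "\<gamma>' t = a.X (a.Phi (t, y), t) - a.X (a.Phi (t, x), t)" for t
  have nz: "\<gamma> t \<noteq> 0" for t using a.Phi_inj xy by (auto simp: \<gamma>_def)
  have d: "(\<gamma> has_vector_derivative \<gamma>' t) (at t)" for t
    unfolding \<gamma>_def \<gamma>'_def by (intro has_vector_derivative_diff a.Phi_props)
  have c: "continuous_on A \<gamma>" "continuous_on A \<gamma>'" for A
    unfolding \<gamma>_def \<gamma>'_def
    by (intro continuous_intros Cinf_continuous Cinf_compose[OF a.Phi_props(1)] Cinf_compose[OF a.XC] smooth_intros)+
  have "continuous_on {0..1} (\<lambda>t. \<gamma>' t / \<gamma> t)" using c nz by (intro continuous_intros) auto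
  then obtain g where g: "\<And>t. t \<in> {0..1} \<Longrightarrow> (g has_vector_derivative \<gamma>' t / \<gamma> t) (at t within {0..1})"
    by (rule antiderivative_continuous) (rule that)
  have gc: "continuous_on {0..1} g"
    unfolding continuous_on_eq_continuous_within by (intro ballI has_vector_derivative_continuous[OF g])
  have const: "\<gamma> t * exp (- g t) = \<gamma> 0 * exp (- g 0)" if t: "t \<in> {0..1}" for t
  proof -
    have "((\<lambda>t. \<gamma> t * exp (- g t)) has_derivative (\<lambda>h. 0)) (at s within {0..1})" if s: "s \<in> {0..1}" for s
    proof -
      have "(exp has_field_derivative exp (- g s)) (at (- g s))" by (rule DERIV_exp)
      from field_vector_diff_chain_within[OF has_vector_derivative_minus[OF g[OF s]] has_field_derivative_at_within[OF this]]
      have "((\<lambda>t. exp (- g t)) has_vector_derivative - (\<gamma>' s / \<gamma> s) * exp (- g s)) (at s within {0..1})" by (simp add: o_def)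
      from has_vector_derivative_mult[OF has_vector_derivative_at_within[OF d[of s]] this]
      show ?thesis using nz[of s] by (simp add: has_vector_derivative_def)
    qed
    then obtain k where "\<And>s. s \<in> {0..1} \<Longrightarrow> \<gamma> s * exp (- g s) = k"
      using has_derivative_zero_constant[of "{0..1::real}" "\<lambda>t. \<gamma> t * exp (- g t)"] by auto
    then show ?thesis using t by simp
  qed
  have "\<gamma> t = exp (g t + (Ln (\<gamma> 0) - g 0))" if t: "t \<in> {0..1}" for t
  proof -
    have "\<gamma> t = \<gamma> t * exp (- g t) * exp (g t)" by (simp add: mult.assoc mult_exp_exp)
    also have "\<dots> = exp (g t + (Ln (\<gamma> 0) - g 0))"
      unfolding const[OF t] using nz[of 0] by (simp add: exp_add exp_diff exp_minus divide_inverse)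
    finally show ?thesis .
  qed
  then have "angle_change \<gamma> = (Im (g 1 + (Ln (\<gamma> 0) - g 0)) - Im (g 0 + (Ln (\<gamma> 0) - g 0))) / (2 * pi)"
    by (intro angle_change_eq[where l = "\<lambda>t. g t + (Ln (\<gamma> 0) - g 0)"] continuous_on_add gc continuous_on_const)
  moreover have "((\<lambda>t. Im (\<gamma>' t / \<gamma> t)) has_integral Im (g 1 - g 0)) {0..1}"
  proof -
    have "((\<lambda>t. \<gamma>' t / \<gamma> t) has_integral g 1 - g 0) {0..1}"
      by (rule fundamental_theorem_of_calculus) (use g in auto)
    from has_integral_linear[OF this bounded_linear_Im] show ?thesis by (simp add: o_def)
  qed
  then have "integral {0..1} (\<lambda>t. Im (\<gamma>' t / \<gamma> t)) = Im (g 1 - g 0)" by (rule integral_unique)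
  ultimately show ?thesis using wind_flow[OF A xy] by (simp add: \<gamma>_def[abs_def] \<gamma>'_def)
qed

section \<open>Area in the disk\<close>

text \<open>Coordinates in \<open>real^2\<close>, where determinants and the change of variables for
  measures are formulated.\<close>

definition cart :: "real^2 \<Rightarrow> complex" where "cart v = Complex (v $ 1) (v $ 2)"

definition uncart :: "complex \<Rightarrow> real^2" where "uncart z = vector [Re z, Im z]"

lemma uncart_cart [simp]: "uncart (cart v) = v"
  by (simp add: cart_def uncart_def vec_eq_iff forall_2)

lemma cart_uncart [simp]: "cart (uncart z) = z"
  by (simp add: cart_def uncart_def)

lemma bounded_linear_cart: "bounded_linear cart"
  unfolding linear_conv_bounded_linear[symmetric]
  by (auto intro!: linearI simp: cart_def complex_eq_iff)

lemma bounded_linear_uncart: "bounded_linear uncart"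
  unfolding linear_conv_bounded_linear[symmetric]
  by (auto intro!: linearI simp: uncart_def vec_eq_iff forall_2)

lemma cart_measurable [measurable]: "cart \<in> borel_measurable borel"
  by (intro borel_measurable_continuous_onI linear_continuous_on bounded_linear_cart)

lemma cart_vimage_box: "cart -` box l u = box (uncart l) (uncart u)"
  by (auto simp: cart_def uncart_def in_box_complex_iff mem_box_cart forall_2)

lemma emeasure_box_cart:
  assumes "Re l \<le> Re u" "Im l \<le> Im u"
  shows "emeasure lborel (box (uncart l) (uncart u)) = ennreal ((Re u - Re l) * (Im u - Im l))"
proof -
  have ne: "cbox (uncart l) (uncart u) \<noteq> {}"
    using assms by (auto simp: uncart_def interval_ne_empty_cart forall_2)
  have "measure lborel (box (uncart l) (uncart u)) = measure lborel (cbox (uncart l) (uncart u))"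
    by (simp add: measure_lborel_box_eq measure_lborel_cbox_eq)
  also have "\<dots> = (Re u - Re l) * (Im u - Im l)"
    unfolding content_cbox_cart[OF ne] by (simp add: UNIV_2 uncart_def)
  finally show ?thesis
    by (subst emeasure_eq_ennreal_measure) (use emeasure_lborel_box_finite in \<open>auto simp: less_top\<close>)
qed

lemma lborel_complex_eqI:
  fixes M :: "complex measure"
  assumes s: "sets M = sets borel"
    and e: "\<And>l u. Re l \<le> Re u \<Longrightarrow> Im l \<le> Im u \<Longrightarrow>
      emeasure M (box l u) = ennreal ((Re u - Re l) * (Im u - Im l))"
  shows "M = lborel"
proof (rule sym, rule lborel_eqI)
  fix l u :: complex assume le: "\<And>b. b \<in> Basis \<Longrightarrow> l \<bullet> b \<le> u \<bullet> b"
  have lu: "Re l \<le> Re u" "Im l \<le> Im u" using le[of 1] le[of \<i>] by (auto simp: Basis_complex_def)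
  show "emeasure M (box l u) = ennreal (\<Prod>b\<in>Basis. (u - l) \<bullet> b)"
    unfolding e[OF lu] by (simp add: Basis_complex_def)
qed (rule s)

lemma lborel_cart: "distr lborel borel cart = lborel"
proof (rule lborel_complex_eqI)
  fix l u :: complex assume "Re l \<le> Re u" "Im l \<le> Im u"
  then show "emeasure (distr lborel borel cart) (box l u) = ennreal ((Re u - Re l) * (Im u - Im l))"
    by (subst emeasure_distr) (auto simp: cart_vimage_box emeasure_box_cart)
qed simp

text \<open>Boxes determine the measure. The preimage of a box is open and, as F is the identity far
  out, bounded; the change of variables with |det| = 1 compares its area with that of the
  box.\<close>

lemma lborel_preserved:
  assumes F: "Cinf F" "bij F" and jac: "\<And>z. om (FD F z 1) (FD F z \<i>) = 1"
    and out: "\<And>z. R < norm z \<Longrightarrow> F z = z"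
  shows "distr lborel borel F = lborel"
proof (rule lborel_complex_eqI)
  fix l u :: complex assume lu: "Re l \<le> Re u" "Im l \<le> Im u"
  have cF: "continuous_on UNIV F" by (rule Cinf_continuous[OF F(1)])
  define V where "V = F -` box l u"
  have oV: "open V" unfolding V_def by (rule open_vimage[OF open_box cF])
  have bV: "bounded V"
  proof (rule bounded_subset)
    show "bounded (box l u \<union> cball 0 R)" by simp
    show "V \<subseteq> box l u \<union> cball 0 R" unfolding V_def using out by (auto simp: not_le[symmetric])
  qed
  define S where "S = cart -` V"
  have oS: "open S" unfolding S_def
    by (rule open_vimage[OF oV linear_continuous_on[OF bounded_linear_cart]])
  have "S = uncart ` V" unfolding S_def by (force simp: image_iff)
  then have bS: "bounded S" using bounded_linear_image[OF bV bounded_linear_uncart] by simp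
  have mS: "S \<in> lmeasurable" by (rule lmeasurable_open[OF bS oS])
  define G where "G = (\<lambda>v. uncart (F (cart v)))"
  have GS: "G ` S = box (uncart l) (uncart u)"
  proof -
    have "surj F" using F(2) bij_is_surj by blast
    then have "F ` V = box l u" unfolding V_def by (simp add: surj_image_vimage_eq)
    moreover have "cart ` S = V" unfolding S_def by (force simp: image_iff intro: cart_uncart[symmetric])
    ultimately have "G ` S = uncart ` box l u" unfolding G_def by (metis image_image)
    also have "\<dots> = cart -` box l u" by (force simp: image_iff)
    finally show ?thesis by (simp add: cart_vimage_box)
  qed
  define G' where "G' x = (\<lambda>h. uncart (FD F (cart x) (cart h)))" for x
  have G': "(G has_derivative G' x) (at x within S)" for x
    unfolding G_def G'_def
    by (rule bounded_linear.has_derivative[OF bounded_linear_uncart],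
        rule has_derivative_compose[OF bounded_linear_imp_has_derivative[OF bounded_linear_cart]
          Cinf_has_derivative[OF F(1)]])
  have ax: "cart (axis 1 1) = 1" "cart (axis 2 1) = \<i>"
    by (auto simp: cart_def axis_def complex_eq_iff)
  have det: "\<bar>det (matrix (G' x))\<bar> = 1" for x
    using jac[of "cart x"] unfolding det_2 matrix_def G'_def
    by (simp add: ax uncart_def om_def algebra_simps)
  have inj: "inj_on G S" 
  proof (rule inj_onI)
    fix v w assume "G v = G w"
    then have "F (cart v) = F (cart w)" unfolding G_def by (metis cart_uncart)
    then have "cart v = cart w" using bij_is_inj[OF F(2)] by (simp add: inj_eq)
    then show "v = w" by (metis uncart_cart)
  qed
  let ?c = "(Re u - Re l) * (Im u - Im l)"
  have c0: "0 \<le> ?c" using lu by simp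
  have "measure lebesgue (box (uncart l) (uncart u)) = ?c"
    using emeasure_box_cart[OF lu] c0 by (simp add: measure_def)
  moreover have "box (uncart l) (uncart u) \<in> lmeasurable" by simp
  ultimately have "((\<lambda>x. \<bar>det (matrix (G' x))\<bar>) has_integral ?c) S"
    using has_measure_differentiable_image[OF _ G' inj, of ?c] mS GS by (auto intro: fmeasurableD)
  then have "integral S (\<lambda>x. 1::real) = ?c" by (simp add: det has_integral_iff)
  then have "measure lborel S = ?c"
    using lmeasure_integral[OF mS] oS by simp
  moreover have "emeasure lborel S < \<infinity>" by (rule emeasure_bounded_finite[OF bS])
  ultimately have eS: "emeasure lborel S = ennreal ?c"
    by (simp add: emeasure_eq_ennreal_measure less_top)
  have mF: "F \<in> borel_measurable borel" by (rule borel_measurable_continuous_onI[OF cF])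
  have "emeasure (distr lborel borel F) (box l u) = emeasure lborel V"
    using mF by (subst emeasure_distr) (auto simp: V_def)
  also have "\<dots> = emeasure (distr lborel borel cart) V" by (simp add: lborel_cart)
  also have "\<dots> = emeasure lborel S" using oV by (subst emeasure_distr) (auto simp: S_def)
  finally show "emeasure (distr lborel borel F) (box l u) = ennreal ?c" using eS by simp
qed simp

section \<open>Area on the disk and integration over chords\<close>

abbreviation disk_measure :: "complex measure" where "disk_measure \<equiv> restrict_space lborel Disk"

lemma emeasure_Disk: "emeasure lborel Disk = ennreal pi"
  using emeasure_cball[of 1 "0::complex"] by (simp add: unit_ball_vol_2)

lemma space_disk_measure [simp]: "space disk_measure = Disk"
  by (simp add: space_restrict_space)

lemma finite_disk_measure: "finite_measure disk_measure"
  by (rule finite_measureI) (simp add: emeasure_restrict_space emeasure_Disk)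

lemma disk_measure_area: "measure disk_measure Disk = pi"
  by (simp add: measure_def emeasure_restrict_space emeasure_Disk)

lemma disk_measurable: "f \<in> borel_measurable borel \<Longrightarrow> f \<in> borel_measurable disk_measure"
  by (simp add: measurable_restrict_space1)

lemma integrable_disk:
  fixes f :: "complex \<Rightarrow> 'b::{banach, second_countable_topology}"
  assumes "f \<in> borel_measurable borel" "\<And>w. w \<in> Disk \<Longrightarrow> norm (f w) \<le> B"
  shows "integrable disk_measure f"
  using finite_measure.integrable_const_bound[OF finite_disk_measure, of f B]
  by (simp add: assms disk_measurable AE_restrict_space_iff)

lemma integrable_disk_continuous:
  fixes f :: "complex \<Rightarrow> 'b::euclidean_space"
  assumes "continuous_on UNIV f"
  shows "integrable disk_measure f"
proof -
  have "compact (f ` Disk)" by (rule compact_continuous_image) (use assms continuous_on_subset in auto)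
  then obtain B where "\<forall>w\<in>Disk. norm (f w) \<le> B" by (metis compact_imp_bounded bounded_iff imageI)
  then show ?thesis
    by (intro integrable_disk[of f B]) (auto intro: borel_measurable_continuous_onI assms)
qed

lemma integral_disk:
  fixes f :: "complex \<Rightarrow> 'b::{banach, second_countable_topology}"
  shows "integral\<^sup>L disk_measure f = (\<integral>w. indicator Disk w *\<^sub>R f w \<partial>lborel)"
  by (simp add: integral_restrict_space)

text \<open>Both orders of the axes are treated at once; the second variable s, over which Fubini
  integrates first, runs in the direction e of the derivative in \<open>green_disk\<close>.\<close>

lemma lborel_coords:
  assumes "(e, e') = (1, \<i>) \<or> (e, e') = (\<i>, 1)"
  shows "distr (lborel \<Otimes>\<^sub>M lborel) borel (\<lambda>(t::real, s::real). s *\<^sub>R e + t *\<^sub>R e') = (lborel :: complex measure)"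
proof (rule lborel_complex_eqI)
  fix l u :: complex assume lu: "Re l \<le> Re u" "Im l \<le> Im u"
  let ?c = "\<lambda>(t::real, s::real). s *\<^sub>R e + t *\<^sub>R e'"
  have [measurable]: "?c \<in> borel_measurable (lborel \<Otimes>\<^sub>M lborel)" by measurable
  have sub: "?c -` box l u = (if e = 1 then {Im l<..<Im u} \<times> {Re l<..<Re u} else {Re l<..<Re u} \<times> {Im l<..<Im u})"
    using assms by (auto simp: in_box_complex_iff)
  have "emeasure (distr (lborel \<Otimes>\<^sub>M lborel) borel ?c) (box l u)
      = emeasure (lborel \<Otimes>\<^sub>M lborel) (?c -` box l u)"
    by (subst emeasure_distr) (auto simp: space_pair_measure)
  also have "\<dots> = ennreal ((Re u - Re l) * (Im u - Im l))"
    using lu unfolding sub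
    by (simp add: lborel.emeasure_pair_measure_Times ennreal_mult' mult.commute)
  finally show "emeasure (distr (lborel \<Otimes>\<^sub>M lborel) borel ?c) (box l u)
     = ennreal ((Re u - Re l) * (Im u - Im l))" .
qed simp

lemma norm_coords:
  assumes "(e, e') = (1, \<i>) \<or> (e, e') = (\<i>, 1)"
  shows "(norm (s *\<^sub>R e + t *\<^sub>R e'))\<^sup>2 = s\<^sup>2 + t\<^sup>2"
  using assms by (auto simp: cmod_power2)

text \<open>The slices in direction e are chords whose endpoints lie on the circle, where P
  vanishes.\<close>

lemma green_disk:
  fixes P :: "complex \<Rightarrow> real"
  assumes P: "Cinf P" and zero: "\<And>z. norm z = 1 \<Longrightarrow> P z = 0"
    and e: "(e, e') = (1, \<i>) \<or> (e, e') = (\<i>, 1)"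
  shows "(\<integral>w. FD P w e \<partial>disk_measure) = 0"
proof -
  let ?c = "\<lambda>(t::real, s::real). s *\<^sub>R e + t *\<^sub>R e'"
  have [measurable]: "?c \<in> borel_measurable (lborel \<Otimes>\<^sub>M lborel)" by measurable
  have cP: "continuous_on A (\<lambda>w. FD P w e)" for A
    by (rule Cinf_continuous) (intro smooth_intros Cinf_FD P)
  let ?f = "\<lambda>w. indicator Disk w * FD P w e"
  have "integrable disk_measure (\<lambda>w. FD P w e)" by (rule integrable_disk_continuous[OF cP])
  then have int: "integrable lborel ?f" by (simp add: integrable_restrict_space)
  have int2: "integrable (lborel \<Otimes>\<^sub>M lborel) (\<lambda>p. ?f (?c p))"
    using integrable_distr[of ?c "lborel \<Otimes>\<^sub>M lborel" borel ?f] int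
    unfolding lborel_coords[OF e] by simp
  have inner: "(\<integral>s. ?f (s *\<^sub>R e + t *\<^sub>R e') \<partial>lborel) = 0" for t
  proof (cases "\<bar>t\<bar> \<le> 1")
    case False
    have "s *\<^sub>R e + t *\<^sub>R e' \<notin> Disk" for s
    proof
      assume "s *\<^sub>R e + t *\<^sub>R e' \<in> Disk"
      then have "(norm (s *\<^sub>R e + t *\<^sub>R e'))\<^sup>2 \<le> 1\<^sup>2" by (intro power_mono) auto
      then have "t\<^sup>2 \<le> 1\<^sup>2" unfolding norm_coords[OF e] by (smt (verit) zero_le_power2 one_power2)
      then show False using False abs_le_square_iff[of t 1] by simp
    qed
    then show ?thesis by simp
  next
    case True
    define r where "r = sqrt (1 - t\<^sup>2)"
    have t2: "t\<^sup>2 \<le> 1" using True by (simp add: abs_square_le_1)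
    have r0: "0 \<le> r" and r2: "r\<^sup>2 = 1 - t\<^sup>2" using t2 by (auto simp: r_def)
    have mem: "s *\<^sub>R e + t *\<^sub>R e' \<in> Disk \<longleftrightarrow> s \<in> {-r..r}" for s
    proof -
      have "s *\<^sub>R e + t *\<^sub>R e' \<in> Disk \<longleftrightarrow> (norm (s *\<^sub>R e + t *\<^sub>R e'))\<^sup>2 \<le> 1\<^sup>2"
        using abs_le_square_iff[of "norm (s *\<^sub>R e + t *\<^sub>R e')" 1] by simp
      also have "\<dots> \<longleftrightarrow> s\<^sup>2 \<le> r\<^sup>2" unfolding norm_coords[OF e] r2 by auto
      also have "\<dots> \<longleftrightarrow> \<bar>s\<bar> \<le> \<bar>r\<bar>" by (rule abs_le_square_iff[symmetric])
      finally show ?thesis using r0 by auto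
    qed
    have d: "((\<lambda>s. P (s *\<^sub>R e + t *\<^sub>R e')) has_vector_derivative FD P (s *\<^sub>R e + t *\<^sub>R e') e) (at s within {-r..r})" for s
    proof -
      have "((\<lambda>s. s *\<^sub>R e + t *\<^sub>R e') has_derivative (\<lambda>h. h *\<^sub>R e)) (at s within {-r..r})"
        by (auto intro!: derivative_eq_intros)
      from has_derivative_compose[OF this Cinf_has_derivative[OF P]]
      show ?thesis unfolding has_vector_derivative_def by (simp add: linear_cmul[OF linear_FD[OF P]])
    qed
    have end0: "P (s *\<^sub>R e + t *\<^sub>R e') = 0" if "s\<^sup>2 = r\<^sup>2" for s
    proof (rule zero)
      have "(norm (s *\<^sub>R e + t *\<^sub>R e'))\<^sup>2 = 1" unfolding norm_coords[OF e] that r2 by simp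
      then show "norm (s *\<^sub>R e + t *\<^sub>R e') = 1" 
        using norm_ge_zero[of "s *\<^sub>R e + t *\<^sub>R e'"] by (auto simp: power2_eq_1_iff simp del: norm_ge_zero)
    qed
    have "(\<integral>s. indicator {-r..r} s *\<^sub>R FD P (s *\<^sub>R e + t *\<^sub>R e') e \<partial>lborel)
        = P (r *\<^sub>R e + t *\<^sub>R e') - P ((-r) *\<^sub>R e + t *\<^sub>R e')"
    proof (rule integral_FTC_Icc)
      show "- r \<le> r" using r0 by simp
      show "continuous_on {- r..r} (\<lambda>s. FD P (s *\<^sub>R e + t *\<^sub>R e') e)"
        by (rule continuous_on_compose2[OF cP[of UNIV]]) (auto intro!: continuous_intros)
    qed (rule d)
    also have "\<dots> = 0" using end0[of r] end0[of "-r"] by simp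
    finally show ?thesis using mem by (simp add: indicator_def of_bool_def)
  qed
  have "(\<integral>w. FD P w e \<partial>disk_measure) = integral\<^sup>L (distr (lborel \<Otimes>\<^sub>M lborel) borel ?c) ?f"
    by (simp add: integral_disk lborel_coords[OF e])
  also have "\<dots> = (\<integral>p. ?f (?c p) \<partial>(lborel \<Otimes>\<^sub>M lborel))"
    by (rule integral_distr) (use int in auto)
  also have "\<dots> = (\<integral>t. (\<integral>s. ?f (?c (t, s)) \<partial>lborel) \<partial>lborel)"
    by (rule lborel_pair.integral_fst'[OF int2, symmetric])
  also have "\<dots> = 0" by (simp add: inner)
  finally show ?thesis .
qed

section \<open>The winding kernel\<close>

lemma integral_lborel_affine:
  fixes f :: "complex \<Rightarrow> 'b::{banach, second_countable_topology}"
  assumes [measurable]: "f \<in> borel_measurable borel" and c: "c \<noteq> 0"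
  shows "integral\<^sup>L lborel f = c\<^sup>2 *\<^sub>R (\<integral>v. f (z + c *\<^sub>R v) \<partial>lborel)"
proof -
  have "integral\<^sup>L lborel f
      = integral\<^sup>L (density (distr lborel borel (\<lambda>x::complex. z + c *\<^sub>R x)) (\<lambda>_. ennreal (\<bar>c\<bar> ^ DIM(complex)))) f"
    by (subst lborel_affine[OF c, of z]) (simp add: ennreal_power)
  also have "\<dots> = (\<integral>v. (\<bar>c\<bar> ^ DIM(complex)) *\<^sub>R f v \<partial>distr lborel borel (\<lambda>x::complex. z + c *\<^sub>R x))"
    by (rule integral_density) auto
  also have "\<dots> = (\<integral>v. (\<bar>c\<bar> ^ DIM(complex)) *\<^sub>R f (z + c *\<^sub>R v) \<partial>lborel)"
    by (rule integral_distr) auto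
  finally show ?thesis by simp
qed

lemma integrable_inverse_square_line: "integrable lborel (\<lambda>x::real. inverse (1 + x\<^sup>2))"
  using integrable_inverse_1_plus_square by (simp add: set_integrable_def einterval_def)

text \<open>Since (1 + a + b)^2 >= (1 + a)(1 + b) for a, b >= 0, the kernel is dominated by a
  product of functions of one variable.\<close>

lemma integrable_cauchy_kernel:
  "integrable lborel (\<lambda>v::complex. 2 / ((norm v)\<^sup>2 + 1)\<^sup>2)"
proof -
  let ?c = "\<lambda>(t::real, s::real). s *\<^sub>R 1 + t *\<^sub>R \<i>"
  have [measurable]: "?c \<in> borel_measurable (lborel \<Otimes>\<^sub>M lborel)" by measurable
  let ?g = "\<lambda>p::real \<times> real. 2 * (inverse (1 + (fst p)\<^sup>2) * inverse (1 + (snd p)\<^sup>2))"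
  have g: "integrable (lborel \<Otimes>\<^sub>M lborel) ?g"
  proof (rule lborel_pair.Fubini_integrable)
    have eq: "(\<integral>y. norm (?g (x, y)) \<partial>lborel) = 2 * inverse (1 + x\<^sup>2) * (\<integral>y. inverse (1 + y\<^sup>2) \<partial>lborel)" for x
    proof -
      have "norm (?g (x, y)) = 2 * inverse (1 + x\<^sup>2) * inverse (1 + y\<^sup>2)" for y
        by (simp add: abs_mult add_nonneg_nonneg)
      then show ?thesis by simp
    qed
    show "integrable lborel (\<lambda>x. \<integral>y. norm (?g (x, y)) \<partial>lborel)"
      unfolding eq using integrable_inverse_square_line by simp
    show "AE x in lborel. integrable lborel (\<lambda>y. ?g (x, y))"
      using integrable_inverse_square_line by simp
  qed measurable
  have nc: "(norm (?c p))\<^sup>2 = (snd p)\<^sup>2 + (fst p)\<^sup>2" for p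
    by (cases p) (simp add: cmod_power2)
  have "integrable (lborel \<Otimes>\<^sub>M lborel) (\<lambda>p. 2 / ((norm (?c p))\<^sup>2 + 1)\<^sup>2)"
  proof (rule Bochner_Integration.integrable_bound[OF g])
    have "norm (2 / ((norm (?c p))\<^sup>2 + 1)\<^sup>2) \<le> norm (?g p)" for p
    proof -
      let ?a = "(fst p)\<^sup>2" and ?b = "(snd p)\<^sup>2"
      have ab: "0 \<le> ?a" "0 \<le> ?b" "0 \<le> ?a * ?b" by auto
      have "(?b + ?a + 1)\<^sup>2 - (1 + ?a) * (1 + ?b) = ?a * ?a + ?b * ?b + ?a + ?b + ?a * ?b"
        by (simp add: power2_eq_square algebra_simps)
      moreover have "0 \<le> ?a * ?a + ?b * ?b + ?a + ?b + ?a * ?b" using ab by (intro add_nonneg_nonneg) auto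
      ultimately have "(1 + ?a) * (1 + ?b) \<le> (?b + ?a + 1)\<^sup>2" by linarith
      moreover have "0 < (1 + ?a) * (1 + ?b)" using ab by (auto intro!: mult_pos_pos simp: add_pos_nonneg)
      ultimately have "2 / (?b + ?a + 1)\<^sup>2 \<le> 2 / ((1 + ?a) * (1 + ?b))"
        by (intro frac_le) auto
      moreover have "norm (?g p) = 2 * (inverse (1 + ?a) * inverse (1 + ?b))"
        using ab by (simp add: abs_mult)
      ultimately show ?thesis unfolding nc by (simp only: inverse_mult_distrib divide_inverse) simp
    qed
    then show "AE p in lborel \<Otimes>\<^sub>M lborel. norm (2 / ((norm (?c p))\<^sup>2 + 1)\<^sup>2) \<le> norm (?g p)" by simp
  qed measurable
  then have "integrable (distr (lborel \<Otimes>\<^sub>M lborel) borel ?c) (\<lambda>v. 2 / ((norm v)\<^sup>2 + 1)\<^sup>2)"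
    by (subst integrable_distr_eq) auto
  then show ?thesis by (simp add: lborel_coords)
qed

text \<open>The substitution w = z + c v frees the kernel of the scale and puts it into the argument
  of g, where dominated convergence applies.\<close>

lemma approximate_identity:
  fixes g :: "complex \<Rightarrow> real" and \<delta> :: "nat \<Rightarrow> real"
  assumes g [measurable]: "g \<in> borel_measurable borel" and B: "\<And>w. \<bar>g w\<bar> \<le> B" and z: "isCont g z"
    and d: "\<delta> \<longlonglongrightarrow> 0" "\<And>n. 0 < \<delta> n"
  shows "(\<lambda>n. \<integral>w. g w * (2 * (\<delta> n)\<^sup>2 / ((norm (w - z))\<^sup>2 + (\<delta> n)\<^sup>2)\<^sup>2) \<partial>lborel)
     \<longlonglongrightarrow> g z * (\<integral>v. 2 / ((norm (v::complex))\<^sup>2 + 1)\<^sup>2 \<partial>lborel)"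
proof -
  have B0: "0 \<le> B" using B[of 0] by linarith
  have eq: "(\<integral>w. g w * (2 * c\<^sup>2 / ((norm (w - z))\<^sup>2 + c\<^sup>2)\<^sup>2) \<partial>lborel)
      = (\<integral>v. g (z + c *\<^sub>R v) * (2 / ((norm v)\<^sup>2 + 1)\<^sup>2) \<partial>lborel)" if "0 < c" for c :: real
  proof -
    have "(\<integral>w. g w * (2 * c\<^sup>2 / ((norm (w - z))\<^sup>2 + c\<^sup>2)\<^sup>2) \<partial>lborel)
        = c\<^sup>2 *\<^sub>R (\<integral>v. g (z + c *\<^sub>R v) * (2 * c\<^sup>2 / ((norm (z + c *\<^sub>R v - z))\<^sup>2 + c\<^sup>2)\<^sup>2) \<partial>lborel)"
      using that by (intro integral_lborel_affine) auto
    also have "\<dots> = (\<integral>v. c\<^sup>2 * (g (z + c *\<^sub>R v) * (2 * c\<^sup>2 / ((norm (z + c *\<^sub>R v - z))\<^sup>2 + c\<^sup>2)\<^sup>2)) \<partial>lborel)"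
      by (simp only: real_scaleR_def integral_mult_right_zero)
    also have "\<dots> = (\<integral>v. g (z + c *\<^sub>R v) * (2 / ((norm v)\<^sup>2 + 1)\<^sup>2) \<partial>lborel)"
    proof (rule Bochner_Integration.integral_cong[OF refl])
      fix v :: complex
      have "(norm (z + c *\<^sub>R v - z))\<^sup>2 + c\<^sup>2 = c\<^sup>2 * ((norm v)\<^sup>2 + 1)"
        using that by (simp add: power_mult_distrib algebra_simps)
      then show "c\<^sup>2 * (g (z + c *\<^sub>R v) * (2 * c\<^sup>2 / ((norm (z + c *\<^sub>R v - z))\<^sup>2 + c\<^sup>2)\<^sup>2))
          = g (z + c *\<^sub>R v) * (2 / ((norm v)\<^sup>2 + 1)\<^sup>2)"
        using that by (simp add: power_mult_distrib power2_eq_square)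
    qed
    finally show ?thesis .
  qed
  have "(\<lambda>n. \<integral>v. g (z + \<delta> n *\<^sub>R v) * (2 / ((norm v)\<^sup>2 + 1)\<^sup>2) \<partial>lborel)
     \<longlonglongrightarrow> (\<integral>v. g z * (2 / ((norm (v::complex))\<^sup>2 + 1)\<^sup>2) \<partial>lborel)"
  proof (rule integral_dominated_convergence[where w = "\<lambda>v. B * (2 / ((norm v)\<^sup>2 + 1)\<^sup>2)"])
    show "AE v in lborel. (\<lambda>n. g (z + \<delta> n *\<^sub>R v) * (2 / ((norm v)\<^sup>2 + 1)\<^sup>2))
        \<longlonglongrightarrow> g z * (2 / ((norm v)\<^sup>2 + 1)\<^sup>2)"
    proof (rule AE_I2)
      fix v :: complex
      have "(\<lambda>n. z + \<delta> n *\<^sub>R v) \<longlonglongrightarrow> z + 0 *\<^sub>R v" by (intro tendsto_intros d)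
      then have "(\<lambda>n. g (z + \<delta> n *\<^sub>R v)) \<longlonglongrightarrow> g z" using isCont_tendsto_compose[OF z] by simp
      then show "(\<lambda>n. g (z + \<delta> n *\<^sub>R v) * (2 / ((norm v)\<^sup>2 + 1)\<^sup>2)) \<longlonglongrightarrow> g z * (2 / ((norm v)\<^sup>2 + 1)\<^sup>2)"
        by (intro tendsto_mult tendsto_const)
    qed
    show "integrable lborel (\<lambda>v::complex. B * (2 / ((norm v)\<^sup>2 + 1)\<^sup>2))"
      by (rule integrable_mult_right) (rule integrable_cauchy_kernel)
    show "AE v in lborel. norm (g (z + \<delta> n *\<^sub>R v) * (2 / ((norm v)\<^sup>2 + 1)\<^sup>2)) \<le> B * (2 / ((norm v)\<^sup>2 + 1)\<^sup>2)" for n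
    proof (rule AE_I2)
      fix v :: complex
      show "norm (g (z + \<delta> n *\<^sub>R v) * (2 / ((norm v)\<^sup>2 + 1)\<^sup>2)) \<le> B * (2 / ((norm v)\<^sup>2 + 1)\<^sup>2)"
        unfolding real_norm_def abs_mult using B[of "z + \<delta> n *\<^sub>R v"] B0 by (intro mult_mono) auto
    qed
  qed measurable
  then show ?thesis by (simp only: eq[OF d(2)] integral_mult_right_zero)
qed

text \<open>The integrand is the divergence of the field h times \<kappa>, which vanishes on the
  circle.\<close>

lemma green_field:
  fixes h :: "complex \<Rightarrow> real" and \<kappa> :: "complex \<Rightarrow> complex"
  assumes h: "Cinf h" "\<And>z. norm z = 1 \<Longrightarrow> h z = 0" and k: "Cinf \<kappa>"
  shows "(\<integral>w. FD h w (\<kappa> w) + h w * (Re (FD \<kappa> w 1) + Im (FD \<kappa> w \<i>)) \<partial>disk_measure) = 0"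
proof -
  have d: "FD (\<lambda>w. h w * Re (\<kappa> w)) w v = FD h w v * Re (\<kappa> w) + h w * Re (FD \<kappa> w v)"
    "FD (\<lambda>w. h w * Im (\<kappa> w)) w v = FD h w v * Im (\<kappa> w) + h w * Im (FD \<kappa> w v)" for w v
  proof -
    have "((\<lambda>w. h w * Re (\<kappa> w)) has_derivative (\<lambda>v. FD h w v * Re (\<kappa> w) + h w * Re (FD \<kappa> w v))) (at w)"
      by (rule derivative_eq_intros Cinf_has_derivative h k refl)+ (simp add: fun_eq_iff)
    from FD_eq[OF this] show "FD (\<lambda>w. h w * Re (\<kappa> w)) w v = FD h w v * Re (\<kappa> w) + h w * Re (FD \<kappa> w v)" by simp
    have "((\<lambda>w. h w * Im (\<kappa> w)) has_derivative (\<lambda>v. FD h w v * Im (\<kappa> w) + h w * Im (FD \<kappa> w v))) (at w)"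
      by (rule derivative_eq_intros Cinf_has_derivative h k refl)+ (simp add: fun_eq_iff)
    from FD_eq[OF this] show "FD (\<lambda>w. h w * Im (\<kappa> w)) w v = FD h w v * Im (\<kappa> w) + h w * Im (FD \<kappa> w v)" by simp
  qed
  have C: "Cinf (\<lambda>w. h w * Re (\<kappa> w))" "Cinf (\<lambda>w. h w * Im (\<kappa> w))"
    by (intro smooth_intros h k Cinf_compose[OF Cinf_Re])+
  have i: "integrable disk_measure (\<lambda>w. FD (\<lambda>w. h w * Re (\<kappa> w)) w 1)"
      "integrable disk_measure (\<lambda>w. FD (\<lambda>w. h w * Im (\<kappa> w)) w \<i>)"
    by (intro integrable_disk_continuous Cinf_continuous smooth_intros C)+
  have split: "FD h w (\<kappa> w) + h w * (Re (FD \<kappa> w 1) + Im (FD \<kappa> w \<i>))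
      = FD (\<lambda>w. h w * Re (\<kappa> w)) w 1 + FD (\<lambda>w. h w * Im (\<kappa> w)) w \<i>" for w
  proof -
    have "FD h w (\<kappa> w) = FD h w (Re (\<kappa> w) *\<^sub>R 1 + Im (\<kappa> w) *\<^sub>R \<i>)"
      by (rule arg_cong[where f = "FD h w"]) (simp add: complex_eq_iff)
    also have "\<dots> = Re (\<kappa> w) *\<^sub>R FD h w 1 + Im (\<kappa> w) *\<^sub>R FD h w \<i>"
      using linear_FD[OF h(1), of w] by (simp only: linear_add linear_cmul)
    finally show ?thesis unfolding d by (simp add: algebra_simps)
  qed
  show ?thesis unfolding split
    using green_disk[OF C(1), of 1 \<i>] green_disk[OF C(2), of \<i> 1] h(2) i by simp
qed

text \<open>For c = 1 this is the radial field, whose divergence is an approximate identity; for c =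
  i it is the rotational field, which has divergence 0.\<close>

lemma regularized_field:
  fixes c z :: complex
  assumes e: "0 < \<epsilon>"
  defines "\<kappa> \<equiv> \<lambda>w. (1 / ((norm (w - z))\<^sup>2 + \<epsilon>)) *\<^sub>R (c * (w - z))"
  shows "Cinf \<kappa>"
    and "Re (FD \<kappa> w 1) + Im (FD \<kappa> w \<i>) = Re c * (2 * \<epsilon> / ((norm (w - z))\<^sup>2 + \<epsilon>)\<^sup>2)"
proof -
  have pos: "0 < (w - z) \<bullet> (w - z) + \<epsilon>" for w using e by (simp add: add_nonneg_pos)
  have k: "\<kappa> = (\<lambda>w. (1 / ((w - z) \<bullet> (w - z) + \<epsilon>)) *\<^sub>R (c * (w - z)))"
    unfolding \<kappa>_def by (simp add: power2_norm_eq_inner)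
  have ne: "(w - z) \<bullet> (w - z) + \<epsilon> \<noteq> 0" for w using pos[of w] by simp
  show "Cinf \<kappa>" unfolding k by (intro smooth_intros Cinf_divide) (use ne in auto)
  have div_eq: "Re ((1 / q) *\<^sub>R (c * 1) - (2 * (u \<bullet> 1) / q\<^sup>2) *\<^sub>R (c * u)) + Im ((1 / q) *\<^sub>R (c * \<i>) - (2 * (u \<bullet> \<i>) / q\<^sup>2) *\<^sub>R (c * u))
      = 2 * Re c / q - (2 * Re c * (u \<bullet> u)) / q\<^sup>2" for q :: real and u :: complex
    by (simp add: inner_complex_def algebra_simps add_divide_distrib diff_divide_distrib)
  let ?u = "w - z"
  let ?q = "?u \<bullet> ?u + \<epsilon>"
  have "(\<kappa> has_derivative (\<lambda>v. (1 / ?q) *\<^sub>R (c * v) - (2 * (?u \<bullet> v) / ?q\<^sup>2) *\<^sub>R (c * ?u))) (at w)"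
    unfolding k
    by (rule derivative_eq_intros refl ne)+
      (simp add: fun_eq_iff ne power2_eq_square inner_commute scaleR_conv_of_real field_simps)
  from FD_eq[OF this] have "FD \<kappa> w v = (1 / ?q) *\<^sub>R (c * v) - (2 * (?u \<bullet> v) / ?q\<^sup>2) *\<^sub>R (c * ?u)" for v by simp
  then have "Re (FD \<kappa> w 1) + Im (FD \<kappa> w \<i>)
      = 2 * Re c / ?q - (2 * Re c * (?u \<bullet> ?u)) / ?q\<^sup>2"
    by (simp only: div_eq)
  also have "2 * Re c / ?q = 2 * Re c * ?q / ?q\<^sup>2"
    using ne[of w] by (simp add: power2_eq_square)
  also have "2 * Re c * ?q / ?q\<^sup>2 - (2 * Re c * (?u \<bullet> ?u)) / ?q\<^sup>2 = Re c * (2 * \<epsilon> / ?q\<^sup>2)"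
    by (simp only: diff_divide_distrib[symmetric]) (simp add: algebra_simps)
  finally show "Re (FD \<kappa> w 1) + Im (FD \<kappa> w \<i>) = Re c * (2 * \<epsilon> / ((norm (w - z))\<^sup>2 + \<epsilon>)\<^sup>2)"
    by (simp add: power2_norm_eq_inner)
qed


lemma integrable_disk_quotient:
  fixes f :: "complex \<Rightarrow> 'b::euclidean_space"
  assumes "continuous_on UNIV f" "0 < \<epsilon>"
  shows "integrable disk_measure (\<lambda>w. (1 / ((norm (w - z))\<^sup>2 + \<epsilon>)) *\<^sub>R f w)"
proof (rule integrable_disk_continuous)
  have "(norm (w - z))\<^sup>2 + \<epsilon> \<noteq> 0" for w using assms(2) by (smt (verit) zero_le_power2)
  then show "continuous_on UNIV (\<lambda>w. (1 / ((norm (w - z))\<^sup>2 + \<epsilon>)) *\<^sub>R f w)"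
    by (intro continuous_intros assms) auto
qed

abbreviation cauchy_mass :: real where
  "cauchy_mass \<equiv> \<integral>v. 2 / ((norm (v::complex))\<^sup>2 + 1)\<^sup>2 \<partial>lborel"

text \<open>Green's formula trades the radial derivative of h for h times the divergence of the
  radial field, an approximate identity of mass \<open>cauchy_mass\<close>. Extended by 0, h is
  continuous on the plane, which covers points z on the circle too.\<close>

lemma radial_limit_mass:
  fixes h :: "complex \<Rightarrow> real"
  assumes h: "Cinf h" "\<And>w. norm w = 1 \<Longrightarrow> h w = 0" and z: "z \<in> Disk"
    and d: "\<delta> \<longlonglongrightarrow> 0" "\<And>n. 0 < \<delta> n"
  shows "(\<lambda>n. \<integral>w. (1 / ((norm (w - z))\<^sup>2 + (\<delta> n)\<^sup>2)) * FD h w (w - z) \<partial>disk_measure)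
     \<longlonglongrightarrow> - (h z * cauchy_mass)"
proof -
  define g where "g w = (if w \<in> Disk then h w else 0)" for w
  have cg: "continuous_on UNIV g"
  proof -
    have "continuous_on (Disk \<union> {w. 1 \<le> norm w}) g"
      unfolding g_def
    proof (rule continuous_on_If)
      show "closed {w::complex. 1 \<le> norm w}" by (intro closed_Collect_le continuous_intros)
    qed (use h in \<open>auto intro: Cinf_continuous\<close>)
    moreover have "Disk \<union> {w::complex. 1 \<le> norm w} = UNIV" by auto
    ultimately show ?thesis by simp
  qed
  have "compact (h ` Disk)" by (rule compact_continuous_image) (auto intro: Cinf_continuous h)
  then obtain B where B: "\<And>w. w \<in> Disk \<Longrightarrow> \<bar>h w\<bar> \<le> B"
    by (metis compact_imp_bounded bounded_iff imageI real_norm_def)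
  have B0: "0 \<le> B" using B[OF z] by linarith
  have lim: "(\<lambda>n. \<integral>w. g w * (2 * (\<delta> n)\<^sup>2 / ((norm (w - z))\<^sup>2 + (\<delta> n)\<^sup>2)\<^sup>2) \<partial>lborel) \<longlonglongrightarrow> g z * cauchy_mass"
  proof (rule approximate_identity)
    show "g \<in> borel_measurable borel" by (rule borel_measurable_continuous_onI[OF cg])
    show "\<bar>g w\<bar> \<le> B" for w using B[of w] B0 by (auto simp: g_def)
    show "isCont g z" using cg by (simp add: continuous_on_eq_continuous_at)
  qed (rule d)+
  have eq: "(\<integral>w. (1 / ((norm (w - z))\<^sup>2 + \<epsilon>)) * FD h w (w - z) \<partial>disk_measure)
      = - (\<integral>w. g w * (2 * \<epsilon> / ((norm (w - z))\<^sup>2 + \<epsilon>)\<^sup>2) \<partial>lborel)" if e: "0 < \<epsilon>" for \<epsilon>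
  proof -
    let ?q = "\<lambda>w. (norm (w - z))\<^sup>2 + \<epsilon>"
    have q: "?q w \<noteq> 0" for w using e by (smt (verit) zero_le_power2)
    have "(\<integral>w. FD h w ((1 / ?q w) *\<^sub>R (1 * (w - z))) + h w * (Re 1 * (2 * \<epsilon> / (?q w)\<^sup>2)) \<partial>disk_measure) = 0"
      using green_field[OF h regularized_field(1)[OF e, of z 1]]
      unfolding regularized_field(2)[OF e, of z 1] .
    moreover have "FD h w ((1 / ?q w) *\<^sub>R (1 * (w - z))) = (1 / ?q w) * FD h w (w - z)" for w
      using linear_cmul[OF linear_FD[OF h(1)], of w "1 / ?q w" "w - z"] by simp
    ultimately have 0: "(\<integral>w. (1 / ?q w) * FD h w (w - z) + h w * (2 * \<epsilon> / (?q w)\<^sup>2) \<partial>disk_measure) = 0"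
      by simp
    have c: "continuous_on UNIV (\<lambda>w. FD h w (w - z))"
      by (rule Cinf_continuous) (intro smooth_intros h)
    have i1: "integrable disk_measure (\<lambda>w. (1 / ?q w) * FD h w (w - z))"
      using integrable_disk_quotient[OF c e, of z] by simp
    have i2: "integrable disk_measure (\<lambda>w. h w * (2 * \<epsilon> / (?q w)\<^sup>2))"
      by (intro integrable_disk_continuous continuous_intros Cinf_continuous h) (use q in auto)
    have "(\<integral>w. h w * (2 * \<epsilon> / (?q w)\<^sup>2) \<partial>disk_measure) = (\<integral>w. g w * (2 * \<epsilon> / (?q w)\<^sup>2) \<partial>lborel)"
      unfolding integral_disk by (rule Bochner_Integration.integral_cong) (auto simp: g_def indicator_def)
    then show ?thesis using 0 Bochner_Integration.integral_add[OF i1 i2] by linarith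
  qed
  have "g z = h z" using z by (simp add: g_def)
  moreover have "0 < (\<delta> n)\<^sup>2" for n using d(2)[of n] by simp
  ultimately show ?thesis using tendsto_minus[OF lim] by (simp only: eq)
qed

text \<open>A test function with gradient w that vanishes on the circle; it evaluates the constants
  in the kernel identity.\<close>

definition quad :: "complex \<Rightarrow> real" where "quad w = (w \<bullet> w - 1) / 2"

lemma Cinf_quad: "Cinf quad"
  unfolding quad_def by (intro smooth_intros Cinf_divide) auto

lemma FD_quad: "FD quad w v = w \<bullet> v"
proof -
  have "(quad has_derivative (\<lambda>v. w \<bullet> v)) (at w)"
    unfolding quad_def by (rule derivative_eq_intros refl)+ (auto simp: fun_eq_iff inner_commute)
  from FD_eq[OF this] show ?thesis by simp
qed

lemma quad_circle: "norm w = 1 \<Longrightarrow> quad w = 0"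
  by (simp add: quad_def power2_norm_eq_inner[symmetric])

lemma square_ratio_limit:
  assumes d: "\<delta> \<longlonglongrightarrow> 0" "\<And>n. 0 < \<delta> n"
  shows "(\<lambda>n. \<integral>w. (1 / ((norm (w - z))\<^sup>2 + (\<delta> n)\<^sup>2)) * (norm (w - z))\<^sup>2 \<partial>disk_measure) \<longlonglongrightarrow> pi"
proof -
  interpret finite_measure disk_measure by (rule finite_disk_measure)
  have "(\<lambda>n. \<integral>w. (1 / ((norm (w - z))\<^sup>2 + (\<delta> n)\<^sup>2)) * (norm (w - z))\<^sup>2 \<partial>disk_measure)
     \<longlonglongrightarrow> (\<integral>w. 1 \<partial>disk_measure)"
  proof (rule integral_dominated_convergence[where w = "\<lambda>_. 1"])
    have "(\<lambda>n. (1 / ((norm (w - z))\<^sup>2 + (\<delta> n)\<^sup>2)) * (norm (w - z))\<^sup>2) \<longlonglongrightarrow> 1" if "w \<noteq> z" for w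
    proof -
      have "(\<lambda>n. (1 / ((norm (w - z))\<^sup>2 + (\<delta> n)\<^sup>2)) * (norm (w - z))\<^sup>2)
        \<longlonglongrightarrow> (1 / ((norm (w - z))\<^sup>2 + 0\<^sup>2)) * (norm (w - z))\<^sup>2"
        using that by (intro tendsto_intros d) auto
      then show ?thesis using that by simp
    qed
    then show "AE w in disk_measure. (\<lambda>n. (1 / ((norm (w - z))\<^sup>2 + (\<delta> n)\<^sup>2)) * (norm (w - z))\<^sup>2) \<longlonglongrightarrow> 1"
      using AE_lborel_singleton[of z] by (auto simp: AE_restrict_space_iff)
    show "AE w in disk_measure. norm ((1 / ((norm (w - z))\<^sup>2 + (\<delta> n)\<^sup>2)) * (norm (w - z))\<^sup>2) \<le> 1" for n
      using d(2)[of n] by (intro AE_I2) (simp add: divide_le_eq_1 add_nonneg_pos)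
  qed (auto intro!: disk_measurable)
  then show ?thesis by (simp add: disk_measure_area)
qed

text \<open>Testing the radial identity at the centre with the function (|w|^2 - 1)/2 compares the
  mass of the kernel with the area of the disk.\<close>
lemma cauchy_mass_eq: "cauchy_mass = 2 * pi"
proof -
  let ?d = "\<lambda>n. inverse (real (Suc n))"
  have d: "?d \<longlonglongrightarrow> 0" "\<And>n. 0 < ?d n" using LIMSEQ_inverse_real_of_nat by auto
  have "(\<lambda>n. \<integral>w. (1 / ((norm (w - 0))\<^sup>2 + (?d n)\<^sup>2)) * FD quad w (w - 0) \<partial>disk_measure)
     \<longlonglongrightarrow> - (quad 0 * cauchy_mass)"
    by (rule radial_limit_mass[OF Cinf_quad quad_circle _ d]) auto
  moreover have "(\<lambda>n. \<integral>w. (1 / ((norm (w - 0))\<^sup>2 + (?d n)\<^sup>2)) * FD quad w (w - 0) \<partial>disk_measure) \<longlonglongrightarrow> pi"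
    using square_ratio_limit[OF d, of 0] unfolding FD_quad by (simp add: power2_norm_eq_inner)
  ultimately have "- (quad 0 * cauchy_mass) = pi" by (rule LIMSEQ_unique)
  then show ?thesis by (simp add: quad_def)
qed

text \<open>Components along z and iz are treated separately. The tangential one is exactly 0 by
  Green's formula for the rotational field. The radial one follows from z . (w - z) = w . (w - z) -
  |w - z|^2, the first term being the radial derivative of \<open>quad\<close>. At z = 0 both
  directions degenerate and the integrand is odd.\<close>

lemma centroid_limit:
  fixes \<delta> :: "nat \<Rightarrow> real"
  assumes z: "z \<in> Disk" and d: "\<delta> \<longlonglongrightarrow> 0" "\<And>n. 0 < \<delta> n"
  shows "(\<lambda>n. \<integral>w. (1 / ((norm (w - z))\<^sup>2 + (\<delta> n)\<^sup>2)) *\<^sub>R (w - z) \<partial>disk_measure) \<longlonglongrightarrow> - (pi *\<^sub>R z)"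
proof -
  define q where "q n w = 1 / ((norm (w - z))\<^sup>2 + (\<delta> n)\<^sup>2)" for n w
  define N where "N n = (\<integral>w. q n w *\<^sub>R (w - z) \<partial>disk_measure)" for n
  have dp: "0 < (\<delta> n)\<^sup>2" for n using d(2)[of n] by simp
  have iq: "integrable disk_measure (\<lambda>w. q n w *\<^sub>R f w)" if "continuous_on UNIV f" for n and f :: "complex \<Rightarrow> 'b::euclidean_space"
    unfolding q_def by (rule integrable_disk_quotient[OF that dp])
  have iN: "integrable disk_measure (\<lambda>w. q n w *\<^sub>R (w - z))" for n by (intro iq continuous_intros)
  have inner: "v \<bullet> N n = (\<integral>w. q n w * (v \<bullet> (w - z)) \<partial>disk_measure)" for v n
    unfolding N_def using integral_inner_right[OF iN[of n], of v] by simp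
  have tang: "(\<i> * z) \<bullet> N n = 0" for n
  proof -
    have "(\<integral>w. FD quad w (q n w *\<^sub>R (\<i> * (w - z))) + quad w * (Re \<i> * (2 * (\<delta> n)\<^sup>2 / ((norm (w - z))\<^sup>2 + (\<delta> n)\<^sup>2)\<^sup>2)) \<partial>disk_measure) = 0"
      using green_field[OF Cinf_quad quad_circle regularized_field(1)[OF dp[of n], of z \<i>]]
      unfolding regularized_field(2)[OF dp[of n], of z \<i>] q_def .
    moreover have "FD quad w (q n w *\<^sub>R (\<i> * (w - z))) = - (q n w * ((\<i> * z) \<bullet> (w - z)))" for w
      unfolding FD_quad by (simp add: inner_complex_def algebra_simps)
    ultimately show ?thesis unfolding inner by simp
  qed
  have radial: "(\<lambda>n. z \<bullet> N n) \<longlonglongrightarrow> - (pi * (norm z)\<^sup>2)"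
  proof -
    have eq: "z \<bullet> N n = (\<integral>w. q n w * FD quad w (w - z) \<partial>disk_measure) - (\<integral>w. q n w * (norm (w - z))\<^sup>2 \<partial>disk_measure)" for n
    proof -
      have i: "integrable disk_measure (\<lambda>w. q n w * FD quad w (w - z))"
          "integrable disk_measure (\<lambda>w. q n w * (norm (w - z))\<^sup>2)"
        using iq[of "\<lambda>w. w \<bullet> (w - z)" n, OF continuous_on_inner[OF continuous_on_id]] iq[of "\<lambda>w. (norm (w - z))\<^sup>2" n]
        by (simp_all add: FD_quad continuous_intros)
      have "q n w * (z \<bullet> (w - z)) = q n w * FD quad w (w - z) - q n w * (norm (w - z))\<^sup>2" for w
        by (simp add: FD_quad power2_norm_eq_inner inner_diff_left inner_diff_right algebra_simps)
      then show ?thesis unfolding inner using i by simp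
    qed
    have "(\<lambda>n. z \<bullet> N n) \<longlonglongrightarrow> - (quad z * cauchy_mass) - pi"
      unfolding eq q_def
      by (intro tendsto_diff radial_limit_mass square_ratio_limit Cinf_quad quad_circle z d)
    moreover have "- (quad z * cauchy_mass) - pi = - (pi * (norm z)\<^sup>2)"
      unfolding cauchy_mass_eq by (simp add: quad_def power2_norm_eq_inner field_simps)
    ultimately show ?thesis by simp
  qed
  have "N \<longlonglongrightarrow> - (pi *\<^sub>R z)"
  proof (cases "z = 0")
    case True
    have "N n = 0" for n
    proof -
      let ?f = "\<lambda>w. indicator Disk w *\<^sub>R (q n w *\<^sub>R w)"
      have mf: "?f \<in> borel_measurable borel" unfolding q_def
        by (intro borel_measurable_scaleR borel_measurable_indicator) auto
      have "N n = integral\<^sup>L lborel ?f" unfolding N_def integral_disk using True by simp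
      also have "\<dots> = (- 1)\<^sup>2 *\<^sub>R (\<integral>v. ?f (0 + (- 1) *\<^sub>R v) \<partial>lborel)"
        by (rule integral_lborel_affine[OF mf]) simp
      also have "\<dots> = (\<integral>v. - ?f v \<partial>lborel)"
        by (simp add: True q_def indicator_def)
      also have "\<dots> = - N n" unfolding N_def integral_disk using True by simp
      finally show ?thesis by (simp add: eq_neg_iff_add_eq_0)
    qed
    then have "N = (\<lambda>_. 0)" by (simp add: fun_eq_iff)
    then show ?thesis using True by simp
  next
    case False
    have exp: "v = ((z \<bullet> v) / (norm z)\<^sup>2) *\<^sub>R z + (((\<i> * z) \<bullet> v) / (norm z)\<^sup>2) *\<^sub>R (\<i> * z)" for v
    proof -
      have "(norm z)\<^sup>2 *\<^sub>R v = (z \<bullet> v) *\<^sub>R z + ((\<i> * z) \<bullet> v) *\<^sub>R (\<i> * z)"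
        unfolding cmod_power2 by (simp add: complex_eq_iff inner_complex_def algebra_simps power2_eq_square)
      then have "v = inverse ((norm z)\<^sup>2) *\<^sub>R ((z \<bullet> v) *\<^sub>R z + ((\<i> * z) \<bullet> v) *\<^sub>R (\<i> * z))"
        using False by (simp flip: \<open>(norm z)\<^sup>2 *\<^sub>R v = _\<close>)
      then show ?thesis by (simp add: scaleR_add_right divide_inverse mult.commute)
    qed
    have "N n = ((z \<bullet> N n) / (norm z)\<^sup>2) *\<^sub>R z" for n using exp[of "N n"] by (simp add: tang)
    moreover have "(\<lambda>n. ((z \<bullet> N n) / (norm z)\<^sup>2) *\<^sub>R z) \<longlonglongrightarrow> (- (pi * (norm z)\<^sup>2) / (norm z)\<^sup>2) *\<^sub>R z"
      using False by (intro tendsto_intros radial) auto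
    ultimately show ?thesis using False by simp
  qed
  then show ?thesis unfolding N_def q_def .
qed

lemma Im_divide_om: "Im (a / u) = - om a u / (norm u)\<^sup>2"
  by (simp add: om_def Im_divide cmod_power2)

text \<open>By \<open>Im_divide_om\<close> the integrand is -om (X w - X z) (w - z) / |w - z|^2.
  After regularization it splits into the radial derivative of h, which yields the mass term, and
  the constant vector X z paired with the centroid integral. The Lipschitz bound provides the
  dominating constant.\<close>

theorem kernel_identity:
  fixes h :: "complex \<Rightarrow> real" and X :: "complex \<Rightarrow> complex"
  assumes h: "Cinf h" "\<And>w. norm w = 1 \<Longrightarrow> h w = 0"
    and X: "Cinf X" "\<And>w v. FD h w v = om (X w) v"
    and L: "\<And>w. norm (X w - X z) \<le> L * norm (w - z)" and z: "z \<in> Disk"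
  shows "(\<integral>w. Im ((X w - X z) / (w - z)) \<partial>disk_measure) = 2 * pi * h z + pi * om z (X z)"
proof -
  interpret finite_measure disk_measure by (rule finite_disk_measure)
  define \<delta> where "\<delta> n = inverse (real (Suc n))" for n
  have d: "\<delta> \<longlonglongrightarrow> 0" "\<And>n. 0 < \<delta> n" using LIMSEQ_inverse_real_of_nat unfolding \<delta>_def by auto
  have dp: "0 < (\<delta> n)\<^sup>2" for n using d(2)[of n] by simp
  define q where "q n w = 1 / ((norm (w - z))\<^sup>2 + (\<delta> n)\<^sup>2)" for n w
  have cX: "continuous_on A X" for A by (rule Cinf_continuous[OF X(1)])
  have [measurable]: "X \<in> borel_measurable borel" by (rule borel_measurable_continuous_onI[OF cX])
  have [measurable]: "(\<lambda>w. om (f w) (g w)) \<in> borel_measurable borel"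
    if [measurable]: "f \<in> borel_measurable borel" "g \<in> borel_measurable borel" for f g :: "complex \<Rightarrow> complex"
    unfolding om_def by measurable
  have "(\<lambda>n. \<integral>w. - (q n w * om (X w - X z) (w - z)) \<partial>disk_measure)
     \<longlonglongrightarrow> (\<integral>w. Im ((X w - X z) / (w - z)) \<partial>disk_measure)"
  proof (rule integral_dominated_convergence[where w = "\<lambda>_. \<bar>L\<bar>"])
    show "AE w in disk_measure. (\<lambda>n. - (q n w * om (X w - X z) (w - z))) \<longlonglongrightarrow> Im ((X w - X z) / (w - z))"
    proof (rule AE_I2)
      fix w
      show "(\<lambda>n. - (q n w * om (X w - X z) (w - z))) \<longlonglongrightarrow> Im ((X w - X z) / (w - z))"
      proof (cases "w = z")
        case True then show ?thesis by (simp add: om_def)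
      next
        case False
        have "(\<lambda>n. - (q n w * om (X w - X z) (w - z)))
          \<longlonglongrightarrow> - ((1 / ((norm (w - z))\<^sup>2 + 0\<^sup>2)) * om (X w - X z) (w - z))"
          unfolding q_def using False by (intro tendsto_intros d) auto
        then show ?thesis by (simp add: Im_divide_om)
      qed
    qed
    show "AE w in disk_measure. norm (- (q n w * om (X w - X z) (w - z))) \<le> \<bar>L\<bar>" for n
    proof (rule AE_I2)
      fix w
      have "\<bar>om (X w - X z) (w - z)\<bar> \<le> norm (X w - X z) * norm (w - z)"
        unfolding om_eq_inner using Cauchy_Schwarz_ineq2[of "\<i> * (X w - X z)" "w - z"] by (simp add: norm_mult)
      also have "\<dots> \<le> (\<bar>L\<bar> * norm (w - z)) * norm (w - z)"
        using order_trans[OF L[of w] mult_right_mono[OF abs_ge_self norm_ge_zero]] by (intro mult_right_mono) auto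
      also have "\<dots> \<le> \<bar>L\<bar> * ((norm (w - z))\<^sup>2 + (\<delta> n)\<^sup>2)"
        using mult_left_mono[of "(norm (w - z))\<^sup>2" "(norm (w - z))\<^sup>2 + (\<delta> n)\<^sup>2" "\<bar>L\<bar>"]
        by (simp add: power2_eq_square mult.assoc)
      finally have "\<bar>om (X w - X z) (w - z)\<bar> / ((norm (w - z))\<^sup>2 + (\<delta> n)\<^sup>2) \<le> \<bar>L\<bar>"
        using dp[of n] by (subst pos_divide_le_eq) (auto intro: add_nonneg_pos)
      then show "norm (- (q n w * om (X w - X z) (w - z))) \<le> \<bar>L\<bar>"
        unfolding q_def by (simp add: abs_mult)
    qed
  qed (auto intro!: disk_measurable simp: q_def)
  moreover have "(\<lambda>n. \<integral>w. - (q n w * om (X w - X z) (w - z)) \<partial>disk_measure)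
     \<longlonglongrightarrow> 2 * pi * h z + pi * om z (X z)"
  proof -
    have eq: "(\<integral>w. - (q n w * om (X w - X z) (w - z)) \<partial>disk_measure)
       = om (X z) (\<integral>w. q n w *\<^sub>R (w - z) \<partial>disk_measure) - (\<integral>w. q n w * FD h w (w - z) \<partial>disk_measure)" for n
    proof -
      have i1: "integrable disk_measure (\<lambda>w. q n w *\<^sub>R (w - z))"
        unfolding q_def by (rule integrable_disk_quotient[OF _ dp]) (intro continuous_intros)
      have c: "continuous_on UNIV (\<lambda>w. FD h w (w - z))"
        by (rule Cinf_continuous) (intro smooth_intros h)
      have i2: "integrable disk_measure (\<lambda>w. q n w * FD h w (w - z))"
        unfolding q_def using integrable_disk_quotient[OF c dp] by simp
      have bl: "bounded_linear (om (X z))"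
        by (rule bounded_bilinear.bounded_linear_right[OF bounded_bilinear_om])
      have e1: "om (X z) (\<integral>w. q n w *\<^sub>R (w - z) \<partial>disk_measure) = (\<integral>w. om (X z) (q n w *\<^sub>R (w - z)) \<partial>disk_measure)"
        by (rule integral_bounded_linear[OF bl i1, symmetric])
      have "- (q n w * om (X w - X z) (w - z)) = om (X z) (q n w *\<^sub>R (w - z)) - q n w * FD h w (w - z)" for w
        unfolding X(2) by (simp add: om_def algebra_simps)
      then show ?thesis unfolding e1
        using Bochner_Integration.integral_diff[OF integrable_bounded_linear[OF bl i1] i2] by simp
    qed
    have "(\<lambda>n. om (X z) (\<integral>w. q n w *\<^sub>R (w - z) \<partial>disk_measure) - (\<integral>w. q n w * FD h w (w - z) \<partial>disk_measure))
      \<longlonglongrightarrow> om (X z) (- (pi *\<^sub>R z)) - - (h z * cauchy_mass)"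
      unfolding q_def
      by (intro tendsto_diff bounded_bilinear.tendsto[OF bounded_bilinear_om] tendsto_const
          centroid_limit radial_limit_mass h z d)
    moreover have "om (X z) (- (pi *\<^sub>R z)) - - (h z * cauchy_mass) = 2 * pi * h z + pi * om z (X z)"
      unfolding cauchy_mass_eq by (simp add: om_def algebra_simps)
    ultimately show ?thesis unfolding eq by simp
  qed
  ultimately show ?thesis by (rule LIMSEQ_unique)
qed

section \<open>Action and average winding\<close>

context ham_flow
begin

lemma FD_slice: "FD (\<lambda>z. H (z, t)) w v = om (X (w, t)) v"
proof -
  have "((\<lambda>z. (z, t)) has_derivative (\<lambda>v. (v, 0))) (at w)" by (auto intro!: derivative_eq_intros)
  from FD_eq[OF FD_compose[OF H this]] show ?thesis by (simp add: FD_hfield[OF H])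
qed

lemma kernel_integral:
  assumes R1: "R < 1" and z: "z \<in> Disk"
  shows "(\<integral>w. Im ((X (w, t) - X (z, t)) / (w - z)) \<partial>disk_measure) = 2 * pi * H (z, t) + pi * om z (X (z, t))"
proof -
  obtain L where L: "L \<ge> 0" "\<And>t a b. norm (X (a, t) - X (b, t)) \<le> L * norm (a - b)" by (rule X_Lipschitz) (rule that)
  show ?thesis
  proof (rule kernel_identity[of "\<lambda>z. H (z, t)" "\<lambda>z. X (z, t)" z L])
    show "Cinf (\<lambda>z. H (z, t))" "Cinf (\<lambda>z. X (z, t))"
      by (intro Cinf_compose[OF H] Cinf_compose[OF XC] smooth_intros)+
  qed (use R1 z L supp_z FD_slice in auto)
qed

lemma flow_preserves_lborel: "distr lborel borel (\<lambda>z. Phi (t, z)) = lborel"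
proof (rule lborel_preserved[OF _ Phi_bij])
  show "Cinf (\<lambda>z. Phi (t, z))" by (intro Cinf_compose[OF Phi_props(1)] smooth_intros)
  have "FD (\<lambda>z. Phi (t, z)) z = (\<lambda>h. FD Phi (t, z) (0, h))" for z
    by (rule FD_eq[OF FD_partial_right[OF Phi_props(1)]])
  then show "om (FD (\<lambda>z. Phi (t, z)) z 1) (FD (\<lambda>z. Phi (t, z)) z \<i>) = 1" for z by (simp add: Phi_jac)
qed (rule Phi_static)

lemma Phi_in_Disk: "R < 1 \<Longrightarrow> Phi (t, z) \<in> Disk \<longleftrightarrow> z \<in> Disk"
  using Phi_bound[of z 1 t] Phi_static[of z t] by (cases "norm z \<le> 1") auto

lemma Phi_measurable [measurable]: "(\<lambda>z. Phi (t, z)) \<in> borel_measurable borel"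
  by (intro borel_measurable_continuous_onI Cinf_continuous Cinf_compose[OF Phi_props(1)] smooth_intros)

lemma integral_flow:
  fixes k :: "complex \<Rightarrow> 'b::{banach, second_countable_topology}"
  assumes R1: "R < 1" and k [measurable]: "k \<in> borel_measurable borel"
  shows "(\<integral>y. k (Phi (t, y)) \<partial>disk_measure) = integral\<^sup>L disk_measure k"
proof -
  have [measurable]: "(\<lambda>w. indicator Disk w *\<^sub>R k w) \<in> borel_measurable borel"
    by (intro borel_measurable_scaleR borel_measurable_indicator k) auto
  have "integral\<^sup>L disk_measure k = (\<integral>w. indicator Disk w *\<^sub>R k w \<partial>distr lborel borel (\<lambda>z. Phi (t, z)))"
    unfolding integral_disk flow_preserves_lborel ..
  also have "\<dots> = (\<integral>y. indicator Disk (Phi (t, y)) *\<^sub>R k (Phi (t, y)) \<partial>lborel)"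
    by (rule integral_distr) auto
  also have "\<dots> = (\<integral>y. k (Phi (t, y)) \<partial>disk_measure)"
    unfolding integral_disk by (simp only: indicator_def Phi_in_Disk[OF R1])
  finally show ?thesis ..
qed

lemma flow_preserves_disk:
  assumes R1: "R < 1"
  shows "(\<lambda>z. Phi (t, z)) \<in> measurable disk_measure disk_measure"
    and "distr disk_measure disk_measure (\<lambda>z. Phi (t, z)) = disk_measure"
proof -
  show m: "(\<lambda>z. Phi (t, z)) \<in> measurable disk_measure disk_measure"
    by (rule measurable_restrict_space3) (simp, use Phi_in_Disk[OF R1] in blast)
  show "distr disk_measure disk_measure (\<lambda>z. Phi (t, z)) = disk_measure"
  proof (rule measure_eqI)
    fix A assume "A \<in> sets (distr disk_measure disk_measure (\<lambda>z. Phi (t, z)))"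
    then have A: "A \<in> sets disk_measure" by simp
    then have A': "A \<subseteq> Disk" "A \<in> sets borel" by (auto simp: sets_restrict_space_iff)
    have sub: "(\<lambda>z. Phi (t, z)) -` A \<subseteq> Disk" using A' Phi_in_Disk[OF R1] by auto
    have "emeasure (distr disk_measure disk_measure (\<lambda>z. Phi (t, z))) A = emeasure disk_measure ((\<lambda>z. Phi (t, z)) -` A \<inter> Disk)"
      using emeasure_distr[OF m A] by simp
    also have "\<dots> = emeasure lborel ((\<lambda>z. Phi (t, z)) -` A)"
      using sub by (subst emeasure_restrict_space) (auto simp: Int_absorb2)
    also have "\<dots> = emeasure (distr lborel borel (\<lambda>z. Phi (t, z))) A"
      using A' by (subst emeasure_distr) auto
    also have "\<dots> = emeasure disk_measure A"
      using A' by (simp add: flow_preserves_lborel emeasure_restrict_space)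
    finally show "emeasure (distr disk_measure disk_measure (\<lambda>z. Phi (t, z))) A = emeasure disk_measure A" .
  qed simp
qed

text \<open>The angular speed of the difference of two trajectories. For equal points division by
  zero gives 0, which keeps the function bounded and measurable on the diagonal.\<close>

definition rate :: "(complex \<times> complex) \<times> real \<Rightarrow> real" where
  "rate q = Im ((X (Phi (snd q, snd (fst q)), snd q) - X (Phi (snd q, fst (fst q)), snd q)) /
    (Phi (snd q, snd (fst q)) - Phi (snd q, fst (fst q))))"

lemma rate_measurable [measurable]: "rate \<in> borel_measurable borel"
proof -
  have N: "(\<lambda>q. X (Phi (snd q, snd (fst q)), snd q) - X (Phi (snd q, fst (fst q)), snd q)) \<in> borel_measurable borel"
    by (intro borel_measurable_continuous_onI Cinf_continuous
        Cinf_compose[OF XC] Cinf_compose[OF Phi_props(1)] smooth_intros)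
  have D: "(\<lambda>q. Phi (snd q, snd (fst q)) - Phi (snd q, fst (fst q))) \<in> borel_measurable borel"
    by (intro borel_measurable_continuous_onI Cinf_continuous Cinf_compose[OF Phi_props(1)] smooth_intros)
  have "Im \<in> borel_measurable borel" by (intro borel_measurable_continuous_onI continuous_intros)
  from measurable_compose[OF borel_measurable_divide[OF N D] this]
  show ?thesis by (simp add: rate_def[abs_def])
qed

lemma rate_bound: obtains L where "\<And>q. \<bar>rate q\<bar> \<le> L"
proof -
  obtain L where L: "L \<ge> 0" "\<And>t a b. norm (X (a, t) - X (b, t)) \<le> L * norm (a - b)" by (rule X_Lipschitz) (rule that)
  have "\<bar>rate q\<bar> \<le> L" for q
  proof -
    have *: "norm ((X (a, t) - X (b, t)) / (a - b)) \<le> L" for a b t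
      using L by (cases "a = b") (simp_all add: norm_divide divide_le_eq)
    show ?thesis unfolding rate_def by (rule order_trans[OF abs_Im_le_cmod *])
  qed
  then show thesis by (rule that)
qed

end

section \<open>Integration over time and the action along a flow\<close>

lemma continuous_bounded_on_compact:
  assumes "continuous_on A f" "compact A"
  obtains B where "\<And>x. x \<in> A \<Longrightarrow> norm (f x) \<le> B"
  using compact_imp_bounded[OF compact_continuous_image[OF assms]] unfolding bounded_iff by blast

abbreviation time_measure :: "real measure" where "time_measure \<equiv> restrict_space lborel {0..1}"

lemma finite_time_measure: "finite_measure time_measure"
  by (rule finite_measureI) (simp add: emeasure_restrict_space space_restrict_space)

lemma space_time_measure [simp]: "space time_measure = {0..1}"
  by (simp add: space_restrict_space)

lemma measure_time_measure [simp]: "measure time_measure {0..1} = 1"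
  by (simp add: measure_restrict_space)

lemma integral_time:
  fixes f :: "real \<Rightarrow> real"
  assumes [measurable]: "f \<in> borel_measurable borel" and B: "\<And>t. t \<in> {0..1} \<Longrightarrow> \<bar>f t\<bar> \<le> B"
  shows "integrable time_measure f" "integral {0..1} f = integral\<^sup>L time_measure f"
proof -
  interpret finite_measure time_measure by (rule finite_time_measure)
  show i: "integrable time_measure f"
    by (rule integrable_const_bound[of _ B]) (auto simp: AE_restrict_space_iff B measurable_restrict_space1)
  then have "set_integrable lborel {0..1} f" by (simp add: set_integrable_def integrable_restrict_space)
  from set_borel_integral_eq_integral(2)[OF this] show "integral {0..1} f = integral\<^sup>L time_measure f"
    by (simp add: set_lebesgue_integral_def integral_restrict_space)
qed

text \<open>The Poincare lemma by integration of \<mu> (t p) . p along radii, which stay in the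
  disk. Closedness turns the differential of the integrand into the t-derivative of t (\<mu> (t w) .
  v).\<close>

lemma closed_form_primitive:
  fixes \<mu> :: "complex \<Rightarrow> complex"
  assumes m: "Cinf \<mu>" and cl: "\<And>w u v. w \<in> Disk \<Longrightarrow> FD \<mu> w u \<bullet> v = FD \<mu> w v \<bullet> u"
  obtains F where "Cinf F" "\<And>w v. w \<in> Disk \<Longrightarrow> FD F w v = \<mu> w \<bullet> v"
proof -
  define f where "f q = \<mu> (fst q *\<^sub>R snd q) \<bullet> snd q" for q :: "real \<times> complex"
  have fC: "Cinf f" unfolding f_def by (intro smooth_intros Cinf_compose[OF m])
  obtain y where y: "Cinf y" "\<And>p. y (0, p) = 0"
    "\<And>t p h. ((\<lambda>t. FD y (t, p) (0, h)) has_vector_derivative FD f (t, p) (0, h)) (at t)"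
    by (rule smooth_antiderivative[OF fC]) (rule that)
  have FDf: "FD f (t, p) (0, h) = t * (FD \<mu> (t *\<^sub>R p) h \<bullet> p) + \<mu> (t *\<^sub>R p) \<bullet> h" for t p h
  proof -
    have d: "((\<lambda>p. t *\<^sub>R p) has_derivative (\<lambda>h. t *\<^sub>R h)) (at p)" by (auto intro!: derivative_eq_intros)
    have "((\<lambda>p. \<mu> (t *\<^sub>R p) \<bullet> p) has_derivative (\<lambda>h. \<mu> (t *\<^sub>R p) \<bullet> h + FD \<mu> (t *\<^sub>R p) (t *\<^sub>R h) \<bullet> p)) (at p)"
      by (rule has_derivative_inner[OF FD_compose[OF m d] has_derivative_ident])
    then have "((\<lambda>p. f (t, p)) has_derivative (\<lambda>h. \<mu> (t *\<^sub>R p) \<bullet> h + FD \<mu> (t *\<^sub>R p) (t *\<^sub>R h) \<bullet> p)) (at p)"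
      by (simp add: f_def)
    from fun_cong[OF has_derivative_unique[OF FD_partial_right[OF fC] this], of h]
    show ?thesis using linear_cmul[OF linear_FD[OF m], of "t *\<^sub>R p" t h] by simp
  qed
  have "FD (\<lambda>p. y (1, p)) w v = \<mu> w \<bullet> v" if w: "w \<in> Disk" for w v
  proof -
    define g where "g t = FD y (t, w) (0, v) - t * (\<mu> (t *\<^sub>R w) \<bullet> v)" for t
    have gd: "(g has_vector_derivative 0) (at t)" if t: "t \<in> {0..1}" for t
    proof -
      have tw: "t *\<^sub>R w \<in> Disk" using w t by (simp add: mult_le_one)
      have "((\<lambda>t. t *\<^sub>R w) has_derivative (\<lambda>h. h *\<^sub>R w)) (at t)" by (auto intro!: derivative_eq_intros)
      note dm = FD_compose[OF m this]
      have "((\<lambda>t. t * (\<mu> (t *\<^sub>R w) \<bullet> v)) has_derivative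
         (\<lambda>h. t * (FD \<mu> (t *\<^sub>R w) (h *\<^sub>R w) \<bullet> v) + h * (\<mu> (t *\<^sub>R w) \<bullet> v))) (at t)"
        by (rule has_derivative_mult[OF has_derivative_ident has_derivative_inner_left[OF dm]])
      then have "((\<lambda>t. t * (\<mu> (t *\<^sub>R w) \<bullet> v)) has_vector_derivative FD f (t, w) (0, v)) (at t)"
        unfolding has_vector_derivative_def
        by (simp add: FDf linear_cmul[OF linear_FD[OF m]] cl[OF tw, of w v] algebra_simps)
      from has_vector_derivative_diff[OF y(3)[of w v t] this] show ?thesis unfolding g_def by simp
    qed
    have "g 1 = g 0"
      by (rule constant_of_zero_vector_derivative[of "{0..1}" g]) (use gd in auto)
    moreover have "FD y (0, w) (0, v) = 0"
    proof -
      have "((\<lambda>p. y (0, p)) has_derivative (\<lambda>h. 0)) (at w)" by (simp add: y(2))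
      from fun_cong[OF has_derivative_unique[OF FD_partial_right[OF y(1)] this], of v] show ?thesis .
    qed
    ultimately have "FD y (1, w) (0, v) = \<mu> w \<bullet> v" by (simp add: g_def)
    then show ?thesis using fun_cong[OF FD_eq[OF FD_partial_right[OF y(1)]], of 1 w v] by simp
  qed
  moreover have "Cinf (\<lambda>p. y (1, p))" by (intro Cinf_compose[OF y(1)] smooth_intros)
  ultimately show thesis by (rule that[rotated])
qed

lemma primitive_curl:
  assumes lam: "primitive_form lam" and g: "Cinf g" "\<And>z. z \<in> Disk \<Longrightarrow> g z = lam z" and w: "w \<in> Disk"
  shows "FD g w u \<bullet> v - FD g w v \<bullet> u = om u v"
proof -
  have e: "dD lam w = FD g w" by (rule dD_extension[OF g w])
  have "Im (dD lam w 1) - Re (dD lam w \<i>) = 1" using lam w unfolding primitive_form_def by blast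
  then have e: "Im (FD g w 1) = 1 + Re (FD g w \<i>)" unfolding e by simp
  have "FD g w u = Re u *\<^sub>R FD g w 1 + Im u *\<^sub>R FD g w \<i>" "FD g w v = Re v *\<^sub>R FD g w 1 + Im v *\<^sub>R FD g w \<i>"
    by (rule complex_linear_expand[OF linear_FD[OF g(1)]])+
  then show ?thesis using e by (simp add: inner_complex_def om_def algebra_simps)
qed

text \<open>\<open>flow_action\<close> supplies one function with the required differential and
  boundary values; two such functions differ by a constant, which is 0 on the circle.\<close>

lemma action_flow:
  assumes A: "ham_flow K r" "r < 1" "\<And>z. z \<in> Disk \<Longrightarrow> ham_flow.Phi K (1, z) = phi z"
    and lam: "primitive_form lam" and g: "Cinf g" "\<And>z. z \<in> Disk \<Longrightarrow> g z = lam z" and z: "z \<in> Disk"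
  shows "action phi lam z = integral {0..1} (\<lambda>t. K (ham_flow.Phi K (t, z), t) +
      g (ham_flow.Phi K (t, z)) \<bullet> hfield K (ham_flow.Phi K (t, z), t))"
proof -
  interpret k: ham_flow K r by (rule A)
  obtain a where a: "Cinf a"
    "\<And>z. a z = integral {0..1} (\<lambda>t. K (k.Phi (t, z), t) + g (k.Phi (t, z)) \<bullet> k.X (k.Phi (t, z), t))"
    "\<And>z. r < norm z \<Longrightarrow> a z = 0"
    "\<And>z h. \<forall>s u v. FD g (k.Phi (s, z)) u \<bullet> v - FD g (k.Phi (s, z)) v \<bullet> u = om u v \<Longrightarrow>
      FD a z h = g (k.Phi (1, z)) \<bullet> FD k.Phi (1, z) (0, h) - g z \<bullet> h"
    by (rule k.flow_action[OF g(1)]) (rule that)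
  have Pd: "k.Phi (s, w) \<in> Disk" if "w \<in> Disk" for s w using that k.Phi_in_Disk[OF A(2)] by simp
  have dphi: "dD phi w v = FD k.Phi (1, w) (0, v)" if "w \<in> Disk" for w v
  proof -
    have C: "Cinf (\<lambda>z. k.Phi (1, z))" by (intro Cinf_compose[OF k.Phi_props(1)] smooth_intros)
    show ?thesis using dD_extension[OF C A(3) that] FD_eq[OF FD_partial_right[OF k.Phi_props(1)], of 1 w] by simp
  qed
  let ?D = "\<lambda>w v. lam (phi w) \<bullet> dD phi w v - lam w \<bullet> v"
  let ?P = "\<lambda>a. smooth_on Disk a \<and> (\<forall>w\<in>Disk. (a has_derivative ?D w) (at w within Disk)) \<and> (\<forall>w\<in>sphere 0 1. a w = 0)"
  have Pa: "?P a"
  proof (intro conjI ballI)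
    show "smooth_on Disk a" using a(1) unfolding smooth_on_def Cinf_on_def by blast
    show "(a has_derivative ?D w) (at w within Disk)" if w: "w \<in> Disk" for w
    proof -
      have "FD a w = ?D w"
      proof
        fix v
        have "FD a w v = g (k.Phi (1, w)) \<bullet> FD k.Phi (1, w) (0, v) - g w \<bullet> v"
          by (rule a(4)) (use primitive_curl[OF lam g Pd[OF w]] in simp)
        then show "FD a w v = ?D w v" using g(2) Pd[OF w, of 1] A(3)[OF w] w dphi[OF w] by simp
      qed
      then show ?thesis using has_derivative_at_withinI[OF Cinf_has_derivative[OF a(1), of w], of Disk] by simp
    qed
    show "a w = 0" if "w \<in> sphere 0 1" for w using that A(2) by (intro a(3)) simp
  qed
  have uniq: "b z = a z" if b: "?P b" for b
  proof -
    have "((\<lambda>w. b w - a w) has_derivative (\<lambda>h. 0)) (at w within Disk)" if "w \<in> Disk" for w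
    proof -
      have "(b has_derivative ?D w) (at w within Disk)" "(a has_derivative ?D w) (at w within Disk)"
        using b Pa that by blast+
      from has_derivative_diff[OF this] show ?thesis by simp
    qed
    then obtain c where c: "\<And>w. w \<in> Disk \<Longrightarrow> b w - a w = c"
      using has_derivative_zero_constant[of Disk "\<lambda>w. b w - a w"] convex_cball by blast
    have "b 1 = 0" "a 1 = 0" using b Pa by auto
    then show ?thesis using c[of 1] c[OF z] by simp
  qed
  have "action phi lam z = a z" unfolding action_def
  proof (rule the_equality)
    show "\<exists>b. smooth_on Disk b \<and> (\<forall>w\<in>Disk. (b has_derivative ?D w) (at w within Disk)) \<and>
        (\<forall>w\<in>sphere 0 1. b w = 0) \<and> b z = a z" using Pa by blast
    fix c assume "\<exists>b. smooth_on Disk b \<and> (\<forall>w\<in>Disk. (b has_derivative ?D w) (at w within Disk)) \<and>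
        (\<forall>w\<in>sphere 0 1. b w = 0) \<and> b z = c"
    then show "c = a z" using uniq by blast
  qed
  then show ?thesis by (simp add: a(2))
qed

text \<open>The form (x dy - y dx)/2 in the encoding of \<open>primitive_form\<close>; pairing it
  with X gives half of om z (X z), the second term of the kernel identity up to the factor 2
  pi.\<close>

definition lam0 :: "complex \<Rightarrow> complex" where "lam0 z = \<i> / 2 * z"

lemma Cinf_lam0: "Cinf lam0"
  unfolding lam0_def by (intro smooth_intros)

lemma FD_lam0: "FD lam0 z v = \<i> / 2 * v"
proof -
  have "(lam0 has_derivative (\<lambda>v. \<i> / 2 * v)) (at z)" unfolding lam0_def
    by (rule has_derivative_mult_right) (rule has_derivative_ident)
  from FD_eq[OF this] show ?thesis by simp
qed

lemma primitive_lam0: "primitive_form lam0"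
  unfolding primitive_form_def
proof (intro conjI ballI)
  show "smooth_on Disk lam0" using Cinf_lam0 unfolding smooth_on_def Cinf_on_def by blast
  show "Im (dD lam0 z 1) - Re (dD lam0 z \<i>) = 1" if "z \<in> Disk" for z
    using dD_extension[OF Cinf_lam0 refl that] by (simp add: FD_lam0)
qed

lemma lam0_inner: "lam0 z \<bullet> v = om z v / 2"
  by (simp add: lam0_def om_def inner_complex_def)

text \<open>Two primitives of omega_0 differ by an exact form dF on the disk, so the actions differ
  by F at the image point minus F at the point. This is at most twice the maximum of |F|, whatever
  the map.\<close>

lemma action_change_primitive:
  assumes lam: "primitive_form lam"
  obtains B where "\<And>psi z. realizable psi \<Longrightarrow> z \<in> Disk \<Longrightarrow> \<bar>action psi lam z - action psi lam0 z\<bar> \<le> B"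
proof -
  obtain g where g: "Cinf g" "\<And>z. z \<in> Disk \<Longrightarrow> g z = lam z"
    using lam Cinf_extension[of lam] unfolding primitive_form_def by metis
  define \<mu> where "\<mu> z = g z - lam0 z" for z
  have mC: "Cinf \<mu>" unfolding \<mu>_def by (intro smooth_intros g Cinf_compose[OF Cinf_lam0])
  have FDm: "FD \<mu> w v = FD g w v - FD lam0 w v" for w v
    unfolding \<mu>_def
    using FD_eq[OF has_derivative_diff[OF Cinf_has_derivative[OF g(1)] Cinf_has_derivative[OF Cinf_lam0]], of w] by simp
  have cl: "FD \<mu> w u \<bullet> v = FD \<mu> w v \<bullet> u" if "w \<in> Disk" for w u v
    using primitive_curl[OF lam g that, of u v] primitive_curl[OF primitive_lam0 Cinf_lam0 refl that, of u v]
    by (simp add: FDm inner_diff_left)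
  obtain F where F: "Cinf F" "\<And>w v. w \<in> Disk \<Longrightarrow> FD F w v = \<mu> w \<bullet> v"
    by (rule closed_form_primitive[OF mC cl]) (assumption, rule that)
  have "compact (F ` Disk)" by (rule compact_continuous_image) (auto intro: Cinf_continuous F)
  then obtain B where B: "\<And>w. w \<in> Disk \<Longrightarrow> \<bar>F w\<bar> \<le> B"
    by (metis compact_imp_bounded bounded_iff imageI real_norm_def)
  have "\<bar>action psi lam z - action psi lam0 z\<bar> \<le> 2 * B" if psi: "realizable psi" and z: "z \<in> Disk" for psi z
  proof -
    obtain K r where A: "ham_flow K r" "r < 1" "\<And>z. z \<in> Disk \<Longrightarrow> ham_flow.Phi K (1, z) = psi z"
      using psi unfolding realizable_def by blast
    interpret k: ham_flow K r by (rule A)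
    have Pd: "k.Phi (s, w) \<in> Disk" if "w \<in> Disk" for s w using that k.Phi_in_Disk[OF A(2)] by simp
    let ?f = "\<lambda>g t. K (k.Phi (t, z), t) + g (k.Phi (t, z)) \<bullet> k.X (k.Phi (t, z), t)"
    have c: "?f g integrable_on {0..1}" if "Cinf g" for g :: "complex \<Rightarrow> complex"
      by (intro integrable_continuous_interval Cinf_continuous smooth_intros Cinf_compose[OF k.H] Cinf_compose[OF that]
          Cinf_compose[OF k.XC] Cinf_compose[OF k.Phi_props(1)])
    have "((\<lambda>t. ?f g t - ?f lam0 t) has_integral F (k.Phi (1, z)) - F (k.Phi (0, z))) {0..1}"
    proof (rule fundamental_theorem_of_calculus)
      fix t :: real
      have "((\<lambda>t. F (k.Phi (t, z))) has_vector_derivative FD F (k.Phi (t, z)) (k.X (k.Phi (t, z), t))) (at t)"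
        by (rule FD_compose_vector[OF F(1) k.Phi_props(3)])
      moreover have "FD F (k.Phi (t, z)) (k.X (k.Phi (t, z), t)) = ?f g t - ?f lam0 t"
        unfolding F(2)[OF Pd[OF z]] \<mu>_def by (simp add: inner_diff_left)
      ultimately show "((\<lambda>t. F (k.Phi (t, z))) has_vector_derivative ?f g t - ?f lam0 t) (at t within {0..1})"
        by (auto intro: has_vector_derivative_at_within)
    qed simp
    then have "integral {0..1} (\<lambda>t. ?f g t - ?f lam0 t) = F (k.Phi (1, z)) - F (k.Phi (0, z))"
      by (rule integral_unique)
    moreover have "action psi lam z = integral {0..1} (?f g)" by (rule action_flow[OF A lam g z])
    moreover have "action psi lam0 z = integral {0..1} (?f lam0)" by (rule action_flow[OF A primitive_lam0 Cinf_lam0 refl z])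
    ultimately have "action psi lam z - action psi lam0 z = F (k.Phi (1, z)) - F (k.Phi (0, z))"
      using integral_diff[OF c[OF g(1)] c[OF Cinf_lam0]] by simp
    then show ?thesis using B[OF Pd[OF z, of 1]] B[OF Pd[OF z, of 0]] by linarith
  qed
  then show thesis by (rule that)
qed


text \<open>\<open>wind\<close> is given by a description. Off the diagonal it is replaced here by a
  bounded Borel function defined everywhere, to which Fubini's and Birkhoff's theorems
  apply.\<close>

theorem wind_average:
  assumes phi: "realizable phi"
  obtains W B where "W \<in> borel_measurable borel" "\<And>q. \<bar>W q\<bar> \<le> B"
    "\<And>x y. x \<in> Disk \<Longrightarrow> y \<in> Disk \<Longrightarrow> x \<noteq> y \<Longrightarrow> wind phi x y = W (x, y)"
    "\<And>x. x \<in> Disk \<Longrightarrow> (\<integral>y. W (x, y) \<partial>disk_measure) = action phi lam0 x"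
proof -
  obtain K r where A: "ham_flow K r" "r < 1" "\<And>z. z \<in> Disk \<Longrightarrow> ham_flow.Phi K (1, z) = phi z"
    using phi unfolding realizable_def by blast
  interpret k: ham_flow K r by (rule A)
  interpret T: finite_measure time_measure by (rule finite_time_measure)
  interpret D: finite_measure disk_measure by (rule finite_disk_measure)
  interpret TD: pair_sigma_finite disk_measure time_measure ..
  obtain L where L: "\<And>q. \<bar>k.rate q\<bar> \<le> L" by (rule k.rate_bound) (rule that)
  define W where "W q = (\<integral>t. k.rate (q, t) \<partial>time_measure) / (2 * pi)" for q
  have tm: "(\<lambda>t. t) \<in> measurable time_measure lborel" and dm: "(\<lambda>w. w) \<in> measurable disk_measure lborel"
    by (rule measurable_restrict_space1, simp)+
  have m1 [measurable]: "(\<lambda>t. k.rate (q, t)) \<in> borel_measurable borel" for q by measurable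
  have i1: "integrable time_measure (\<lambda>t. k.rate (q, t))"
    and i2: "integral {0..1} (\<lambda>t. k.rate (q, t)) = (\<integral>t. k.rate (q, t) \<partial>time_measure)" for q
    using integral_time[OF m1 L] by auto
  have Wm: "W \<in> borel_measurable borel"
  proof -
    have "k.rate \<in> borel_measurable (borel \<Otimes>\<^sub>M lborel)"
      using k.rate_measurable
      unfolding measurable_cong_sets[OF sets_pair_measure_cong[OF refl sets_lborel] refl] borel_prod .
    from measurable_compose[OF measurable_Pair[OF measurable_fst measurable_compose[OF measurable_snd tm]] this]
    have "k.rate \<in> borel_measurable (borel \<Otimes>\<^sub>M time_measure)" by (simp only: prod.collapse)
    then have "(\<lambda>q. \<integral>t. k.rate (q, t) \<partial>time_measure) \<in> borel_measurable borel"
      by (intro T.borel_measurable_lebesgue_integral) (simp add: split_beta')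
    then show ?thesis unfolding W_def by measurable
  qed
  have Wb: "\<bar>W q\<bar> \<le> L / (2 * pi)" for q
  proof -
    have "\<bar>\<integral>t. k.rate (q, t) \<partial>time_measure\<bar> \<le> (\<integral>t. \<bar>k.rate (q, t)\<bar> \<partial>time_measure)"
      by (rule integral_abs_bound)
    also have "\<dots> \<le> (\<integral>t. L \<partial>time_measure)" using i1 L by (intro integral_mono) auto
    finally show ?thesis unfolding W_def by (simp add: abs_mult divide_right_mono)
  qed
  have Ww: "wind phi x y = W (x, y)" if "x \<in> Disk" "y \<in> Disk" "x \<noteq> y" for x y
    unfolding W_def i2[symmetric] using wind_integral[OF A that] by (simp add: k.rate_def)
  have "(\<integral>y. W (x, y) \<partial>disk_measure) = action phi lam0 x" if x: "x \<in> Disk" for x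
  proof -
    have Px: "k.Phi (t, x) \<in> Disk" for t using k.Phi_in_Disk[OF A(2)] x by simp
    have mx: "(\<lambda>q. k.rate ((x, fst q), snd q)) \<in> borel_measurable borel"
      by (rule measurable_compose[OF _ k.rate_measurable])
        (intro borel_measurable_continuous_onI continuous_intros)
    then have "(\<lambda>q. k.rate ((x, fst q), snd q)) \<in> borel_measurable (lborel \<Otimes>\<^sub>M lborel)"
      by (simp add: borel_prod cong: measurable_cong_sets)
    from measurable_compose[OF measurable_Pair[OF measurable_compose[OF measurable_fst dm] measurable_compose[OF measurable_snd tm]] this]
    have mx': "(\<lambda>q. k.rate ((x, fst q), snd q)) \<in> borel_measurable (disk_measure \<Otimes>\<^sub>M time_measure)"
      by (simp only: fst_conv snd_conv)
    interpret P: finite_measure "disk_measure \<Otimes>\<^sub>M time_measure"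
      by (rule finite_measure_pair_measure) unfold_locales
    have int: "integrable (disk_measure \<Otimes>\<^sub>M time_measure) (\<lambda>q. k.rate ((x, fst q), snd q))"
      by (rule P.integrable_const_bound[of _ L]) (use L mx' in auto)
    \<comment> \<open>Preservation of area substitutes w for the position of y at time t; then the
      kernel identity is used at the position of x.\<close>
    have slice: "(\<integral>y. k.rate ((x, y), t) \<partial>disk_measure)
        = 2 * pi * K (k.Phi (t, x), t) + pi * om (k.Phi (t, x)) (k.X (k.Phi (t, x), t))" for t
    proof -
      let ?k = "\<lambda>w. Im ((k.X (w, t) - k.X (k.Phi (t, x), t)) / (w - k.Phi (t, x)))"
      have N: "(\<lambda>w. k.X (w, t) - k.X (k.Phi (t, x), t)) \<in> borel_measurable borel"
        by (intro borel_measurable_continuous_onI Cinf_continuous Cinf_compose[OF k.XC] smooth_intros)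
      have D: "(\<lambda>w. w - k.Phi (t, x)) \<in> borel_measurable borel" by measurable
      have "Im \<in> borel_measurable borel" by (intro borel_measurable_continuous_onI continuous_intros)
      from measurable_compose[OF borel_measurable_divide[OF N D] this]
      have "(\<integral>y. ?k (k.Phi (t, y)) \<partial>disk_measure) = integral\<^sup>L disk_measure ?k"
        by (rule k.integral_flow[OF A(2)])
      then show ?thesis unfolding k.kernel_integral[OF A(2) Px] by (simp add: k.rate_def)
    qed
    have "(\<integral>y. (\<integral>t. k.rate ((x, y), t) \<partial>time_measure) \<partial>disk_measure)
        = (\<integral>t. (\<integral>y. k.rate ((x, y), t) \<partial>disk_measure) \<partial>time_measure)"
      using TD.Fubini_integral[of "\<lambda>y t. k.rate ((x, y), t)"] int by (simp add: split_beta')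
    also have "\<dots> = (\<integral>t. 2 * pi * (K (k.Phi (t, x), t) + lam0 (k.Phi (t, x)) \<bullet> k.X (k.Phi (t, x), t)) \<partial>time_measure)"
      unfolding slice lam0_inner by (simp only: distrib_left) simp
    also have "\<dots> = 2 * pi * (\<integral>t. K (k.Phi (t, x), t) + lam0 (k.Phi (t, x)) \<bullet> k.X (k.Phi (t, x), t) \<partial>time_measure)"
      by (rule integral_mult_right_zero)
    also have "(\<integral>t. K (k.Phi (t, x), t) + lam0 (k.Phi (t, x)) \<bullet> k.X (k.Phi (t, x), t) \<partial>time_measure)
        = integral {0..1} (\<lambda>t. K (k.Phi (t, x), t) + lam0 (k.Phi (t, x)) \<bullet> k.X (k.Phi (t, x), t))" (is "integral\<^sup>L _ ?f = _")
    proof -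
      have c: "continuous_on UNIV ?f"
        by (intro Cinf_continuous smooth_intros Cinf_compose[OF k.H] Cinf_compose[OF Cinf_lam0]
          Cinf_compose[OF k.XC] Cinf_compose[OF k.Phi_props(1)])
      obtain B where "\<And>t. t \<in> {0..1} \<Longrightarrow> norm (?f t) \<le> B"
        by (rule continuous_bounded_on_compact[OF continuous_on_subset[OF c] compact_Icc, OF subset_UNIV]) (rule that)
      then have B: "\<And>t. t \<in> {0..1} \<Longrightarrow> \<bar>?f t\<bar> \<le> B" by simp
      show ?thesis by (rule integral_time(2)[OF borel_measurable_continuous_onI[OF c] B, symmetric])
    qed
    also have "\<dots> = action phi lam0 x" by (rule action_flow[OF A primitive_lam0 Cinf_lam0 refl x, symmetric])
    finally show ?thesis unfolding W_def by simp
  qed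
  then show thesis using that Wm Wb Ww by blast
qed

lemma realizable_preserves_disk:
  assumes phi: "realizable phi"
  shows "phi \<in> measurable disk_measure disk_measure" "distr disk_measure disk_measure phi = disk_measure"
    and "inj_on phi Disk" "phi ` Disk \<subseteq> Disk"
proof -
  obtain K r where A: "ham_flow K r" "r < 1" "\<And>z. z \<in> Disk \<Longrightarrow> ham_flow.Phi K (1, z) = phi z"
    using phi unfolding realizable_def by blast
  interpret k: ham_flow K r by (rule A)
  show "phi \<in> measurable disk_measure disk_measure"
    by (rule measurable_cong[THEN iffD1, OF _ k.flow_preserves_disk(1)[OF A(2), of 1]]) (simp add: A(3))
  show "distr disk_measure disk_measure phi = disk_measure"
    using k.flow_preserves_disk(2)[OF A(2), of 1] A(3)
      distr_cong[OF refl refl, of disk_measure "\<lambda>z. k.Phi (1, z)" phi disk_measure] by simp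
  show "inj_on phi Disk" using A(3) k.Phi_inj by (intro inj_onI) metis
  show "phi ` Disk \<subseteq> Disk" using A(3) k.Phi_in_Disk[OF A(2)] by (metis image_subsetI)
qed

lemma realizable_funpow:
  assumes phi: "realizable phi"
  shows "realizable (phi ^^ Suc n)"
proof (induction n)
  case 0 then show ?case using phi by simp
next
  case (Suc n)
  from realizable_compose(1)[OF Suc phi] show ?case by (simp add: o_def)
qed

lemma wind_funpow:
  assumes phi: "realizable phi" and xy: "x \<in> Disk" "y \<in> Disk" "x \<noteq> y"
  shows "wind (phi ^^ Suc n) x y = (\<Sum>i<Suc n. wind phi ((phi ^^ i) x) ((phi ^^ i) y))"
proof (induction n)
  case 0 then show ?case by simp
next
  case (Suc n)
  have "wind (\<lambda>z. phi ((phi ^^ Suc n) z)) x y = wind (phi ^^ Suc n) x y + wind phi ((phi ^^ Suc n) x) ((phi ^^ Suc n) y)"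
    by (rule realizable_compose(2)[OF realizable_funpow[OF phi] phi xy])
  then show ?case using Suc by (simp add: o_def)
qed

section \<open>Birkhoff's theorem and the asymptotic action\<close>

text \<open>The maximum of the first partial sums along an orbit, the empty one included.\<close>
primrec max_sum :: "('a \<Rightarrow> 'a) \<Rightarrow> ('a \<Rightarrow> real) \<Rightarrow> nat \<Rightarrow> 'a \<Rightarrow> real" where
  "max_sum T g 0 x = 0"
| "max_sum T g (Suc n) x = max 0 (g x + max_sum T g n (T x))"

lemma max_sum_nonneg: "0 \<le> max_sum T g n x"
  by (cases n) auto

lemma max_sum_mono: "max_sum T g n x \<le> max_sum T g (Suc n) x"
proof (induction n arbitrary: x)
  case 0 then show ?case by simp
next
  case (Suc n)
  show ?case using Suc[of "T x"] by (simp only: max_sum.simps)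
qed

lemma sum_le_max_sum: "(\<Sum>i<n. g ((T ^^ i) x)) \<le> max_sum T g n x"
proof (induction n arbitrary: x)
  case 0 then show ?case by simp
next
  case (Suc n)
  have "(\<Sum>i<Suc n. g ((T ^^ i) x)) = g x + (\<Sum>i<n. g ((T ^^ i) (T x)))"
    by (subst sum.lessThan_Suc_shift) (simp add: funpow_swap1)
  also have "\<dots> \<le> g x + max_sum T g n (T x)" using Suc by simp
  finally show ?case by simp
qed

locale finite_measure_preserving = finite_measure M for M :: "'a measure" +
  fixes T :: "'a \<Rightarrow> 'a"
  assumes T [measurable]: "T \<in> measurable M M" and preserved: "distr M M T = M"
begin

lemma integral_T:
  fixes f :: "'a \<Rightarrow> real"
  assumes "integrable M f"
  shows "integrable M (\<lambda>x. f (T x))" "(\<integral>x. f (T x) \<partial>M) = integral\<^sup>L M f"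
proof -
  show "integrable M (\<lambda>x. f (T x))" using integrable_distr[OF T, of f] assms by (simp add: preserved)
  show "(\<integral>x. f (T x) \<partial>M) = integral\<^sup>L M f" using integral_distr[OF T, of f] assms by (simp add: preserved)
qed

lemma max_sum_integrable: "integrable M g \<Longrightarrow> integrable M (max_sum T g n)"
proof (induction n)
  case 0
  have "max_sum T g 0 = (\<lambda>x. 0)" by (simp add: fun_eq_iff)
  then show ?case by simp
next
  case (Suc n)
  have "max_sum T g (Suc n) = (\<lambda>x. max 0 (g x + max_sum T g n (T x)))" by (simp add: fun_eq_iff)
  moreover have "integrable M (\<lambda>x. max 0 (g x + max_sum T g n (T x)))"
    by (rule integrable_max[OF integrable_zero
          Bochner_Integration.integrable_add[OF Suc.prems integral_T(1)[OF Suc.IH[OF Suc.prems]]]])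
  ultimately show ?case by simp
qed

text \<open>Garsia's argument: where the maximal sum is positive, it exceeds its own value at T x by
  at most g x; elsewhere it is 0 and the difference is at most 0. The difference has integral 0 by
  invariance, and the sets of positivity increase with n.\<close>

lemma maximal_ergodic:
  assumes g: "integrable M g"
  shows "0 \<le> (\<integral>x. (if \<exists>n. 0 < max_sum T g n x then g x else 0) \<partial>M)"
proof -
  note mi = max_sum_integrable[OF g]
  have [measurable]: "max_sum T g n \<in> borel_measurable M" "g \<in> borel_measurable M" for n using mi g by auto
  let ?f = "\<lambda>n x. if 0 < max_sum T g n x then g x else 0"
  have int: "integrable M (?f n)" for n
    by (rule Bochner_Integration.integrable_bound[OF g]) auto
  have pos: "0 \<le> integral\<^sup>L M (?f n)" for n
  proof -
    have pw: "max_sum T g n x - max_sum T g n (T x) \<le> ?f n x" for x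
    proof (cases n)
      case 0 then show ?thesis by simp
    next
      case (Suc k)
      show ?thesis
        using max_sum_mono[of T g k "T x"] max_sum_nonneg[of T g n "T x"] unfolding Suc
        by (auto simp: max_def split: if_splits)
    qed
    have "0 = (\<integral>x. max_sum T g n x - max_sum T g n (T x) \<partial>M)"
      using integral_T[OF mi[of n]] mi[of n] by simp
    also have "\<dots> \<le> integral\<^sup>L M (?f n)"
      by (rule integral_mono) (use pw int mi integral_T[OF mi[of n]] in auto)
    finally show ?thesis .
  qed
  have "(\<lambda>n. integral\<^sup>L M (?f n)) \<longlonglongrightarrow> (\<integral>x. (if \<exists>n. 0 < max_sum T g n x then g x else 0) \<partial>M)"
  proof (rule integral_dominated_convergence[where w = "\<lambda>x. \<bar>g x\<bar>"])
    show "AE x in M. (\<lambda>n. ?f n x) \<longlonglongrightarrow> (if \<exists>n. 0 < max_sum T g n x then g x else 0)"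
    proof (rule AE_I2)
      fix x
      show "(\<lambda>n. ?f n x) \<longlonglongrightarrow> (if \<exists>n. 0 < max_sum T g n x then g x else 0)"
      proof (cases "\<exists>n. 0 < max_sum T g n x")
        case True
        then obtain k where k: "0 < max_sum T g k x" by blast
        have "incseq (\<lambda>n. max_sum T g n x)" by (rule incseq_SucI) (rule max_sum_mono)
        then have "0 < max_sum T g n x" if "n \<ge> k" for n
          using k that by (meson incseqD less_le_trans)
        then have "eventually (\<lambda>n. ?f n x = g x) sequentially"
          unfolding eventually_sequentially by auto
        then show ?thesis using True by (simp add: tendsto_eventually)
      next
        case False then show ?thesis by simp
      qed
    qed
    show "integrable M (\<lambda>x. \<bar>g x\<bar>)" using g by simp
  qed (use int in auto)
  then show ?thesis by (rule LIMSEQ_le_const) (use pos in auto)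
qed

definition S :: "('a \<Rightarrow> real) \<Rightarrow> nat \<Rightarrow> 'a \<Rightarrow> real" where "S f n x = (\<Sum>i<n. f ((T ^^ i) x))"

lemma S_Suc: "S f (Suc n) x = f x + S f n (T x)"
  unfolding S_def by (subst sum.lessThan_Suc_shift) (simp add: funpow_swap1)

lemma funpow_measurable [measurable]: "(T ^^ n) \<in> measurable M M"
  by (induction n) (auto simp: id_def intro: measurable_comp[OF _ T])

lemma S_measurable [measurable]: "f \<in> borel_measurable M \<Longrightarrow> S f n \<in> borel_measurable M"
  unfolding S_def[abs_def] by (intro borel_measurable_sum measurable_compose[OF funpow_measurable])

text \<open>Unlike the condition \<open>limsup S f n x / n > b\<close>, unboundedness of \<open>S f n x - n * b\<close> is
  obviously invariant, and it follows from that condition.\<close>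
definition exceeds :: "('a \<Rightarrow> real) \<Rightarrow> real \<Rightarrow> 'a \<Rightarrow> bool" where
  "exceeds f b x \<longleftrightarrow> (\<forall>k::nat. \<exists>n. real k < S f n x - real n * b)"

lemma exceeds_T: "exceeds f b (T x) \<longleftrightarrow> exceeds f b x"
proof
  assume e: "exceeds f b (T x)"
  show "exceeds f b x" unfolding exceeds_def
  proof
    fix k :: nat
    obtain j :: nat where j: "real k + \<bar>f x - b\<bar> \<le> real j" using real_arch_simple by blast
    obtain n where "real j < S f n (T x) - real n * b" using e unfolding exceeds_def by blast
    then have "real k < S f (Suc n) x - real (Suc n) * b" using j by (simp add: S_Suc algebra_simps)
    then show "\<exists>n. real k < S f n x - real n * b" by blast
  qed
next
  assume e: "exceeds f b x"
  show "exceeds f b (T x)" unfolding exceeds_def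
  proof
    fix k :: nat
    obtain j :: nat where j: "real k + \<bar>f x - b\<bar> \<le> real j" using real_arch_simple by blast
    obtain n where n: "real j < S f n x - real n * b" using e unfolding exceeds_def by blast
    then obtain m where "n = Suc m" using j by (cases n) (auto simp: S_def)
    then have "real k < S f m (T x) - real m * b" using n j by (simp add: S_Suc algebra_simps)
    then show "\<exists>n. real k < S f n (T x) - real n * b" by blast
  qed
qed

lemma exceeds_measurable [measurable]: "f \<in> borel_measurable M \<Longrightarrow> Measurable.pred M (exceeds f b)"
  unfolding exceeds_def[abs_def] by measurable

text \<open>The maximal inequality is applied to f - b, set to 0 off the invariant set. On the set
  some partial sum is positive; off it all maximal sums vanish, so the set in the inequality is
  exactly P.\<close>

lemma invariant_average:
  assumes f: "integrable M f" and P [measurable]: "Measurable.pred M P"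
    and inv: "\<And>x. P (T x) \<longleftrightarrow> P x" and ex: "\<And>x. P x \<Longrightarrow> exceeds f b x"
  shows "b * measure M {x \<in> space M. P x} \<le> (\<integral>x. (if P x then f x else 0) \<partial>M)"
proof -
  have [measurable]: "f \<in> borel_measurable M" using f by auto
  define g where "g x = (if P x then f x - b else 0)" for x
  have g1: "integrable M (\<lambda>x. if P x then f x else 0)"
    by (rule Bochner_Integration.integrable_bound[OF f]) auto
  have g2: "integrable M (\<lambda>x. if P x then b else 0)"
    by (rule integrable_const_bound[of _ "\<bar>b\<bar>"]) auto
  have gs: "g = (\<lambda>x. (if P x then f x else 0) - (if P x then b else 0))" by (auto simp: g_def)
  have gi: "integrable M g" unfolding gs using g1 g2 by simp
  have Pn: "P ((T ^^ i) x) \<longleftrightarrow> P x" for i x by (induction i) (auto simp: inv)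
  have iff: "(\<exists>n. 0 < max_sum T g n x) \<longleftrightarrow> P x" for x
  proof
    assume P: "P x"
    obtain n where n: "real 0 < S f n x - real n * b" using ex[OF P] unfolding exceeds_def by blast
    have "(\<Sum>i<n. g ((T ^^ i) x)) = S f n x - real n * b"
      by (simp add: g_def Pn P S_def sum_subtractf)
    then have "0 < max_sum T g n x" using sum_le_max_sum[of g T x n] n by simp
    then show "\<exists>n. 0 < max_sum T g n x" ..
  next
    have "\<not> P x \<Longrightarrow> max_sum T g n x = 0" for n
      by (induction n arbitrary: x) (auto simp: g_def inv)
    then show "\<exists>n. 0 < max_sum T g n x \<Longrightarrow> P x" by force
  qed
  have "0 \<le> (\<integral>x. (if P x then g x else 0) \<partial>M)" using maximal_ergodic[OF gi] by (simp add: iff)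
  also have "\<dots> = integral\<^sup>L M g" by (rule Bochner_Integration.integral_cong) (auto simp: g_def)
  also have "\<dots> = (\<integral>x. (if P x then f x else 0) \<partial>M) - (\<integral>x. (if P x then b else 0) \<partial>M)"
    unfolding gs by (rule Bochner_Integration.integral_diff[OF g1 g2])
  also have "(\<integral>x. (if P x then b else 0) \<partial>M) = (\<integral>x. b * indicator {x \<in> space M. P x} x \<partial>M)"
    by (rule Bochner_Integration.integral_cong) auto
  also have "\<dots> = b * measure M {x \<in> space M. P x}" by simp
  finally show ?thesis by simp
qed

lemma S_uminus: "S (\<lambda>x. - f x) n x = - S f n x"
  by (simp add: S_def sum_negf)

text \<open>On the invariant set in question the integral of f is at least b and at most a times its
  measure, although a < b.\<close>

lemma oscillation_null:
  assumes f: "integrable M f" and ab: "a < b"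
  shows "AE x in M. \<not> (exceeds f b x \<and> exceeds (\<lambda>x. - f x) (- a) x)"
proof -
  have [measurable]: "f \<in> borel_measurable M" using f by auto
  let ?P = "\<lambda>x. exceeds f b x \<and> exceeds (\<lambda>x. - f x) (- a) x"
  have m [measurable]: "Measurable.pred M ?P" by measurable
  have "b * measure M {x \<in> space M. ?P x} \<le> (\<integral>x. (if ?P x then f x else 0) \<partial>M)"
    by (rule invariant_average[OF f m]) (auto simp: exceeds_T)
  moreover have "(- a) * measure M {x \<in> space M. ?P x} \<le> (\<integral>x. (if ?P x then - f x else 0) \<partial>M)"
    by (rule invariant_average[OF _ m]) (use f in \<open>auto simp: exceeds_T\<close>)
  moreover have "(\<integral>x. (if ?P x then - f x else 0) \<partial>M) = - (\<integral>x. (if ?P x then f x else 0) \<partial>M)"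
  proof -
    have eq: "(\<lambda>x. if ?P x then - f x else 0) = (\<lambda>x. - (if ?P x then f x else 0))" by (simp add: fun_eq_iff)
    show ?thesis unfolding eq by (rule Bochner_Integration.integral_minus)
  qed
  ultimately have "(b - a) * measure M {x \<in> space M. ?P x} \<le> 0" by (simp add: algebra_simps)
  then have "measure M {x \<in> space M. ?P x} = 0"
    using ab measure_nonneg[of M "{x \<in> space M. ?P x}"] by (simp add: mult_le_0_iff)
  then have "emeasure M {x \<in> space M. ?P x} = 0" by (simp add: emeasure_eq_measure)
  moreover have "{x \<in> space M. ?P x} \<in> sets M" by measurable
  ultimately show ?thesis by (intro AE_I[where N = "{x \<in> space M. ?P x}"]) auto
qed

lemma exceeds_of_limsup:
  assumes "ereal b < limsup (\<lambda>n. ereal (S f n x / real n))"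
  shows "exceeds f b x"
proof -
  obtain c where c: "ereal b < ereal c" "ereal c < limsup (\<lambda>n. ereal (S f n x / real n))"
    using ereal_dense3[OF assms] by auto
  have fr: "\<exists>n\<ge>N. c < S f n x / real n" for N
  proof (rule ccontr)
    assume "\<not> (\<exists>n\<ge>N. c < S f n x / real n)"
    then have "eventually (\<lambda>n. ereal (S f n x / real n) \<le> ereal c) sequentially"
      unfolding eventually_sequentially by (auto simp: not_less)
    from Limsup_bounded[OF this] show False using c by simp
  qed
  show ?thesis unfolding exceeds_def
  proof
    fix k :: nat
    have bc: "0 < c - b" using c by simp
    obtain N :: nat where N: "real k / (c - b) \<le> real N" using real_arch_simple by blast
    obtain n where n: "n \<ge> Suc N" "c < S f n x / real n" using fr by blast
    have "c * real n < S f n x" using n by (simp add: pos_less_divide_eq)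
    moreover have "real k \<le> real N * (c - b)" using N bc by (simp add: pos_divide_le_eq)
    moreover have "real N * (c - b) \<le> real n * (c - b)" using n bc by (intro mult_right_mono) auto
    ultimately have "real k < S f n x - real n * b" by (simp add: algebra_simps)
    then show "\<exists>n. real k < S f n x - real n * b" by blast
  qed
qed

text \<open>If the lower and upper limits of the averages differed, two rationals would separate
  them; each of the countably many pairs is excluded almost everywhere. Boundedness of f makes the
  common limit finite.\<close>

theorem birkhoff:
  assumes f [measurable]: "f \<in> borel_measurable M" and B: "\<And>x. \<bar>f x\<bar> \<le> B"
  shows "AE x in M. convergent (\<lambda>n. S f n x / real n)"
proof -
  have fi: "integrable M f" by (rule integrable_const_bound[of _ B]) (use B in auto)
  have B0: "0 \<le> B" using B[of undefined] by linarith
  have bound: "\<bar>S f n x / real n\<bar> \<le> B" for n x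
  proof (cases "n = 0")
    case False
    have "\<bar>S f n x\<bar> \<le> (\<Sum>i<n. \<bar>f ((T ^^ i) x)\<bar>)" unfolding S_def by (rule sum_abs)
    also have "\<dots> \<le> (\<Sum>i<n. B)" by (rule sum_mono) (rule B)
    finally show ?thesis using False by (simp add: abs_divide pos_divide_le_eq mult.commute)
  qed (simp add: B0)
  let ?R = "{p :: rat \<times> rat. fst p < snd p}"
  have "AE x in M. \<forall>p\<in>?R. \<not> (exceeds f (of_rat (snd p)) x \<and> exceeds (\<lambda>x. - f x) (- of_rat (fst p)) x)"
  proof (rule AE_ball_countable[THEN iffD2])
    show "\<forall>p\<in>?R. AE x in M. \<not> (exceeds f (of_rat (snd p)) x \<and> exceeds (\<lambda>x. - f x) (- of_rat (fst p)) x)"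
      by (intro ballI oscillation_null[OF fi]) (simp add: of_rat_less)
  qed (rule countableI_type)
  then show ?thesis
  proof (rule AE_mp, intro AE_I2 impI)
    fix x assume *: "\<forall>p\<in>?R. \<not> (exceeds f (of_rat (snd p)) x \<and> exceeds (\<lambda>x. - f x) (- of_rat (fst p)) x)"
    define X where "X n = ereal (S f n x / real n)" for n
    then have Xf: "X = (\<lambda>n. ereal (S f n x / real n))" by (simp add: X_def fun_eq_iff)
    have bb: "S f n x / real n \<le> B" "- B \<le> S f n x / real n" for n
      using bound[of n x] unfolding abs_le_iff by linarith+
    have le: "limsup X \<le> liminf X"
    proof (rule ccontr)
      assume "\<not> limsup X \<le> liminf X"
      then obtain a where a: "liminf X < real_of_rat a" "real_of_rat a < limsup X"
        using ereal_dense3 by (auto simp: not_le)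
      then obtain b where b: "ereal (real_of_rat a) < real_of_rat b" "real_of_rat b < limsup X"
        using ereal_dense3 by blast
      have "exceeds f (of_rat b) x" by (rule exceeds_of_limsup) (use b(2) Xf in simp)
      moreover have "exceeds (\<lambda>x. - f x) (- of_rat a) x"
      proof (rule exceeds_of_limsup)
        have "limsup (\<lambda>n. ereal (S (\<lambda>x. - f x) n x / real n)) = limsup (\<lambda>n. - X n)"
          by (simp add: S_uminus X_def)
        also have "\<dots> = - liminf X" by (rule ereal_Limsup_uminus)
        finally show "ereal (- of_rat a) < limsup (\<lambda>n. ereal (S (\<lambda>x. - f x) n x / real n))"
          using a(1) ereal_minus_less_minus[of "ereal (real_of_rat a)" "liminf X"] by simp
      qed
      moreover have "a < b" using b(1) by (simp add: of_rat_less)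
      ultimately show False using * by force
    qed
    moreover have "liminf X \<le> limsup X" by (rule Liminf_le_Limsup) simp
    ultimately have "X \<longlonglongrightarrow> limsup X" by (intro tendsto_iff_Liminf_eq_Limsup[THEN iffD2]) auto
    moreover have "limsup X \<le> ereal B"
      by (rule Limsup_bounded) (simp add: X_def bb)
    moreover have "ereal (- B) \<le> limsup X"
    proof (rule order_trans)
      show "ereal (- B) \<le> liminf X" by (rule Liminf_bounded) (simp add: X_def bb)
      show "liminf X \<le> limsup X" by (rule Liminf_le_Limsup) simp
    qed
    ultimately obtain r where "X \<longlonglongrightarrow> ereal r" using le by (cases "limsup X") auto
    then show "convergent (\<lambda>n. S f n x / real n)" unfolding X_def convergent_def by auto
  qed
qed

end


section \<open>Asymptotic winding numbers along orbits\<close>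

lemma orbit_in_Disk:
  assumes "realizable phi" "x \<in> Disk"
  shows "(phi ^^ i) x \<in> Disk"
proof (induction i)
  case 0 then show ?case using assms(2) by simp
next
  case (Suc i)
  then have "phi ((phi ^^ i) x) \<in> Disk" using realizable_preserves_disk(4)[OF assms(1)] by blast
  then show ?case by simp
qed

lemma orbits_distinct:
  assumes phi: "realizable phi" and xy: "x \<in> Disk" "y \<in> Disk" "x \<noteq> y"
  shows "(phi ^^ i) x \<noteq> (phi ^^ i) y"
proof (induction i)
  case 0 then show ?case using xy by simp
next
  case (Suc i)
  then show ?case
    using inj_onD[OF realizable_preserves_disk(3)[OF phi] _ orbit_in_Disk[OF phi xy(1)] orbit_in_Disk[OF phi xy(2)], of i i] by auto
qed

lemma wind_average_orbit:
  assumes phi: "realizable phi" and xy: "x \<in> Disk" "y \<in> Disk" "x \<noteq> y"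
    and W: "\<And>x y. x \<in> Disk \<Longrightarrow> y \<in> Disk \<Longrightarrow> x \<noteq> y \<Longrightarrow> wind phi x y = W (x, y)"
  shows "wind (phi ^^ n) x y / real n = (\<Sum>i<n. W ((phi ^^ i) x, (phi ^^ i) y)) / real n"
proof (cases n)
  case (Suc k)
  have "wind phi ((phi ^^ i) x) ((phi ^^ i) y) = W ((phi ^^ i) x, (phi ^^ i) y)" for i
    by (intro W orbit_in_Disk orbits_distinct phi xy)
  then show ?thesis unfolding Suc wind_funpow[OF phi xy] by simp
qed simp

lemma AE_disk_distinct: "AE y in disk_measure. y \<noteq> x"
  using AE_lborel_singleton[of x] by (auto simp: AE_restrict_space_iff)

text \<open>Applied to area on the disk this gives almost every \<open>x\<close>, applied to counting measure on a
  finite orbit it gives every point of that orbit.\<close>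
lemma asym_wind_exists_AE:
  fixes N :: "complex measure"
  assumes phi: "realizable phi" and N: "finite_measure N" and idN: "(\<lambda>x. x) \<in> measurable N borel"
    and sp: "space N \<subseteq> Disk" and m: "phi \<in> measurable N N" and pres: "distr N N phi = N"
  shows "AE x in N. AE y in disk_measure. asym_wind_exists phi x y"
proof -
  obtain W B where W: "W \<in> borel_measurable borel" "\<And>q. \<bar>W q\<bar> \<le> B"
    "\<And>x y. x \<in> Disk \<Longrightarrow> y \<in> Disk \<Longrightarrow> x \<noteq> y \<Longrightarrow> wind phi x y = W (x, y)"
    "\<And>x. x \<in> Disk \<Longrightarrow> (\<integral>y. W (x, y) \<partial>disk_measure) = action phi lam0 x"
    by (rule wind_average[OF phi]) (rule that)
  note pd = realizable_preserves_disk[OF phi]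
  interpret N: finite_measure N by (rule N)
  interpret D: finite_measure disk_measure by (rule finite_disk_measure)
  interpret ND: pair_sigma_finite N disk_measure ..
  let ?M = "N \<Otimes>\<^sub>M disk_measure"
  let ?T = "\<lambda>(x, y). (phi x, phi y)"
  interpret P: finite_measure ?M by (rule finite_measure_pair_measure) unfold_locales
  have T: "?T \<in> measurable ?M ?M"
    unfolding split_beta'
    by (intro measurable_Pair measurable_compose[OF measurable_fst m] measurable_compose[OF measurable_snd pd(1)])
  have dT: "distr ?M ?M ?T = ?M"
    using pair_measure_distr[OF m pd(1)] unfolding pd(2) pres using D.sigma_finite_measure_axioms by simp
  interpret F: finite_measure_preserving ?M ?T by unfold_locales (rule T, rule dT)
  have idD: "(\<lambda>w. w) \<in> measurable disk_measure borel"
    by (rule measurable_restrict_space1) simp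
  have "W \<in> borel_measurable (borel \<Otimes>\<^sub>M borel)" using W(1) unfolding borel_prod .
  from measurable_compose[OF measurable_Pair[OF measurable_compose[OF measurable_fst idN] measurable_compose[OF measurable_snd idD]] this]
  have Wm: "W \<in> borel_measurable ?M" by (simp only: prod.collapse)
  have pow: "(?T ^^ i) (x, y) = ((phi ^^ i) x, (phi ^^ i) y)" for i x y
    by (induction i) auto
  have conv: "AE x in N. AE y in disk_measure. convergent (\<lambda>n. F.S W n (x, y) / real n)"
    by (rule ND.AE_pair[OF F.birkhoff[OF Wm W(2)]])
  have "AE y in disk_measure. asym_wind_exists phi x y"
    if x: "x \<in> space N" and c: "AE y in disk_measure. convergent (\<lambda>n. F.S W n (x, y) / real n)" for x
  proof -
    \<comment> \<open>The winding number is an orbit sum of \<open>W\<close> only off the diagonal,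
      which for each x is a null set of y.\<close>
    from c have "AE y in disk_measure. y \<in> Disk \<and> asym_wind_exists phi x y"
      using AE_disk_distinct[of x] AE_space
    proof eventually_elim
      case (elim y)
      have "x \<in> Disk" "y \<in> Disk" "x \<noteq> y" using x sp elim by auto
      then have "(\<lambda>n. wind (phi ^^ n) x y / real n) = (\<lambda>n. F.S W n (x, y) / real n)"
        using wind_average_orbit[OF phi _ _ _ W(3), of x y] unfolding F.S_def pow by (intro ext) blast
      then show ?case using elim(1) \<open>y \<in> Disk\<close> unfolding asym_wind_exists_def by simp
    qed
    then show ?thesis by simp
  qed
  then show ?thesis by (rule eventually_elim2[OF AE_space conv])
qed

lemma asym_wind_exists_AE_disk:
  assumes "realizable phi"
  shows "AE x in disk_measure. AE y in disk_measure. asym_wind_exists phi x y"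
  by (rule asym_wind_exists_AE[OF assms finite_disk_measure])
    (auto intro: realizable_preserves_disk[OF assms] measurable_restrict_space1)

lemma asym_wind_exists_periodic:
  assumes phi: "realizable phi" and x: "periodic_point phi x"
  shows "AE y in disk_measure. asym_wind_exists phi x y"
proof -
  obtain k where k: "x \<in> Disk" "k \<ge> 1" "(phi ^^ k) x = x" using x unfolding periodic_point_def by blast
  define A where "A = (\<lambda>i. (phi ^^ i) x) ` {..<k}"
  have A: "finite A" "x \<in> A" "A \<subseteq> Disk"
    using k orbit_in_Disk[OF phi k(1)] unfolding A_def by (auto intro!: image_eqI[of _ _ 0])
  have sub: "phi ` A \<subseteq> A"
  proof (rule image_subsetI)
    fix a assume "a \<in> A"
    then obtain i where i: "i < k" "a = (phi ^^ i) x" unfolding A_def by blast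
    show "phi a \<in> A"
    proof (cases "Suc i = k")
      case True
      then have "phi a = x" using i k(3) by auto
      then show ?thesis using A by simp
    next
      case False
      then have "Suc i < k" using i by simp
      then show ?thesis unfolding A_def i(2) by (intro image_eqI[of _ _ "Suc i"]) auto
    qed
  qed
  have inj: "inj_on phi A" using inj_on_subset[OF realizable_preserves_disk(3)[OF phi] A(3)] .
  have bij: "bij_betw phi A A"
    unfolding bij_betw_def using inj endo_inj_surj[OF A(1) sub inj] by simp
  \<comment> \<open>Counting measure on the orbit is invariant because phi permutes it, and a
    property holding almost everywhere for it holds at every point, in particular at x.\<close>
  have "AE x in count_space A. AE y in disk_measure. asym_wind_exists phi x y"
  proof (rule asym_wind_exists_AE[OF phi])
    show "finite_measure (count_space A)" by (rule finite_measure_count_space[OF A(1)])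
    show "distr (count_space A) (count_space A) phi = count_space A" by (rule distr_bij_count_space[OF bij])
  qed (use A sub in auto)
  then show ?thesis using A(2) by (simp add: AE_count_space)
qed

theorem asymptotic_action_eq:
  assumes phi: "realizable phi" and x: "x \<in> Disk"
    and ex: "AE y in disk_measure. asym_wind_exists phi x y" and lam: "primitive_form lam"
  shows "asym_wind phi x \<in> borel_measurable disk_measure" "integrable disk_measure (asym_wind phi x)"
    and "(\<lambda>n. action (phi ^^ n) lam x / real n) \<longlonglongrightarrow> integral\<^sup>L disk_measure (asym_wind phi x)"
proof -
  interpret D: finite_measure disk_measure by (rule finite_disk_measure)
  obtain W B where W: "W \<in> borel_measurable borel" "\<And>q. \<bar>W q\<bar> \<le> B"
    "\<And>x y. x \<in> Disk \<Longrightarrow> y \<in> Disk \<Longrightarrow> x \<noteq> y \<Longrightarrow> wind phi x y = W (x, y)"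
    "\<And>x. x \<in> Disk \<Longrightarrow> (\<integral>y. W (x, y) \<partial>disk_measure) = action phi lam0 x"
    by (rule wind_average[OF phi]) (rule that)
  have B0: "0 \<le> B" using W(2)[of undefined] by linarith
  define s where "s n y = wind (phi ^^ n) x y / real n" for n y
  have step: "s (Suc n) \<in> borel_measurable disk_measure
      \<and> (\<integral>y. s (Suc n) y \<partial>disk_measure) = action (phi ^^ Suc n) lam0 x / real (Suc n)" for n
  proof -
    obtain V C where V: "V \<in> borel_measurable borel" "\<And>q. \<bar>V q\<bar> \<le> C"
      "\<And>x y. x \<in> Disk \<Longrightarrow> y \<in> Disk \<Longrightarrow> x \<noteq> y \<Longrightarrow> wind (phi ^^ Suc n) x y = V (x, y)"
      "\<And>x. x \<in> Disk \<Longrightarrow> (\<integral>y. V (x, y) \<partial>disk_measure) = action (phi ^^ Suc n) lam0 x"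
      by (rule wind_average[OF realizable_funpow[OF phi]]) (rule that)
    have vm: "(\<lambda>y. V (x, y)) \<in> borel_measurable borel"
      by (rule measurable_compose[OF _ V(1)]) (intro borel_measurable_continuous_onI continuous_intros)
    \<comment> \<open>At y = x the value of \<open>wind\<close> is whatever its description yields;
      keeping it as a constant makes \<open>s\<close> itself measurable, not just a function equal
      to it almost everywhere.\<close>
    let ?v = "\<lambda>y. (if y = x then wind (phi ^^ Suc n) x x else V (x, y)) / real (Suc n)"
    have "?v \<in> borel_measurable borel"
      by (intro borel_measurable_divide measurable_If vm borel_measurable_const) simp_all
    then have vD: "?v \<in> borel_measurable disk_measure" by (rule disk_measurable)
    have sv: "s (Suc n) y = ?v y" if "y \<in> space disk_measure" for y
      using V(3)[OF x, of y] that unfolding s_def by auto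
    have sm: "s (Suc n) \<in> borel_measurable disk_measure"
      using vD measurable_cong[of disk_measure "s (Suc n)" ?v borel] sv by blast
    have "(\<integral>y. s (Suc n) y \<partial>disk_measure) = (\<integral>y. V (x, y) / real (Suc n) \<partial>disk_measure)"
    proof (rule integral_cong_AE)
      show "AE y in disk_measure. s (Suc n) y = V (x, y) / real (Suc n)"
        using AE_disk_distinct[of x] AE_space by eventually_elim (simp only: sv if_False)
    qed (use sm disk_measurable[OF vm] in auto)
    then show ?thesis using sm V(4)[OF x] by simp
  qed
  have s0: "s 0 = (\<lambda>y. 0)" by (simp add: s_def fun_eq_iff)
  have sm: "s n \<in> borel_measurable disk_measure" for n
    using step by (cases n) (simp_all add: s0)
  have aw: "asym_wind phi x = (\<lambda>y. lim (\<lambda>n. s n y))" by (simp add: asym_wind_def s_def fun_eq_iff)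
  show am: "asym_wind phi x \<in> borel_measurable disk_measure"
    unfolding aw by (rule borel_measurable_lim_metric[OF sm])
  \<comment> \<open>The bound from \<open>wind_average\<close> for an iterate may depend on the
    iterate. The orbit sum of the single function \<open>W\<close> of phi gives one bound for all
    n.\<close>
  have sb: "AE y in disk_measure. norm (s (Suc n) y) \<le> B" for n
    using AE_disk_distinct[of x] AE_space
  proof eventually_elim
    case (elim y)
    have "\<bar>\<Sum>i<Suc n. W ((phi ^^ i) x, (phi ^^ i) y)\<bar> \<le> (\<Sum>i<Suc n. \<bar>W ((phi ^^ i) x, (phi ^^ i) y)\<bar>)"
      by (rule sum_abs)
    also have "\<dots> \<le> (\<Sum>i<Suc n. B)" by (intro sum_mono W(2))
    finally show ?case
      using wind_average_orbit[OF phi x _ _ W(3), of y "Suc n"] elim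
      unfolding s_def by (simp add: abs_divide pos_divide_le_eq mult.commute del: sum.lessThan_Suc)
  qed
  have lim: "AE y in disk_measure. (\<lambda>n. s (Suc n) y) \<longlonglongrightarrow> asym_wind phi x y"
    using ex
  proof eventually_elim
    case (elim y)
    then have "(\<lambda>n. s n y) \<longlonglongrightarrow> asym_wind phi x y"
      unfolding asym_wind_exists_def asym_wind_def s_def by (simp add: convergent_LIMSEQ_iff)
    then show ?case by (rule LIMSEQ_Suc)
  qed
  have cB: "integrable disk_measure (\<lambda>y. B)" by simp
  show "integrable disk_measure (asym_wind phi x)"
    by (rule integrable_dominated_convergence[OF am sm cB lim sb])
  have "(\<lambda>n. \<integral>y. s (Suc n) y \<partial>disk_measure) \<longlonglongrightarrow> integral\<^sup>L disk_measure (asym_wind phi x)"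
    by (rule integral_dominated_convergence[OF am sm cB lim sb])
  then have l0: "(\<lambda>n. action (phi ^^ Suc n) lam0 x / real (Suc n)) \<longlonglongrightarrow> integral\<^sup>L disk_measure (asym_wind phi x)"
    using step by simp
  obtain C where C: "\<And>psi z. realizable psi \<Longrightarrow> z \<in> Disk \<Longrightarrow> \<bar>action psi lam z - action psi lam0 z\<bar> \<le> C"
    by (rule action_change_primitive[OF lam]) (rule that)
  have "(\<lambda>n. (action (phi ^^ Suc n) lam x - action (phi ^^ Suc n) lam0 x) / real (Suc n)) \<longlonglongrightarrow> 0"
  proof (rule Lim_null_comparison)
    show "\<forall>\<^sub>F n in sequentially. norm ((action (phi ^^ Suc n) lam x - action (phi ^^ Suc n) lam0 x) / real (Suc n)) \<le> C / real (Suc n)"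
      using C[OF realizable_funpow[OF phi] x] by (intro always_eventually allI) (simp add: abs_divide divide_right_mono)
    show "(\<lambda>n. C / real (Suc n)) \<longlonglongrightarrow> 0"
      by (rule LIMSEQ_Suc[OF lim_const_over_n])
  qed
  from tendsto_add[OF this l0]
  have "(\<lambda>n. action (phi ^^ Suc n) lam x / real (Suc n)) \<longlonglongrightarrow> integral\<^sup>L disk_measure (asym_wind phi x)"
    by (simp add: diff_divide_distrib)
  then show "(\<lambda>n. action (phi ^^ n) lam x / real n) \<longlonglongrightarrow> integral\<^sup>L disk_measure (asym_wind phi x)"
    by (rule LIMSEQ_imp_Suc)
qed

lemma AE_lebesgue_on_Disk: "(AE y in lebesgue_on Disk. P y) \<longleftrightarrow> (AE y in disk_measure. P y)"
  by (simp add: AE_restrict_space_iff AE_completion_iff)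

lemma integral_lebesgue_on_Disk:
  fixes f :: "complex \<Rightarrow> real"
  assumes f: "f \<in> borel_measurable disk_measure"
  shows "integrable (lebesgue_on Disk) f \<longleftrightarrow> integrable disk_measure f"
    and "integral\<^sup>L (lebesgue_on Disk) f = integral\<^sup>L disk_measure f"
proof -
  have "(\<lambda>w. indicator Disk w *\<^sub>R f w) \<in> borel_measurable lborel"
    using f by (subst (asm) borel_measurable_restrict_space_iff) auto
  then show "integrable (lebesgue_on Disk) f \<longleftrightarrow> integrable disk_measure f"
    "integral\<^sup>L (lebesgue_on Disk) f = integral\<^sup>L disk_measure f"
    using integrable_completion[of "\<lambda>w. indicator Disk w *\<^sub>R f w" lborel]
      integral_completion[of "\<lambda>w. indicator Disk w *\<^sub>R f w" lborel]
    by (simp_all add: integrable_restrict_space integral_restrict_space)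
qed

theorem theorem1:
  assumes "phi \<in> Diff_c"
  shows "\<exists>\<Omega>. \<Omega> \<subseteq> Disk \<and> Disk - \<Omega> \<in> null_sets lebesgue
     \<and> {x. periodic_point phi x} \<subseteq> \<Omega>
     \<and> (\<forall>x\<in>\<Omega>. \<forall>lam. primitive_form lam \<longrightarrow>
          asym_action_exists phi lam x
        \<and> (AE y in lebesgue_on Disk. asym_wind_exists phi x y)
        \<and> integrable (lebesgue_on Disk) (\<lambda>y. asym_wind phi x y)
        \<and> asym_action phi lam x = (\<integral>y. asym_wind phi x y \<partial>lebesgue_on Disk))"
proof (intro exI conjI ballI allI impI)
  have phi: "realizable phi" by (rule realizable_Diff_c[OF assms])
  \<comment> \<open>Almost everywhere existence of the winding number is the only condition imposed
    on x; \<open>asymptotic_action_eq\<close> derives all other claims from it.\<close>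
  let ?\<Omega> = "{x \<in> Disk. AE y in disk_measure. asym_wind_exists phi x y}"
  show "?\<Omega> \<subseteq> Disk" by blast
  show "Disk - ?\<Omega> \<in> null_sets lebesgue"
  proof -
    have "AE x in lebesgue. x \<in> Disk \<longrightarrow> (AE y in disk_measure. asym_wind_exists phi x y)"
      using asym_wind_exists_AE_disk[OF phi] by (simp add: AE_restrict_space_iff AE_completion_iff)
    then have "{x \<in> space lebesgue. \<not> (x \<in> Disk \<longrightarrow> (AE y in disk_measure. asym_wind_exists phi x y))} \<in> null_sets lebesgue"
      by (simp only: completion.AE_iff_null_sets)
    moreover have "{x \<in> space lebesgue. \<not> (x \<in> Disk \<longrightarrow> (AE y in disk_measure. asym_wind_exists phi x y))} = Disk - ?\<Omega>"
      by auto
    ultimately show ?thesis by simp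
  qed
  show "{x. periodic_point phi x} \<subseteq> ?\<Omega>"
    using asym_wind_exists_periodic[OF phi] by (auto simp: periodic_point_def)
  fix x lam assume "x \<in> ?\<Omega>" and lam: "primitive_form lam"
  then have x: "x \<in> Disk" and ex: "AE y in disk_measure. asym_wind_exists phi x y" by auto
  note * = asymptotic_action_eq[OF phi x ex lam]
  show "asym_action_exists phi lam x"
    unfolding asym_action_exists_def convergent_def using *(3) by blast
  show "AE y in lebesgue_on Disk. asym_wind_exists phi x y" using ex by (simp only: AE_lebesgue_on_Disk)
  show "integrable (lebesgue_on Disk) (\<lambda>y. asym_wind phi x y)"
    using *(2) integral_lebesgue_on_Disk(1)[OF *(1)] by simp
  show "asym_action phi lam x = (\<integral>y. asym_wind phi x y \<partial>lebesgue_on Disk)"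
    unfolding asym_action_def integral_lebesgue_on_Disk(2)[OF *(1)] by (rule limI[OF *(3)])
qed

end
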